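(* In the setting and under the hypotheses of the a priori estimate (with $\varepsilon_0>0$ such that $(\mathcal P^\sigma_{\mathcal R_\varepsilon})$ has a minimizer for $0<\varepsilon<\varepsilon_0$), let $\{\varepsilon_k\}\subset(0,\varepsilon_0)$ be a null sequence and for each $k$ let $(\theta^*_{\varepsilon_k},\mathbf y_k)$ be a minimizer of $(\mathcal P^\sigma_{\mathcal R_{\varepsilon_k}})$, with $\mathbf u_k:=\mathcal F^\sigma_{\theta^*_{\varepsilon_k}}(\mathbf y_k)$. Then $\{(\mathbf y_k,\mathbf u_k)\}$ has at least one weak accumulation point in $L^2_\mu(Y_0;W_\infty)\times L^2_\mu(Y_0;L^2(I;\mathbb R^m))$. Every such point $(\widehat{\mathbf y},\widehat{\mathbf u})$ satisfies $\|\widehat{\mathbf y}\|_{L^\infty_\mu(Y_0;W_\infty)}\le2M_{Y_0}$ and, for $\mu$-a.e. $y_0\in Y_0$, $\dot{\widehat{\mathbf y}}(y_0)=f(\widehat{\mathbf y}(y_0))+B\widehat{\mathbf u}(y_0)$, $\widehat{\mathbf y}(y_0)(0)=y_0$, and $(\widehat{\mathbf y}(y_0),\widehat{\mathbf u}(y_0))$ is a minimizer of $(P^{y_0}_\beta)$. If $Q$ is invertible, every weakly convergent subsequence of $\{(\mathbf y_k,\mathbf u_k)\}$ converges strongly in $L^2_\mu(Y_0;W_\infty)\times L^2_\mu(Y_0;L^2(I;\mathbb R^m))$.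
   Context: Setting of the a priori estimate: $I=[0,\infty)$, $W_\infty=\{y\in L^2(I;\mathbb R^n):\dot y\in L^2(I;\mathbb R^n)\}$ with norm $\|y\|_{W_\infty}=(\|y\|_{L^2}^2+\|\dot y\|_{L^2}^2)^{1/2}$; $C_\imath>0$ is a constant with $\sup_{t\ge0}|y(t)|\le C_\imath\|y\|_{W_\infty}$. Given $f:\mathbb R^n\to\mathbb R^n$, $B\in\mathbb R^{n\times m}$, positive semidefinite $Q$, $\beta>0$, problem $(P^{y_0}_\beta)$ is: minimize $J(y,u)=\frac12\int_0^\infty(|Qy|^2+\beta|u|^2)dt$ over $(y,u)\in W_\infty\times L^2(I;\mathbb R^m)$ with $\dot y=f(y)+Bu$, $y(0)=y_0$; the minimum is assumed attained. Standing Assumption 1: $Y_0\subset\mathbb R^n$ is compact with $0\in Y_0$, and (A.1) $f\in C^1$, $f(0)=0$, $Df$ Lipschitz on compact sets; (A.2) there exist an open neighbourhood $\mathcal N(Y_0)$ of $Y_0$ and $F^*:\mathcal N(Y_0)\to\mathbb R^m$, $F^*(0)=0$, such that for every $y_0\in\mathcal N(Y_0)$ the closed-loop system $\dot y=f(y)+BF^*(y)$, $y(0)=y_0$ has a unique solution $y^*(y_0)\in W_\infty$ and $(y^*(y_0),F^*(y^*(y_0)))$ minimizes $(P^{y_0}_\beta)$; (A.3) $y_0\mapsto y^*(y_0)$ is continuously Fréchet differentiable from $\mathcal N(Y_0)$ to $W_\infty$ and $\|y^*(y_0)\|_{W_\infty}\le M|y_0|$ for some $M>0$ and all $y_0\in\mathcal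 N(Y_0)$. Set $M_{Y_0}=M\max_{y_0\in Y_0}|y_0|$, $\widehat M=C_\imath M_{Y_0}$, $\mathcal Y_{ad}=\{y\in W_\infty:\|y\|_{W_\infty}\le2M_{Y_0}\}$; (A.4) $F^*$ extends to a $C^1$ map on $\bar B_{2\widehat M}(0)$ with Lipschitz derivative there. Assumption 3: there is $C>0$ such that for every $y_0\in\mathcal N(Y_0)$, $\delta y_0\in\mathbb R^n$ and $\delta v\in L^2(I;\mathbb R^n)$ there is a unique $\delta y\in W_\infty$ with $\dot{\delta y}=Df(y^*(y_0))\delta y+B\,DF^*(y^*(y_0))\delta y+\delta v$, $\delta y(0)=\delta y_0$, and $\|\delta y\|_{W_\infty}\le C(\|\delta v\|_{L^2}+|\delta y_0|)$. $\mathcal H$ is the set of operators $\mathcal F:\mathcal Y_{ad}\to L^2(I;\mathbb R^m)$, $\mathcal F(y)(t)=F(y(t))$, with $F:\bar B_{2\widehat M}(0)\to\mathbb R^m$ Lipschitz and $F(0)=0$. $a(\mathcal F)(y,y_0,\phi)=(\dot y-f(y)-B\mathcal F(y),\phi)_{L^2(I;\mathbb R^n)}+(y(0)-y_0)\cdot\phi(0)$. $(Y_0,\mathcal A,\mu)$ is a complete probability space whose $\sigma$-algebra contains the Borel sets; an ensemble solution for $\mathcal F$ is $\mathbf y\in L^\infty_\mu(Y_0;W_\infty)$ with $\|\mathbf y\|_{L^\infty_\mu(Y_0;W_\infty)}\le2M_{Y_0}$ and $\int_{Y_0}a(\mathcal F)(\mathbf y(y_0),y_0,\Phi(y_0))\,d\mu=0$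 for all $\Phi\in L^2_\mu(Y_0;W_\infty)$; $j(\mathbf y,\mathcal F)=\int_{Y_0}J(\mathbf y(y_0),\mathcal F(\mathbf y(y_0)))\,d\mu$. Networks: architecture $(N_0,\dots,N_L)$, $N_0=n$, $N_L=m$, $L\ge2$; $\theta=(W_1,b_1,\dots,W_L,b_L)$; $f_{i,\theta}(x)=\sigma(W_ix+b_i)$ for $i<L$, $f_{L,\theta}(x)=W_Lx+b_L$, $\Psi_\theta=f_{L,\theta}\circ\dots\circ f_{1,\theta}$, $F^\sigma_\theta(x)=\Psi_\theta(x)-\Psi_\theta(0)$, $\mathcal F^\sigma_\theta$ its Nemytskii operator. $\mathcal R_{ad}=\{\theta:\|W_1\|_\infty\le\eta_1,\ |b_i|_\infty\le\eta_2\ \forall i\}$. $\mathcal G_{\mathcal R}(\theta)=\alpha_{\mathcal R}\sum_{i=2}^L\|W_i\|^2$ if $\theta\in\mathcal R_{ad}$, $+\infty$ otherwise. Problem $(\mathcal P^\sigma_{\mathcal R})$: minimize $j(\mathbf y,\mathcal F^\sigma_\theta)+\mathcal G_{\mathcal R}(\theta)$ over $\theta\in\mathcal R$ and ensemble solutions $\mathbf y$ for $\mathcal F^\sigma_\theta$. A network is $\varepsilon$-approximating if $|F^*(x)-F^\sigma_\theta(x)|+\|DF^*(x)-DF^\sigma_\theta(x)\|\le\varepsilon$ for $|x|\le2\widehat M$. Hypotheses of the a priori estimate: $\sigma\in C^1(\mathbb R)$ not a polynomial; $\eta_1,\eta_2>0$ fixed; for each $\varepsilon>0$ an architecture $\mathcal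 R_\varepsilon$ with $L_\varepsilon$ layers and an $\varepsilon$-approximating $\theta_\varepsilon=(W^\varepsilon_1,\dots,b^\varepsilon_{L_\varepsilon})\in\mathcal R_{\varepsilon,ad}$; there is $\varepsilon_2>0$ with $\sum_{i=2}^{L_\varepsilon}\|W^\varepsilon_i\|^2>0$ and $0<\alpha_{\mathcal R_\varepsilon}\le\varepsilon/(2\sum_{i=2}^{L_\varepsilon}\|W^\varepsilon_i\|^2)$ for $0<\varepsilon<\varepsilon_2$. *)

theory Defs
  imports "HOL-Analysis.Analysis" "HOL-Probability.Probability"
begin

definition sq_int :: "(real \<Rightarrow> 'a::euclidean_space) \<Rightarrow> bool" where
  "sq_int g \<longleftrightarrow> set_borel_measurable lborel {0..} g \<and>
                 set_integrable lborel {0..} (\<lambda>t. (norm (g t))\<^sup>2)"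

definition L2norm :: "(real \<Rightarrow> 'a::euclidean_space) \<Rightarrow> real" where
  "L2norm g = sqrt (set_lebesgue_integral lborel {0..} (\<lambda>t. (norm (g t))\<^sup>2))"

definition L2ip :: "(real \<Rightarrow> 'a::euclidean_space) \<Rightarrow> (real \<Rightarrow> 'a) \<Rightarrow> real" where
  "L2ip a b = set_lebesgue_integral lborel {0..} (\<lambda>t. a t \<bullet> b t)"

text \<open>y is (the continuous representative of) an element of W_oo with weak derivative y'.\<close>
definition has_Wderiv :: "(real \<Rightarrow> 'a::euclidean_space) \<Rightarrow> (real \<Rightarrow> 'a) \<Rightarrow> bool" where
  "has_Wderiv y y' \<longleftrightarrow> sq_int y \<and> sq_int y' \<and>
     (\<forall>t\<ge>0. y t = y 0 + set_lebesgue_integral lborel {0..t} y')"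

definition inW :: "(real \<Rightarrow> 'a::euclidean_space) \<Rightarrow> bool" where
  "inW y \<longleftrightarrow> (\<exists>y'. has_Wderiv y y')"

definition Wdot :: "(real \<Rightarrow> 'a::euclidean_space) \<Rightarrow> (real \<Rightarrow> 'a)" where
  "Wdot y = (SOME y'. has_Wderiv y y')"

definition Wnorm :: "(real \<Rightarrow> 'a::euclidean_space) \<Rightarrow> real" where
  "Wnorm y = sqrt ((L2norm y)\<^sup>2 + (L2norm (Wdot y))\<^sup>2)"

definition Wip :: "(real \<Rightarrow> 'a::euclidean_space) \<Rightarrow> (real \<Rightarrow> 'a) \<Rightarrow> real" where
  "Wip a b = L2ip a b + L2ip (Wdot a) (Wdot b)"

text \<open>Strong (Bochner) measurability of Y : space mu -> V, where V is given by a membership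
  predicate and a norm: a.e. limit in norm of simple (finitely-valued, measurable) functions.\<close>
definition strongly_meas ::
  "'a measure \<Rightarrow> ((real \<Rightarrow> 'c::euclidean_space) \<Rightarrow> bool) \<Rightarrow> ((real \<Rightarrow> 'c) \<Rightarrow> real)
     \<Rightarrow> ('a \<Rightarrow> real \<Rightarrow> 'c) \<Rightarrow> bool" where
  "strongly_meas \<mu> V nrm Y \<longleftrightarrow>
     (\<exists>s :: nat \<Rightarrow> 'a \<Rightarrow> real \<Rightarrow> 'c.
        (\<forall>k. finite (s k ` space \<mu>) \<and> (\<forall>x\<in>space \<mu>. V (s k x)) \<and>
             (\<forall>x\<in>space \<mu>. s k -` {s k x} \<inter> space \<mu> \<in> sets \<mu>)) \<and>
        (AE x in \<mu>. (\<lambda>k. nrm (\<lambda>t. s k x t - Y x t)) \<longlonglongrightarrow> 0))"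

definition bochner_L2 ::
  "'a measure \<Rightarrow> ((real \<Rightarrow> 'c::euclidean_space) \<Rightarrow> bool) \<Rightarrow> ((real \<Rightarrow> 'c) \<Rightarrow> real)
     \<Rightarrow> ('a \<Rightarrow> real \<Rightarrow> 'c) \<Rightarrow> bool" where
  "bochner_L2 \<mu> V nrm Y \<longleftrightarrow> strongly_meas \<mu> V nrm Y \<and> (AE x in \<mu>. V (Y x)) \<and>
     integrable \<mu> (\<lambda>x. (nrm (Y x))\<^sup>2)"

definition bochner_ip :: "'a measure \<Rightarrow> ((real \<Rightarrow> 'c::euclidean_space) \<Rightarrow> (real \<Rightarrow> 'c) \<Rightarrow> real)
     \<Rightarrow> ('a \<Rightarrow> real \<Rightarrow> 'c) \<Rightarrow> ('a \<Rightarrow> real \<Rightarrow> 'c) \<Rightarrow> real" where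
  "bochner_ip \<mu> ip Y Z = (\<integral>x. ip (Y x) (Z x) \<partial>\<mu>)"

definition bochner_norm :: "'a measure \<Rightarrow> ((real \<Rightarrow> 'c::euclidean_space) \<Rightarrow> real)
     \<Rightarrow> ('a \<Rightarrow> real \<Rightarrow> 'c) \<Rightarrow> real" where
  "bochner_norm \<mu> nrm Y = sqrt (\<integral>x. (nrm (Y x))\<^sup>2 \<partial>\<mu>)"

definition Jcost :: "real^'n^'n \<Rightarrow> real \<Rightarrow> (real \<Rightarrow> real^'n) \<Rightarrow> (real \<Rightarrow> real^'m) \<Rightarrow> ennreal" where
  "Jcost Q \<beta> y u =
     (\<integral>\<^sup>+t\<in>{0..}. ennreal ((norm (Q *v y t))\<^sup>2 + \<beta> * (norm (u t))\<^sup>2) \<partial>lborel) / 2"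

definition feasible :: "(real^'n \<Rightarrow> real^'n) \<Rightarrow> real^'m^'n \<Rightarrow> real^'n
     \<Rightarrow> (real \<Rightarrow> real^'n) \<Rightarrow> (real \<Rightarrow> real^'m) \<Rightarrow> bool" where
  "feasible f B y0 y u \<longleftrightarrow> has_Wderiv y (\<lambda>t. f (y t) + B *v u t) \<and> sq_int u \<and> y 0 = y0"

definition OCP_min :: "(real^'n \<Rightarrow> real^'n) \<Rightarrow> real^'m^'n \<Rightarrow> real^'n^'n \<Rightarrow> real \<Rightarrow> real^'n
     \<Rightarrow> (real \<Rightarrow> real^'n) \<Rightarrow> (real \<Rightarrow> real^'m) \<Rightarrow> bool" where
  "OCP_min f B Q \<beta> y0 y u \<longleftrightarrow> feasible f B y0 y u \<and>
     (\<forall>y' u'. feasible f B y0 y' u' \<longrightarrow> Jcost Q \<beta> y u \<le> Jcost Q \<beta> y' u')"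

definition aform :: "(real^'n \<Rightarrow> real^'n) \<Rightarrow> real^'m^'n \<Rightarrow> (real^'n \<Rightarrow> real^'m)
     \<Rightarrow> (real \<Rightarrow> real^'n) \<Rightarrow> real^'n \<Rightarrow> (real \<Rightarrow> real^'n) \<Rightarrow> real" where
  "aform f B F y y0 \<phi> =
     L2ip (\<lambda>t. Wdot y t - f (y t) - B *v F (y t)) \<phi> + (y 0 - y0) \<bullet> \<phi> 0"

definition ens_sol :: "(real^'n) measure \<Rightarrow> (real^'n \<Rightarrow> real^'n) \<Rightarrow> real^'m^'n \<Rightarrow> real
     \<Rightarrow> (real^'n \<Rightarrow> real^'m) \<Rightarrow> (real^'n \<Rightarrow> real \<Rightarrow> real^'n) \<Rightarrow> bool" where
  "ens_sol \<mu> f B MY0 F Y \<longleftrightarrow>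
     strongly_meas \<mu> inW Wnorm Y \<and> (AE x in \<mu>. inW (Y x) \<and> Wnorm (Y x) \<le> 2 * MY0) \<and>
     (\<forall>\<Phi>. bochner_L2 \<mu> inW Wnorm \<Phi> \<longrightarrow>
        integrable \<mu> (\<lambda>x. aform f B F (Y x) x (\<Phi> x)) \<and>
        (\<integral>x. aform f B F (Y x) x (\<Phi> x) \<partial>\<mu>) = 0)"

definition jens :: "(real^'n) measure \<Rightarrow> real^'n^'n \<Rightarrow> real \<Rightarrow> (real^'n \<Rightarrow> real^'m)
     \<Rightarrow> (real^'n \<Rightarrow> real \<Rightarrow> real^'n) \<Rightarrow> ennreal" where
  "jens \<mu> Q \<beta> F Y = (\<integral>\<^sup>+x. Jcost Q \<beta> (Y x) (\<lambda>t. F (Y x t)) \<partial>\<mu>)"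

text \<open>An architecture (N_0,...,N_L) with N_0 = n, N_L = m is represented by the list
  hid = [N_1,...,N_{L-1}] of hidden widths (L >= 2 iff hid is nonempty).
  Parameters: W_1 (rows j < N_1, each a vector in R^n), b_1, the middle layers
  (W_i,b_i), i = 2..L-1 (entries indexed below the widths), W_L (rows indexed by the
  output coordinates), b_L.\<close>
record ('n::finite, 'm::finite) nnet =
  W1 :: "nat \<Rightarrow> real^'n"
  b1 :: "nat \<Rightarrow> real"
  mid :: "((nat \<Rightarrow> nat \<Rightarrow> real) \<times> (nat \<Rightarrow> real)) list"
  WL :: "'m \<Rightarrow> nat \<Rightarrow> real"
  bL :: "real^'m"

definition arch_ok :: "nat list \<Rightarrow> bool" where
  "arch_ok hid \<longleftrightarrow> hid \<noteq> [] \<and> (\<forall>d\<in>set hid. 0 < d)"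

definition params :: "nat list \<Rightarrow> ('n::finite, 'm::finite) nnet set" where
  "params hid = {\<theta>. length (mid \<theta>) = length hid - 1}"

definition layer :: "(real \<Rightarrow> real) \<Rightarrow> nat \<Rightarrow> nat \<Rightarrow> (nat \<Rightarrow> nat \<Rightarrow> real) \<times> (nat \<Rightarrow> real)
     \<Rightarrow> (nat \<Rightarrow> real) \<Rightarrow> (nat \<Rightarrow> real)" where
  "layer \<sigma> d d' Wb h = (\<lambda>j. if j < d' then \<sigma> ((\<Sum>k<d. fst Wb j k * h k) + snd Wb j) else 0)"

fun mids_eval :: "(real \<Rightarrow> real) \<Rightarrow> nat list \<Rightarrow> ((nat \<Rightarrow> nat \<Rightarrow> real) \<times> (nat \<Rightarrow> real)) list
     \<Rightarrow> (nat \<Rightarrow> real) \<Rightarrow> (nat \<Rightarrow> real)" where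
  "mids_eval \<sigma> (d # d' # ds) (Wb # Ls) h = mids_eval \<sigma> (d' # ds) Ls (layer \<sigma> d d' Wb h)"
| "mids_eval \<sigma> _ _ h = h"

definition Psi :: "(real \<Rightarrow> real) \<Rightarrow> nat list \<Rightarrow> ('n::finite, 'm::finite) nnet \<Rightarrow> real^'n \<Rightarrow> real^'m" where
  "Psi \<sigma> hid \<theta> x =
     (let h1 = (\<lambda>j. if j < hd hid then \<sigma> (W1 \<theta> j \<bullet> x + b1 \<theta> j) else 0);
          hL = mids_eval \<sigma> hid (mid \<theta>) h1
      in (\<chi> r. (\<Sum>k<last hid. WL \<theta> r k * hL k) + bL \<theta> $ r))"

definition Fnet :: "(real \<Rightarrow> real) \<Rightarrow> nat list \<Rightarrow> ('n::finite, 'm::finite) nnet \<Rightarrow> real^'n \<Rightarrow> real^'m" where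
  "Fnet \<sigma> hid \<theta> x = Psi \<sigma> hid \<theta> x - Psi \<sigma> hid \<theta> 0"

definition Rad :: "nat list \<Rightarrow> real \<Rightarrow> real \<Rightarrow> ('n::finite, 'm::finite) nnet \<Rightarrow> bool" where
  "Rad hid \<eta>1 \<eta>2 \<theta> \<longleftrightarrow>
     (\<forall>j<hd hid. \<forall>i. \<bar>W1 \<theta> j $ i\<bar> \<le> \<eta>1) \<and>
     (\<forall>j<hd hid. \<bar>b1 \<theta> j\<bar> \<le> \<eta>2) \<and>
     (\<forall>i<length (mid \<theta>). \<forall>j<hid ! (i+1). \<bar>snd (mid \<theta> ! i) j\<bar> \<le> \<eta>2) \<and>
     (\<forall>r. \<bar>bL \<theta> $ r\<bar> \<le> \<eta>2)"

definition sumsqW :: "nat list \<Rightarrow> ('n::finite, 'm::finite) nnet \<Rightarrow> real" where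
  "sumsqW hid \<theta> =
     (\<Sum>i<length (mid \<theta>). \<Sum>j<hid ! (i+1). \<Sum>k<hid ! i. (fst (mid \<theta> ! i) j k)\<^sup>2) +
     (\<Sum>r\<in>UNIV. \<Sum>k<last hid. (WL \<theta> r k)\<^sup>2)"

definition Greg :: "nat list \<Rightarrow> real \<Rightarrow> real \<Rightarrow> real \<Rightarrow> ('n::finite, 'm::finite) nnet \<Rightarrow> ennreal" where
  "Greg hid \<eta>1 \<eta>2 \<alpha> \<theta> = (if Rad hid \<eta>1 \<eta>2 \<theta> then ennreal (\<alpha> * sumsqW hid \<theta>) else \<top>)"

definition net_min :: "(real^'n) measure \<Rightarrow> (real^'n \<Rightarrow> real^'n) \<Rightarrow> real^'m^'n \<Rightarrow> real^'n^'n
     \<Rightarrow> real \<Rightarrow> real \<Rightarrow> (real \<Rightarrow> real) \<Rightarrow> nat list \<Rightarrow> real \<Rightarrow> real \<Rightarrow> real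
     \<Rightarrow> ('n, 'm) nnet \<Rightarrow> (real^'n \<Rightarrow> real \<Rightarrow> real^'n) \<Rightarrow> bool" where
  "net_min \<mu> f B Q \<beta> MY0 \<sigma> hid \<eta>1 \<eta>2 \<alpha> \<theta> Y \<longleftrightarrow>
     \<theta> \<in> params hid \<and> ens_sol \<mu> f B MY0 (Fnet \<sigma> hid \<theta>) Y \<and>
     (\<forall>\<theta>' Y'. \<theta>' \<in> params hid \<and> ens_sol \<mu> f B MY0 (Fnet \<sigma> hid \<theta>') Y' \<longrightarrow>
        jens \<mu> Q \<beta> (Fnet \<sigma> hid \<theta>) Y + Greg hid \<eta>1 \<eta>2 \<alpha> \<theta>
          \<le> jens \<mu> Q \<beta> (Fnet \<sigma> hid \<theta>') Y' + Greg hid \<eta>1 \<eta>2 \<alpha> \<theta>')"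

text \<open>epsilon-approximation of F* (with derivative of its C^1 extension on the closed ball of radius R).\<close>
definition eps_approx :: "(real \<Rightarrow> real) \<Rightarrow> nat list \<Rightarrow> (real^'n \<Rightarrow> real^'m) \<Rightarrow> real \<Rightarrow> real
     \<Rightarrow> ('n::finite, 'm::finite) nnet \<Rightarrow> bool" where
  "eps_approx \<sigma> hid Fs R \<epsilon> \<theta> \<longleftrightarrow>
     (\<forall>x. norm x \<le> R \<longrightarrow>
        norm (Fs x - Fnet \<sigma> hid \<theta> x) +
        onorm (\<lambda>h. frechet_derivative Fs (at x within cball 0 R) h
                   - frechet_derivative (Fnet \<sigma> hid \<theta>) (at x) h) \<le> \<epsilon>)"

definition cl_sol :: "(real^'n \<Rightarrow> real^'n) \<Rightarrow> real^'m^'n \<Rightarrow> (real^'n \<Rightarrow> real^'m) \<Rightarrow> real^'n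
     \<Rightarrow> (real \<Rightarrow> real^'n) \<Rightarrow> bool" where
  "cl_sol f B Fs y0 z \<longleftrightarrow> has_Wderiv z (\<lambda>t. f (z t) + B *v Fs (z t)) \<and> z 0 = y0"

definition MY0 :: "real \<Rightarrow> (real^'n) set \<Rightarrow> real" where
  "MY0 M Y0 = M * (SUP y\<in>Y0. norm y)"

definition standing_assumption_1 ::
  "(real^'n \<Rightarrow> real^'n) \<Rightarrow> real^'m^'n \<Rightarrow> real^'n^'n \<Rightarrow> real \<Rightarrow> (real^'n) set \<Rightarrow> real
   \<Rightarrow> (real^'n) set \<Rightarrow> (real^'n \<Rightarrow> real^'m) \<Rightarrow> (real^'n \<Rightarrow> real \<Rightarrow> real^'n) \<Rightarrow> real \<Rightarrow> bool" where
  "standing_assumption_1 f B Q \<beta> Y0 Ci NY0 Fs ystar M \<longleftrightarrow>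
     compact Y0 \<and> 0 \<in> Y0 \<and>
     \<comment> \<open>(A.1)\<close>
     (\<forall>x. f differentiable (at x)) \<and> f 0 = 0 \<and>
     (\<forall>K. compact K \<longrightarrow> (\<exists>L. \<forall>x\<in>K. \<forall>y\<in>K.
        onorm (\<lambda>h. frechet_derivative f (at x) h - frechet_derivative f (at y) h) \<le> L * dist x y)) \<and>
     \<comment> \<open>(A.2)\<close>
     open NY0 \<and> Y0 \<subseteq> NY0 \<and> Fs 0 = 0 \<and>
     (\<forall>y0\<in>NY0. cl_sol f B Fs y0 (ystar y0) \<and>
        (\<forall>z. cl_sol f B Fs y0 z \<longrightarrow> (\<forall>t\<ge>0. z t = ystar y0 t)) \<and>
        OCP_min f B Q \<beta> y0 (ystar y0) (\<lambda>t. Fs (ystar y0 t))) \<and>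
     \<comment> \<open>(A.3)\<close>
     (\<exists>Dy :: real^'n \<Rightarrow> real^'n \<Rightarrow> real \<Rightarrow> real^'n. \<forall>y0\<in>NY0.
        (\<forall>h h'. Dy y0 (h + h') = (\<lambda>t. Dy y0 h t + Dy y0 h' t)) \<and>
        (\<forall>a h. Dy y0 (a *\<^sub>R h) = (\<lambda>t. a *\<^sub>R Dy y0 h t)) \<and>
        (\<forall>h. inW (Dy y0 h)) \<and>
        ((\<lambda>h. Wnorm (\<lambda>t. ystar (y0 + h) t - ystar y0 t - Dy y0 h t) / norm h) \<longlongrightarrow> 0) (at 0) \<and>
        (\<forall>e>0. \<exists>d>0. \<forall>y1\<in>NY0. dist y1 y0 < d \<longrightarrow>
            (\<forall>h. Wnorm (\<lambda>t. Dy y1 h t - Dy y0 h t) \<le> e * norm h))) \<and>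
     0 < M \<and> (\<forall>y0\<in>NY0. Wnorm (ystar y0) \<le> M * norm y0) \<and>
     \<comment> \<open>(A.4), with radius 2 Mhat, Mhat = Ci * M_{Y0}\<close>
     (\<exists>DF :: real^'n \<Rightarrow> real^'n \<Rightarrow> real^'m.
        (\<forall>x\<in>cball 0 (2 * (Ci * MY0 M Y0)). (Fs has_derivative DF x) (at x within cball 0 (2 * (Ci * MY0 M Y0)))) \<and>
        (\<exists>L. \<forall>x\<in>cball 0 (2 * (Ci * MY0 M Y0)). \<forall>y\<in>cball 0 (2 * (Ci * MY0 M Y0)).
            onorm (\<lambda>h. DF x h - DF y h) \<le> L * dist x y))"

definition lin_sol :: "(real^'n \<Rightarrow> real^'n) \<Rightarrow> real^'m^'n \<Rightarrow> (real^'n \<Rightarrow> real^'m)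
     \<Rightarrow> (real \<Rightarrow> real^'n) \<Rightarrow> real^'n \<Rightarrow> (real \<Rightarrow> real^'n) \<Rightarrow> (real \<Rightarrow> real^'n) \<Rightarrow> bool" where
  "lin_sol f B Fs ys dy0 dv z \<longleftrightarrow>
     has_Wderiv z (\<lambda>t. frechet_derivative f (at (ys t)) (z t)
                       + B *v frechet_derivative Fs (at (ys t)) (z t) + dv t) \<and> z 0 = dy0"

definition assumption_3 :: "(real^'n \<Rightarrow> real^'n) \<Rightarrow> real^'m^'n \<Rightarrow> (real^'n \<Rightarrow> real^'m)
     \<Rightarrow> (real^'n) set \<Rightarrow> (real^'n \<Rightarrow> real \<Rightarrow> real^'n) \<Rightarrow> real \<Rightarrow> bool" where
  "assumption_3 f B Fs NY0 ystar C \<longleftrightarrow> 0 < C \<and>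
     (\<forall>y0\<in>NY0. \<forall>dy0 dv. sq_int dv \<longrightarrow>
        (\<exists>z. lin_sol f B Fs (ystar y0) dy0 dv z \<and>
             (\<forall>z'. lin_sol f B Fs (ystar y0) dy0 dv z' \<longrightarrow> (\<forall>t\<ge>0. z' t = z t)) \<and>
             Wnorm z \<le> C * (L2norm dv + norm dy0)))"

definition weak_sub_conv :: "(real^'n) measure \<Rightarrow> (nat \<Rightarrow> real^'n \<Rightarrow> real \<Rightarrow> real^'n)
     \<Rightarrow> (nat \<Rightarrow> real^'n \<Rightarrow> real \<Rightarrow> real^'m) \<Rightarrow> (nat \<Rightarrow> nat)
     \<Rightarrow> (real^'n \<Rightarrow> real \<Rightarrow> real^'n) \<Rightarrow> (real^'n \<Rightarrow> real \<Rightarrow> real^'m) \<Rightarrow> bool" where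
  "weak_sub_conv \<mu> Y U r Yh Uh \<longleftrightarrow> strict_mono r \<and>
     bochner_L2 \<mu> inW Wnorm Yh \<and> bochner_L2 \<mu> sq_int L2norm Uh \<and>
     (\<forall>\<Phi>. bochner_L2 \<mu> inW Wnorm \<Phi> \<longrightarrow>
        (\<lambda>k. bochner_ip \<mu> Wip (Y (r k)) \<Phi>) \<longlonglongrightarrow> bochner_ip \<mu> Wip Yh \<Phi>) \<and>
     (\<forall>\<Psi>. bochner_L2 \<mu> sq_int L2norm \<Psi> \<longrightarrow>
        (\<lambda>k. bochner_ip \<mu> L2ip (U (r k)) \<Psi>) \<longlonglongrightarrow> bochner_ip \<mu> L2ip Uh \<Psi>)"

end

theory Submission
  imports Defs
begin

text \<open>For every initial value x in Y0 the optimal pair (y*(x), F*(y*(x))) is the only minimizer and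
  attracts near-minimizers strongly: if a feasible pair (y, u) with y in the admissible ball has cost at most V(x) + d,
  then its distance to the optimal pair is at most L * sqrt d. To see this, put w = u - F*(y). As long as y stays in
  a neighbourhood of the optimal trajectory all of whose points are initial values of optimal closed-loop
  trajectories, dynamic programming on short intervals and a second-order expansion of the cost around
  the optimal trajectories give J(y, u) \<ge> V(x) + \<beta>/2 * \<integral> |w|^2. Hence w is of size sqrt d,
  and the linear stability of Assumption 3, upgraded to the nonlinear closed loop by Picard iteration, bounds y - y*(x) by w,
  which in turn keeps y inside the neighbourhood. Such a neighbourhood exists because the closed-loop flow is continuous and injective,
  so that by invariance of domain the trajectories starting in an open set sweep out open sets.

  Comparing the network minimizers with the perturbed closed loops of the \<epsilon>-approximating networks shows that their
  ensemble costs tend to the integral of V. Since V(x) is a pointwise lower bound, the costs converge in L^1, hence almost everywhere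
  along subsequences, and dominated convergence yields strong convergence of the whole sequence to the ensemble of
  optimal pairs; weak accumulation points are therefore unique.\<close>

section \<open>Square-integrable functions\<close>

definition l2 :: "'a measure \<Rightarrow> ('a \<Rightarrow> 'b::euclidean_space) \<Rightarrow> bool" where
  "l2 M g \<longleftrightarrow> g \<in> borel_measurable M \<and> integrable M (\<lambda>x. (norm (g x))\<^sup>2)"

definition l2n :: "'a measure \<Rightarrow> ('a \<Rightarrow> 'b::euclidean_space) \<Rightarrow> real" where
  "l2n M g = sqrt (\<integral>x. (norm (g x))\<^sup>2 \<partial>M)"

lemma l2D [dest]: "l2 M g \<Longrightarrow> g \<in> borel_measurable M" "l2 M g \<Longrightarrow> integrable M (\<lambda>x. (norm (g x))\<^sup>2)"
  by (auto simp: l2_def)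

lemma l2n_nonneg [simp]: "0 \<le> l2n M g"
  by (simp add: l2n_def)

lemma l2n_sq: "(l2n M g)\<^sup>2 = (\<integral>x. (norm (g x))\<^sup>2 \<partial>M)"
  by (simp add: l2n_def)

lemma l2_bound:
  assumes "l2 M g" "h \<in> borel_measurable M" "\<And>x. x \<in> space M \<Longrightarrow> norm (h x) \<le> K * norm (g x)" "0 \<le> K"
  shows "l2 M h" "l2n M h \<le> K * l2n M g"
proof -
  have sq: "(norm (h x))\<^sup>2 \<le> K\<^sup>2 * (norm (g x))\<^sup>2" if "x \<in> space M" for x
    using power_mono[OF assms(3)[OF that], of 2] by (simp add: power_mult_distrib)
  have int: "integrable M (\<lambda>x. K\<^sup>2 * (norm (g x))\<^sup>2)" using assms by auto
  have inth: "integrable M (\<lambda>x. (norm (h x))\<^sup>2)"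
    by (rule Bochner_Integration.integrable_bound[OF int]) (use assms sq in auto)
  then show "l2 M h" using assms by (auto simp: l2_def)
  have "(\<integral>x. (norm (h x))\<^sup>2 \<partial>M) \<le> (\<integral>x. K\<^sup>2 * (norm (g x))\<^sup>2 \<partial>M)"
    by (rule integral_mono[OF inth int]) (use sq in auto)
  also have "\<dots> = K\<^sup>2 * (l2n M g)\<^sup>2" by (simp add: l2n_sq)
  finally show "l2n M h \<le> K * l2n M g"
    unfolding l2n_def[of M h] using assms(4) by (simp add: real_le_lsqrt power_mult_distrib)
qed

lemma integrable_l2_mult:
  assumes "l2 M a" "l2 M b"
  shows "integrable M (\<lambda>x. norm (a x) * norm (b x))"
proof (rule Bochner_Integration.integrable_bound[of _ "\<lambda>x. (norm (a x))\<^sup>2 + (norm (b x))\<^sup>2"])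
  show "AE x in M. norm (norm (a x) * norm (b x)) \<le> norm ((norm (a x))\<^sup>2 + (norm (b x))\<^sup>2)"
  proof (rule AE_I2)
    fix x
    have "0 \<le> (norm (a x) - norm (b x))\<^sup>2" "0 \<le> norm (a x) * norm (b x)" by auto
    then have "norm (a x) * norm (b x) \<le> (norm (a x))\<^sup>2 + (norm (b x))\<^sup>2"
      unfolding power2_diff by linarith
    then show "norm (norm (a x) * norm (b x)) \<le> norm ((norm (a x))\<^sup>2 + (norm (b x))\<^sup>2)"
      by simp
  qed
qed (use assms l2D(1)[OF assms(1)] l2D(1)[OF assms(2)] in auto)

lemma integrable_l2_inner:
  assumes "l2 M a" "l2 M b"
  shows "integrable M (\<lambda>x. a x \<bullet> b x)"
  by (rule Bochner_Integration.integrable_bound[OF integrable_l2_mult[OF assms]])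
    (use l2D(1)[OF assms(1)] l2D(1)[OF assms(2)] in \<open>auto simp: Cauchy_Schwarz_ineq2\<close>)

lemma quadratic_nonneg_imp_le:
  fixes p b q :: real
  assumes "\<And>s. 0 \<le> p + 2 * s * b + s\<^sup>2 * q" "0 \<le> p" "0 \<le> q"
  shows "b \<le> sqrt p * sqrt q"
proof (cases "b \<le> 0")
  case True
  then show ?thesis using assms by (meson mult_nonneg_nonneg order_trans real_sqrt_ge_0_iff)
next
  case False
  then have b: "0 < b" by simp
  show ?thesis
  proof (cases "q = 0")
    case True
    have "0 \<le> p + 2 * (- (p + 1) / b) * b" using assms(1)[of "- (p + 1) / b"] True by simp
    then show ?thesis using b assms(2) by simp
  next
    case False
    then have q: "0 < q" using assms by simp
    have "0 \<le> p + 2 * (- b / q) * b + (- b / q)\<^sup>2 * q" by (rule assms)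
    also have "\<dots> = p - b\<^sup>2 / q" using q by (simp add: field_simps power2_eq_square)
    finally have "b\<^sup>2 \<le> p * q" using q by (simp add: field_simps)
    then have "b \<le> sqrt (p * q)" by (simp add: real_le_rsqrt)
    then show ?thesis by (simp add: real_sqrt_mult)
  qed
qed

lemma l2_mult_le:
  assumes "l2 M a" "l2 M b"
  shows "(\<integral>x. norm (a x) * norm (b x) \<partial>M) \<le> l2n M a * l2n M b"
proof -
  have ia: "integrable M (\<lambda>x. (norm (a x))\<^sup>2)" and ib: "integrable M (\<lambda>x. (norm (b x))\<^sup>2)" using assms by auto
  note iab = integrable_l2_mult[OF assms]
  show ?thesis unfolding l2n_def
  proof (rule quadratic_nonneg_imp_le)
    fix s :: real
    have "0 \<le> (\<integral>x. (norm (a x) + s * norm (b x))\<^sup>2 \<partial>M)" by simp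
    also have "\<dots> = (\<integral>x. (norm (a x))\<^sup>2 + (2 * s) * (norm (a x) * norm (b x)) + s\<^sup>2 * (norm (b x))\<^sup>2 \<partial>M)"
      by (rule Bochner_Integration.integral_cong) (auto simp: power2_sum power_mult_distrib)
    also have "\<dots> = (\<integral>x. (norm (a x))\<^sup>2 \<partial>M) + 2 * s * (\<integral>x. norm (a x) * norm (b x) \<partial>M) + s\<^sup>2 * (\<integral>x. (norm (b x))\<^sup>2 \<partial>M)"
      using ia ib iab by (simp add: Bochner_Integration.integral_add)
    finally show "0 \<le> \<dots>" .
  qed auto
qed

lemma l2_inner_le:
  assumes "l2 M a" "l2 M b"
  shows "\<bar>\<integral>x. a x \<bullet> b x \<partial>M\<bar> \<le> l2n M a * l2n M b"
proof -
  have "\<bar>\<integral>x. a x \<bullet> b x \<partial>M\<bar> \<le> (\<integral>x. norm (a x \<bullet> b x) \<partial>M)"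
    using integral_norm_bound[of M "\<lambda>x. a x \<bullet> b x"] by simp
  also have "\<dots> \<le> (\<integral>x. norm (a x) * norm (b x) \<partial>M)"
    by (intro integral_mono integrable_norm integrable_l2_inner integrable_l2_mult assms)
      (simp add: Cauchy_Schwarz_ineq2)
  finally show ?thesis using l2_mult_le[OF assms] by linarith
qed

lemma l2_add:
  assumes "l2 M a" "l2 M b"
  shows "l2 M (\<lambda>x. a x + b x)" "l2n M (\<lambda>x. a x + b x) \<le> l2n M a + l2n M b"
proof -
  have [measurable]: "a \<in> borel_measurable M" "b \<in> borel_measurable M" using assms by auto
  have ia: "integrable M (\<lambda>x. (norm (a x))\<^sup>2)" and ib: "integrable M (\<lambda>x. (norm (b x))\<^sup>2)" using assms by auto
  note iab = integrable_l2_inner[OF assms]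
  have eq: "(norm (a x + b x))\<^sup>2 = (norm (a x))\<^sup>2 + 2 * (a x \<bullet> b x) + (norm (b x))\<^sup>2" for x
    by (simp add: power2_norm_eq_inner inner_simps inner_commute)
  show 1: "l2 M (\<lambda>x. a x + b x)" using ia ib iab unfolding l2_def eq by auto
  have "(l2n M (\<lambda>x. a x + b x))\<^sup>2 = (l2n M a)\<^sup>2 + 2 * (\<integral>x. a x \<bullet> b x \<partial>M) + (l2n M b)\<^sup>2"
    using ia ib iab by (simp add: l2n_sq eq)
  also have "\<dots> \<le> (l2n M a + l2n M b)\<^sup>2" using l2_inner_le[OF assms] by (simp add: power2_sum)
  finally show "l2n M (\<lambda>x. a x + b x) \<le> l2n M a + l2n M b"
    by (meson l2n_nonneg add_nonneg_nonneg power2_le_imp_le)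
qed

lemma l2_scaleR:
  assumes "l2 M a"
  shows "l2 M (\<lambda>x. s *\<^sub>R a x)" "l2n M (\<lambda>x. s *\<^sub>R a x) = \<bar>s\<bar> * l2n M a"
  using assms by (auto simp: l2_def l2n_def power_mult_distrib real_sqrt_mult)

lemma l2_uminus:
  assumes "l2 M a"
  shows "l2 M (\<lambda>x. - a x)" "l2n M (\<lambda>x. - a x) = l2n M a"
  using assms by (auto simp: l2_def l2n_def)

lemma l2_diff:
  assumes "l2 M a" "l2 M b"
  shows "l2 M (\<lambda>x. a x - b x)" "l2n M (\<lambda>x. a x - b x) \<le> l2n M a + l2n M b"
  using l2_add[OF assms(1) l2_uminus(1)[OF assms(2)]] l2_uminus(2)[OF assms(2)] by auto

lemma l2n_minus_commute: "l2n M (\<lambda>x. a x - b x) = l2n M (\<lambda>x. b x - a x)"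
  by (simp add: l2n_def norm_minus_commute)

lemma l2n_sum_sq_diff:
  assumes "l2 M a" "l2 M b"
  shows "\<bar>(l2n M a)\<^sup>2 - (l2n M b)\<^sup>2\<bar> \<le> l2n M (\<lambda>x. a x - b x) * (l2n M a + l2n M b)"
proof -
  have 1: "\<bar>l2n M a - l2n M b\<bar> \<le> l2n M (\<lambda>x. a x - b x)"
    using l2_add(2)[OF l2_diff(1)[OF assms] assms(2)] l2_add(2)[OF l2_diff(1)[OF assms(2,1)] assms(1)]
      l2n_minus_commute[of M a b] by simp
  have "(l2n M a)\<^sup>2 - (l2n M b)\<^sup>2 = (l2n M a - l2n M b) * (l2n M a + l2n M b)"
    by (simp add: power2_eq_square algebra_simps)
  then have "\<bar>(l2n M a)\<^sup>2 - (l2n M b)\<^sup>2\<bar> = \<bar>l2n M a - l2n M b\<bar> * (l2n M a + l2n M b)"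
    by (simp add: abs_mult)
  then show ?thesis using 1 by (simp add: mult_right_mono)
qed

lemma l2n_cong_AE:
  assumes "l2 M a" "l2 M b" "AE x in M. a x = b x"
  shows "l2n M a = l2n M b"
  unfolding l2n_def by (rule arg_cong[where f=sqrt], rule integral_cong_AE)
    (use assms l2D(1)[OF assms(1)] l2D(1)[OF assms(2)] in auto)

lemma l2n_eq_0_AE:
  assumes "l2 M a" "l2n M a = 0"
  shows "AE x in M. a x = 0"
proof -
  have "(\<integral>x. (norm (a x))\<^sup>2 \<partial>M) = 0" using assms(2) by (simp add: l2n_def)
  then have "AE x in M. (norm (a x))\<^sup>2 = 0"
    using assms(1) by (subst (asm) integral_nonneg_eq_0_iff_AE) auto
  then show ?thesis by simp
qed

section \<open>The space of states on the half line\<close>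

definition HL :: "real measure" where "HL = restrict_space lborel {0..}"

lemma space_HL [simp]: "space HL = {0..}" by (simp add: HL_def space_restrict_space)

lemma sq_int_l2: "sq_int g \<longleftrightarrow> l2 HL g"
  unfolding sq_int_def l2_def HL_def set_borel_measurable_def set_integrable_def
  by (simp add: borel_measurable_restrict_space_iff integrable_restrict_space)

lemma L2norm_l2n: "L2norm g = l2n HL g"
  unfolding L2norm_def l2n_def HL_def set_lebesgue_integral_def
  by (simp add: integral_restrict_space)

lemma L2ip_HL: "L2ip a b = (\<integral>t. a t \<bullet> b t \<partial>HL)"
  unfolding L2ip_def HL_def set_lebesgue_integral_def
  by (simp add: integral_restrict_space)

lemma set_integral_HL:
  fixes a :: "real \<Rightarrow> 'a::euclidean_space"
  shows "0 \<le> s \<Longrightarrow> set_lebesgue_integral lborel {s..t} a = set_lebesgue_integral HL {s..t} a"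
  unfolding HL_def set_lebesgue_integral_def
  by (auto simp: integral_restrict_space indicator_def intro!: Bochner_Integration.integral_cong)

lemma AE_HL: "(AE t in HL. P t) \<longleftrightarrow> (AE t in lborel. 0 \<le> t \<longrightarrow> P t)"
  unfolding HL_def by (subst AE_restrict_space_iff) auto

lemma l2_HL_set_integrable:
  fixes a :: "real \<Rightarrow> 'a::euclidean_space"
  assumes "l2 HL a" "0 \<le> s"
  shows "set_integrable lborel {s..t} a"
proof -
  have m: "(\<lambda>x. indicator {0..} x *\<^sub>R a x) \<in> borel_measurable lborel"
    using l2D(1)[OF assms(1)] unfolding HL_def by (simp add: borel_measurable_restrict_space_iff)
  have i: "integrable lborel (\<lambda>x. indicator {0..} x *\<^sub>R (norm (a x))\<^sup>2)"
    using l2D(2)[OF assms(1)] unfolding HL_def by (simp add: integrable_restrict_space)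
  have i1: "integrable lborel (\<lambda>x. indicator {s..t} x :: real)"
    by (simp add: integrable_indicator_iff emeasure_lborel_Icc_eq)
  have eq: "indicator {s..t} x *\<^sub>R a x = indicator {s..t} x *\<^sub>R (indicator {0..} x *\<^sub>R a x)" for x
    using assms(2) by (auto simp: indicator_def)
  show ?thesis unfolding set_integrable_def
  proof (rule Bochner_Integration.integrable_bound[OF Bochner_Integration.integrable_add[OF i i1]])
    show "(\<lambda>x. indicat_real {s..t} x *\<^sub>R a x) \<in> borel_measurable lborel"
      unfolding eq using m by measurable
    show "AE x in lborel. norm (indicat_real {s..t} x *\<^sub>R a x)
         \<le> norm (indicat_real {0..} x *\<^sub>R (norm (a x))\<^sup>2 + indicat_real {s..t} x)"
    proof (rule AE_I2)
      fix x
      have "norm (a x) \<le> (norm (a x))\<^sup>2 + 1"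
        using zero_le_power2[of "norm (a x) - 1/2"] by (simp add: power2_diff power_divide)
      moreover have "0 \<le> (norm (a x))\<^sup>2 + 1" by (simp add: add_nonneg_nonneg)
      ultimately show "norm (indicat_real {s..t} x *\<^sub>R a x)
         \<le> norm (indicat_real {0..} x *\<^sub>R (norm (a x))\<^sup>2 + indicat_real {s..t} x)"
        using assms(2) by (auto simp: indicator_def)
    qed
  qed
qed

lemma continuous_on_HL_measurable:
  fixes a :: "real \<Rightarrow> 'a::euclidean_space"
  shows "continuous_on {0..} a \<Longrightarrow> a \<in> borel_measurable HL"
  unfolding HL_def by (metis borel_measurable_continuous_on_restrict measurable_lborel2 restrict_space_sets_cong sets_lborel measurable_cong_sets)

lemma l2_HL_cong: "(\<And>t. 0 \<le> t \<Longrightarrow> a t = b t) \<Longrightarrow> l2 HL a = l2 HL b"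
  unfolding l2_def
  by (intro conj_cong measurable_cong Bochner_Integration.integrable_cong) auto

lemma l2n_HL_cong: "(\<And>t. 0 \<le> t \<Longrightarrow> a t = b t) \<Longrightarrow> l2n HL a = l2n HL b"
  unfolding l2n_def by (intro arg_cong[where f=sqrt] Bochner_Integration.integral_cong) auto

lemma has_Wderiv_l2: "has_Wderiv y y' \<longleftrightarrow> l2 HL y \<and> l2 HL y' \<and>
     (\<forall>t\<ge>0. y t = y 0 + set_lebesgue_integral lborel {0..t} y')"
  by (simp add: has_Wderiv_def sq_int_l2)

lemma has_Wderiv_cong:
  assumes "\<And>t. 0 \<le> t \<Longrightarrow> y t = z t" "\<And>t. 0 \<le> t \<Longrightarrow> y' t = z' t"
  shows "has_Wderiv y y' = has_Wderiv z z'"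
proof -
  have "set_lebesgue_integral lborel {0..t} y' = set_lebesgue_integral lborel {0..t} z'" for t
    by (rule set_lebesgue_integral_cong) (use assms in auto)
  then show ?thesis unfolding has_Wderiv_l2 using l2_HL_cong[of y z] l2_HL_cong[of y' z'] assms by auto
qed

lemma integral_Icc_zero_AE:
  fixes g :: "real \<Rightarrow> 'a::euclidean_space"
  assumes g: "l2 HL g" and z: "\<And>t. 0 \<le> t \<Longrightarrow> set_lebesgue_integral lborel {0..t} g = 0"
  shows "AE t in HL. g t = 0"
proof -
  have "AE t in lborel. indicator {0..real n} t *\<^sub>R g t = 0" for n
  proof -
    have int: "integrable lborel (\<lambda>t. indicator {0..real n} t *\<^sub>R g t)"
      using l2_HL_set_integrable[OF g, of 0 "real n"] by (simp add: set_integrable_def)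
    have tot: "(\<integral>x. indicator {0..real n} x *\<^sub>R g x \<partial>lborel) = 0"
      using z[of "real n"] by (simp add: set_lebesgue_integral_def)
    show ?thesis
    proof (rule sigma_finite_measure.density_zero[OF sigma_finite_lborel int])
      fix A :: "real set" assume "A \<in> sets lborel"
      then have 1: "A \<in> sigma_sets UNIV (range atMost)" by (simp add: borel_eq_atMost)
      have 2: "Int_stable (range (atMost :: real \<Rightarrow> _))"
        by (auto simp: Int_stable_def)
      have 3: "range (atMost::real \<Rightarrow> _) \<subseteq> Pow UNIV" by simp
      from 2 3 1 show "set_lebesgue_integral lborel A (\<lambda>t. indicator {0..real n} t *\<^sub>R g t) = 0"
      proof (induction rule: sigma_sets_induct_disjoint)
        case (basic A)
        then obtain s where A: "A = {..s}" by auto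
        have "indicator A x *\<^sub>R indicator {0..real n} x *\<^sub>R g x = indicator {0..min s (real n)} x *\<^sub>R g x" for x
          by (auto simp: A indicator_def)
        then have "set_lebesgue_integral lborel A (\<lambda>t. indicator {0..real n} t *\<^sub>R g t) =
          set_lebesgue_integral lborel {0..min s (real n)} g"
          by (simp only: set_lebesgue_integral_def)
        also have "\<dots> = 0"
        proof (cases "0 \<le> s")
          case False
          then have "{0..min s (real n)} = {}" by auto
          then show ?thesis unfolding set_lebesgue_integral_def by simp
        qed (use z in auto)
        finally show ?case .
      next
        case empty then show ?case by (simp add: set_lebesgue_integral_def)
      next
        case (compl A)
        then have A: "A \<in> sets lborel" by (simp add: borel_eq_atMost)
        have "set_lebesgue_integral lborel (UNIV - A) (\<lambda>t. indicator {0..real n} t *\<^sub>R g t) =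
           (\<integral>x. indicator {0..real n} x *\<^sub>R g x - indicator A x *\<^sub>R indicator {0..real n} x *\<^sub>R g x \<partial>lborel)"
          unfolding set_lebesgue_integral_def
          by (rule Bochner_Integration.integral_cong) (auto simp: indicator_def)
        also have "\<dots> = 0"
          using tot compl(2) integrable_mult_indicator[OF A int] int
          by (simp add: set_lebesgue_integral_def)
        finally show ?case .
      next
        case (union A)
        have A: "\<And>i. A i \<in> sets lborel" using union by (auto simp: borel_eq_atMost)
        have UA: "(\<Union>i. A i) \<in> sets lborel" using A by auto
        have "(\<Sum>i. set_lebesgue_integral lborel (A i) (\<lambda>t. indicator {0..real n} t *\<^sub>R g t)) =
          set_lebesgue_integral lborel (\<Union>i. A i) (\<lambda>t. indicator {0..real n} t *\<^sub>R g t)"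
          by (rule lebesgue_integral_countable_add[symmetric])
            (use A union(1) integrable_mult_indicator[OF UA int] in \<open>auto simp: disjoint_family_on_def set_integrable_def\<close>)
        then show ?case using union by simp
      qed
    qed
  qed
  then have "AE t in lborel. \<forall>n. indicator {0..real n} t *\<^sub>R g t = 0" unfolding AE_all_countable by blast
  then show ?thesis unfolding AE_HL
  proof eventually_elim
    case (elim t)
    obtain n where "t \<le> real n" using real_arch_simple by blast
    then show ?case using elim[rule_format, of n] by (auto simp: indicator_def)
  qed
qed

lemma set_integral_Icc:
  fixes a :: "real \<Rightarrow> 'a::euclidean_space"
  assumes "l2 HL a" "0 \<le> s"
  shows "a integrable_on {s..t}" "set_lebesgue_integral lborel {s..t} a = integral {s..t} a"
  using set_borel_integral_eq_integral[OF l2_HL_set_integrable[OF assms]] by auto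

lemma has_WderivD:
  assumes "has_Wderiv y a"
  shows "l2 HL y" "l2 HL a" "0 \<le> t \<Longrightarrow> y t = y 0 + set_lebesgue_integral lborel {0..t} a"
  using assms unfolding has_Wderiv_l2 by blast+

lemma has_Wderiv_increment:
  assumes "has_Wderiv y a" "0 \<le> s" "s \<le> t"
  shows "y t - y s = set_lebesgue_integral lborel {s..t} a"
proof -
  have l: "l2 HL a" and e: "\<And>t. 0 \<le> t \<Longrightarrow> y t = y 0 + set_lebesgue_integral lborel {0..t} a"
    using has_WderivD[OF assms(1)] by blast+
  have "integral {0..s} a + integral {s..t} a = integral {0..t} a"
    using Henstock_Kurzweil_Integration.integral_combine[OF assms(2,3) set_integral_Icc(1)[OF l, of 0 t]] by simp
  then show ?thesis using e[of s] e[of t] set_integral_Icc(2)[OF l] assms by (simp add: algebra_simps)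
qed

lemma continuous_on_indefinite:
  fixes a :: "real \<Rightarrow> 'a::euclidean_space"
  assumes l: "l2 HL a"
  shows "continuous_on {0..} (\<lambda>t. set_lebesgue_integral lborel {0..t} a)"
proof -
  have c: "continuous_on {0..real n} (\<lambda>t. set_lebesgue_integral lborel {0..t} a)" for n
    using indefinite_integral_continuous_1[OF set_integral_Icc(1)[OF l, of 0 "real n"]]
    by (simp add: set_integral_Icc(2)[OF l])
  show ?thesis unfolding continuous_on_eq_continuous_within
  proof
    fix x :: real assume x: "x \<in> {0..}"
    obtain n where n: "x < real n" using reals_Archimedean2 by blast
    have "continuous (at x within {0..real n}) (\<lambda>t. set_lebesgue_integral lborel {0..t} a)"
      using c[of n] x n by (auto simp: continuous_on_eq_continuous_within)
    moreover have "at x within {0..real n} = at x within {0..}"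
      by (rule at_within_nhd[of _ "{..<real n}"]) (use n in auto)
    ultimately show "continuous (at x within {0..}) (\<lambda>t. set_lebesgue_integral lborel {0..t} a)" by simp
  qed
qed

lemma has_Wderiv_continuous:
  assumes "has_Wderiv y a"
  shows "continuous_on {0..} y"
proof -
  have "continuous_on {0..} (\<lambda>t. y 0 + set_lebesgue_integral lborel {0..t} a)"
    by (intro continuous_on_add continuous_on_const continuous_on_indefinite) (use has_WderivD[OF assms] in blast)
  moreover have "continuous_on {0..} y = continuous_on {0..} (\<lambda>t. y 0 + set_lebesgue_integral lborel {0..t} a)"
    by (rule continuous_on_cong[OF refl], rule has_WderivD(3)[OF assms]) simp
  ultimately show ?thesis by simp
qed

lemma has_Wderiv_add:
  assumes "has_Wderiv y a" "has_Wderiv z b"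
  shows "has_Wderiv (\<lambda>t. y t + z t) (\<lambda>t. a t + b t)"
proof -
  note D = has_WderivD[OF assms(1)] has_WderivD[OF assms(2)]
  have "l2 HL a" "l2 HL b" using D by blast+
  then have 1: "(LBINT t:{0..t}. a t + b t) = (LBINT t:{0..t}. a t) + (LBINT t:{0..t}. b t)" for t
    by (intro set_integral_add l2_HL_set_integrable) auto
  show ?thesis unfolding has_Wderiv_l2
  proof (intro conjI allI impI)
    fix t :: real assume "0 \<le> t"
    show "y t + z t = y 0 + z 0 + (LBINT t:{0..t}. a t + b t)"
      unfolding D(3)[OF \<open>0 \<le> t\<close>] D(6)[OF \<open>0 \<le> t\<close>] using 1[of t] by (simp add: algebra_simps)
  qed (intro l2_add D)+
qed

lemma has_Wderiv_scaleR:
  assumes "has_Wderiv y a"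
  shows "has_Wderiv (\<lambda>t. s *\<^sub>R y t) (\<lambda>t. s *\<^sub>R a t)"
  unfolding has_Wderiv_l2
proof (intro conjI allI impI)
  fix t :: real assume t: "0 \<le> t"
  show "s *\<^sub>R y t = s *\<^sub>R y 0 + (LBINT t:{0..t}. s *\<^sub>R a t)"
    unfolding has_WderivD(3)[OF assms t] by (simp add: scaleR_add_right)
qed (intro l2_scaleR has_WderivD[OF assms])+

lemma has_Wderiv_diff:
  assumes "has_Wderiv y a" "has_Wderiv z b"
  shows "has_Wderiv (\<lambda>t. y t - z t) (\<lambda>t. a t - b t)"
  using has_Wderiv_add[OF assms(1) has_Wderiv_scaleR[OF assms(2), of "-1"]] by simp

lemma has_Wderiv_unique:
  assumes "has_Wderiv y a" "has_Wderiv y b"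
  shows "AE t in HL. a t = b t"
proof -
  have "has_Wderiv (\<lambda>t. y t - y t) (\<lambda>t. a t - b t)" by (rule has_Wderiv_diff[OF assms])
  from has_WderivD[OF this] have "AE t in HL. a t - b t = 0" by (intro integral_Icc_zero_AE) auto
  then show ?thesis by simp
qed

lemma has_Wderiv_congD:
  assumes "has_Wderiv y a" "\<And>t. 0 \<le> t \<Longrightarrow> a t = b t"
  shows "has_Wderiv y b"
  using has_Wderiv_cong[of y y a b] assms by blast

lemma inWI: "has_Wderiv y a \<Longrightarrow> inW y" by (auto simp: inW_def)

lemma has_Wderiv_Wdot: "inW y \<Longrightarrow> has_Wderiv y (Wdot y)"
  unfolding inW_def Wdot_def by (metis someI_ex)

lemma Wnorm_eq:
  assumes "has_Wderiv y a"
  shows "Wnorm y = sqrt ((l2n HL y)\<^sup>2 + (l2n HL a)\<^sup>2)"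
proof -
  have d: "has_Wderiv y (Wdot y)" using assms by (intro has_Wderiv_Wdot inWI)
  have "l2n HL (Wdot y) = l2n HL a"
    by (rule l2n_cong_AE) (use has_WderivD[OF assms] has_WderivD[OF d] has_Wderiv_unique[OF d assms] in blast)+
  then show ?thesis by (simp add: Wnorm_def L2norm_l2n)
qed

lemma Wnorm_nonneg [simp]: "0 \<le> Wnorm y" by (simp add: Wnorm_def)

lemma l2n_le_Wnorm: "l2n HL y \<le> Wnorm y"
  by (simp add: Wnorm_def L2norm_l2n real_le_rsqrt)

lemma Wnorm_cong:
  assumes "has_Wderiv y a" "\<And>t. 0 \<le> t \<Longrightarrow> y t = z t"
  shows "Wnorm z = Wnorm y"
proof -
  have "has_Wderiv z a" using assms has_Wderiv_cong[of y z a a] by simp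
  then show ?thesis using l2n_HL_cong[of y z] assms by (simp add: Wnorm_eq[OF assms(1)] Wnorm_eq[of z a])
qed

lemma Wnorm_add_le:
  assumes "inW y" "inW z"
  shows "Wnorm (\<lambda>t. y t + z t) \<le> Wnorm y + Wnorm z"
proof -
  obtain a b where ab: "has_Wderiv y a" "has_Wderiv z b" using assms by (auto simp: inW_def)
  then have "l2 HL y" "l2 HL z" "l2 HL a" "l2 HL b" by (blast dest: has_WderivD)+
  then have "Wnorm (\<lambda>t. y t + z t) \<le> sqrt ((l2n HL y + l2n HL z)\<^sup>2 + (l2n HL a + l2n HL b)\<^sup>2)"
    unfolding Wnorm_eq[OF has_Wderiv_add[OF ab]]
    by (intro real_sqrt_le_mono add_mono power_mono l2_add) auto
  also have "\<dots> \<le> Wnorm y + Wnorm z"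
    unfolding Wnorm_eq[OF ab(1)] Wnorm_eq[OF ab(2)]
    using real_sqrt_sum_squares_triangle_ineq[of "l2n HL y" "l2n HL z" "l2n HL a" "l2n HL b"] by simp
  finally show ?thesis .
qed

lemma Wnorm_scaleR:
  assumes "inW y"
  shows "Wnorm (\<lambda>t. s *\<^sub>R y t) = \<bar>s\<bar> * Wnorm y"
proof -
  obtain a where a: "has_Wderiv y a" using assms by (auto simp: inW_def)
  then have "l2 HL y" "l2 HL a" by (blast dest: has_WderivD)+
  then show ?thesis unfolding Wnorm_eq[OF a] Wnorm_eq[OF has_Wderiv_scaleR[OF a]]
    by (simp add: l2_scaleR power_mult_distrib distrib_left[symmetric] real_sqrt_mult)
qed

lemma inW_diff: "inW y \<Longrightarrow> inW z \<Longrightarrow> inW (\<lambda>t. y t - z t)"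
  unfolding inW_def using has_Wderiv_diff by blast

lemma inW_scaleR: "inW y \<Longrightarrow> inW (\<lambda>t. s *\<^sub>R y t)"
  unfolding inW_def using has_Wderiv_scaleR by blast

lemma inW_l2: "inW y \<Longrightarrow> l2 HL y"
  by (auto simp: inW_def dest: has_WderivD)

lemma Wnorm_minus_commute:
  assumes "inW y" "inW z"
  shows "Wnorm (\<lambda>t. y t - z t) = Wnorm (\<lambda>t. z t - y t)"
  using Wnorm_scaleR[OF inW_diff[OF assms], of "-1"] by simp

lemma Wnorm_le_diff:
  assumes "inW y" "inW z"
  shows "Wnorm y \<le> Wnorm z + Wnorm (\<lambda>t. y t - z t)"
  using Wnorm_add_le[OF assms(2) inW_diff[OF assms]] by simp

text \<open>Extension by zero to the whole line turns shifts of half-line functions into translations.\<close>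

lemma l2_HL_lborel:
  "l2 HL a \<longleftrightarrow> l2 lborel (\<lambda>t. indicator {0..} t *\<^sub>R a t)"
  "l2n HL a = l2n lborel (\<lambda>t. indicator {0..} t *\<^sub>R a t)"
proof -
  have eq: "(norm (indicator {0..} t *\<^sub>R a t))\<^sup>2 = indicator {0..} t *\<^sub>R (norm (a t))\<^sup>2" for t :: real
    by (auto simp: indicator_def)
  show "l2 HL a \<longleftrightarrow> l2 lborel (\<lambda>t. indicator {0..} t *\<^sub>R a t)"
    unfolding l2_def eq HL_def by (simp add: borel_measurable_restrict_space_iff integrable_restrict_space)
  show "l2n HL a = l2n lborel (\<lambda>t. indicator {0..} t *\<^sub>R a t)"
    unfolding l2n_def eq HL_def by (simp add: integral_restrict_space)
qed

lemma l2_lborel_shift: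
  assumes "l2 lborel (a::real \<Rightarrow> _)"
  shows "l2 lborel (\<lambda>t. a (s + t))" "l2n lborel (\<lambda>t. a (s + t)) = l2n lborel a"
  using assms lborel_integrable_real_affine_iff[of 1 "\<lambda>t. (norm (a t))\<^sup>2" s]
    lborel_integral_real_affine[of 1 "\<lambda>t. (norm (a t))\<^sup>2" s]
  by (auto simp: l2_def l2n_def)

definition trunc :: "real \<Rightarrow> (real \<Rightarrow> 'a::real_normed_vector) \<Rightarrow> real \<Rightarrow> 'a" where
  "trunc \<tau> a t = (if t < \<tau> then a t else 0)"

definition cat :: "real \<Rightarrow> (real \<Rightarrow> 'a) \<Rightarrow> (real \<Rightarrow> 'a) \<Rightarrow> real \<Rightarrow> 'a" where
  "cat \<tau> a b t = (if t < \<tau> then a t else b (t - \<tau>))"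

lemma l2_trunc:
  assumes "l2 HL a"
  shows "l2 HL (trunc \<tau> a)" "l2n HL (trunc \<tau> a) \<le> l2n HL a"
proof -
  have [measurable]: "a \<in> borel_measurable HL" using assms by auto
  have m: "trunc \<tau> a \<in> borel_measurable HL"
  proof -
    have "(\<lambda>t. t) \<in> borel_measurable HL" by (rule continuous_on_HL_measurable) simp
    then have [measurable]: "Measurable.pred HL (\<lambda>t. t < \<tau>)" by simp
    show ?thesis unfolding trunc_def by measurable
  qed
  show "l2 HL (trunc \<tau> a)" "l2n HL (trunc \<tau> a) \<le> l2n HL a"
    using l2_bound[OF assms m, of 1] by (auto simp: trunc_def)
qed

lemma l2_shift:
  assumes "l2 HL a" "0 \<le> \<tau>"
  shows "l2 HL (\<lambda>t. a (\<tau> + t))" "(l2n HL a)\<^sup>2 = (l2n HL (trunc \<tau> a))\<^sup>2 + (l2n HL (\<lambda>t. a (\<tau> + t)))\<^sup>2"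
    "l2n HL (\<lambda>t. a (\<tau> + t)) \<le> l2n HL a"
proof -
  define r where "r = (\<lambda>t. a t - trunc \<tau> a t)"
  have lr: "l2 HL r" unfolding r_def by (intro l2_diff assms l2_trunc)
  have eq: "indicator {0..} (\<tau> + t) *\<^sub>R r (\<tau> + t) = indicator {0..} t *\<^sub>R a (\<tau> + t)" for t
    using assms by (auto simp: r_def trunc_def indicator_def)
  note 1 = l2_lborel_shift[OF lr[unfolded l2_HL_lborel(1)], of \<tau>, unfolded eq]
  show "l2 HL (\<lambda>t. a (\<tau> + t))" using 1(1) by (simp add: l2_HL_lborel(1))
  have n: "l2n HL (\<lambda>t. a (\<tau> + t)) = l2n HL r" using 1(2) by (simp add: l2_HL_lborel(2))
  have "(l2n HL a)\<^sup>2 = (\<integral>t. (norm (trunc \<tau> a t))\<^sup>2 + (norm (r t))\<^sup>2 \<partial>HL)"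
    unfolding l2n_sq by (rule Bochner_Integration.integral_cong) (auto simp: r_def trunc_def)
  also have "\<dots> = (l2n HL (trunc \<tau> a))\<^sup>2 + (l2n HL r)\<^sup>2"
    unfolding l2n_sq by (rule Bochner_Integration.integral_add) (use lr l2_trunc[OF assms(1)] in auto)
  finally show 2: "(l2n HL a)\<^sup>2 = (l2n HL (trunc \<tau> a))\<^sup>2 + (l2n HL (\<lambda>t. a (\<tau> + t)))\<^sup>2"
    by (simp add: n)
  show "l2n HL (\<lambda>t. a (\<tau> + t)) \<le> l2n HL a"
    by (rule power2_le_imp_le) (use 2 in auto)
qed

lemma l2_cat:
  assumes "l2 HL a" "l2 HL b" "0 \<le> \<tau>"
  shows "l2 HL (cat \<tau> a b)" "(l2n HL (cat \<tau> a b))\<^sup>2 = (l2n HL (trunc \<tau> a))\<^sup>2 + (l2n HL b)\<^sup>2"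
proof -
  have eq: "indicator {0..} (- \<tau> + t) *\<^sub>R b (- \<tau> + t) = indicator {0..} t *\<^sub>R (if t < \<tau> then 0 else b (t - \<tau>))" for t
    using assms by (auto simp: indicator_def)
  have 1: "l2 HL (\<lambda>t. if t < \<tau> then 0 else b (t - \<tau>))"
    using l2_lborel_shift(1)[OF assms(2)[unfolded l2_HL_lborel(1)], of "-\<tau>", unfolded eq]
    by (simp add: l2_HL_lborel(1))
  have "cat \<tau> a b = (\<lambda>t. trunc \<tau> a t + (if t < \<tau> then 0 else b (t - \<tau>)))"
    by (auto simp: cat_def trunc_def)
  then show 2: "l2 HL (cat \<tau> a b)" using l2_add(1)[OF l2_trunc(1)[OF assms(1)] 1] by simp
  have "trunc \<tau> (cat \<tau> a b) = trunc \<tau> a" by (auto simp: cat_def trunc_def)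
  moreover have "l2n HL (\<lambda>t. cat \<tau> a b (\<tau> + t)) = l2n HL b"
    by (rule l2n_HL_cong) (auto simp: cat_def)
  ultimately show "(l2n HL (cat \<tau> a b))\<^sup>2 = (l2n HL (trunc \<tau> a))\<^sup>2 + (l2n HL b)\<^sup>2"
    using l2_shift(2)[OF 2 assms(3)] by simp
qed

lemma set_integral_shift:
  fixes a :: "real \<Rightarrow> 'a::euclidean_space"
  shows "(LBINT t:{s..t}. a (\<tau> + t)) = set_lebesgue_integral lborel {\<tau> + s..\<tau> + t} a"
proof -
  have "indicat_real {\<tau> + s..\<tau> + t} (\<tau> + x) = indicator {s..t} x" for x
    by (auto simp: indicator_def)
  then show ?thesis using lborel_integral_real_affine[of 1 "\<lambda>x. indicator {\<tau> + s..\<tau> + t} x *\<^sub>R a x" \<tau>]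
    unfolding set_lebesgue_integral_def by simp
qed

lemma has_Wderiv_shift:
  assumes "has_Wderiv y a" "0 \<le> \<tau>"
  shows "has_Wderiv (\<lambda>t. y (\<tau> + t)) (\<lambda>t. a (\<tau> + t))"
  unfolding has_Wderiv_l2
proof (intro conjI allI impI)
  show "l2 HL (\<lambda>t. y (\<tau> + t))" "l2 HL (\<lambda>t. a (\<tau> + t))"
    by (intro l2_shift assms(2) has_WderivD[OF assms(1)])+
  fix t :: real assume "0 \<le> t"
  then show "y (\<tau> + t) = y (\<tau> + 0) + (LBINT t:{0..t}. a (\<tau> + t))"
    using has_Wderiv_increment[OF assms(1), of \<tau> "\<tau> + t"] assms(2) by (simp add: set_integral_shift diff_eq_eq)
qed

lemma has_Wderiv_cat:
  assumes y: "has_Wderiv y a" and z: "has_Wderiv z b" and "y \<tau> = z 0" "0 \<le> \<tau>"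
  shows "has_Wderiv (cat \<tau> y z) (cat \<tau> a b)"
  unfolding has_Wderiv_l2
proof (intro conjI allI impI)
  have ly: "l2 HL y" "l2 HL z" and la: "l2 HL a" "l2 HL b" using has_WderivD[OF y] has_WderivD[OF z] by blast+
  show "l2 HL (cat \<tau> y z)" by (rule l2_cat[OF ly assms(4)])
  show lc: "l2 HL (cat \<tau> a b)" by (rule l2_cat[OF la assms(4)])
  have y0: "cat \<tau> y z 0 = y 0" using assms by (auto simp: cat_def)
  have i1: "set_lebesgue_integral lborel {0..t} (cat \<tau> a b) = y t - y 0" if "0 \<le> t" "t \<le> \<tau>" for t
  proof -
    have "set_lebesgue_integral lborel {0..t} (cat \<tau> a b) = set_lebesgue_integral lborel {0..t} a"
      unfolding set_lebesgue_integral_def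
    proof (rule integral_cong_AE)
      show "AE x in lborel. indicat_real {0..t} x *\<^sub>R cat \<tau> a b x = indicat_real {0..t} x *\<^sub>R a x"
        using AE_lborel_singleton[of \<tau>] by eventually_elim (use that in \<open>auto simp: cat_def indicator_def\<close>)
    qed (use l2_HL_set_integrable[OF lc, of 0 t] l2_HL_set_integrable[OF la(1), of 0 t] in \<open>auto simp: set_integrable_def\<close>)
    then show ?thesis using has_Wderiv_increment[OF y, of 0 t] that by simp
  qed
  fix t :: real assume t: "0 \<le> t"
  show "cat \<tau> y z t = cat \<tau> y z 0 + set_lebesgue_integral lborel {0..t} (cat \<tau> a b)"
  proof (cases "t < \<tau>")
    case True
    then show ?thesis using i1[of t] t y0 by (simp add: cat_def)
  next
    case False
    have "set_lebesgue_integral lborel {0..t} (cat \<tau> a b) =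
       set_lebesgue_integral lborel {0..\<tau>} (cat \<tau> a b) + set_lebesgue_integral lborel {\<tau>..t} (cat \<tau> a b)"
      using Henstock_Kurzweil_Integration.integral_combine[OF assms(4) _ set_integral_Icc(1)[OF lc, of 0 t]] False assms(4)
      by (simp add: set_integral_Icc(2)[OF lc])
    also have "set_lebesgue_integral lborel {\<tau>..t} (cat \<tau> a b) = (LBINT s:{0..t - \<tau>}. cat \<tau> a b (\<tau> + s))"
      by (simp add: set_integral_shift)
    also have "\<dots> = set_lebesgue_integral lborel {0..t - \<tau>} b"
      by (rule set_lebesgue_integral_cong) (auto simp: cat_def)
    also have "\<dots> = z (t - \<tau>) - z 0" using has_Wderiv_increment[OF z, of 0 "t - \<tau>"] False by simp
    finally show ?thesis using i1[of \<tau>] assms(3,4) y0 False by (simp add: cat_def[of \<tau> y z t])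
  qed
qed

lemma gronwall:
  fixes \<phi> :: "real \<Rightarrow> real"
  assumes c: "continuous_on {0..T} \<phi>" and K: "0 \<le> K" and a: "0 \<le> a"
    and le: "\<And>t. 0 \<le> t \<Longrightarrow> t \<le> T \<Longrightarrow> \<phi> t \<le> a + K * integral {0..t} \<phi>"
    and t: "0 \<le> t" "t \<le> T"
  shows "\<phi> t \<le> a * exp (K * t)"
proof -
  define \<psi> where "\<psi> = (\<lambda>t. exp (- (K * t)) * (a + K * integral {0..t} \<phi>))"
  have "\<psi> t \<le> \<psi> 0"
  proof (rule DERIV_nonpos_imp_decreasing_open[OF t(1)])
    have "continuous_on {0..t} (\<lambda>t. integral {0..t} \<phi>)"
      by (intro indefinite_integral_continuous_1 integrable_continuous_real continuous_on_subset[OF c]) (use t in auto)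
    then show "continuous_on {0..t} \<psi>" unfolding \<psi>_def by (intro continuous_intros)
    fix x assume x: "0 < x" "x < t"
    have "((\<lambda>t. integral {0..t} \<phi>) has_real_derivative \<phi> x) (at x within {0..T})"
      by (rule integral_has_real_derivative[OF c]) (use x t in auto)
    then have [derivative_intros]: "((\<lambda>t. integral {0..t} \<phi>) has_real_derivative \<phi> x) (at x)"
      using x t at_within_Icc_at[of 0 x T] by simp
    have "(\<psi> has_real_derivative exp (- (K * x)) * (K * \<phi> x) - K * exp (- (K * x)) * (a + K * integral {0..x} \<phi>)) (at x)"
      unfolding \<psi>_def by (auto intro!: derivative_eq_intros)
    moreover have "exp (- (K * x)) * (K * \<phi> x) - K * exp (- (K * x)) * (a + K * integral {0..x} \<phi>)
      = exp (- (K * x)) * K * (\<phi> x - (a + K * integral {0..x} \<phi>))" by (simp add: algebra_simps)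
    moreover have "\<dots> \<le> 0" using le[of x] x t K by (intro mult_nonneg_nonpos) auto
    ultimately show "\<exists>y. (\<psi> has_real_derivative y) (at x) \<and> y \<le> 0" by metis
  qed
  then have "exp (- (K * t)) * (a + K * integral {0..t} \<phi>) \<le> a" by (simp add: \<psi>_def)
  then have "a + K * integral {0..t} \<phi> \<le> a * exp (K * t)" by (simp add: exp_minus field_simps)
  then show ?thesis using le[OF t] by linarith
qed

lemma gronwall_backward:
  fixes \<phi> :: "real \<Rightarrow> real"
  assumes c: "continuous_on {0..T} \<phi>" and K: "0 \<le> K"
    and le: "\<And>t. 0 \<le> t \<Longrightarrow> t \<le> T \<Longrightarrow> \<phi> t \<le> K * integral {t..T} \<phi>"
    and t: "0 \<le> t" "t \<le> T"
  shows "\<phi> t \<le> 0"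
proof -
  have split: "integral {x..T} \<phi> = integral {0..T} \<phi> - integral {0..x} \<phi>" if "0 \<le> x" "x \<le> T" for x
    using Henstock_Kurzweil_Integration.integral_combine[OF that integrable_continuous_real[OF c]] by simp
  define m where "m = (\<lambda>x. integral {0..T} \<phi> - integral {0..x} \<phi>)"
  define \<psi> where "\<psi> = (\<lambda>t. exp (K * t) * m t)"
  have "\<psi> t \<le> \<psi> T"
  proof (rule DERIV_nonneg_imp_increasing_open[OF t(2)])
    have "continuous_on {0..T} (\<lambda>t. integral {0..t} \<phi>)"
      by (intro indefinite_integral_continuous_1 integrable_continuous_real c)
    then have "continuous_on {t..T} (\<lambda>t. integral {0..t} \<phi>)" by (rule continuous_on_subset) (use t in auto)
    then show "continuous_on {t..T} \<psi>" unfolding \<psi>_def m_def by (intro continuous_intros)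
    fix x assume x: "t < x" "x < T"
    have "((\<lambda>t. integral {0..t} \<phi>) has_real_derivative \<phi> x) (at x within {0..T})"
      by (rule integral_has_real_derivative[OF c]) (use x t in auto)
    then have [derivative_intros]: "((\<lambda>t. integral {0..t} \<phi>) has_real_derivative \<phi> x) (at x)"
      using x t at_within_Icc_at[of 0 x T] by simp
    have "(\<psi> has_real_derivative K * exp (K * x) * m x - exp (K * x) * \<phi> x) (at x)"
      unfolding \<psi>_def m_def by (auto intro!: derivative_eq_intros)
    moreover have "K * exp (K * x) * m x - exp (K * x) * \<phi> x = exp (K * x) * (K * m x - \<phi> x)" by (simp add: algebra_simps)
    moreover have "0 \<le> \<dots>" using le[of x] x t split[of x] by (intro mult_nonneg_nonneg) (auto simp: m_def)
    ultimately show "\<exists>y. (\<psi> has_real_derivative y) (at x) \<and> 0 \<le> y" by metis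
  qed
  then have "m t \<le> 0" by (simp add: \<psi>_def m_def mult_le_0_iff)
  then have "K * integral {t..T} \<phi> \<le> 0" using K split[OF t] by (simp add: m_def mult_nonneg_nonpos)
  then show ?thesis using le[OF t] by linarith
qed

lemma norm_set_integral_Icc_le:
  fixes a :: "real \<Rightarrow> 'a::euclidean_space"
  assumes "l2 HL a" "0 \<le> s" "b integrable_on {s..t}" "\<And>x. s \<le> x \<Longrightarrow> x < t \<Longrightarrow> norm (a x) \<le> b x"
  shows "norm (set_lebesgue_integral lborel {s..t} a) \<le> integral {s..t} b"
proof -
  let ?a = "a(t := 0)" and ?b = "b(t := 0)"
  have ia: "?a integrable_on {s..t}"
    by (rule integrable_spike[OF set_integral_Icc(1)[OF assms(1,2)], of "{t}"]) auto
  have ib: "?b integrable_on {s..t}" by (rule integrable_spike[OF assms(3), of "{t}"]) auto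
  have "norm (integral {s..t} ?a) \<le> integral {s..t} ?b"
    by (rule integral_norm_bound_integral[OF ia ib]) (use assms in auto)
  moreover have "integral {s..t} a = integral {s..t} ?a" by (rule integral_spike[of "{t}"]) auto
  moreover have "integral {s..t} b = integral {s..t} ?b" by (rule integral_spike[of "{t}"]) auto
  ultimately show ?thesis unfolding set_integral_Icc(2)[OF assms(1,2)] by simp
qed

lemma l2_indicator_Icc:
  assumes "0 \<le> \<tau>"
  shows "l2 HL (\<lambda>t. indicator {0..\<tau>} t :: real)" "l2n HL (\<lambda>t. indicator {0..\<tau>} t :: real) = sqrt \<tau>"
proof -
    have e: "indicat_real {0..} t *\<^sub>R indicat_real {0..\<tau>} t = indicator {0..\<tau>} t" for t
      using assms by (auto simp: indicator_def)
    have e2: "(norm (indicat_real {0..\<tau>} t))\<^sup>2 = indicator {0..\<tau>} t" for t by (auto simp: indicator_def)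
    show "l2 HL (\<lambda>t. indicator {0..\<tau>} t :: real)"
      unfolding l2_HL_lborel(1) e unfolding l2_def e2 using assms by (auto simp: integrable_indicator_iff)
    show "l2n HL (\<lambda>t. indicator {0..\<tau>} t :: real) = sqrt \<tau>"
      unfolding l2_HL_lborel(2) e unfolding l2n_def e2 using assms by simp
qed

lemma integral_Icc_sq_le:
  fixes a :: "real \<Rightarrow> 'a::euclidean_space"
  assumes "l2 HL a" "0 \<le> \<tau>"
  shows "(\<lambda>t. norm (a t)) integrable_on {0..\<tau>}" "integral {0..\<tau>} (\<lambda>t. norm (a t)) \<le> sqrt \<tau> * l2n HL (trunc \<tau> a)"
proof -
  have ln: "l2 HL (\<lambda>t. norm (a t))" using assms(1) by (auto simp: l2_def)
  show "(\<lambda>t. norm (a t)) integrable_on {0..\<tau>}" by (rule set_integral_Icc(1)[OF ln]) simp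
  note ind = l2_indicator_Icc[OF assms(2)]
  have tn: "l2 HL (trunc \<tau> a)" by (rule l2_trunc[OF assms(1)])
  have "integral {0..\<tau>} (\<lambda>t. norm (a t)) = set_lebesgue_integral lborel {0..\<tau>} (\<lambda>t. norm (a t))"
    by (rule set_integral_Icc(2)[OF ln, symmetric]) simp
  also have "\<dots> = set_lebesgue_integral HL {0..\<tau>} (\<lambda>t. norm (a t))" by (rule set_integral_HL) simp
  also have "\<dots> = (\<integral>t. norm (indicat_real {0..\<tau>} t) * norm (trunc \<tau> a t) \<partial>HL)"
    unfolding set_lebesgue_integral_def
  proof (rule integral_cong_AE)
    have "AE t in HL. t \<noteq> \<tau>" unfolding AE_HL using AE_lborel_singleton[of \<tau>] by eventually_elim auto
    then show "AE t in HL. indicat_real {0..\<tau>} t *\<^sub>R norm (a t) = norm (indicat_real {0..\<tau>} t) * norm (trunc \<tau> a t)"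
      by eventually_elim (auto simp: indicator_def trunc_def)
  qed (use l2D(1)[OF ind(1)] l2D(1)[OF ln] l2D(1)[OF tn] in \<open>auto simp del: borel_measurable_indicator_iff\<close>)
  also have "\<dots> \<le> sqrt \<tau> * l2n HL (trunc \<tau> a)" using l2_mult_le[OF ind(1) tn] by (simp add: ind)
  finally show "integral {0..\<tau>} (\<lambda>t. norm (a t)) \<le> sqrt \<tau> * l2n HL (trunc \<tau> a)" .
qed

lemma gronwall_integral_eq:
  fixes \<zeta> e :: "real \<Rightarrow> 'a::euclidean_space"
  assumes c: "continuous_on {0..\<tau>} \<zeta>" and l: "l2 HL e" and K: "0 \<le> K"
    and eq: "\<And>t. 0 \<le> t \<Longrightarrow> t \<le> \<tau> \<Longrightarrow> \<zeta> t = \<zeta> 0 + set_lebesgue_integral lborel {0..t} e"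
    and le: "\<And>t. 0 \<le> t \<Longrightarrow> t < \<tau> \<Longrightarrow> norm (e t) \<le> K * norm (\<zeta> t) + b t"
    and b: "b integrable_on {0..\<tau>}" "\<And>t. 0 \<le> t \<Longrightarrow> t \<le> \<tau> \<Longrightarrow> 0 \<le> b t"
    and t: "0 \<le> t" "t \<le> \<tau>"
  shows "norm (\<zeta> t) \<le> (norm (\<zeta> 0) + integral {0..\<tau>} b) * exp (K * t)"
proof (rule gronwall[OF _ K])
  show "continuous_on {0..\<tau>} (\<lambda>t. norm (\<zeta> t))" using c by (intro continuous_intros)
  show "0 \<le> norm (\<zeta> 0) + integral {0..\<tau>} b" using b by (intro add_nonneg_nonneg integral_nonneg) auto
  fix s assume s: "0 \<le> s" "s \<le> \<tau>"
  have iz: "(\<lambda>t. norm (\<zeta> t)) integrable_on {0..s}"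
    by (intro integrable_continuous_real continuous_intros continuous_on_subset[OF c]) (use s in auto)
  have ib: "b integrable_on {0..s}" by (rule integrable_on_subinterval[OF b(1)]) (use s in auto)
  have "norm (set_lebesgue_integral lborel {0..s} e) \<le> integral {0..s} (\<lambda>t. K * norm (\<zeta> t) + b t)"
    by (rule norm_set_integral_Icc_le[OF l]) (use s le iz ib in \<open>auto intro!: integrable_add integrable_on_mult_right\<close>)
  also have "\<dots> = K * integral {0..s} (\<lambda>t. norm (\<zeta> t)) + integral {0..s} b"
    using iz ib by (simp add: Henstock_Kurzweil_Integration.integral_add integrable_on_mult_right)
  also have "integral {0..s} b \<le> integral {0..\<tau>} b"
    by (rule integral_subset_le) (use s ib b in auto)
  finally have "norm (set_lebesgue_integral lborel {0..s} e) \<le> K * integral {0..s} (\<lambda>t. norm (\<zeta> t)) + integral {0..\<tau>} b"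
    by simp
  moreover have "norm (\<zeta> s) \<le> norm (\<zeta> 0) + norm (set_lebesgue_integral lborel {0..s} e)"
    unfolding eq[OF s] by (rule norm_triangle_ineq)
  ultimately show "norm (\<zeta> s) \<le> norm (\<zeta> 0) + integral {0..\<tau>} b + K * integral {0..s} (\<lambda>t. norm (\<zeta> t))"
    by simp
qed (use t in auto)

lemma gronwall_backward_Wderiv:
  fixes \<zeta> e :: "real \<Rightarrow> 'a::euclidean_space"
  assumes \<zeta>: "has_Wderiv \<zeta> e" and K: "0 \<le> K" and z: "\<zeta> \<tau> = 0"
    and le: "\<And>t. 0 \<le> t \<Longrightarrow> norm (e t) \<le> K * norm (\<zeta> t)"
    and t: "0 \<le> t" "t \<le> \<tau>"
  shows "\<zeta> t = 0"
proof -
  have c: "continuous_on {0..\<tau>} \<zeta>" using has_Wderiv_continuous[OF \<zeta>] by (rule continuous_on_subset) auto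
  have "norm (\<zeta> t) \<le> 0"
  proof (rule gronwall_backward[OF _ K _ t])
    show "continuous_on {0..\<tau>} (\<lambda>t. norm (\<zeta> t))" using c by (intro continuous_intros)
    fix s assume s: "0 \<le> s" "s \<le> \<tau>"
    have iz: "(\<lambda>t. norm (\<zeta> t)) integrable_on {s..\<tau>}"
      by (intro integrable_continuous_real continuous_intros continuous_on_subset[OF c]) (use s in auto)
    have "norm (\<zeta> s) = norm (set_lebesgue_integral lborel {s..\<tau>} e)"
      using has_Wderiv_increment[OF \<zeta> s] z by (metis diff_0 norm_minus_cancel)
    also have "\<dots> \<le> integral {s..\<tau>} (\<lambda>t. K * norm (\<zeta> t))"
      by (rule norm_set_integral_Icc_le[OF has_WderivD(2)[OF \<zeta>]]) (use s le iz in \<open>auto intro!: integrable_on_mult_right\<close>)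
    finally show "norm (\<zeta> s) \<le> K * integral {s..\<tau>} (\<lambda>t. norm (\<zeta> t))" by simp
  qed
  then show ?thesis by simp
qed

lemma l2_trunc_bounded:
  fixes a :: "real \<Rightarrow> 'a::euclidean_space"
  assumes "trunc \<tau> a \<in> borel_measurable HL" "\<And>t. 0 \<le> t \<Longrightarrow> t < \<tau> \<Longrightarrow> norm (a t) \<le> m" "0 \<le> m" "0 \<le> \<tau>"
  shows "l2 HL (trunc \<tau> a)" "l2n HL (trunc \<tau> a) \<le> m * sqrt \<tau>"
  using l2_bound[OF l2_indicator_Icc(1)[OF assms(4)] assms(1), of m] assms(2,3)
  unfolding l2_indicator_Icc(2)[OF assms(4)] by (auto simp: trunc_def indicator_def)

lemma trunc_measurable:
  fixes a :: "real \<Rightarrow> 'a::euclidean_space"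
  assumes [measurable]: "a \<in> borel_measurable HL"
  shows "trunc \<tau> a \<in> borel_measurable HL"
proof -
  have "(\<lambda>t. t) \<in> borel_measurable HL" by (rule continuous_on_HL_measurable) simp
  then have [measurable]: "Measurable.pred HL (\<lambda>t. t < \<tau>)" by simp
  show ?thesis unfolding trunc_def by measurable
qed

definition trap :: "real \<Rightarrow> real \<Rightarrow> real \<Rightarrow> real" where
  "trap a b t = 1 - max 0 (min t b - a) / (b - a)"

lemma trap_simps:
  assumes "a < b"
  shows "t \<le> a \<Longrightarrow> trap a b t = 1" "b \<le> t \<Longrightarrow> trap a b t = 0" "0 \<le> trap a b t" "trap a b t \<le> 1"
  using assms by (auto simp: trap_def field_simps max_def min_def)

lemma has_Wderiv_trap:
  fixes v :: "'a::euclidean_space"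
  assumes "0 \<le> a" "a < b"
  shows "has_Wderiv (\<lambda>t. trap a b t *\<^sub>R v) (\<lambda>t. (- 1 / (b - a) * indicator {a..b} t) *\<^sub>R v)"
  unfolding has_Wderiv_l2
proof (intro conjI allI impI)
  have b0: "0 \<le> b" using assms by simp
  have idm: "(\<lambda>t. t) \<in> borel_measurable HL" by (rule continuous_on_HL_measurable) simp
  have m1: "(\<lambda>t. trap a b t *\<^sub>R v) \<in> borel_measurable HL"
    unfolding trap_def by (intro continuous_on_HL_measurable continuous_intros) (use assms in auto)
  show "l2 HL (\<lambda>t. trap a b t *\<^sub>R v)"
    using l2_bound(1)[OF l2_indicator_Icc(1)[OF b0] m1, of "norm v"] trap_simps[OF assms(2)]
    by (auto simp: indicator_def mult_left_le_one_le)
  have [measurable]: "Measurable.pred HL (\<lambda>t. t \<in> {a..b})"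
    unfolding atLeastAtMost_iff using idm by measurable
  have m2: "(\<lambda>t. (- 1 / (b - a) * indicator {a..b} t) *\<^sub>R v) \<in> borel_measurable HL"
    unfolding indicator_def by measurable
  show "l2 HL (\<lambda>t. (- 1 / (b - a) * indicator {a..b} t) *\<^sub>R v)"
    using l2_bound(1)[OF l2_indicator_Icc(1)[OF b0] m2, of "norm v / (b - a)"] assms
    by (auto simp: indicator_def)
  fix t :: real assume t: "0 \<le> t"
  have "(LBINT s:{0..t}. (- 1 / (b - a) * indicator {a..b} s) *\<^sub>R v) =
     (LBINT s. indicator {max 0 a..min t b} s *\<^sub>R ((- 1 / (b - a)) *\<^sub>R v))"
    unfolding set_lebesgue_integral_def using assms(1)
    by (intro Bochner_Integration.integral_cong) (auto simp: indicator_def)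
  also have "\<dots> = measure lborel {max 0 a..min t b} *\<^sub>R ((- 1 / (b - a)) *\<^sub>R v)"
    by (cases "max 0 a \<le> min t b") (auto simp: integral_scaleR_left)
  also have "measure lborel {max 0 a..min t b} = max 0 (min t b - a)" using assms by (cases "a \<le> min t b") auto
  finally have "(LBINT s:{0..t}. (- 1 / (b - a) * indicator {a..b} s) *\<^sub>R v) = (- max 0 (min t b - a) / (b - a)) *\<^sub>R v"
    by simp
  moreover have "trap a b 0 = 1" using assms by (simp add: trap_simps)
  ultimately show "trap a b t *\<^sub>R v = trap a b 0 *\<^sub>R v + (LBINT s:{0..t}. (- 1 / (b - a) * indicator {a..b} s) *\<^sub>R v)"
    by (simp add: trap_def scaleR_left_diff_distrib)
qed

lemma l2_limit:
  assumes a: "\<And>j. l2 M (a j)" "\<And>j. l2n M (a j) \<le> r"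
    and lim: "\<And>x. x \<in> space M \<Longrightarrow> (\<lambda>j. a j x) \<longlonglongrightarrow> b x"
  shows "l2 M b" "l2n M b \<le> r"
proof -
  have [measurable]: "\<And>j. a j \<in> borel_measurable M" using a by auto
  have b[measurable]: "b \<in> borel_measurable M" by (rule borel_measurable_LIMSEQ_metric[OF _ lim]) auto
  have r: "0 \<le> r" using a(2)[of 0] l2n_nonneg[of M "a 0"] by linarith
  have "(\<integral>\<^sup>+x. ennreal ((norm (b x))\<^sup>2) \<partial>M) = (\<integral>\<^sup>+x. liminf (\<lambda>j. ennreal ((norm (a j x))\<^sup>2)) \<partial>M)"
  proof (rule nn_integral_cong)
    fix x assume "x \<in> space M"
    from lim[OF this] have "(\<lambda>j. ennreal ((norm (a j x))\<^sup>2)) \<longlonglongrightarrow> ennreal ((norm (b x))\<^sup>2)"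
      by (intro tendsto_ennrealI tendsto_power tendsto_norm)
    then show "ennreal ((norm (b x))\<^sup>2) = liminf (\<lambda>j. ennreal ((norm (a j x))\<^sup>2))"
      by (rule lim_imp_Liminf[OF trivial_limit_sequentially, symmetric])
  qed
  also have "\<dots> \<le> liminf (\<lambda>j. \<integral>\<^sup>+x. ennreal ((norm (a j x))\<^sup>2) \<partial>M)"
    by (rule nn_integral_liminf) auto
  also have "\<dots> \<le> liminf (\<lambda>j. ennreal (r\<^sup>2))"
  proof (rule Liminf_mono, rule always_eventually, rule allI)
    fix j
    have "(\<integral>\<^sup>+x. ennreal ((norm (a j x))\<^sup>2) \<partial>M) = ennreal ((l2n M (a j))\<^sup>2)"
      unfolding l2n_sq by (rule nn_integral_eq_integral) (use a in auto)
    also have "\<dots> \<le> ennreal (r\<^sup>2)" using a(2)[of j] by (intro ennreal_leI power_mono) auto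
    finally show "(\<integral>\<^sup>+x. ennreal ((norm (a j x))\<^sup>2) \<partial>M) \<le> ennreal (r\<^sup>2)" .
  qed
  also have "\<dots> = ennreal (r\<^sup>2)" by (simp add: Liminf_const)
  finally have le: "(\<integral>\<^sup>+x. ennreal ((norm (b x))\<^sup>2) \<partial>M) \<le> ennreal (r\<^sup>2)" .
  then have "(\<integral>\<^sup>+x. ennreal ((norm (b x))\<^sup>2) \<partial>M) < \<infinity>"
    using order_le_less_trans[OF le ennreal_less_top] by simp
  then have i: "integrable M (\<lambda>x. (norm (b x))\<^sup>2)" by (intro integrableI_nonneg) auto
  then show "l2 M b" using b by (simp add: l2_def)
  have "ennreal ((l2n M b)\<^sup>2) \<le> ennreal (r\<^sup>2)"
    using le nn_integral_eq_integral[OF i] by (simp add: l2n_sq)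
  then have "(l2n M b)\<^sup>2 \<le> r\<^sup>2" by (subst (asm) ennreal_le_iff) auto
  then show "l2n M b \<le> r" using r by (rule power2_le_imp_le)
qed

lemma lipschitz_continuous_on:
  fixes F :: "'a::real_normed_vector \<Rightarrow> 'b::real_normed_vector"
  assumes "\<And>a b. a \<in> S \<Longrightarrow> b \<in> S \<Longrightarrow> norm (F a - F b) \<le> K * norm (a - b)"
  shows "continuous_on S F"
  unfolding continuous_on_def
proof
  fix x assume x: "x \<in> S"
  have "((\<lambda>a. F a - F x) \<longlongrightarrow> 0) (at x within S)"
  proof (rule Lim_null_comparison)
    show "\<forall>\<^sub>F a in at x within S. norm (F a - F x) \<le> K * norm (a - x)"
      unfolding eventually_at_filter using assms x by auto
    have "((\<lambda>a. K * norm (a - x)) \<longlongrightarrow> K * norm (x - x)) (at x within S)"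
      by (intro tendsto_intros)
    then show "((\<lambda>a. K * norm (a - x)) \<longlongrightarrow> 0) (at x within S)" by simp
  qed
  then show "(F \<longlongrightarrow> F x) (at x within S)" by (simp add: LIM_zero_iff)
qed

section \<open>Perturbation of the closed loop\<close>

text \<open>A and DF stand for the derivatives of the closed-loop field f + B F* and of F* on the ball of radius R;
  only these quantitative consequences of C^1 with Lipschitz derivative enter.\<close>

locale closed_loop =
  fixes f :: "real^'n \<Rightarrow> real^'n" and B :: "real^'m^'n" and Fs :: "real^'n \<Rightarrow> real^'m"
    and A :: "real^'n \<Rightarrow> real^'n \<Rightarrow> real^'n" and DF :: "real^'n \<Rightarrow> real^'n \<Rightarrow> real^'m"
    and Q :: "real^'n^'n" and \<beta> Ci R K :: real
  assumes Ci: "0 < Ci"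
    and embed: "\<And>(y::real \<Rightarrow> real^'n) t. inW y \<Longrightarrow> 0 \<le> t \<Longrightarrow> norm (y t) \<le> Ci * Wnorm y"
    and beta: "0 < \<beta>" and R: "0 < R" and K: "1 \<le> K"
    and linA: "\<And>x. norm x \<le> R \<Longrightarrow> linear (A x)"
    and A_bd: "\<And>x h. norm x \<le> R \<Longrightarrow> norm (A x h) \<le> K * norm h"
    and A_lip: "\<And>x y h. norm x \<le> R \<Longrightarrow> norm y \<le> R \<Longrightarrow> norm (A x h - A y h) \<le> K * norm (x - y) * norm h"
    and G_lip: "\<And>a b. norm a \<le> R \<Longrightarrow> norm b \<le> R \<Longrightarrow>
       norm ((f a + B *v Fs a) - (f b + B *v Fs b)) \<le> K * norm (a - b)"
    and G_quad: "\<And>a b c. norm a \<le> R \<Longrightarrow> norm b \<le> R \<Longrightarrow> norm c \<le> R \<Longrightarrow>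
       norm ((f a + B *v Fs a) - (f b + B *v Fs b) - A c (a - b)) \<le> K * (norm (a - c) + norm (b - c)) * norm (a - b)"
    and f0: "f 0 = 0" and Fs0: "Fs 0 = 0"
    and linDF: "\<And>x. norm x \<le> R \<Longrightarrow> linear (DF x)"
    and DF_bd: "\<And>x h. norm x \<le> R \<Longrightarrow> norm (DF x h) \<le> K * norm h"
    and DF_lip: "\<And>x y h. norm x \<le> R \<Longrightarrow> norm y \<le> R \<Longrightarrow> norm (DF x h - DF y h) \<le> K * norm (x - y) * norm h"
    and Fs_lip: "\<And>a b. norm a \<le> R \<Longrightarrow> norm b \<le> R \<Longrightarrow> norm (Fs a - Fs b) \<le> K * norm (a - b)"
    and Fs_quad: "\<And>a b c. norm a \<le> R \<Longrightarrow> norm b \<le> R \<Longrightarrow> norm c \<le> R \<Longrightarrow>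
       norm (Fs a - Fs b - DF c (a - b)) \<le> K * (norm (a - c) + norm (b - c)) * norm (a - b)"
    and B_bd: "\<And>w. norm (B *v w) \<le> K * norm w"
    and Q_bd: "\<And>x. norm (Q *v x) \<le> K * norm x"
begin

definition G where "G x = f x + B *v Fs x"

lemma K0: "0 \<le> K" "0 < K" using K by auto

lemma G_lip': "norm a \<le> R \<Longrightarrow> norm b \<le> R \<Longrightarrow> norm (G a - G b) \<le> K * norm (a - b)"
  unfolding G_def by (rule G_lip)

lemma G_quad': "norm a \<le> R \<Longrightarrow> norm b \<le> R \<Longrightarrow> norm c \<le> R \<Longrightarrow>
  norm (G a - G b - A c (a - b)) \<le> K * (norm (a - c) + norm (b - c)) * norm (a - b)"
  unfolding G_def by (rule G_quad)

lemma Wderiv_bd: "has_Wderiv y a \<Longrightarrow> 0 \<le> t \<Longrightarrow> norm (y t) \<le> Ci * Wnorm (y::real \<Rightarrow> real^'n)"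
  using embed inWI by blast

lemma nemytskii_l2:
  fixes F :: "real^'n \<Rightarrow> 'b::euclidean_space"
  assumes "continuous_on {0..} y" "\<And>t. 0 \<le> t \<Longrightarrow> norm (y t) \<le> R" "l2 HL y"
    and lip: "\<And>a b. norm a \<le> R \<Longrightarrow> norm b \<le> R \<Longrightarrow> norm (F a - F b) \<le> L * norm (a - b)" and "F 0 = 0" "0 \<le> L"
  shows "l2 HL (\<lambda>t. F (y t))" "l2n HL (\<lambda>t. F (y t)) \<le> L * l2n HL y"
proof -
  have "continuous_on (cball 0 R) F" by (rule lipschitz_continuous_on[of _ _ L]) (use lip in auto)
  then have "continuous_on {0..} (\<lambda>t. F (y t))"
    by (rule continuous_on_compose2[OF _ assms(1)]) (use assms in auto)
  then have m: "(\<lambda>t. F (y t)) \<in> borel_measurable HL" by (rule continuous_on_HL_measurable)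
  have "norm (F (y t)) \<le> L * norm (y t)" if "0 \<le> t" for t
    using lip[of "y t" 0] assms(2)[OF that] R assms(5) by simp
  then show "l2 HL (\<lambda>t. F (y t))" "l2n HL (\<lambda>t. F (y t)) \<le> L * l2n HL y"
    using l2_bound[OF assms(3) m, of L] assms(6) by auto
qed

lemma family_measurable:
  fixes D :: "real^'n \<Rightarrow> real^'n \<Rightarrow> 'b::euclidean_space"
  assumes c: "continuous_on {0..} c" "\<And>t. 0 \<le> t \<Longrightarrow> norm (c t) \<le> R" and z: "z \<in> borel_measurable HL"
    and lin: "\<And>x. norm x \<le> R \<Longrightarrow> linear (D x)"
    and bd: "\<And>x h. norm x \<le> R \<Longrightarrow> norm (D x h) \<le> K * norm h"
    and lip: "\<And>x y h. norm x \<le> R \<Longrightarrow> norm y \<le> R \<Longrightarrow> norm (D x h - D y h) \<le> K * norm (x - y) * norm h"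
  shows "(\<lambda>t. D (c t) (z t)) \<in> borel_measurable HL"
proof -
  have cont: "continuous_on {0..} (\<lambda>t. D (c t) h)" for h
    by (rule continuous_on_compose2[OF lipschitz_continuous_on[of "cball 0 R" "\<lambda>x. D x h" "K * norm h"] c(1)])
       (use lip c in \<open>auto simp: mult_ac\<close>)
  then have [measurable]: "(\<lambda>t. D (c t) h) \<in> borel_measurable HL" for h by (rule continuous_on_HL_measurable)
  have [measurable]: "z \<in> borel_measurable HL" by fact
  have eq: "D (c t) (z t) = (\<Sum>b\<in>Basis. (z t \<bullet> b) *\<^sub>R D (c t) b)" if "t \<in> space HL" for t
  proof -
    have l: "linear (D (c t))" using lin c(2) that by auto
    have "D (c t) (z t) = D (c t) (\<Sum>b\<in>Basis. (z t \<bullet> b) *\<^sub>R b)" by (simp add: euclidean_representation)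
    also have "\<dots> = (\<Sum>b\<in>Basis. (z t \<bullet> b) *\<^sub>R D (c t) b)" by (simp add: linear_sum[OF l] linear_cmul[OF l])
    finally show ?thesis .
  qed
  have "(\<lambda>t. \<Sum>b\<in>Basis. (z t \<bullet> b) *\<^sub>R D (c t) b) \<in> borel_measurable HL" by measurable
  then show ?thesis using measurable_cong[of HL "\<lambda>t. D (c t) (z t)" "\<lambda>t. \<Sum>b\<in>Basis. (z t \<bullet> b) *\<^sub>R D (c t) b" borel] eq by simp
qed

lemma family_l2:
  fixes D :: "real^'n \<Rightarrow> real^'n \<Rightarrow> 'b::euclidean_space"
  assumes c: "continuous_on {0..} c" "\<And>t. 0 \<le> t \<Longrightarrow> norm (c t) \<le> R" and z: "l2 HL z"
    and lin: "\<And>x. norm x \<le> R \<Longrightarrow> linear (D x)"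
    and bd: "\<And>x h. norm x \<le> R \<Longrightarrow> norm (D x h) \<le> K * norm h"
    and lip: "\<And>x y h. norm x \<le> R \<Longrightarrow> norm y \<le> R \<Longrightarrow> norm (D x h - D y h) \<le> K * norm (x - y) * norm h"
  shows "l2 HL (\<lambda>t. D (c t) (z t))" "l2n HL (\<lambda>t. D (c t) (z t)) \<le> K * l2n HL z"
  using l2_bound[OF z family_measurable[OF c l2D(1)[OF z] lin bd lip], of K] bd c(2) K0 by auto

lemma l2_B: "l2 HL w \<Longrightarrow> l2 HL (\<lambda>t. B *v w t)" "l2 HL w \<Longrightarrow> l2n HL (\<lambda>t. B *v w t) \<le> K * l2n HL w"
proof -
  assume w: "l2 HL w"
  have "continuous_on UNIV ((*v) B)" by (rule linear_continuous_on) (simp add: matrix_vector_mul_bounded_linear)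
  then have m: "(\<lambda>t. B *v w t) \<in> borel_measurable HL"
    using borel_measurable_continuous_on l2D(1)[OF w] by blast
  show "l2 HL (\<lambda>t. B *v w t)" "l2n HL (\<lambda>t. B *v w t) \<le> K * l2n HL w"
    using l2_bound[OF w m, of K] B_bd K0 by auto
qed

lemma l2_Q: "l2 HL w \<Longrightarrow> l2 HL (\<lambda>t. Q *v w t)" "l2 HL w \<Longrightarrow> l2n HL (\<lambda>t. Q *v w t) \<le> K * l2n HL w"
proof -
  assume w: "l2 HL w"
  have "continuous_on UNIV ((*v) Q)" by (rule linear_continuous_on) (simp add: matrix_vector_mul_bounded_linear)
  then have m: "(\<lambda>t. Q *v w t) \<in> borel_measurable HL"
    using borel_measurable_continuous_on l2D(1)[OF w] by blast
  show "l2 HL (\<lambda>t. Q *v w t)" "l2n HL (\<lambda>t. Q *v w t) \<le> K * l2n HL w"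
    using l2_bound[OF w m, of K] Q_bd K0 by auto
qed

definition lin_solvable :: "(real \<Rightarrow> real^'n) \<Rightarrow> real \<Rightarrow> bool" where
  "lin_solvable c C \<longleftrightarrow> 0 < C \<and> (\<forall>h v. l2 HL v \<longrightarrow>
     (\<exists>z. has_Wderiv z (\<lambda>t. A (c t) (z t) + v t) \<and> z 0 = h) \<and>
     (\<forall>z. has_Wderiv z (\<lambda>t. A (c t) (z t) + v t) \<and> z 0 = h \<longrightarrow> Wnorm z \<le> C * (l2n HL v + norm h)))"

lemma lin_solvable_bd:
  assumes "lin_solvable c C" "l2 HL v" "has_Wderiv z (\<lambda>t. A (c t) (z t) + v t)"
  shows "Wnorm z \<le> C * (l2n HL v + norm (z 0))"
  using assms unfolding lin_solvable_def by blast

lemma lin_solvable_mono: "lin_solvable c C \<Longrightarrow> C \<le> C' \<Longrightarrow> lin_solvable c C'"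
proof -
  assume lb: "lin_solvable c C" and le: "C \<le> C'"
  have "Wnorm z \<le> C' * (l2n HL v + norm h)"
    if "l2 HL v" "has_Wderiv z (\<lambda>t. A (c t) (z t) + v t)" "z 0 = h" for z v h
    using lin_solvable_bd[OF lb that(1,2)] mult_right_mono[OF le, of "l2n HL v + norm h"] that(3)
    by (simp add: add_nonneg_nonneg)
  then show "lin_solvable c C'" using lb le unfolding lin_solvable_def by force
qed

lemma stability:
  assumes c: "continuous_on {0..} c" "\<And>t. 0 \<le> t \<Longrightarrow> norm (c t) \<le> R" and lb: "lin_solvable c C"
    and ya: "has_Wderiv ya (\<lambda>t. G (ya t) + k (ya t) + va t)" and yb: "has_Wderiv yb (\<lambda>t. G (yb t) + k (yb t) + vb t)"
    and v: "l2 HL va" "l2 HL vb"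
    and R: "\<And>t. 0 \<le> t \<Longrightarrow> norm (ya t) \<le> R" "\<And>t. 0 \<le> t \<Longrightarrow> norm (yb t) \<le> R"
    and near: "\<And>t. 0 \<le> t \<Longrightarrow> norm (ya t - c t) \<le> \<sigma>" "\<And>t. 0 \<le> t \<Longrightarrow> norm (yb t - c t) \<le> \<sigma>"
    and k: "\<And>a b. norm a \<le> R \<Longrightarrow> norm b \<le> R \<Longrightarrow> norm (k a - k b) \<le> \<epsilon> * norm (a - b)" "0 \<le> \<epsilon>"
    and small: "C * (2 * K * \<sigma> + \<epsilon>) \<le> 1/2"
  shows "Wnorm (\<lambda>t. ya t - yb t) \<le> 2 * C * (l2n HL (\<lambda>t. va t - vb t) + norm (ya 0 - yb 0))"
proof -
  define \<zeta> where "\<zeta> t = ya t - yb t" for t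
  define e where "e t = (G (ya t) + k (ya t) + va t) - (G (yb t) + k (yb t) + vb t) - A (c t) (\<zeta> t)" for t
  have d: "has_Wderiv \<zeta> (\<lambda>t. (G (ya t) + k (ya t) + va t) - (G (yb t) + k (yb t) + vb t))"
    unfolding \<zeta>_def by (rule has_Wderiv_diff[OF ya yb])
  have l\<zeta>: "l2 HL \<zeta>" using has_WderivD(1)[OF d] .
  have lA: "l2 HL (\<lambda>t. A (c t) (\<zeta> t))" by (rule family_l2(1)[OF c l\<zeta> linA A_bd A_lip])
  have le: "l2 HL e" unfolding e_def by (rule l2_diff(1)[OF has_WderivD(2)[OF d] lA])
  have lv: "l2 HL (\<lambda>t. va t - vb t)" by (rule l2_diff(1)[OF v])
  have lr: "l2 HL (\<lambda>t. e t - (va t - vb t))" by (rule l2_diff(1)[OF le lv])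
  define q where "q = 2 * K * \<sigma> + \<epsilon>"
  have \<sigma>: "0 \<le> \<sigma>" using near(1)[of 0] norm_ge_zero[of "ya 0 - c 0"] by linarith
  have q0: "0 \<le> q" using \<sigma> K0 k(2) by (simp add: q_def)
  have pw: "norm (e t - (va t - vb t)) \<le> q * norm (\<zeta> t)" if t: "0 \<le> t" for t
  proof -
    have "e t - (va t - vb t) = (G (ya t) - G (yb t) - A (c t) (ya t - yb t)) + (k (ya t) - k (yb t))"
      by (simp add: e_def \<zeta>_def)
    also have "norm \<dots> \<le> K * (norm (ya t - c t) + norm (yb t - c t)) * norm (ya t - yb t) + \<epsilon> * norm (ya t - yb t)"
      by (intro norm_triangle_le add_mono G_quad' k R c t)
    also have "\<dots> \<le> K * (\<sigma> + \<sigma>) * norm (ya t - yb t) + \<epsilon> * norm (ya t - yb t)"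
      by (intro add_mono mult_right_mono mult_left_mono near t) (use K0 in auto)
    finally show ?thesis by (simp add: q_def \<zeta>_def algebra_simps)
  qed
  have "l2n HL (\<lambda>t. e t - (va t - vb t)) \<le> q * l2n HL \<zeta>"
    by (rule l2_bound(2)[OF l\<zeta> l2D(1)[OF lr]]) (use pw q0 in auto)
  then have 1: "l2n HL e \<le> q * l2n HL \<zeta> + l2n HL (\<lambda>t. va t - vb t)"
    using l2_add(2)[OF lr lv] by simp
  have C: "0 < C" using lb by (simp add: lin_solvable_def)
  have "(\<lambda>t. A (c t) (\<zeta> t) + e t) = (\<lambda>t. (G (ya t) + k (ya t) + va t) - (G (yb t) + k (yb t) + vb t))"
    by (simp add: e_def fun_eq_iff)
  with d have "has_Wderiv \<zeta> (\<lambda>t. A (c t) (\<zeta> t) + e t)" by (simp only:)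
  from lin_solvable_bd[OF lb le this] have "Wnorm \<zeta> \<le> C * (l2n HL e + norm (\<zeta> 0))" .
  also have "\<dots> \<le> C * (q * l2n HL \<zeta> + l2n HL (\<lambda>t. va t - vb t) + norm (\<zeta> 0))"
    using 1 C by (intro mult_left_mono add_mono) auto
  also have "\<dots> = (C * q) * l2n HL \<zeta> + C * (l2n HL (\<lambda>t. va t - vb t) + norm (\<zeta> 0))" by (simp add: algebra_simps)
  also have "\<dots> \<le> (1/2) * l2n HL \<zeta> + C * (l2n HL (\<lambda>t. va t - vb t) + norm (\<zeta> 0))"
    using small by (intro add_mono mult_right_mono) (auto simp: q_def)
  also have "\<dots> \<le> (1/2) * Wnorm \<zeta> + C * (l2n HL (\<lambda>t. va t - vb t) + norm (\<zeta> 0))"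
    using l2n_le_Wnorm[of \<zeta>] by simp
  finally show ?thesis by (simp add: \<zeta>_def[abs_def])
qed

lemma l2n_zero [simp]: "l2n M (\<lambda>x. 0) = 0" by (simp add: l2n_def)
lemma l2_zero [simp]: "l2 M (\<lambda>x. 0)" by (simp add: l2_def)

lemma has_Wderiv_zero: "has_Wderiv (\<lambda>t. 0::real^'n) (\<lambda>t. 0)"
  unfolding has_Wderiv_l2 by simp

lemma Wnorm_zero: "Wnorm (\<lambda>t. 0::real^'n) = 0"
  using Wnorm_eq[OF has_Wderiv_zero] by simp

lemma l2_HL_AE_integrable_limit:
  fixes s :: "nat \<Rightarrow> real \<Rightarrow> real^'n"
  assumes s: "\<And>j. l2 HL (s j)" and lim: "\<And>t. 0 \<le> t \<Longrightarrow> (\<lambda>j. s j t) \<longlonglongrightarrow> b t"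
    and w: "l2 HL w" and bd: "\<And>j t. 0 \<le> t \<Longrightarrow> norm (s j t) \<le> m + w t" and t: "0 \<le> t"
  shows "(\<lambda>j. set_lebesgue_integral lborel {0..t} (s j)) \<longlonglongrightarrow> set_lebesgue_integral lborel {0..t} b"
  unfolding set_lebesgue_integral_def
proof (rule integral_dominated_convergence)
  have i: "integrable lborel (\<lambda>x. indicator {0..t} x *\<^sub>R s j x)" for j
    using l2_HL_set_integrable[OF s] by (simp add: set_integrable_def)
  then show m: "(\<lambda>x. indicator {0..t} x *\<^sub>R s j x) \<in> borel_measurable lborel" for j by auto
  have l: "(\<lambda>j. indicator {0..t} x *\<^sub>R s j x) \<longlonglongrightarrow> indicator {0..t} x *\<^sub>R b x" for x
    by (cases "0 \<le> x \<and> x \<le> t") (use lim in auto)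
  then show "AE x in lborel. (\<lambda>j. indicator {0..t} x *\<^sub>R s j x) \<longlonglongrightarrow> indicator {0..t} x *\<^sub>R b x" by simp
  show "(\<lambda>x. indicator {0..t} x *\<^sub>R b x) \<in> borel_measurable lborel"
    by (rule borel_measurable_LIMSEQ_metric[OF m l])
  have "integrable lborel (\<lambda>x. indicator {0..t} x *\<^sub>R w x)"
    using l2_HL_set_integrable[OF w] by (simp add: set_integrable_def)
  moreover have "integrable lborel (\<lambda>x. indicator {0..t} x *\<^sub>R m)"
    by (intro integrable_scaleR_left) (auto simp: integrable_indicator_iff emeasure_lborel_Icc_eq)
  ultimately show "integrable lborel (\<lambda>x. indicator {0..t} x *\<^sub>R m + indicator {0..t} x *\<^sub>R w x)"
    by (intro Bochner_Integration.integrable_add)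
  show "AE x in lborel. norm (indicator {0..t} x *\<^sub>R s j x) \<le> indicator {0..t} x *\<^sub>R m + indicator {0..t} x *\<^sub>R w x" for j
    by (rule AE_I2) (use bd in \<open>auto simp: indicator_def\<close>)
qed

text \<open>Picard iteration for z = y - c, each step solving the linearisation along c.\<close>

lemma perturbation:
  assumes c: "has_Wderiv c (\<lambda>t. G (c t))" "\<And>t. 0 \<le> t \<Longrightarrow> norm (c t) \<le> \<rho>0" and lb: "lin_solvable c C"
    and v: "l2 HL v"
    and k: "\<And>a b. norm a \<le> R \<Longrightarrow> norm b \<le> R \<Longrightarrow> norm (k a - k b) \<le> \<epsilon> * norm (a - b)" "0 \<le> \<epsilon>" "k 0 = 0"
    and \<rho>: "0 < \<rho>" "\<rho>0 + Ci * \<rho> \<le> R" and small: "C * (2 * K * (Ci * \<rho>) + \<epsilon>) \<le> 1/2"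
    and small2: "C * (l2n HL v + \<epsilon> * l2n HL c + norm h) \<le> \<rho> / 2"
  shows "\<exists>y. has_Wderiv y (\<lambda>t. G (y t) + k (y t) + v t) \<and> y 0 = c 0 + h \<and>
     Wnorm (\<lambda>t. y t - c t) \<le> 2 * C * (l2n HL v + \<epsilon> * l2n HL c + norm h) \<and>
     (\<forall>t\<ge>0. norm (y t) \<le> R \<and> norm (y t - c t) \<le> Ci * \<rho>)"
proof -
  define q where "q = 2 * K * (Ci * \<rho>) + \<epsilon>"
  define m where "m = Ci * \<rho>"
  have m0: "0 < m" using Ci \<rho> by (simp add: m_def)
  have q0: "0 \<le> q" using m0 K0 k(2) by (simp add: q_def m_def[symmetric])
  have C: "0 < C" using lb by (simp add: lin_solvable_def)
  have cR: "norm (c t) \<le> R" if "0 \<le> t" for t using c(2)[OF that] \<rho>(2) m0 by (simp add: m_def)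
  have cc: "continuous_on {0..} c" by (rule has_Wderiv_continuous[OF c(1)])
  have lc: "l2 HL c" "l2 HL (\<lambda>t. G (c t))" using has_WderivD[OF c(1)] by blast+
  have czR: "norm (c t + x) \<le> R" if "0 \<le> t" "norm x \<le> m" for t x
    using c(2)[OF that(1)] that(2) \<rho>(2) norm_triangle_ineq[of "c t" x] by (simp add: m_def)
  define \<Phi> where "\<Phi> z t = G (c t + z t) - G (c t) - A (c t) (z t) + k (c t + z t) + v t" for z :: "real \<Rightarrow> real^'n" and t
  have \<Phi>_lip: "norm (\<Phi> z1 t - \<Phi> z2 t) \<le> q * norm (z1 t - z2 t)"
    if t: "0 \<le> t" and z: "norm (z1 t) \<le> m" "norm (z2 t) \<le> m" for z1 z2 t
  proof -
    have lin: "linear (A (c t))" by (rule linA[OF cR[OF t]])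
    have eq: "\<Phi> z1 t - \<Phi> z2 t = (G (c t + z1 t) - G (c t + z2 t) - A (c t) ((c t + z1 t) - (c t + z2 t))) + (k (c t + z1 t) - k (c t + z2 t))"
      by (simp add: \<Phi>_def linear_diff[OF lin])
    have g: "norm (G (c t + z1 t) - G (c t + z2 t) - A (c t) ((c t + z1 t) - (c t + z2 t))) \<le> K * (norm (z1 t) + norm (z2 t)) * norm (z1 t - z2 t)"
      using G_quad'[OF czR[OF t z(1)] czR[OF t z(2)] cR[OF t]] by simp
    have kk: "norm (k (c t + z1 t) - k (c t + z2 t)) \<le> \<epsilon> * norm (z1 t - z2 t)"
      using k(1)[OF czR[OF t z(1)] czR[OF t z(2)]] by simp
    have "K * (norm (z1 t) + norm (z2 t)) * norm (z1 t - z2 t) \<le> K * (m + m) * norm (z1 t - z2 t)"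
      by (intro mult_right_mono mult_left_mono add_mono z K0) simp
    then show ?thesis unfolding eq using g kk
      by (intro norm_triangle_le) (simp add: q_def m_def algebra_simps)
  qed
  have \<Phi>0: "l2 HL (\<Phi> (\<lambda>t. 0))" "l2n HL (\<Phi> (\<lambda>t. 0)) \<le> l2n HL v + \<epsilon> * l2n HL c"
    "\<And>t. 0 \<le> t \<Longrightarrow> norm (\<Phi> (\<lambda>t. 0) t) \<le> \<epsilon> * norm (c t) + norm (v t)"
  proof -
    have e: "\<Phi> (\<lambda>t. 0) t = k (c t) + v t" if "0 \<le> t" for t
      using linear_0[OF linA[OF cR[OF that]]] by (simp add: \<Phi>_def)
    note kc = nemytskii_l2[OF cc cR lc(1) k(1) k(3,2)]
    show "l2 HL (\<Phi> (\<lambda>t. 0))" using l2_add(1)[OF kc(1) v] l2_HL_cong[of "\<Phi> (\<lambda>t. 0)" "\<lambda>t. k (c t) + v t"] e by simp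
    show "l2n HL (\<Phi> (\<lambda>t. 0)) \<le> l2n HL v + \<epsilon> * l2n HL c"
      using l2_add(2)[OF kc(1) v] kc(2) l2n_HL_cong[of "\<Phi> (\<lambda>t. 0)" "\<lambda>t. k (c t) + v t"] e by simp
    fix t :: real assume t: "0 \<le> t"
    have "norm (k (c t)) \<le> \<epsilon> * norm (c t)" using k(1)[OF cR[OF t], of 0] k(3) R by simp
    then show "norm (\<Phi> (\<lambda>t. 0) t) \<le> \<epsilon> * norm (c t) + norm (v t)"
      unfolding e[OF t] using norm_triangle_ineq[of "k (c t)" "v t"] by linarith
  qed
  have \<Phi>_meas: "\<Phi> z \<in> borel_measurable HL" if cz: "continuous_on {0..} z" and z: "\<And>t. 0 \<le> t \<Longrightarrow> norm (z t) \<le> m" for z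
  proof -
    have cz': "continuous_on {0..} (\<lambda>t. c t + z t)" by (intro continuous_on_add cc cz)
    have "continuous_on (cball 0 R) G" by (rule lipschitz_continuous_on[of _ _ K]) (use G_lip' in auto)
    then have [measurable]: "(\<lambda>t. G (c t + z t)) \<in> borel_measurable HL"
      by (intro continuous_on_HL_measurable continuous_on_compose2[OF _ cz']) (use czR z in auto)
    have "continuous_on (cball 0 R) k" by (rule lipschitz_continuous_on[of _ _ \<epsilon>]) (use k in auto)
    then have [measurable]: "(\<lambda>t. k (c t + z t)) \<in> borel_measurable HL"
      by (intro continuous_on_HL_measurable continuous_on_compose2[OF _ cz']) (use czR z in auto)
    have [measurable]: "(\<lambda>t. A (c t) (z t)) \<in> borel_measurable HL"
      by (rule family_measurable[OF cc cR continuous_on_HL_measurable[OF cz] linA A_bd A_lip])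
    have [measurable]: "(\<lambda>t. G (c t)) \<in> borel_measurable HL" "v \<in> borel_measurable HL" using lc v by auto
    show ?thesis unfolding \<Phi>_def by measurable
  qed
  have \<Phi>_l2: "l2 HL (\<Phi> z)" "l2n HL (\<Phi> z) \<le> q * l2n HL z + l2n HL v + \<epsilon> * l2n HL c"
    if mz: "\<Phi> z \<in> borel_measurable HL" and lz: "l2 HL z" and z: "\<And>t. 0 \<le> t \<Longrightarrow> norm (z t) \<le> m" for z
  proof -
    have "norm (\<Phi> z t - \<Phi> (\<lambda>t. 0) t) \<le> q * norm (z t)" if "0 \<le> t" for t
      using \<Phi>_lip[where ?z1.0 = z and ?z2.0 = "\<lambda>t. 0" and t = t] z[OF that] that m0 by simp
    then have 1: "l2 HL (\<lambda>t. \<Phi> z t - \<Phi> (\<lambda>t. 0) t)" "l2n HL (\<lambda>t. \<Phi> z t - \<Phi> (\<lambda>t. 0) t) \<le> q * l2n HL z"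
      using l2_bound[OF lz borel_measurable_diff[OF mz l2D(1)[OF \<Phi>0(1)]], of q] q0 by auto
    show "l2 HL (\<Phi> z)" using l2_add(1)[OF 1(1) \<Phi>0(1)] by simp
    show "l2n HL (\<Phi> z) \<le> q * l2n HL z + l2n HL v + \<epsilon> * l2n HL c"
      using l2_add(2)[OF 1(1) \<Phi>0(1)] 1(2) \<Phi>0(2) by simp
  qed
  define good where "good z \<longleftrightarrow> inW z \<and> Wnorm z \<le> \<rho>" for z :: "real \<Rightarrow> real^'n"
  have good_bd: "norm (z t) \<le> m" if "good z" "0 \<le> t" for z t
    using embed[of z t] that Ci mult_left_mono[of "Wnorm z" \<rho> Ci] unfolding good_def m_def by linarith
  have good_l2: "l2 HL z" "continuous_on {0..} z" if "good z" for z
    using that has_Wderiv_continuous inW_l2 unfolding good_def inW_def by blast+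
  have \<Phi>_good: "l2 HL (\<Phi> z)" "l2n HL (\<Phi> z) \<le> q * \<rho> + l2n HL v + \<epsilon> * l2n HL c" if "good z" for z
  proof -
    note b = \<Phi>_l2[OF \<Phi>_meas[OF good_l2(2)[OF that] good_bd[OF that]] good_l2(1)[OF that] good_bd[OF that]]
    show "l2 HL (\<Phi> z)" by (rule b)
    have "q * l2n HL z \<le> q * \<rho>" using l2n_le_Wnorm[of z] that q0 by (intro mult_left_mono) (auto simp: good_def)
    then show "l2n HL (\<Phi> z) \<le> q * \<rho> + l2n HL v + \<epsilon> * l2n HL c" using b(2) by linarith
  qed
  define S where "S z = (SOME w. has_Wderiv w (\<lambda>t. A (c t) (w t) + \<Phi> z t) \<and> w 0 = h)" for z
  have S: "has_Wderiv (S z) (\<lambda>t. A (c t) (S z t) + \<Phi> z t)" "S z 0 = h" if "good z" for z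
  proof -
    have "\<exists>w. has_Wderiv w (\<lambda>t. A (c t) (w t) + \<Phi> z t) \<and> w 0 = h"
      using lb \<Phi>_good(1)[OF that] unfolding lin_solvable_def by blast
    from someI_ex[OF this] show "has_Wderiv (S z) (\<lambda>t. A (c t) (S z t) + \<Phi> z t)" "S z 0 = h"
      by (simp_all add: S_def)
  qed
  have S_good: "good (S z)" if "good z" for z
  proof -
    have "Wnorm (S z) \<le> C * (l2n HL (\<Phi> z) + norm h)"
      using lin_solvable_bd[OF lb \<Phi>_good(1)[OF that] S(1)[OF that]] S(2)[OF that] by simp
    also have "\<dots> \<le> C * (q * \<rho> + l2n HL v + \<epsilon> * l2n HL c + norm h)"
      using \<Phi>_good(2)[OF that] C by (intro mult_left_mono) auto
    also have "\<dots> = (C * q) * \<rho> + C * (l2n HL v + \<epsilon> * l2n HL c + norm h)" by (simp add: algebra_simps)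
    also have "\<dots> \<le> (1/2) * \<rho> + \<rho> / 2" using small small2 \<rho> by (intro add_mono mult_right_mono) (auto simp: q_def)
    finally show ?thesis using S(1)[OF that] by (auto simp: good_def intro: inWI)
  qed
  have S_contr: "Wnorm (\<lambda>t. S z1 t - S z2 t) \<le> (1/2) * Wnorm (\<lambda>t. z1 t - z2 t)" if g: "good z1" "good z2" for z1 z2
  proof -
    have d0: "has_Wderiv (\<lambda>t. S z1 t - S z2 t) (\<lambda>t. (A (c t) (S z1 t) + \<Phi> z1 t) - (A (c t) (S z2 t) + \<Phi> z2 t))"
      by (rule has_Wderiv_diff) (use S g in auto)
    have eq: "(A (c t) (S z1 t) + \<Phi> z1 t) - (A (c t) (S z2 t) + \<Phi> z2 t) = A (c t) (S z1 t - S z2 t) + (\<Phi> z1 t - \<Phi> z2 t)" if "0 \<le> t" for t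
      using linear_diff[OF linA[OF cR[OF that]]] by simp
    have d: "has_Wderiv (\<lambda>t. S z1 t - S z2 t) (\<lambda>t. A (c t) (S z1 t - S z2 t) + (\<Phi> z1 t - \<Phi> z2 t))"
      by (rule has_Wderiv_congD[OF d0 eq])
    have l: "l2 HL (\<lambda>t. \<Phi> z1 t - \<Phi> z2 t)" by (intro l2_diff \<Phi>_good g)
    have lz: "l2 HL (\<lambda>t. z1 t - z2 t)" by (intro l2_diff good_l2 g)
    have b: "l2n HL (\<lambda>t. \<Phi> z1 t - \<Phi> z2 t) \<le> q * l2n HL (\<lambda>t. z1 t - z2 t)"
      by (rule l2_bound(2)[OF lz l2D(1)[OF l] _ q0]) (use \<Phi>_lip good_bd g in auto)
    have "Wnorm (\<lambda>t. S z1 t - S z2 t) \<le> C * l2n HL (\<lambda>t. \<Phi> z1 t - \<Phi> z2 t)"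
      using lin_solvable_bd[OF lb l d] S(2) g by simp
    also have "\<dots> \<le> C * (q * l2n HL (\<lambda>t. z1 t - z2 t))" using b C by (intro mult_left_mono) auto
    also have "\<dots> \<le> (1/2) * l2n HL (\<lambda>t. z1 t - z2 t)"
      using mult_right_mono[OF small, of "l2n HL (\<lambda>t. z1 t - z2 t)"] by (simp add: q_def mult.assoc)
    also have "\<dots> \<le> (1/2) * Wnorm (\<lambda>t. z1 t - z2 t)" using l2n_le_Wnorm[of "\<lambda>t. z1 t - z2 t"] by simp
    finally show ?thesis .
  qed
  define zs where "zs j = (S ^^ j) (\<lambda>t. 0)" for j
  have zs_Suc: "zs (Suc j) = S (zs j)" for j by (simp add: zs_def)
  have zg: "good (zs j)" for j
  proof (induction j)
    case 0 show ?case using inWI[OF has_Wderiv_zero] Wnorm_zero \<rho> by (simp add: zs_def good_def)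
  qed (simp add: zs_Suc S_good)
  have geo: "Wnorm (\<lambda>t. zs (Suc j) t - zs j t) \<le> \<rho> * (1/2)^j" for j
  proof (induction j)
    case 0
    then show ?case using zg[of 1] by (simp add: zs_def good_def)
  next
    case (Suc j)
    have "Wnorm (\<lambda>t. zs (Suc (Suc j)) t - zs (Suc j) t) \<le> (1/2) * Wnorm (\<lambda>t. zs (Suc j) t - zs j t)"
      using S_contr[OF zg[of "Suc j"] zg[of j]] by (simp add: zs_Suc)
    then show ?case using Suc by simp
  qed
  have conv: "convergent (\<lambda>j. zs j t)" if t: "0 \<le> t" for t
  proof -
    have b: "norm (zs (Suc j) t - zs j t) \<le> m * (1/2)^j" for j
    proof -
      have "inW (\<lambda>t. zs (Suc j) t - zs j t)" using zg by (intro inW_diff) (auto simp: good_def)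
      from embed[OF this t] have "norm (zs (Suc j) t - zs j t) \<le> Ci * Wnorm (\<lambda>t. zs (Suc j) t - zs j t)" .
      also have "\<dots> \<le> Ci * (\<rho> * (1/2)^j)" using geo Ci by (intro mult_left_mono) auto
      finally show ?thesis by (simp add: m_def)
    qed
    have "summable (\<lambda>j. m * (1/2::real)^j)" by (intro summable_mult summable_geometric) simp
    then have "summable (\<lambda>j. zs (Suc j) t - zs j t)" by (rule summable_comparison_test'[where N = 0]) (rule b)
    then have "convergent (\<lambda>n. \<Sum>j<n. zs (Suc j) t - zs j t)" by (simp add: summable_iff_convergent)
    then show ?thesis unfolding sum_lessThan_telescope[of "\<lambda>j. zs j t"] by (simp only: convergent_diff_const_right_iff)
  qed
  define z where "z t = lim (\<lambda>j. zs j t)" for t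
  have lim: "(\<lambda>j. zs j t) \<longlonglongrightarrow> z t" if "0 \<le> t" for t
    using conv[OF that] by (simp add: z_def convergent_LIMSEQ_iff)
  have zb: "norm (z t) \<le> m" if "0 \<le> t" for t
    using LIMSEQ_le_const2[OF tendsto_norm[OF lim[OF that]], of m] good_bd[OF zg that] by blast
  have lz: "l2 HL z"
  proof (rule l2_limit(1)[of HL zs \<rho>])
    show "l2n HL (zs j) \<le> \<rho>" for j using l2n_le_Wnorm[of "zs j"] zg[of j] by (simp add: good_def)
  qed (use good_l2 zg lim in auto)
  have lim\<Phi>: "(\<lambda>j. \<Phi> (zs j) t) \<longlonglongrightarrow> \<Phi> z t" if t: "0 \<le> t" for t
  proof (rule LIM_zero_cancel, rule Lim_null_comparison)
    show "\<forall>\<^sub>F j in sequentially. norm (\<Phi> (zs j) t - \<Phi> z t) \<le> q * norm (zs j t - z t)"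
      using \<Phi>_lip[where ?z1.0 = "zs j" and ?z2.0 = z and t = t for j] good_bd[OF zg t] zb[OF t] t by simp
    have "(\<lambda>j. q * norm (zs j t - z t)) \<longlonglongrightarrow> q * norm (z t - z t)" by (intro tendsto_intros lim t)
    then show "(\<lambda>j. q * norm (zs j t - z t)) \<longlonglongrightarrow> 0" by simp
  qed
  have limA: "(\<lambda>j. A (c t) (zs (Suc j) t)) \<longlonglongrightarrow> A (c t) (z t)" if t: "0 \<le> t" for t
  proof -
    have "bounded_linear (A (c t))" using linA[OF cR[OF t]] by (simp add: linear_conv_bounded_linear)
    then show ?thesis using bounded_linear.tendsto LIMSEQ_Suc[OF lim[OF t]] by blast
  qed
  have m\<Phi>: "\<Phi> z \<in> borel_measurable HL"
    by (rule borel_measurable_LIMSEQ_metric[of "\<lambda>j. \<Phi> (zs j)"]) (use l2D(1)[OF \<Phi>_good(1)[OF zg]] lim\<Phi> in auto)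
  have l\<Phi>: "l2 HL (\<Phi> z)" by (rule \<Phi>_l2(1)[OF m\<Phi> lz zb])
  have lA: "l2 HL (\<lambda>t. A (c t) (z t))" by (rule family_l2(1)[OF cc cR lz linA A_bd A_lip])
  have dz: "has_Wderiv z (\<lambda>t. A (c t) (z t) + \<Phi> z t)"
    unfolding has_Wderiv_l2
  proof (intro conjI allI impI lz l2_add lA l\<Phi>)
    fix t :: real assume t: "0 \<le> t"
    have z0: "z 0 = h"
    proof -
      have "(\<lambda>j. zs (Suc j) 0) \<longlonglongrightarrow> z 0" by (rule LIMSEQ_Suc[OF lim]) simp
      then have "(\<lambda>j::nat. h) \<longlonglongrightarrow> z 0" by (simp add: zs_Suc S(2)[OF zg])
      then show ?thesis by (simp add: LIMSEQ_const_iff)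
    qed
    have "l2 HL (\<lambda>t. norm (v t))" "l2 HL (\<lambda>t. norm (c t))" using v lc(1) by (auto simp: l2_def)
    then have lw: "l2 HL (\<lambda>t. \<epsilon> * norm (c t) + norm (v t))"
      using l2_add(1)[OF l2_scaleR(1)[of HL "\<lambda>t. norm (c t)" \<epsilon>]] by simp
    have "(\<lambda>j. set_lebesgue_integral lborel {0..t} (\<lambda>t. A (c t) (zs (Suc j) t) + \<Phi> (zs j) t))
      \<longlonglongrightarrow> set_lebesgue_integral lborel {0..t} (\<lambda>t. A (c t) (z t) + \<Phi> z t)"
    proof (rule l2_HL_AE_integrable_limit[OF _ _ lw _ t])
      show "l2 HL (\<lambda>t. A (c t) (zs (Suc j) t) + \<Phi> (zs j) t)" for j
        using has_WderivD(2)[OF S(1)[OF zg[of j]]] by (simp add: zs_Suc)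
      show "(\<lambda>j. A (c t) (zs (Suc j) t) + \<Phi> (zs j) t) \<longlonglongrightarrow> A (c t) (z t) + \<Phi> z t" if "0 \<le> t" for t
        by (intro tendsto_add limA lim\<Phi> that)
      show "norm (A (c t) (zs (Suc j) t) + \<Phi> (zs j) t) \<le> (K * m + q * m) + (\<epsilon> * norm (c t) + norm (v t))" if t: "0 \<le> t" for j t
      proof -
        have "norm (A (c t) (zs (Suc j) t)) \<le> K * m"
          using A_bd[OF cR[OF t], of "zs (Suc j) t"] mult_left_mono[OF good_bd[OF zg[of "Suc j"] t] K0(1)] by linarith
        moreover have "norm (\<Phi> (zs j) t - \<Phi> (\<lambda>t. 0) t) \<le> q * m"
          using \<Phi>_lip[where ?z1.0 = "zs j" and ?z2.0 = "\<lambda>t. 0" and t = t] t m0 good_bd[OF zg[of j] t] mult_left_mono[OF good_bd[OF zg[of j] t] q0] by simp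
        moreover have "norm (\<Phi> (zs j) t) \<le> norm (\<Phi> (zs j) t - \<Phi> (\<lambda>t. 0) t) + norm (\<Phi> (\<lambda>t. 0) t)"
          by (metis diff_add_cancel norm_triangle_ineq)
        ultimately show ?thesis using \<Phi>0(3)[OF t] norm_triangle_ineq[of "A (c t) (zs (Suc j) t)" "\<Phi> (zs j) t"] by linarith
      qed
    qed
    then have "(\<lambda>j. h + set_lebesgue_integral lborel {0..t} (\<lambda>t. A (c t) (zs (Suc j) t) + \<Phi> (zs j) t))
      \<longlonglongrightarrow> h + set_lebesgue_integral lborel {0..t} (\<lambda>t. A (c t) (z t) + \<Phi> z t)" by (intro tendsto_intros)
    moreover have "h + set_lebesgue_integral lborel {0..t} (\<lambda>t. A (c t) (zs (Suc j) t) + \<Phi> (zs j) t) = zs (Suc j) t" for j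
      using has_WderivD(3)[OF S(1)[OF zg[of j]] t] S(2)[OF zg[of j]] by (simp add: zs_Suc)
    ultimately have "(\<lambda>j. zs (Suc j) t) \<longlonglongrightarrow> h + set_lebesgue_integral lborel {0..t} (\<lambda>t. A (c t) (z t) + \<Phi> z t)" by simp
    with LIMSEQ_Suc[OF lim[OF t]] show "z t = z 0 + set_lebesgue_integral lborel {0..t} (\<lambda>t. A (c t) (z t) + \<Phi> z t)"
      unfolding z0 by (rule LIMSEQ_unique)
  qed
  define y where "y t = c t + z t" for t
  have "has_Wderiv y (\<lambda>t. G (c t) + (A (c t) (z t) + \<Phi> z t))"
    unfolding y_def by (rule has_Wderiv_add[OF c(1) dz])
  then have dy: "has_Wderiv y (\<lambda>t. G (y t) + k (y t) + v t)" by (simp add: \<Phi>_def y_def algebra_simps)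
  have z0: "z 0 = h"
  proof -
    have "(\<lambda>j. zs (Suc j) 0) \<longlonglongrightarrow> z 0" by (rule LIMSEQ_Suc[OF lim]) simp
    then have "(\<lambda>j::nat. h) \<longlonglongrightarrow> z 0" by (simp add: zs_Suc S(2)[OF zg])
    then show ?thesis by (simp add: LIMSEQ_const_iff)
  qed
  have yR: "norm (y t) \<le> R" "norm (y t - c t) \<le> m" if "0 \<le> t" for t
    using czR[OF that zb[OF that]] zb[OF that] by (auto simp: y_def)
  note kc = nemytskii_l2[OF cc cR lc(1) k(1) k(3,2)]
  have dc: "has_Wderiv c (\<lambda>t. G (c t) + k (c t) + - k (c t))" using c(1) by simp
  have "Wnorm (\<lambda>t. y t - c t) \<le> 2 * C * (l2n HL (\<lambda>t. v t - - k (c t)) + norm (y 0 - c 0))"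
    by (rule stability[OF cc cR lb dy dc v l2_uminus(1)[OF kc(1)] yR(1) cR yR(2) _ k(1,2)])
       (use m0 small in \<open>auto simp: m_def\<close>)
  also have "\<dots> \<le> 2 * C * (l2n HL v + \<epsilon> * l2n HL c + norm h)"
    using l2_add(2)[OF v kc(1)] kc(2) C by (intro mult_left_mono) (auto simp: y_def z0)
  finally show ?thesis using dy yR z0 by (intro exI[of _ y]) (auto simp: y_def m_def)
qed

end

lemma l2n_trunc_add:
  assumes "l2 HL a" "0 \<le> s"  "0 \<le> h"
  shows "(l2n HL (trunc (s + h) a))\<^sup>2 = (l2n HL (trunc s a))\<^sup>2 + (l2n HL (trunc h (\<lambda>t. a (s + t))))\<^sup>2"
proof -
  have "trunc s (trunc (s + h) a) = trunc s a" using assms by (auto simp: trunc_def)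
  moreover have "(\<lambda>t. trunc (s + h) a (s + t)) = trunc h (\<lambda>t. a (s + t))" by (auto simp: trunc_def)
  ultimately show ?thesis using l2_shift(2)[OF l2_trunc(1)[OF assms(1)] assms(2), of "s + h"] by simp
qed

context closed_loop
begin

text \<open>The problem on [\<tau>, \<infinity>) is pulled back to [0, \<infinity>): a source on [0, \<tau>] keeps z equal to h there, at the price of the
  term K * sqrt \<tau>.\<close>

lemma tail_lin_solvable:
  assumes c: "continuous_on {0..} c" "\<And>t. 0 \<le> t \<Longrightarrow> norm (c t) \<le> R" and lb: "lin_solvable c C" and \<tau>: "0 \<le> \<tau>"
  shows "lin_solvable (\<lambda>t. c (\<tau> + t)) (C * (1 + K * sqrt \<tau>))"
proof -
  have C: "0 < C" using lb by (simp add: lin_solvable_def)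
  have C': "0 < C * (1 + K * sqrt \<tau>)" using C K0 \<tau> by (simp add: add_pos_nonneg)
  define a where "a h = trunc \<tau> (\<lambda>t. - A (c t) h)" for h
  have a: "l2 HL (a h)" "l2n HL (a h) \<le> K * norm h * sqrt \<tau>" for h
  proof -
    have "(\<lambda>t. A (c t) h) \<in> borel_measurable HL"
      by (rule family_measurable[OF c, of "\<lambda>t. h", OF _ _ linA A_bd A_lip]) auto
    then have "trunc \<tau> (\<lambda>t. - A (c t) h) \<in> borel_measurable HL" by (intro trunc_measurable) simp
    from l2_trunc_bounded[OF this, of "K * norm h"] show "l2 HL (a h)" "l2n HL (a h) \<le> K * norm h * sqrt \<tau>"
      using A_bd[OF c(2)] K0 \<tau> by (auto simp: a_def)
  qed
  define vh where "vh h v = cat \<tau> (a h) v" for h v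
  have vh: "l2 HL (vh h v)" "l2n HL (vh h v) \<le> l2n HL v + K * sqrt \<tau> * norm h" if v: "l2 HL v" for h v
  proof -
    show "l2 HL (vh h v)" unfolding vh_def by (rule l2_cat(1)[OF a(1) v \<tau>])
    have "(l2n HL (vh h v))\<^sup>2 = (l2n HL (trunc \<tau> (a h)))\<^sup>2 + (l2n HL v)\<^sup>2"
      unfolding vh_def by (rule l2_cat(2)[OF a(1) v \<tau>])
    also have "trunc \<tau> (a h) = a h" by (auto simp: a_def trunc_def)
    also have "(l2n HL (a h))\<^sup>2 + (l2n HL v)\<^sup>2 \<le> (l2n HL (a h) + l2n HL v)\<^sup>2" by (simp add: power2_sum)
    finally have "l2n HL (vh h v) \<le> l2n HL (a h) + l2n HL v" by (rule power2_le_imp_le) simp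
    then show "l2n HL (vh h v) \<le> l2n HL v + K * sqrt \<tau> * norm h" using a(2)[of h] by (simp add: mult_ac)
  qed
  show ?thesis unfolding lin_solvable_def
  proof (intro conjI allI impI C')
    fix h and v :: "real \<Rightarrow> real^'n" assume v: "l2 HL v"
    obtain z where z: "has_Wderiv z (\<lambda>t. A (c t) (z t) + vh h v t)" "z 0 = h"
      using lb vh(1)[OF v, of h] unfolding lin_solvable_def by blast
    have "norm (z \<tau> - h) \<le> (norm (z 0 - h) + integral {0..\<tau>} (\<lambda>t. 0)) * exp (K * \<tau>)"
    proof (rule gronwall_integral_eq[where e = "\<lambda>t. A (c t) (z t) + vh h v t"])
      show "continuous_on {0..\<tau>} (\<lambda>t. z t - h)"
        by (intro continuous_intros continuous_on_subset[OF has_Wderiv_continuous[OF z(1)]]) auto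
      show "l2 HL (\<lambda>t. A (c t) (z t) + vh h v t)" by (rule has_WderivD(2)[OF z(1)])
      fix t :: real assume t: "0 \<le> t"
      show "z t - h = z 0 - h + set_lebesgue_integral lborel {0..t} (\<lambda>t. A (c t) (z t) + vh h v t)"
        by (subst has_WderivD(3)[OF z(1) t]) simp
      assume "t < \<tau>"
      then have "A (c t) (z t) + vh h v t = A (c t) (z t - h)"
        using linear_diff[OF linA[OF c(2)[OF t]]] by (simp add: vh_def a_def cat_def trunc_def)
      then show "norm (A (c t) (z t) + vh h v t) \<le> K * norm (z t - h) + 0" using A_bd[OF c(2)[OF t]] by simp
    qed (use K0 \<tau> in auto)
    then have z\<tau>: "z \<tau> = h" using z(2) by simp
    have "has_Wderiv (\<lambda>t. z (\<tau> + t)) (\<lambda>t. A (c (\<tau> + t)) (z (\<tau> + t)) + v t)"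
      by (rule has_Wderiv_congD[OF has_Wderiv_shift[OF z(1) \<tau>]]) (simp add: vh_def cat_def)
    then show "\<exists>z. has_Wderiv z (\<lambda>t. A (c (\<tau> + t)) (z t) + v t) \<and> z 0 = h" using z\<tau> by (intro exI[of _ "\<lambda>t. z (\<tau> + t)"]) simp
  next
    fix h and v z :: "real \<Rightarrow> real^'n" assume v: "l2 HL v" and "has_Wderiv z (\<lambda>t. A (c (\<tau> + t)) (z t) + v t) \<and> z 0 = h"
    then have z: "has_Wderiv z (\<lambda>t. A (c (\<tau> + t)) (z t) + v t)" "z 0 = h" by auto
    define y where "y t = trap \<tau> (\<tau> + 1) t *\<^sub>R h" for t
    have y1: "y t = h" if "t \<le> \<tau>" for t using that by (simp add: y_def trap_simps)
    define y' where "y' t = (- 1 / (\<tau> + 1 - \<tau>) * indicator {\<tau>..\<tau> + 1} t) *\<^sub>R h" for t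
    have y: "has_Wderiv y y'" unfolding y_def y'_def by (rule has_Wderiv_trap[OF \<tau>]) simp
    define zh where "zh = cat \<tau> y z"
    have zh0: "zh 0 = h" using z(2) \<tau> y1 by (auto simp: zh_def cat_def)
    have d: "has_Wderiv zh (\<lambda>t. A (c t) (zh t) + vh h v t)"
      unfolding zh_def
    proof (rule has_Wderiv_congD[OF has_Wderiv_cat[OF y z(1) _ \<tau>]])
      show "y \<tau> = z 0" by (simp add: y1 z(2))
      fix t :: real assume t: "0 \<le> t"
      show "cat \<tau> y' (\<lambda>t. A (c (\<tau> + t)) (z t) + v t) t = A (c t) (cat \<tau> y z t) + vh h v t"
        by (auto simp: cat_def vh_def a_def trunc_def y1 y'_def)
    qed
    have "Wnorm z \<le> Wnorm zh"
    proof -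
      have e1: "l2n HL z \<le> l2n HL zh"
        using l2_shift(3)[OF has_WderivD(1)[OF d] \<tau>] l2n_HL_cong[of "\<lambda>t. zh (\<tau> + t)" z] by (simp add: zh_def cat_def)
      have "l2n HL (\<lambda>t. A (c (\<tau> + t)) (z t) + v t) \<le> l2n HL (\<lambda>t. A (c t) (zh t) + vh h v t)"
        using l2_shift(3)[OF has_WderivD(2)[OF d] \<tau>]
          l2n_HL_cong[of "\<lambda>t. A (c (\<tau> + t)) (zh (\<tau> + t)) + vh h v (\<tau> + t)" "\<lambda>t. A (c (\<tau> + t)) (z t) + v t"]
        by (simp add: zh_def cat_def vh_def)
      then show ?thesis using e1 by (simp add: Wnorm_eq[OF d] Wnorm_eq[OF z(1)] add_mono power_mono)
    qed
    also have "\<dots> \<le> C * (l2n HL (vh h v) + norm h)" using lin_solvable_bd[OF lb vh(1)[OF v] d] zh0 by simp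
    also have "\<dots> \<le> C * (l2n HL v + K * sqrt \<tau> * norm h + norm h)"
      using vh(2)[OF v, of h] C by (intro mult_left_mono) auto
    also have "\<dots> \<le> C * ((1 + K * sqrt \<tau>) * (l2n HL v + norm h))"
      using C K0 \<tau> by (intro mult_left_mono) (auto simp: algebra_simps)
    finally show "Wnorm z \<le> C * (1 + K * sqrt \<tau>) * (l2n HL v + norm h)" by (simp add: mult.assoc)
  qed
qed

definition real_cost :: "(real \<Rightarrow> real^'n) \<Rightarrow> (real \<Rightarrow> real^'m) \<Rightarrow> real" where
  "real_cost y u = ((l2n HL (\<lambda>t. Q *v y t))\<^sup>2 + \<beta> * (l2n HL u)\<^sup>2) / 2"

definition trunc_cost :: "real \<Rightarrow> (real \<Rightarrow> real^'n) \<Rightarrow> (real \<Rightarrow> real^'m) \<Rightarrow> real" where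
  "trunc_cost \<tau> y u = ((l2n HL (trunc \<tau> (\<lambda>t. Q *v y t)))\<^sup>2 + \<beta> * (l2n HL (trunc \<tau> u))\<^sup>2) / 2"

lemma real_cost_shift:
  assumes "l2 HL y" "l2 HL u" "0 \<le> \<tau>"
  shows "real_cost y u = trunc_cost \<tau> y u + real_cost (\<lambda>t. y (\<tau> + t)) (\<lambda>t. u (\<tau> + t))"
  using l2_shift(2)[OF l2_Q(1)[OF assms(1)] assms(3)] l2_shift(2)[OF assms(2,3)]
  by (simp add: real_cost_def trunc_cost_def field_simps)

lemma real_cost_cat:
  assumes "l2 HL y" "l2 HL u" "l2 HL y2" "l2 HL u2" "0 \<le> \<tau>"
  shows "real_cost (cat \<tau> y y2) (cat \<tau> u u2) = trunc_cost \<tau> y u + real_cost y2 u2"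
proof -
  have "(\<lambda>t. Q *v cat \<tau> y y2 t) = cat \<tau> (\<lambda>t. Q *v y t) (\<lambda>t. Q *v y2 t)" by (auto simp: cat_def)
  then show ?thesis
    using l2_cat(2)[OF l2_Q(1)[OF assms(1)] l2_Q(1)[OF assms(3)] assms(5)] l2_cat(2)[OF assms(2,4,5)]
    by (simp add: real_cost_def trunc_cost_def field_simps)
qed

lemma trunc_cost_add:
  assumes "l2 HL y" "l2 HL u" "0 \<le> s" "0 \<le> h"
  shows "trunc_cost (s + h) y u = trunc_cost s y u + trunc_cost h (\<lambda>t. y (s + t)) (\<lambda>t. u (s + t))"
  using l2n_trunc_add[OF l2_Q(1)[OF assms(1)] assms(3,4)] l2n_trunc_add[OF assms(2-4)]
  by (simp add: trunc_cost_def field_simps)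

lemma feasible_iff: "feasible f B y0 y u \<longleftrightarrow> has_Wderiv y (\<lambda>t. f (y t) + B *v u t) \<and> l2 HL u \<and> y 0 = y0"
  by (simp add: feasible_def sq_int_l2)

lemma Fs_l2:
  assumes "has_Wderiv y a" "\<And>t. 0 \<le> t \<Longrightarrow> norm (y t) \<le> R"
  shows "l2 HL (\<lambda>t. Fs (y t))" "l2n HL (\<lambda>t. Fs (y t)) \<le> K * l2n HL y"
  using nemytskii_l2[OF has_Wderiv_continuous[OF assms(1)] assms(2) has_WderivD(1)[OF assms(1)], of Fs K] Fs_lip Fs0 K0 by auto

lemma feasible_iff_deviation:
  assumes "\<And>t. 0 \<le> t \<Longrightarrow> norm (y t) \<le> R"
  shows "feasible f B y0 y u \<longleftrightarrow> has_Wderiv y (\<lambda>t. G (y t) + B *v (u t - Fs (y t))) \<and> l2 HL (\<lambda>t. u t - Fs (y t)) \<and> y 0 = y0"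
proof -
  have eq: "G (y t) + B *v (u t - Fs (y t)) = f (y t) + B *v u t" for t
    by (simp add: G_def matrix_vector_mult_diff_distrib)
  show ?thesis unfolding feasible_iff eq
    using l2_diff(1)[of HL u "\<lambda>t. Fs (y t)"] l2_add(1)[of HL "\<lambda>t. u t - Fs (y t)" "\<lambda>t. Fs (y t)"] Fs_l2(1)[OF _ assms]
    by auto
qed

lemma feasible_shift:
  assumes "feasible f B y0 y u" "0 \<le> \<tau>"
  shows "feasible f B (y \<tau>) (\<lambda>t. y (\<tau> + t)) (\<lambda>t. u (\<tau> + t))"
  using assms has_Wderiv_shift[of y "\<lambda>t. f (y t) + B *v u t" \<tau>] l2_shift(1)[of u \<tau>] by (simp add: feasible_iff)

end

section \<open>Quadratic growth of the cost along near-minimizers\<close>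

locale closed_loop_opt = closed_loop +
  fixes \<rho>0 Mc :: real
  assumes \<rho>0: "0 \<le> \<rho>0" "\<rho>0 < R" and Mc: "0 \<le> Mc"
begin

definition opt :: "real^'a \<Rightarrow> (real \<Rightarrow> real^'a) \<Rightarrow> real \<Rightarrow> bool" where
  "opt x c C \<longleftrightarrow> has_Wderiv c (\<lambda>t. G (c t)) \<and> c 0 = x \<and> (\<forall>t\<ge>0. norm (c t) \<le> \<rho>0) \<and> l2n HL c \<le> Mc \<and> lin_solvable c C \<and>
     (\<forall>y u. feasible f B x y u \<longrightarrow> real_cost c (\<lambda>t. Fs (c t)) \<le> real_cost y u) \<and>
     (\<forall>z. has_Wderiv z (\<lambda>t. G (z t)) \<and> z 0 = x \<longrightarrow> (\<forall>t\<ge>0. z t = c t))"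

lemma optD:
  assumes "opt x c C"
  shows "has_Wderiv c (\<lambda>t. G (c t))" "c 0 = x" "\<And>t. 0 \<le> t \<Longrightarrow> norm (c t) \<le> \<rho>0" "\<And>t. 0 \<le> t \<Longrightarrow> norm (c t) \<le> R"
    "l2n HL c \<le> Mc" "lin_solvable c C" "\<And>y u. feasible f B x y u \<Longrightarrow> real_cost c (\<lambda>t. Fs (c t)) \<le> real_cost y u"
    "\<And>z t. has_Wderiv z (\<lambda>t. G (z t)) \<Longrightarrow> z 0 = x \<Longrightarrow> 0 \<le> t \<Longrightarrow> z t = c t"
    "continuous_on {0..} c" "l2 HL c" "l2 HL (\<lambda>t. Fs (c t))" "0 < C"
proof -
  note a = assms[unfolded opt_def]
  show 1: "has_Wderiv c (\<lambda>t. G (c t))" and "c 0 = x" and b: "\<And>t. 0 \<le> t \<Longrightarrow> norm (c t) \<le> \<rho>0"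
    and lb: "lin_solvable c C" and "l2n HL c \<le> Mc"
    and "\<And>y u. feasible f B x y u \<Longrightarrow> real_cost c (\<lambda>t. Fs (c t)) \<le> real_cost y u"
    "\<And>z t. has_Wderiv z (\<lambda>t. G (z t)) \<Longrightarrow> z 0 = x \<Longrightarrow> 0 \<le> t \<Longrightarrow> z t = c t"
    using a by blast+
  show R: "norm (c t) \<le> R" if "0 \<le> t" for t using b[OF that] \<rho>0 by linarith
  show "continuous_on {0..} c" by (rule has_Wderiv_continuous[OF 1])
  show "l2 HL c" by (rule has_WderivD(1)[OF 1])
  show "l2 HL (\<lambda>t. Fs (c t))" by (rule Fs_l2(1)[OF 1 R])
  show "0 < C" using lb by (simp add: lin_solvable_def)
qed

lemma opt_mono: "opt x c C \<Longrightarrow> C \<le> C' \<Longrightarrow> opt x c C'"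
  unfolding opt_def using lin_solvable_mono by blast

lemma opt_feasible: "opt x c C \<Longrightarrow> feasible f B x c (\<lambda>t. Fs (c t))"
  using optD(1,2,11)[of x c C] unfolding feasible_iff G_def by blast

lemma tail_opt:
  assumes o: "opt x c C" and \<tau>: "0 \<le> \<tau>"
  shows "opt (c \<tau>) (\<lambda>t. c (\<tau> + t)) (C * (1 + K * sqrt \<tau>))"
proof -
  note D = optD[OF o]
  have sh: "has_Wderiv (\<lambda>t. c (\<tau> + t)) (\<lambda>t. G (c (\<tau> + t)))" by (rule has_Wderiv_shift[OF D(1) \<tau>])
  have opt: "real_cost (\<lambda>t. c (\<tau> + t)) (\<lambda>t. Fs (c (\<tau> + t))) \<le> real_cost y u" if fe: "feasible f B (c \<tau>) y u" for y u
  proof -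
    have y: "has_Wderiv y (\<lambda>t. f (y t) + B *v u t)" "l2 HL u" "y 0 = c \<tau>" using fe by (auto simp: feasible_iff)
    have "has_Wderiv (cat \<tau> c y) (\<lambda>t. f (cat \<tau> c y t) + B *v cat \<tau> (\<lambda>t. Fs (c t)) u t)"
      by (rule has_Wderiv_congD[OF has_Wderiv_cat[OF D(1) y(1) y(3)[symmetric] \<tau>]]) (simp add: cat_def G_def)
    moreover have "l2 HL (cat \<tau> (\<lambda>t. Fs (c t)) u)" by (rule l2_cat(1)[OF D(11) y(2) \<tau>])
    moreover have "cat \<tau> c y 0 = x" using \<tau> D(2) y(3) by (cases "\<tau> = 0") (auto simp: cat_def)
    ultimately have "feasible f B x (cat \<tau> c y) (cat \<tau> (\<lambda>t. Fs (c t)) u)" by (simp add: feasible_iff)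
    from D(7)[OF this] show ?thesis
      using real_cost_cat[OF D(10,11) has_WderivD(1)[OF y(1)] y(2) \<tau>] real_cost_shift[OF D(10,11) \<tau>] by simp
  qed
  have un: "z t = c (\<tau> + t)" if z: "has_Wderiv z (\<lambda>t. G (z t))" "z 0 = c \<tau>" "0 \<le> t" for z t
  proof -
    have "has_Wderiv (cat \<tau> c z) (\<lambda>t. G (cat \<tau> c z t))"
      by (rule has_Wderiv_congD[OF has_Wderiv_cat[OF D(1) z(1) z(2)[symmetric] \<tau>]]) (simp add: cat_def)
    moreover have "cat \<tau> c z 0 = x" using \<tau> D(2) z(2) by (cases "\<tau> = 0") (auto simp: cat_def)
    ultimately have "cat \<tau> c z (\<tau> + t) = c (\<tau> + t)" using D(8)[of "cat \<tau> c z" "\<tau> + t"] \<tau> z(3) by simp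
    then show ?thesis using z(3) by (simp add: cat_def)
  qed
  show ?thesis unfolding opt_def
  proof (intro conjI allI impI)
    show "l2n HL (\<lambda>t. c (\<tau> + t)) \<le> Mc" using l2_shift(3)[OF D(10) \<tau>] D(5) by linarith
    show "norm (c (\<tau> + t)) \<le> \<rho>0" if "0 \<le> t" for t using D(3)[of "\<tau> + t"] that \<tau> by simp
    show "lin_solvable (\<lambda>t. c (\<tau> + t)) (C * (1 + K * sqrt \<tau>))" by (rule tail_lin_solvable[OF D(9,4,6) \<tau>])
  qed (use sh opt un in \<open>blast | simp\<close>)+
qed

definition cost_deriv :: "(real \<Rightarrow> real^'a) \<Rightarrow> (real \<Rightarrow> real^'a) \<Rightarrow> (real \<Rightarrow> real^'b) \<Rightarrow> real" where
  "cost_deriv c z w = (\<integral>t. (Q *v c t) \<bullet> (Q *v z t) + \<beta> * (Fs (c t) \<bullet> (DF (c t) (z t) + w t)) \<partial>HL)"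

definition expansion_const :: "real \<Rightarrow> real" where
  "expansion_const C = (K\<^sup>2 + \<beta> * K\<^sup>2) * Mc * (C * K) + K\<^sup>2 + \<beta> * K\<^sup>2 * R + \<beta> * K\<^sup>2 + \<beta> * K"

lemma expansion_pointwise:
  fixes ct \<zeta>t zt :: "real^'a" and wt :: "real^'b"
  assumes cR: "norm ct \<le> R" and yR: "norm (ct + \<zeta>t) \<le> R"
  shows "\<bar>((norm (Q *v (ct + \<zeta>t)))\<^sup>2 + \<beta> * (norm (Fs (ct + \<zeta>t) + wt))\<^sup>2) / 2 - ((norm (Q *v ct))\<^sup>2 + \<beta> * (norm (Fs ct))\<^sup>2) / 2
     - ((Q *v ct) \<bullet> (Q *v zt) + \<beta> * (Fs ct \<bullet> (DF ct zt + wt))) - \<beta> / 2 * (norm wt)\<^sup>2\<bar>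
   \<le> (K\<^sup>2 + \<beta> * K\<^sup>2) * (norm ct * norm (\<zeta>t - zt)) + (K\<^sup>2 + \<beta> * K\<^sup>2 * R + \<beta> * K\<^sup>2) * (norm \<zeta>t)\<^sup>2 + \<beta> * K * (norm \<zeta>t * norm wt)"
proof -
  define \<delta> where "\<delta> = Fs (ct + \<zeta>t) - Fs ct"
  have \<delta>: "norm \<delta> \<le> K * norm \<zeta>t" using Fs_lip[OF yR cR] by (simp add: \<delta>_def)
  have lin: "linear (DF ct)" by (rule linDF[OF cR])
  have a: "norm (Fs ct) \<le> K * norm ct" using Fs_lip[OF cR, of 0] Fs0 R by simp
  have d2: "norm (\<delta> - DF ct zt) \<le> K * (norm \<zeta>t)\<^sup>2 + K * norm (\<zeta>t - zt)"
  proof -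
    have eq: "\<delta> - DF ct zt = (\<delta> - DF ct \<zeta>t) + DF ct (\<zeta>t - zt)" by (simp add: linear_diff[OF lin])
    have "norm (\<delta> - DF ct \<zeta>t) \<le> K * (norm \<zeta>t)\<^sup>2"
      using Fs_quad[OF yR cR cR] by (simp add: \<delta>_def power2_eq_square mult.assoc)
    then show ?thesis unfolding eq
      using DF_bd[OF cR, of "\<zeta>t - zt"] norm_triangle_ineq[of "\<delta> - DF ct \<zeta>t" "DF ct (\<zeta>t - zt)"] by linarith
  qed
  have Qd: "Q *v (ct + \<zeta>t) = Q *v ct + Q *v \<zeta>t" "Q *v (\<zeta>t - zt) = Q *v \<zeta>t - Q *v zt"
    by (simp_all add: matrix_vector_right_distrib matrix_vector_mult_diff_distrib)
  have e1: "((norm (Q *v (ct + \<zeta>t)))\<^sup>2 + \<beta> * (norm (Fs (ct + \<zeta>t) + wt))\<^sup>2) / 2 - ((norm (Q *v ct))\<^sup>2 + \<beta> * (norm (Fs ct))\<^sup>2) / 2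
     - ((Q *v ct) \<bullet> (Q *v zt) + \<beta> * (Fs ct \<bullet> (DF ct zt + wt))) - \<beta> / 2 * (norm wt)\<^sup>2
    = (Q *v ct) \<bullet> (Q *v (\<zeta>t - zt)) + (norm (Q *v \<zeta>t))\<^sup>2 / 2 + \<beta> * (Fs ct \<bullet> (\<delta> - DF ct zt)) + \<beta> * (\<delta> \<bullet> wt) + \<beta> / 2 * (norm \<delta>)\<^sup>2"
  proof -
    have "Fs (ct + \<zeta>t) = Fs ct + \<delta>" by (simp add: \<delta>_def)
    then show ?thesis unfolding Qd
      by (simp add: power2_norm_eq_inner inner_add_left inner_add_right inner_diff_left inner_diff_right inner_commute algebra_simps add_divide_distrib)
  qed
  have t1: "\<bar>(Q *v ct) \<bullet> (Q *v (\<zeta>t - zt))\<bar> \<le> K\<^sup>2 * (norm ct * norm (\<zeta>t - zt))"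
  proof -
    have "\<bar>(Q *v ct) \<bullet> (Q *v (\<zeta>t - zt))\<bar> \<le> norm (Q *v ct) * norm (Q *v (\<zeta>t - zt))" by (rule Cauchy_Schwarz_ineq2)
    also have "\<dots> \<le> (K * norm ct) * (K * norm (\<zeta>t - zt))" by (intro mult_mono Q_bd) (use K0 in auto)
    finally show ?thesis by (simp add: power2_eq_square mult_ac)
  qed
  have t2: "\<bar>(norm (Q *v \<zeta>t))\<^sup>2 / 2\<bar> \<le> K\<^sup>2 * (norm \<zeta>t)\<^sup>2"
  proof -
    have "(norm (Q *v \<zeta>t))\<^sup>2 \<le> (K * norm \<zeta>t)\<^sup>2" by (intro power_mono Q_bd) simp
    moreover have "0 \<le> (norm (Q *v \<zeta>t))\<^sup>2" by simp
    ultimately show ?thesis unfolding power_mult_distrib by linarith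
  qed
  have t3: "\<bar>\<beta> * (Fs ct \<bullet> (\<delta> - DF ct zt))\<bar> \<le> \<beta> * K\<^sup>2 * R * (norm \<zeta>t)\<^sup>2 + \<beta> * K\<^sup>2 * (norm ct * norm (\<zeta>t - zt))"
  proof -
    have "\<bar>Fs ct \<bullet> (\<delta> - DF ct zt)\<bar> \<le> norm (Fs ct) * norm (\<delta> - DF ct zt)" by (rule Cauchy_Schwarz_ineq2)
    also have "\<dots> \<le> (K * norm ct) * (K * (norm \<zeta>t)\<^sup>2 + K * norm (\<zeta>t - zt))" by (intro mult_mono a d2) (use K0 in auto)
    also have "\<dots> = K\<^sup>2 * norm ct * (norm \<zeta>t)\<^sup>2 + K\<^sup>2 * (norm ct * norm (\<zeta>t - zt))" by (simp add: algebra_simps power2_eq_square)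
    also have "\<dots> \<le> K\<^sup>2 * R * (norm \<zeta>t)\<^sup>2 + K\<^sup>2 * (norm ct * norm (\<zeta>t - zt))"
      by (intro add_right_mono mult_right_mono mult_left_mono cR) auto
    finally have "\<beta> * \<bar>Fs ct \<bullet> (\<delta> - DF ct zt)\<bar> \<le> \<beta> * (K\<^sup>2 * R * (norm \<zeta>t)\<^sup>2 + K\<^sup>2 * (norm ct * norm (\<zeta>t - zt)))"
      using beta by (intro mult_left_mono) auto
    moreover have "\<bar>\<beta> * (Fs ct \<bullet> (\<delta> - DF ct zt))\<bar> = \<beta> * \<bar>Fs ct \<bullet> (\<delta> - DF ct zt)\<bar>"
      unfolding abs_mult using beta by simp
    ultimately show ?thesis by (simp add: distrib_left mult.assoc)
  qed
  have t4: "\<bar>\<beta> * (\<delta> \<bullet> wt)\<bar> \<le> \<beta> * K * (norm \<zeta>t * norm wt)"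
  proof -
    have "\<bar>\<delta> \<bullet> wt\<bar> \<le> norm \<delta> * norm wt" by (rule Cauchy_Schwarz_ineq2)
    also have "\<dots> \<le> (K * norm \<zeta>t) * norm wt" by (intro mult_right_mono \<delta>) simp
    finally have "\<beta> * \<bar>\<delta> \<bullet> wt\<bar> \<le> \<beta> * ((K * norm \<zeta>t) * norm wt)" using beta by (intro mult_left_mono) auto
    then show ?thesis using beta by (simp add: abs_mult mult_ac)
  qed
  have t5: "\<bar>\<beta> / 2 * (norm \<delta>)\<^sup>2\<bar> \<le> \<beta> * K\<^sup>2 * (norm \<zeta>t)\<^sup>2"
  proof -
    have "(norm \<delta>)\<^sup>2 \<le> (K * norm \<zeta>t)\<^sup>2" by (intro power_mono \<delta>) simp
    then have "\<beta> / 2 * (norm \<delta>)\<^sup>2 \<le> \<beta> / 2 * (K * norm \<zeta>t)\<^sup>2" using beta by (intro mult_left_mono) auto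
    also have "\<dots> \<le> \<beta> * (K * norm \<zeta>t)\<^sup>2" using beta by (intro mult_right_mono) auto
    finally show ?thesis using beta by (simp add: power_mult_distrib)
  qed
  show ?thesis unfolding e1 distrib_right using t1 t2 t3 t4 t5 by linarith
qed

lemma expansion:
  assumes o: "opt x c C"
    and y: "has_Wderiv y (\<lambda>t. G (y t) + B *v w t)" "y 0 = c 0" and w: "l2 HL w"
    and yR: "\<And>t. 0 \<le> t \<Longrightarrow> norm (y t) \<le> R" and s: "\<And>t. 0 \<le> t \<Longrightarrow> norm (y t - c t) \<le> s"
    and z: "has_Wderiv z (\<lambda>t. A (c t) (z t) + B *v w t)" "z 0 = 0"
    and n: "n = l2n HL (\<lambda>t. y t - c t)"
  shows "\<bar>real_cost y (\<lambda>t. Fs (y t) + w t) - real_cost c (\<lambda>t. Fs (c t)) - cost_deriv c z w - \<beta> / 2 * (l2n HL w)\<^sup>2\<bar>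
     \<le> expansion_const C * (n\<^sup>2 + n * l2n HL w + s * n)"
proof -
  note D = optD[OF o]
  have C: "0 < C" by (rule D)
  define \<zeta> where "\<zeta> t = y t - c t" for t
  have d\<zeta>: "has_Wderiv \<zeta> (\<lambda>t. G (y t) + B *v w t - G (c t))" unfolding \<zeta>_def by (rule has_Wderiv_diff[OF y(1) D(1)])
  have l\<zeta>: "l2 HL \<zeta>" by (rule has_WderivD(1)[OF d\<zeta>])
  have lz: "l2 HL z" by (rule has_WderivD(1)[OF z(1)])
  have ly: "l2 HL y" by (rule has_WderivD(1)[OF y(1)])
  define e where "e t = G (y t) - G (c t) - A (c t) (\<zeta> t)" for t
  have le: "l2 HL e"
  proof -
    have "l2 HL (\<lambda>t. (G (y t) + B *v w t - G (c t)) - B *v w t - A (c t) (\<zeta> t))"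
      by (intro l2_diff(1) has_WderivD(2)[OF d\<zeta>] l2_B(1)[OF w] family_l2(1)[OF D(9,4) l\<zeta> linA A_bd A_lip])
    then show ?thesis by (simp add: e_def[abs_def] algebra_simps)
  qed
  have s0: "0 \<le> s" using s[of 0] norm_ge_zero[of "y 0 - c 0"] by linarith
  have en: "l2n HL e \<le> K * s * n"
  proof -
    have "norm (e t) \<le> (K * s) * norm (\<zeta> t)" if t: "t \<in> space HL" for t
    proof -
      have t: "0 \<le> t" using t by simp
      have "norm (e t) \<le> K * norm (\<zeta> t) * norm (\<zeta> t)"
        using G_quad'[OF yR[OF t] D(4)[OF t] D(4)[OF t]] by (simp add: e_def \<zeta>_def)
      also have "\<dots> \<le> K * s * norm (\<zeta> t)" using s[OF t] K0 by (intro mult_right_mono mult_left_mono) (auto simp: \<zeta>_def)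
      finally show ?thesis .
    qed
    then have "l2n HL e \<le> K * s * l2n HL \<zeta>" by (intro l2_bound(2)[OF l\<zeta> l2D(1)[OF le]]) (use K0 s0 in auto)
    then show ?thesis by (simp add: n \<zeta>_def[abs_def])
  qed
  have dd: "has_Wderiv (\<lambda>t. \<zeta> t - z t) (\<lambda>t. A (c t) (\<zeta> t - z t) + e t)"
    by (rule has_Wderiv_congD[OF has_Wderiv_diff[OF d\<zeta> z(1)]]) (use linear_diff[OF linA[OF D(4)]] in \<open>simp add: e_def\<close>)
  have "Wnorm (\<lambda>t. \<zeta> t - z t) \<le> C * (l2n HL e)"
    using lin_solvable_bd[OF D(6) le dd] y(2) z(2) by (simp add: \<zeta>_def)
  also have "\<dots> \<le> C * (K * s * n)" using en C by (intro mult_left_mono) auto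
  finally have dz: "l2n HL (\<lambda>t. \<zeta> t - z t) \<le> C * K * (s * n)"
    using l2n_le_Wnorm[of "\<lambda>t. \<zeta> t - z t"] by (simp add: mult.assoc)
  have ldz: "l2 HL (\<lambda>t. \<zeta> t - z t)" by (rule l2_diff(1)[OF l\<zeta> lz])
  have lFy: "l2 HL (\<lambda>t. Fs (y t) + w t)" by (intro l2_add(1) Fs_l2(1)[OF y(1) yR] w)
  have lDF: "l2 HL (\<lambda>t. DF (c t) (z t) + w t)" by (intro l2_add(1) family_l2(1)[OF D(9,4) lz linDF DF_bd DF_lip] w)
  have i1: "integrable HL (\<lambda>t. (norm (Q *v y t))\<^sup>2)" using l2_Q(1)[OF ly] by auto
  have i2: "integrable HL (\<lambda>t. (norm (Fs (y t) + w t))\<^sup>2)" using lFy by auto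
  have i3: "integrable HL (\<lambda>t. (norm (Q *v c t))\<^sup>2)" using l2_Q(1)[OF D(10)] by auto
  have i4: "integrable HL (\<lambda>t. (norm (Fs (c t)))\<^sup>2)" using D(11) by auto
  have i5: "integrable HL (\<lambda>t. (Q *v c t) \<bullet> (Q *v z t))" by (intro integrable_l2_inner l2_Q D lz)
  have i6: "integrable HL (\<lambda>t. Fs (c t) \<bullet> (DF (c t) (z t) + w t))" by (intro integrable_l2_inner D lDF)
  have i7: "integrable HL (\<lambda>t. (norm (w t))\<^sup>2)" using w by auto
  define X where "X t = ((norm (Q *v y t))\<^sup>2 + \<beta> * (norm (Fs (y t) + w t))\<^sup>2) / 2 - ((norm (Q *v c t))\<^sup>2 + \<beta> * (norm (Fs (c t)))\<^sup>2) / 2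
     - ((Q *v c t) \<bullet> (Q *v z t) + \<beta> * (Fs (c t) \<bullet> (DF (c t) (z t) + w t))) - \<beta> / 2 * (norm (w t))\<^sup>2" for t
  have iX: "integrable HL X" unfolding X_def
    by (intro Bochner_Integration.integrable_diff Bochner_Integration.integrable_add integrable_mult_right integrable_divide i1 i2 i3 i4 i5 i6 i7)
  have eX: "real_cost y (\<lambda>t. Fs (y t) + w t) - real_cost c (\<lambda>t. Fs (c t)) - cost_deriv c z w - \<beta> / 2 * (l2n HL w)\<^sup>2 = (\<integral>t. X t \<partial>HL)"
  proof -
    define f1 where "f1 t = ((norm (Q *v y t))\<^sup>2 + \<beta> * (norm (Fs (y t) + w t))\<^sup>2) / 2" for t
    define f2 where "f2 t = ((norm (Q *v c t))\<^sup>2 + \<beta> * (norm (Fs (c t)))\<^sup>2) / 2" for t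
    define f3 where "f3 t = (Q *v c t) \<bullet> (Q *v z t) + \<beta> * (Fs (c t) \<bullet> (DF (c t) (z t) + w t))" for t
    define f4 where "f4 t = \<beta> / 2 * (norm (w t))\<^sup>2" for t
    have I: "integrable HL f1" "integrable HL f2" "integrable HL f3" "integrable HL f4"
      unfolding f1_def f2_def f3_def f4_def
      by (intro Bochner_Integration.integrable_add integrable_mult_right integrable_divide i1 i2 i3 i4 i5 i6 i7)+
    have "real_cost y (\<lambda>t. Fs (y t) + w t) = (\<integral>t. f1 t \<partial>HL)" "real_cost c (\<lambda>t. Fs (c t)) = (\<integral>t. f2 t \<partial>HL)"
      "cost_deriv c z w = (\<integral>t. f3 t \<partial>HL)" "\<beta> / 2 * (l2n HL w)\<^sup>2 = (\<integral>t. f4 t \<partial>HL)"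
      using i1 i2 i3 i4 i7 by (simp_all add: real_cost_def cost_deriv_def l2n_sq f1_def f2_def f3_def f4_def)
    moreover have "X t = f1 t - f2 t - f3 t - f4 t" for t by (simp add: X_def f1_def f2_def f3_def f4_def)
    ultimately show ?thesis using I by simp
  qed
  define a1 where "a1 = K\<^sup>2 + \<beta> * K\<^sup>2"
  define a2 where "a2 = K\<^sup>2 + \<beta> * K\<^sup>2 * R + \<beta> * K\<^sup>2"
  have a: "0 \<le> a1" "0 \<le> a2" "0 \<le> \<beta> * K" using beta K0 R by (auto simp: a1_def a2_def)
  define P where "P t = a1 * (norm (c t) * norm (\<zeta> t - z t)) + a2 * (norm (\<zeta> t))\<^sup>2 + \<beta> * K * (norm (\<zeta> t) * norm (w t))" for t
  have p1: "integrable HL (\<lambda>t. norm (c t) * norm (\<zeta> t - z t))" by (rule integrable_l2_mult[OF D(10) ldz])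
  have p2: "integrable HL (\<lambda>t. (norm (\<zeta> t))\<^sup>2)" using l\<zeta> by auto
  have p3: "integrable HL (\<lambda>t. norm (\<zeta> t) * norm (w t))" by (rule integrable_l2_mult[OF l\<zeta> w])
  have iP: "integrable HL P" unfolding P_def
    by (intro Bochner_Integration.integrable_add integrable_mult_right p1 p2 p3)
  have XP: "\<bar>X t\<bar> \<le> P t" if "t \<in> space HL" for t
  proof -
    have t: "0 \<le> t" using that by simp
    have "c t + \<zeta> t = y t" by (simp add: \<zeta>_def)
    then show ?thesis using expansion_pointwise[OF D(4)[OF t], of "\<zeta> t" "w t" "z t"] yR[OF t]
      by (simp add: X_def P_def a1_def a2_def)
  qed
  have n0: "0 \<le> n" by (simp add: n)
  have "\<bar>\<integral>t. X t \<partial>HL\<bar> \<le> (\<integral>t. \<bar>X t\<bar> \<partial>HL)" by (rule integral_abs_bound)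
  also have "\<dots> \<le> (\<integral>t. P t \<partial>HL)" by (rule integral_mono) (use iX iP XP in auto)
  also have "\<dots> = a1 * (\<integral>t. norm (c t) * norm (\<zeta> t - z t) \<partial>HL) + a2 * n\<^sup>2 + \<beta> * K * (\<integral>t. norm (\<zeta> t) * norm (w t) \<partial>HL)"
    unfolding P_def using p1 p2 p3 by (simp add: n l2n_sq \<zeta>_def)
  also have "\<dots> \<le> a1 * (Mc * (C * K * (s * n))) + a2 * n\<^sup>2 + \<beta> * K * (n * l2n HL w)"
  proof (intro add_mono mult_left_mono order_refl a)
    have "(\<integral>t. norm (c t) * norm (\<zeta> t - z t) \<partial>HL) \<le> l2n HL c * l2n HL (\<lambda>t. \<zeta> t - z t)" by (rule l2_mult_le[OF D(10) ldz])
    also have "\<dots> \<le> Mc * (C * K * (s * n))" by (intro mult_mono D(5) dz) (use Mc in auto)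
    finally show "(\<integral>t. norm (c t) * norm (\<zeta> t - z t) \<partial>HL) \<le> Mc * (C * K * (s * n))" .
    show "(\<integral>t. norm (\<zeta> t) * norm (w t) \<partial>HL) \<le> n * l2n HL w"
      using l2_mult_le[OF l\<zeta> w] by (simp add: n \<zeta>_def[abs_def])
  qed
  also have "\<dots> \<le> expansion_const C * (n\<^sup>2 + n * l2n HL w + s * n)"
  proof -
    have E: "expansion_const C = a1 * Mc * (C * K) + a2 + \<beta> * K" by (simp add: expansion_const_def a1_def a2_def)
    have "0 \<le> a1 * Mc * (C * K)" using a Mc C K0 by (intro mult_nonneg_nonneg) auto
    moreover have "0 \<le> s * n" "0 \<le> n * l2n HL w" "0 \<le> n\<^sup>2" using s0 n0 by auto
    ultimately have "a1 * Mc * (C * K) * (s * n) \<le> a1 * Mc * (C * K) * (n\<^sup>2 + n * l2n HL w + s * n)"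
      "a2 * n\<^sup>2 \<le> a2 * (n\<^sup>2 + n * l2n HL w + s * n)" "\<beta> * K * (n * l2n HL w) \<le> \<beta> * K * (n\<^sup>2 + n * l2n HL w + s * n)"
      using a by (auto intro!: mult_left_mono)
    moreover have "a1 * (Mc * (C * K * (s * n))) = a1 * Mc * (C * K) * (s * n)" by simp
    ultimately show ?thesis unfolding E distrib_right[of _ _ "n\<^sup>2 + n * l2n HL w + s * n"] by linarith
  qed
  finally show ?thesis unfolding eX .
qed

definition rad :: "real \<Rightarrow> real" where
  "rad C = min ((R - \<rho>0) / Ci) (1 / (4 * C * K * Ci))"

lemma rad:
  assumes "0 < C"
  shows "0 < rad C" "\<rho>0 + Ci * rad C \<le> R" "C * (2 * K * (Ci * rad C) + 0) \<le> 1/2"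
proof -
  show "0 < rad C" using assms \<rho>0 Ci K0 by (simp add: rad_def)
  have "Ci * rad C \<le> Ci * ((R - \<rho>0) / Ci)" using Ci by (intro mult_left_mono) (auto simp: rad_def)
  then show "\<rho>0 + Ci * rad C \<le> R" using Ci by simp
  have "(2 * C * K * Ci) * rad C \<le> (2 * C * K * Ci) * (1 / (4 * C * K * Ci))"
    using Ci K0 assms by (intro mult_left_mono) (auto simp: rad_def)
  also have "\<dots> = 1/2" using Ci K0 assms by (simp add: field_simps)
  finally show "C * (2 * K * (Ci * rad C) + 0) \<le> 1/2" by (simp add: mult_ac)
qed

lemma expansion_const_nonneg: "0 < C \<Longrightarrow> 0 \<le> expansion_const C"
  unfolding expansion_const_def using beta K0 Mc R by (intro add_nonneg_nonneg mult_nonneg_nonneg) auto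

lemma perturb_opt:
  assumes o: "opt x c C" and v: "l2 HL v" and small: "C * (l2n HL v + norm h) \<le> rad C / 2"
  shows "\<exists>y. has_Wderiv y (\<lambda>t. G (y t) + v t) \<and> y 0 = x + h \<and>
     Wnorm (\<lambda>t. y t - c t) \<le> 2 * C * (l2n HL v + norm h) \<and> (\<forall>t\<ge>0. norm (y t) \<le> R)"
proof -
  note D = optD[OF o]
  have "\<exists>y. has_Wderiv y (\<lambda>t. G (y t) + (\<lambda>x. 0) (y t) + v t) \<and> y 0 = c 0 + h \<and>
     Wnorm (\<lambda>t. y t - c t) \<le> 2 * C * (l2n HL v + 0 * l2n HL c + norm h) \<and>
     (\<forall>t\<ge>0. norm (y t) \<le> R \<and> norm (y t - c t) \<le> Ci * rad C)"
    by (rule perturbation[OF D(1,3,6) v _ _ _ rad[OF D(12)]]) (use small in auto)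
  then show ?thesis using D(2) by auto
qed

lemma quadratic_perturbation_zero:
  fixes a H l0 :: real
  assumes "\<And>l. \<bar>l\<bar> \<le> l0 \<Longrightarrow> 0 \<le> l * a + l\<^sup>2 * H" "0 < l0" "0 \<le> H"
  shows "a = 0"
proof (rule ccontr)
  assume a: "a \<noteq> 0"
  define m where "m = min l0 (\<bar>a\<bar> / (H + 1))"
  have m: "0 < m" "m \<le> l0" using assms a by (auto simp: m_def)
  have "m \<le> \<bar>a\<bar> / (H + 1)" by (simp add: m_def)
  then have "m * (H + 1) \<le> \<bar>a\<bar>" using assms(3) by (subst (asm) pos_le_divide_eq) auto
  define l where "l = (if 0 < a then - m else m)"
  have "0 \<le> l * a + l\<^sup>2 * H" by (rule assms(1)) (use m in \<open>auto simp: l_def\<close>)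
  moreover have "l * a = - (m * \<bar>a\<bar>)" "l\<^sup>2 = m * m" using a by (auto simp: l_def power2_eq_square)
  ultimately have "m * \<bar>a\<bar> \<le> m * (m * H)" by (simp add: mult.assoc)
  then have "\<bar>a\<bar> \<le> m * H" using m by simp
  moreover have "m * H < m * (H + 1)" using m by simp
  ultimately show False using \<open>m * (H + 1) \<le> \<bar>a\<bar>\<close> by linarith
qed

text \<open>Both l w and - l w are admissible control perturbations, so the linear term of the expansion vanishes.\<close>

lemma first_order:
  assumes o: "opt x c C" and w: "l2 HL w"
    and z: "has_Wderiv z (\<lambda>t. A (c t) (z t) + B *v w t)" "z 0 = 0"
  shows "cost_deriv c z w = 0"
proof -
  note D = optD[OF o]
  have C: "0 < C" by (rule D)
  define W where "W = l2n HL w"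
  have W: "0 \<le> W" by (simp add: W_def)
  define l0 where "l0 = rad C / (2 * C * K * (W + 1))"
  have l0: "0 < l0" using rad(1)[OF C] C K0 W by (simp add: l0_def)
  define a where "a = 2 * C * K * W"
  have a0: "0 \<le> a" using C K0 W by (simp add: a_def)
  define H where "H = \<beta> / 2 * W\<^sup>2 + expansion_const C * (a\<^sup>2 + a * W + Ci * a * a)"
  have H: "0 \<le> H" using expansion_const_nonneg[OF C] beta W a0 Ci unfolding H_def
    by (intro add_nonneg_nonneg mult_nonneg_nonneg) auto
  show ?thesis
  proof (rule quadratic_perturbation_zero[OF _ l0 H])
    fix l :: real assume l: "\<bar>l\<bar> \<le> l0"
    have lw: "l2 HL (\<lambda>t. l *\<^sub>R w t)" "l2n HL (\<lambda>t. l *\<^sub>R w t) = \<bar>l\<bar> * W" using l2_scaleR[OF w] by (auto simp: W_def)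
    have v: "l2 HL (\<lambda>t. B *v (l *\<^sub>R w t))" "l2n HL (\<lambda>t. B *v (l *\<^sub>R w t)) \<le> K * (\<bar>l\<bar> * W)"
      using l2_B[OF lw(1)] lw(2) by auto
    have "C * (K * (\<bar>l\<bar> * W)) \<le> C * (K * (l0 * (W + 1)))"
      using l l0 W C K0 by (intro mult_left_mono mult_mono) auto
    also have "l0 * (W + 1) = rad C / (2 * C * K)" using W C K0 by (simp add: l0_def)
    also have "C * (K * (rad C / (2 * C * K))) = rad C / 2" using C K0 by (simp add: field_simps)
    finally have fin: "C * (K * (\<bar>l\<bar> * W)) \<le> rad C / 2" .
    have "C * l2n HL (\<lambda>t. B *v (l *\<^sub>R w t)) \<le> C * (K * (\<bar>l\<bar> * W))" by (intro mult_left_mono v) (use C in auto)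
    then have "C * (l2n HL (\<lambda>t. B *v (l *\<^sub>R w t)) + norm (0::real^'a)) \<le> rad C / 2"
      unfolding norm_zero add_0_right using fin by (rule order_trans)
    from perturb_opt[OF o v(1) this] obtain y where
      y: "has_Wderiv y (\<lambda>t. G (y t) + B *v (l *\<^sub>R w t))" "y 0 = c 0" and
      yn: "Wnorm (\<lambda>t. y t - c t) \<le> 2 * C * l2n HL (\<lambda>t. B *v (l *\<^sub>R w t))" and yR: "\<And>t. 0 \<le> t \<Longrightarrow> norm (y t) \<le> R"
      using D(2) by auto
    have yn': "Wnorm (\<lambda>t. y t - c t) \<le> a * \<bar>l\<bar>"
    proof -
      have "2 * C * l2n HL (\<lambda>t. B *v (l *\<^sub>R w t)) \<le> 2 * C * (K * (\<bar>l\<bar> * W))" by (intro mult_left_mono v) (use C in auto)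
      also have "\<dots> = a * \<bar>l\<bar>" by (simp add: a_def)
      finally show ?thesis using yn by linarith
    qed
    have iW: "inW (\<lambda>t. y t - c t)" by (rule inWI[OF has_Wderiv_diff[OF y(1) D(1)]])
    have s: "norm (y t - c t) \<le> Ci * (a * \<bar>l\<bar>)" if "0 \<le> t" for t
      using embed[OF iW that] mult_left_mono[OF yn' less_imp_le[OF Ci]] by linarith
    define n where "n = l2n HL (\<lambda>t. y t - c t)"
    have n: "0 \<le> n" "n \<le> a * \<bar>l\<bar>" using yn' l2n_le_Wnorm[of "\<lambda>t. y t - c t"] by (auto simp: n_def)
    have dz: "has_Wderiv (\<lambda>t. l *\<^sub>R z t) (\<lambda>t. A (c t) (l *\<^sub>R z t) + B *v (l *\<^sub>R w t))"
      by (rule has_Wderiv_congD[OF has_Wderiv_scaleR[OF z(1), of l]])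
        (simp add: linear_cmul[OF linA[OF D(4)]] matrix_vector_mult_scaleR scaleR_add_right)
    have f0: "\<bar>real_cost y (\<lambda>t. Fs (y t) + l *\<^sub>R w t) - real_cost c (\<lambda>t. Fs (c t)) - cost_deriv c (\<lambda>t. l *\<^sub>R z t) (\<lambda>t. l *\<^sub>R w t) - \<beta> / 2 * (l2n HL (\<lambda>t. l *\<^sub>R w t))\<^sup>2\<bar>
     \<le> expansion_const C * (n\<^sup>2 + n * l2n HL (\<lambda>t. l *\<^sub>R w t) + (Ci * (a * \<bar>l\<bar>)) * n)"
      by (rule expansion[OF o y lw(1) yR s dz _ n_def]) (use z in auto)
    have f1: "expansion_const C * (n\<^sup>2 + n * l2n HL (\<lambda>t. l *\<^sub>R w t) + (Ci * (a * \<bar>l\<bar>)) * n)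
       \<le> expansion_const C * ((a * \<bar>l\<bar>)\<^sup>2 + (a * \<bar>l\<bar>) * (\<bar>l\<bar> * W) + (Ci * (a * \<bar>l\<bar>)) * (a * \<bar>l\<bar>))"
      unfolding lw(2) using n a0 Ci W
      by (intro mult_left_mono[OF _ expansion_const_nonneg[OF C]] add_mono power_mono mult_right_mono mult_left_mono) auto
    have f2: "expansion_const C * ((a * \<bar>l\<bar>)\<^sup>2 + (a * \<bar>l\<bar>) * (\<bar>l\<bar> * W) + (Ci * (a * \<bar>l\<bar>)) * (a * \<bar>l\<bar>)) = l\<^sup>2 * (expansion_const C * (a\<^sup>2 + a * W + Ci * a * a))"
    proof -
      have "\<bar>l\<bar> * \<bar>l\<bar> = l\<^sup>2" by (simp add: power2_eq_square)
      then have "(a * \<bar>l\<bar>)\<^sup>2 = a\<^sup>2 * l\<^sup>2" "(a * \<bar>l\<bar>) * (\<bar>l\<bar> * W) = a * W * l\<^sup>2" "(Ci * (a * \<bar>l\<bar>)) * (a * \<bar>l\<bar>) = Ci * a * a * l\<^sup>2"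
        by (simp_all add: power2_eq_square mult_ac)
      then show ?thesis by (simp only:) (simp add: distrib_left mult_ac)
    qed
    have f3: "real_cost c (\<lambda>t. Fs (c t)) \<le> real_cost y (\<lambda>t. Fs (y t) + l *\<^sub>R w t)"
    proof (rule D(7))
      show "feasible f B x y (\<lambda>t. Fs (y t) + l *\<^sub>R w t)"
        by (rule iffD2[OF feasible_iff_deviation[OF yR]]) (use y lw(1) D(2) in auto)
    qed
    have f4: "cost_deriv c (\<lambda>t. l *\<^sub>R z t) (\<lambda>t. l *\<^sub>R w t) = l * cost_deriv c z w"
    proof -
      have "cost_deriv c (\<lambda>t. l *\<^sub>R z t) (\<lambda>t. l *\<^sub>R w t) = (\<integral>t. l * ((Q *v c t) \<bullet> (Q *v z t) + \<beta> * (Fs (c t) \<bullet> (DF (c t) (z t) + w t))) \<partial>HL)"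
        unfolding cost_deriv_def
      proof (rule Bochner_Integration.integral_cong[OF refl])
        fix t assume "t \<in> space HL"
        then have "DF (c t) (l *\<^sub>R z t) = l *\<^sub>R DF (c t) (z t)" using linear_cmul[OF linDF[OF D(4)]] by simp
        then show "(Q *v c t) \<bullet> (Q *v (l *\<^sub>R z t)) + \<beta> * (Fs (c t) \<bullet> (DF (c t) (l *\<^sub>R z t) + l *\<^sub>R w t)) =
           l * ((Q *v c t) \<bullet> (Q *v z t) + \<beta> * (Fs (c t) \<bullet> (DF (c t) (z t) + w t)))"
          by (simp add: matrix_vector_mult_scaleR inner_add_right algebra_simps)
      qed
      then show ?thesis by (simp add: cost_deriv_def)
    qed
    have f5: "(l2n HL (\<lambda>t. l *\<^sub>R w t))\<^sup>2 = l\<^sup>2 * W\<^sup>2" unfolding lw(2) by (simp add: power_mult_distrib)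
    have f6: "l\<^sup>2 * H = \<beta> / 2 * (l\<^sup>2 * W\<^sup>2) + l\<^sup>2 * (expansion_const C * (a\<^sup>2 + a * W + Ci * a * a))"
      by (simp add: H_def algebra_simps)
    have "real_cost y (\<lambda>t. Fs (y t) + l *\<^sub>R w t) - real_cost c (\<lambda>t. Fs (c t)) - l * cost_deriv c z w - \<beta> / 2 * (l\<^sup>2 * W\<^sup>2) \<le> l\<^sup>2 * (expansion_const C * (a\<^sup>2 + a * W + Ci * a * a))"
      using abs_le_D1[OF order_trans[OF f0 f1]] unfolding f2 f4 f5 .
    then show "0 \<le> l * cost_deriv c z w + l\<^sup>2 * H" using f3 unfolding f6 by linarith
  qed
qed

text \<open>The competitor follows y on [0, h] and the optimal closed loop afterwards. Expanding its cost around the optimal trajectory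
  from y 0 leaves an error of order sqrt h times the square of the deviation w, because y is within sqrt h * |w| of that trajectory.\<close>

lemma segment_dissipation:
  assumes C: "0 < C" and Wb: "0 \<le> Wb"
  shows "\<exists>h0>0. \<exists>K'\<ge>0. \<forall>y u c c2 h. feasible f B (y 0) y u \<and> (\<forall>t\<ge>0. norm (y t) \<le> R) \<and> opt (y 0) c C \<and> opt (y h) c2 C \<and>
     0 \<le> h \<and> h \<le> h0 \<and> l2n HL (\<lambda>t. u t - Fs (y t)) \<le> Wb \<longrightarrow>
     real_cost c (\<lambda>t. Fs (c t)) + (\<beta> / 2 - K' * sqrt h) * (l2n HL (trunc h (\<lambda>t. u t - Fs (y t))))\<^sup>2
       \<le> trunc_cost h y u + real_cost c2 (\<lambda>t. Fs (c2 t))"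
proof -
  define C2 where "C2 = C * (1 + K)"
  have C2: "0 < C2" using C K0 by (simp add: C2_def)
  define a where "a = K * exp K"
  have a0: "0 < a" using K0 by (simp add: a_def)
  define h0 where "h0 = min 1 ((rad C2 / (2 * C2 * a * (Wb + 1)))\<^sup>2)"
  have h0: "0 < h0" using rad(1)[OF C2] C2 a0 Wb by (auto simp: h0_def)
  define b where "b = (1 + 2 * C2) * a"
  define b' where "b' = (1 + 2 * Ci * C2) * a"
  have b0: "0 \<le> b" "0 \<le> b'" using C2 a0 Ci by (auto simp: b_def b'_def)
  define K' where "K' = expansion_const C * (b\<^sup>2 + b + b' * b)"
  have K'0: "0 \<le> K'" using expansion_const_nonneg[OF C] b0 by (simp add: K'_def)
  show ?thesis
  proof (rule exI[of _ h0], rule conjI[OF h0], rule exI[of _ K'], rule conjI[OF K'0], intro allI impI)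
    fix y u c c2 h
    assume "feasible f B (y 0) y u \<and> (\<forall>t\<ge>0. norm (y t) \<le> R) \<and> opt (y 0) c C \<and> opt (y h) c2 C \<and>
     0 \<le> h \<and> h \<le> h0 \<and> l2n HL (\<lambda>t. u t - Fs (y t)) \<le> Wb"
    then have fe: "feasible f B (y 0) y u" and yR: "\<And>t. 0 \<le> t \<Longrightarrow> norm (y t) \<le> R"
      and o: "opt (y 0) c C" and o2: "opt (y h) c2 C" and h: "0 \<le> h" "h \<le> h0"
      and wb: "l2n HL (\<lambda>t. u t - Fs (y t)) \<le> Wb" by auto
    note D = optD[OF o] and D2 = optD[OF o2]
    define w where "w t = u t - Fs (y t)" for t
    have y: "has_Wderiv y (\<lambda>t. G (y t) + B *v w t)" and w: "l2 HL w"
      using iffD1[OF feasible_iff_deviation[OF yR] fe] unfolding w_def by blast+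
    have lu: "l2 HL u" using fe by (simp add: feasible_iff)
    define W where "W = l2n HL (trunc h w)"
    have W: "0 \<le> W" "W \<le> Wb" using l2_trunc(2)[OF w, of h] wb by (auto simp: W_def w_def[abs_def])
    have h1: "h \<le> 1" using h by (simp add: h0_def)
    have sh1: "0 \<le> sqrt h" "sqrt h \<le> 1" using h h1 by auto
    define s0 where "s0 = a * sqrt h * W"
    have s00: "0 \<le> s0" using a0 h W by (simp add: s0_def)
    have near: "norm (y t - c t) \<le> s0" if t: "0 \<le> t" "t \<le> h" for t
    proof -
      have d: "has_Wderiv (\<lambda>t. y t - c t) (\<lambda>t. G (y t) + B *v w t - G (c t))" by (rule has_Wderiv_diff[OF y D(1)])
      note bi = integral_Icc_sq_le[OF l2_B(1)[OF w] h(1)]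
      have "norm (y t - c t) \<le> (norm (y 0 - c 0) + integral {0..h} (\<lambda>t. norm (B *v w t))) * exp (K * t)"
      proof (rule gronwall_integral_eq[OF _ has_WderivD(2)[OF d] K0(1) _ _ bi(1) _ t])
        show "continuous_on {0..h} (\<lambda>t. y t - c t)"
          by (rule continuous_on_subset[OF has_Wderiv_continuous[OF d]]) auto
        fix t :: real assume t: "0 \<le> t"
        show "y t - c t = y 0 - c 0 + set_lebesgue_integral lborel {0..t} (\<lambda>t. G (y t) + B *v w t - G (c t))"
          by (rule has_WderivD(3)[OF d t])
        have "norm (G (y t) + B *v w t - G (c t)) \<le> norm (G (y t) - G (c t)) + norm (B *v w t)"
          using norm_triangle_ineq[of "G (y t) - G (c t)" "B *v w t"] by (simp add: algebra_simps)
        then show "norm (G (y t) + B *v w t - G (c t)) \<le> K * norm (y t - c t) + norm (B *v w t)"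
          using G_lip'[OF yR[OF t] D(4)[OF t]] by linarith
      qed auto
      also have "\<dots> = integral {0..h} (\<lambda>t. norm (B *v w t)) * exp (K * t)" using D(2) by simp
      also have "\<dots> \<le> (sqrt h * (K * W)) * exp K"
      proof (rule mult_mono)
        have "(trunc h (\<lambda>t. B *v w t)) = (\<lambda>t. B *v trunc h w t)" by (auto simp: trunc_def)
        then have "l2n HL (trunc h (\<lambda>t. B *v w t)) \<le> K * W" using l2_B(2)[OF l2_trunc(1)[OF w, of h]] by (simp add: W_def)
        then show "integral {0..h} (\<lambda>t. norm (B *v w t)) \<le> sqrt h * (K * W)"
          using bi(2) mult_left_mono[OF _ sh1(1)] by fastforce
        have "K * t \<le> K * 1" using t h1 K0 by (intro mult_left_mono) auto
        then show "exp (K * t) \<le> exp K" by simp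
      qed (use sh1 K0 W in auto)
      finally show ?thesis by (simp add: s0_def a_def mult_ac)
    qed
    define c' where "c' t = c (h + t)" for t
    have "opt (c h) c' (C * (1 + K * sqrt h))" unfolding c'_def by (rule tail_opt[OF o h(1)])
    moreover have "C * (1 + K * sqrt h) \<le> C2" unfolding C2_def using C K0 sh1
      by (intro mult_left_mono add_left_mono) (auto intro: mult_left_le)
    ultimately have oc': "opt (c h) c' C2" by (rule opt_mono)
    have "C2 * s0 \<le> rad C2 / 2"
    proof -
      have "sqrt h \<le> sqrt ((rad C2 / (2 * C2 * a * (Wb + 1)))\<^sup>2)" using h by (intro real_sqrt_le_mono) (simp add: h0_def)
      also have "\<dots> = rad C2 / (2 * C2 * a * (Wb + 1))" using rad(1)[OF C2] C2 a0 Wb by simp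
      finally have "sqrt h * W \<le> rad C2 / (2 * C2 * a * (Wb + 1)) * (Wb + 1)"
        using W sh1 rad(1)[OF C2] C2 a0 Wb by (intro mult_mono) auto
      also have "\<dots> = rad C2 / (2 * C2 * a)" using Wb by simp
      finally have "C2 * a * (sqrt h * W) \<le> C2 * a * (rad C2 / (2 * C2 * a))" using C2 a0 by (intro mult_left_mono) auto
      also have "\<dots> = rad C2 / 2" using C2 a0 by (simp add: field_simps)
      finally show ?thesis by (simp add: s0_def mult_ac)
    qed
    then have "C2 * (l2n HL (\<lambda>t. 0::real^'a) + norm (y h - c h)) \<le> rad C2 / 2"
      using mult_left_mono[OF near[OF h(1) order_refl] less_imp_le[OF C2]] unfolding l2n_zero add_0 by linarith
    from perturb_opt[OF oc' _ this] obtain yh where yh: "has_Wderiv yh (\<lambda>t. G (yh t))" "yh 0 = y h"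
      and yhn: "Wnorm (\<lambda>t. yh t - c' t) \<le> 2 * C2 * norm (y h - c h)" by auto
    have yc2: "yh t = c2 t" if "0 \<le> t" for t by (rule D2(8)[OF yh that])
    have dyh: "has_Wderiv (\<lambda>t. yh t - c' t) (\<lambda>t. G (yh t) - G (c' t))"
      by (rule has_Wderiv_diff[OF yh(1) optD(1)[OF oc']])
    have Wc2: "Wnorm (\<lambda>t. yh t - c' t) \<le> 2 * C2 * s0"
    proof -
      have "2 * C2 * norm (y h - c h) \<le> 2 * C2 * s0" by (intro mult_left_mono near) (use C2 h in auto)
      then show ?thesis using yhn by linarith
    qed
    define yt where "yt = cat h y c2"
    define wt where "wt = trunc h w"
    have lwt: "l2 HL wt" unfolding wt_def by (rule l2_trunc(1)[OF w])
    have dyt: "has_Wderiv yt (\<lambda>t. G (yt t) + B *v wt t)"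
      unfolding yt_def by (rule has_Wderiv_congD[OF has_Wderiv_cat[OF y D2(1) _ h(1)]]) (use D2(2) in \<open>auto simp: cat_def wt_def trunc_def\<close>)
    have yt0: "yt 0 = c 0" using D(2) D2(2) h by (cases "h = 0") (auto simp: yt_def cat_def)
    have ytR: "norm (yt t) \<le> R" if "0 \<le> t" for t using that yR D2(4) by (auto simp: yt_def cat_def)
    define s where "s = b' * sqrt h * W"
    have s0s: "s0 \<le> s" "Ci * (2 * C2 * s0) \<le> s"
    proof -
      have "s = s0 + Ci * (2 * C2 * s0)" by (simp add: s_def s0_def b'_def algebra_simps)
      moreover have "0 \<le> Ci * (2 * C2 * s0)" using Ci C2 s00 by simp
      ultimately show "s0 \<le> s" "Ci * (2 * C2 * s0) \<le> s" using s00 by linarith+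
    qed
    have yts: "norm (yt t - c t) \<le> s" if t: "0 \<le> t" for t
    proof (cases "t < h")
      case True
      then show ?thesis using near[of t] t s0s by (simp add: yt_def cat_def)
    next
      case False
      then have "yt t - c t = yh (t - h) - c' (t - h)" using yc2[of "t - h"] by (simp add: yt_def cat_def c'_def)
      then have "norm (yt t - c t) \<le> Ci * Wnorm (\<lambda>t. yh t - c' t)"
        using embed[OF inWI[OF dyh], of "t - h"] False by simp
      then show ?thesis using mult_left_mono[OF Wc2 less_imp_le[OF Ci]] s0s by linarith
    qed
    define n where "n = l2n HL (\<lambda>t. yt t - c t)"
    have n: "0 \<le> n" "n \<le> b * sqrt h * W"
    proof -
      show "0 \<le> n" by (simp add: n_def)
      have lyc: "l2 HL (\<lambda>t. y t - c t)" by (rule l2_diff(1)[OF has_WderivD(1)[OF y] D(10)])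
      have "n = l2n HL (cat h (\<lambda>t. y t - c t) (\<lambda>t. yh t - c' t))"
        unfolding n_def by (rule l2n_HL_cong) (use yc2 in \<open>auto simp: yt_def cat_def c'_def\<close>)
      then have "n\<^sup>2 = (l2n HL (trunc h (\<lambda>t. y t - c t)))\<^sup>2 + (l2n HL (\<lambda>t. yh t - c' t))\<^sup>2"
        using l2_cat(2)[OF lyc has_WderivD(1)[OF dyh] h(1)] by simp
      also have "\<dots> \<le> s0\<^sup>2 + (2 * C2 * s0)\<^sup>2"
      proof (intro add_mono power_mono)
        have "l2n HL (trunc h (\<lambda>t. y t - c t)) \<le> s0 * sqrt h"
          by (rule l2_trunc_bounded(2)[OF l2D(1)[OF l2_trunc(1)[OF lyc]]]) (use near s00 h in auto)
        also have "\<dots> \<le> s0" using s00 sh1 by (simp add: mult_left_le)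
        finally show "l2n HL (trunc h (\<lambda>t. y t - c t)) \<le> s0" .
        show "l2n HL (\<lambda>t. yh t - c' t) \<le> 2 * C2 * s0" using Wc2 l2n_le_Wnorm[of "\<lambda>t. yh t - c' t"] by linarith
      qed auto
      also have "\<dots> \<le> (s0 + 2 * C2 * s0)\<^sup>2" using s00 C2 by (simp add: power2_sum)
      finally have "n \<le> s0 + 2 * C2 * s0" by (rule power2_le_imp_le) (use s00 C2 in simp)
      then show "n \<le> b * sqrt h * W" by (simp add: b_def s0_def algebra_simps)
    qed
    obtain z where z: "has_Wderiv z (\<lambda>t. A (c t) (z t) + B *v wt t)" "z 0 = 0"
      using D(6) l2_B(1)[OF lwt] unfolding lin_solvable_def by blast
    have "\<bar>real_cost yt (\<lambda>t. Fs (yt t) + wt t) - real_cost c (\<lambda>t. Fs (c t)) - cost_deriv c z wt - \<beta> / 2 * (l2n HL wt)\<^sup>2\<bar>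
     \<le> expansion_const C * (n\<^sup>2 + n * l2n HL wt + s * n)"
      by (rule expansion[OF o dyt yt0 lwt ytR yts z n_def])
    moreover have "cost_deriv c z wt = 0" by (rule first_order[OF o lwt z])
    moreover have "expansion_const C * (n\<^sup>2 + n * l2n HL wt + s * n) \<le> K' * sqrt h * W\<^sup>2"
    proof -
      define r where "r = sqrt h * W"
      have r: "0 \<le> r" "r \<le> W" using sh1 W by (auto simp: r_def mult_left_le_one_le)
      have "n\<^sup>2 \<le> (b * r)\<^sup>2" using n by (intro power_mono) (auto simp: r_def mult.assoc)
      also have "\<dots> \<le> b\<^sup>2 * (r * W)" using mult_left_mono[OF mult_left_mono[OF r(2,1)], of "b\<^sup>2"] by (simp add: power2_eq_square mult_ac)
      finally have 1: "n\<^sup>2 \<le> b\<^sup>2 * (r * W)" .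
      have 2: "n * W \<le> b * (r * W)" using n W by (simp add: r_def mult_right_mono mult.assoc[symmetric])
      have sr: "s = b' * r" and nr: "n \<le> b * r" using n by (simp_all add: s_def r_def mult.assoc)
      have "s * n \<le> (b' * r) * (b * r)" unfolding sr using nr b0 r by (intro mult_left_mono) auto
      also have "\<dots> \<le> b' * b * (r * W)" using mult_left_mono[OF mult_left_mono[OF r(2,1)], of "b' * b"] b0 by (simp add: mult_ac)
      finally have 3: "s * n \<le> b' * b * (r * W)" .
      have "n\<^sup>2 + n * l2n HL wt + s * n \<le> (b\<^sup>2 + b + b' * b) * (r * W)"
        using 1 2 3 by (simp add: distrib_right wt_def W_def)
      from mult_left_mono[OF this expansion_const_nonneg[OF C]] show ?thesis
        by (simp add: K'_def r_def power2_eq_square mult_ac)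
    qed
    moreover have "real_cost yt (\<lambda>t. Fs (yt t) + wt t) = trunc_cost h y u + real_cost c2 (\<lambda>t. Fs (c2 t))"
    proof -
      have "(\<lambda>t. Fs (yt t) + wt t) = cat h u (\<lambda>t. Fs (c2 t))" by (auto simp: yt_def wt_def cat_def trunc_def w_def)
      then show ?thesis unfolding yt_def using real_cost_cat[OF has_WderivD(1)[OF y] lu D2(10,11) h(1)] by simp
    qed
    moreover have "(l2n HL wt)\<^sup>2 = W\<^sup>2" by (simp add: wt_def W_def)
    moreover have "trunc h (\<lambda>t. u t - Fs (y t)) = wt" by (simp add: wt_def w_def[abs_def])
    ultimately show "real_cost c (\<lambda>t. Fs (c t)) + (\<beta> / 2 - K' * sqrt h) * (l2n HL (trunc h (\<lambda>t. u t - Fs (y t))))\<^sup>2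
       \<le> trunc_cost h y u + real_cost c2 (\<lambda>t. Fs (c2 t))"
      by (simp add: left_diff_distrib)
  qed
qed

text \<open>Summing over a partition of [0, \<tau>] whose mesh tends to zero removes the error term.\<close>

lemma energy_inequality:
  assumes fe: "feasible f B (y 0) y u" and yR: "\<And>t. 0 \<le> t \<Longrightarrow> norm (y t) \<le> R" and \<tau>: "0 \<le> \<tau>"
    and op: "\<And>s. 0 \<le> s \<Longrightarrow> s \<le> \<tau> \<Longrightarrow> \<exists>c. opt (y s) c C" and o0: "opt (y 0) c0 C0"
  shows "real_cost c0 (\<lambda>t. Fs (c0 t)) + \<beta> / 2 * (l2n HL (trunc \<tau> (\<lambda>t. u t - Fs (y t))))\<^sup>2 \<le> real_cost y u"
proof -
  have C: "0 < C" using op[of 0] \<tau> optD(12) by auto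
  define w where "w t = u t - Fs (y t)" for t
  have dy: "has_Wderiv y (\<lambda>t. G (y t) + B *v w t)" and w: "l2 HL w"
    using iffD1[OF feasible_iff_deviation[OF yR] fe] unfolding w_def by blast+
  have ly: "l2 HL y" by (rule has_WderivD(1)[OF dy])
  have lu: "l2 HL u" using fe by (simp add: feasible_iff)
  obtain cc where cc: "\<And>s. 0 \<le> s \<Longrightarrow> s \<le> \<tau> \<Longrightarrow> opt (y s) (cc s) C" using op by metis
  define V where "V s = real_cost (cc s) (\<lambda>t. Fs (cc s t))" for s
  define good where "good y u c c2 h h0 \<longleftrightarrow> feasible f B (y 0) y u \<and> (\<forall>t\<ge>0. norm (y t) \<le> R) \<and> opt (y 0) c C \<and> opt (y h) c2 C \<and>
     0 \<le> h \<and> h \<le> h0 \<and> l2n HL (\<lambda>t. u t - Fs (y t)) \<le> l2n HL w" for y u c c2 h h0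
  obtain h0 K' where h0: "0 < h0" and K': "0 \<le> K'" and seg: "\<And>y u c c2 h. good y u c c2 h h0 \<Longrightarrow>
     real_cost c (\<lambda>t. Fs (c t)) + (\<beta> / 2 - K' * sqrt h) * (l2n HL (trunc h (\<lambda>t. u t - Fs (y t))))\<^sup>2
       \<le> trunc_cost h y u + real_cost c2 (\<lambda>t. Fs (c2 t))"
    using segment_dissipation[OF C l2n_nonneg[of HL w], folded good_def] by blast
  have sum: "V 0 + (\<beta> / 2 - K' * sqrt h) * (l2n HL (trunc (real i * h) w))\<^sup>2 \<le> trunc_cost (real i * h) y u + V (real i * h)"
    if h: "0 \<le> h" "h \<le> h0" and "real i * h \<le> \<tau>" for h and i :: nat
    using that(3)
  proof (induction i)
    case 0
    have "l2n HL (trunc 0 w) = l2n HL (\<lambda>t. 0::real^'b)" "l2n HL (trunc 0 u) = l2n HL (\<lambda>t. 0::real^'b)"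
       "l2n HL (trunc 0 (\<lambda>t. Q *v y t)) = l2n HL (\<lambda>t. 0::real^'a)"
      by (rule l2n_HL_cong, simp add: trunc_def)+
    then show ?case by (simp add: trunc_cost_def)
  next
    case (Suc i)
    define s where "s = real i * h"
    have s: "0 \<le> s" "s + h \<le> \<tau>" "real (Suc i) * h = s + h" using h Suc.prems by (auto simp: s_def algebra_simps)
    have IH: "V 0 + (\<beta> / 2 - K' * sqrt h) * (l2n HL (trunc s w))\<^sup>2 \<le> trunc_cost s y u + V s"
      using Suc.IH s h unfolding s_def by simp
    have "real_cost (cc s) (\<lambda>t. Fs (cc s t)) + (\<beta> / 2 - K' * sqrt h) * (l2n HL (trunc h (\<lambda>t. u (s + t) - Fs (y (s + t)))))\<^sup>2
       \<le> trunc_cost h (\<lambda>t. y (s + t)) (\<lambda>t. u (s + t)) + real_cost (cc (s + h)) (\<lambda>t. Fs (cc (s + h) t))"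
    proof (rule seg, unfold good_def, intro conjI)
      show "feasible f B (y (s + 0)) (\<lambda>t. y (s + t)) (\<lambda>t. u (s + t))" using feasible_shift[OF fe s(1)] by simp
      show "\<forall>t\<ge>0. norm (y (s + t)) \<le> R" using yR s by auto
      show "opt (y (s + 0)) (cc s) C" "opt (y (s + h)) (cc (s + h)) C" using cc s h by auto
      show "l2n HL (\<lambda>t. u (s + t) - Fs (y (s + t))) \<le> l2n HL w" using l2_shift(3)[OF w s(1)] by (simp add: w_def)
    qed (use h in auto)
    moreover have "(l2n HL (trunc (s + h) w))\<^sup>2 = (l2n HL (trunc s w))\<^sup>2 + (l2n HL (trunc h (\<lambda>t. u (s + t) - Fs (y (s + t)))))\<^sup>2"
      using l2n_trunc_add[OF w s(1) h(1)] by (simp add: w_def)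
    moreover have "trunc_cost (s + h) y u = trunc_cost s y u + trunc_cost h (\<lambda>t. y (s + t)) (\<lambda>t. u (s + t))" by (rule trunc_cost_add[OF ly lu s(1) h(1)])
    ultimately show ?case unfolding s(3) using IH by (simp add: V_def distrib_left)
  qed
  define W where "W = (l2n HL (trunc \<tau> w))\<^sup>2"
  have tail: "trunc_cost \<tau> y u + V \<tau> \<le> real_cost y u"
    using optD(7)[OF cc[OF \<tau> order_refl] feasible_shift[OF fe \<tau>]] real_cost_shift[OF ly lu \<tau>] by (simp add: V_def)
  have c0: "real_cost c0 (\<lambda>t. Fs (c0 t)) \<le> V 0" unfolding V_def by (rule optD(7)[OF o0 opt_feasible[OF cc]]) (use \<tau> in auto)
  have lim: "(\<lambda>k. real_cost c0 (\<lambda>t. Fs (c0 t)) + (\<beta> / 2 - K' * sqrt (\<tau> * inverse (real (Suc k)))) * W)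
     \<longlonglongrightarrow> real_cost c0 (\<lambda>t. Fs (c0 t)) + (\<beta> / 2 - K' * sqrt (\<tau> * 0)) * W"
    by (intro tendsto_intros LIMSEQ_inverse_real_of_nat)
  have "\<exists>N. \<forall>k\<ge>N. real_cost c0 (\<lambda>t. Fs (c0 t)) + (\<beta> / 2 - K' * sqrt (\<tau> * inverse (real (Suc k)))) * W \<le> real_cost y u"
  proof -
    have "(\<lambda>k. \<tau> * inverse (real (Suc k))) \<longlonglongrightarrow> \<tau> * 0" by (intro tendsto_intros LIMSEQ_inverse_real_of_nat)
    then have "eventually (\<lambda>k. \<tau> * inverse (real (Suc k)) < h0) sequentially" using order_tendstoD(2)[of _ "\<tau> * 0" _ h0] h0 by simp
    then obtain N where N: "\<And>k. k \<ge> N \<Longrightarrow> \<tau> * inverse (real (Suc k)) < h0" by (auto simp: eventually_sequentially)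
    show ?thesis
    proof (intro exI[of _ N] allI impI)
      fix k assume k: "N \<le> k"
      define h where "h = \<tau> * inverse (real (Suc k))"
      have hk: "real (Suc k) * h = \<tau>" by (simp add: h_def field_simps del: of_nat_Suc)
      have "V 0 + (\<beta> / 2 - K' * sqrt h) * W \<le> trunc_cost \<tau> y u + V \<tau>"
        using sum[of h "Suc k", unfolded hk] N[OF k] \<tau> by (simp add: h_def W_def)
      then show "real_cost c0 (\<lambda>t. Fs (c0 t)) + (\<beta> / 2 - K' * sqrt (\<tau> * inverse (real (Suc k)))) * W \<le> real_cost y u"
        using tail c0 by (simp add: h_def)
    qed
  qed
  from LIMSEQ_le_const2[OF lim this] show ?thesis by (simp add: W_def w_def[abs_def])
qed

text \<open>Exit argument: a first time at which y leaves the tube would contradict the bound that holds up to that time.\<close>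

lemma near_minimizer:
  assumes o0: "opt y0 c0 C0" and r: "0 < r" and tube: "\<And>t x. 0 \<le> t \<Longrightarrow> norm (x - c0 t) < r \<Longrightarrow> \<exists>c. opt x c C1"
  shows "\<exists>L d0. 0 < d0 \<and> 0 \<le> L \<and> (\<forall>y u d. feasible f B y0 y u \<and> (\<forall>t\<ge>0. norm (y t) \<le> R) \<and> 0 \<le> d \<and> d \<le> d0 \<and>
     real_cost y u \<le> real_cost c0 (\<lambda>t. Fs (c0 t)) + d \<longrightarrow>
     Wnorm (\<lambda>t. y t - c0 t) \<le> L * sqrt d \<and> l2n HL (\<lambda>t. u t - Fs (c0 t)) \<le> L * sqrt d)"
proof -
  note D = optD[OF o0]
  have C0: "0 < C0" by (rule D)
  define q where "q = sqrt (2 / \<beta>)"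
  have q: "0 < q" using beta by (simp add: q_def)
  define a where "a = 2 * C0 * K * q"
  have a: "0 < a" using C0 K0 q by (simp add: a_def)
  define m where "m = min (rad C0) (r / (2 * Ci))"
  have m: "0 < m" using rad(1)[OF C0] r Ci by (simp add: m_def)
  define d0 where "d0 = (m / a)\<^sup>2"
  have d0: "0 < d0" using m a by (simp add: d0_def)
  define L where "L = a + q + K * a"
  have L: "0 \<le> L" using a q K0 by (simp add: L_def)
  show ?thesis
  proof (rule exI[of _ L], rule exI[of _ d0], rule conjI[OF d0], rule conjI[OF L], intro allI impI)
    fix y u d
    assume "feasible f B y0 y u \<and> (\<forall>t\<ge>0. norm (y t) \<le> R) \<and> 0 \<le> d \<and> d \<le> d0 \<and> real_cost y u \<le> real_cost c0 (\<lambda>t. Fs (c0 t)) + d"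
    then have fe: "feasible f B y0 y u" and yR: "\<And>t. 0 \<le> t \<Longrightarrow> norm (y t) \<le> R" and d: "0 \<le> d" "d \<le> d0"
      and J: "real_cost y u \<le> real_cost c0 (\<lambda>t. Fs (c0 t)) + d" by auto
    define w where "w t = u t - Fs (y t)" for t
    have dy: "has_Wderiv y (\<lambda>t. G (y t) + B *v w t)" and w: "l2 HL w" and y0: "y 0 = y0"
      using iffD1[OF feasible_iff_deviation[OF yR] fe] unfolding w_def by blast+
    have ad: "a * sqrt d \<le> m"
    proof -
      have "sqrt d \<le> m / a" using real_sqrt_le_mono[OF d(2)] m a by (simp add: d0_def)
      then show ?thesis using a by (simp add: field_simps)
    qed
    have wt: "l2n HL (trunc \<tau> w) \<le> q * sqrt d" if \<tau>: "0 \<le> \<tau>" and near: "\<And>s. 0 \<le> s \<Longrightarrow> s \<le> \<tau> \<Longrightarrow> norm (y s - c0 s) < r" for \<tau>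
    proof -
      have "real_cost c0 (\<lambda>t. Fs (c0 t)) + \<beta> / 2 * (l2n HL (trunc \<tau> (\<lambda>t. u t - Fs (y t))))\<^sup>2 \<le> real_cost y u"
        by (rule energy_inequality[OF _ yR \<tau>, where C = C1 and ?C0.0 = C0]) (use fe y0 tube near o0 in auto)
      then have "\<beta> / 2 * (l2n HL (trunc \<tau> w))\<^sup>2 \<le> d" using J by (simp add: w_def[abs_def])
      then have "(l2n HL (trunc \<tau> w))\<^sup>2 \<le> (2 / \<beta>) * d" using beta by (simp add: field_simps)
      then have "l2n HL (trunc \<tau> w) \<le> sqrt ((2 / \<beta>) * d)" by (simp add: real_le_rsqrt)
      then show ?thesis unfolding q_def real_sqrt_mult .
    qed
    have Cim: "Ci * m \<le> r / 2" "Ci * m \<le> Ci * rad C0"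
    proof -
      have "Ci * m \<le> Ci * (r / (2 * Ci))" using Ci by (intro mult_left_mono) (auto simp: m_def)
      then show "Ci * m \<le> r / 2" using Ci by simp
      show "Ci * m \<le> Ci * rad C0" using Ci by (intro mult_left_mono) (auto simp: m_def)
    qed
    have close: "norm (y \<tau> - c0 \<tau>) \<le> Ci * m" if \<tau>: "0 \<le> \<tau>" and near: "\<And>s. 0 \<le> s \<Longrightarrow> s \<le> \<tau> \<Longrightarrow> norm (y s - c0 s) < r" for \<tau>
    proof -
      have lw: "l2 HL (trunc \<tau> w)" by (rule l2_trunc(1)[OF w])
      have v: "l2 HL (\<lambda>t. B *v trunc \<tau> w t)" "l2n HL (\<lambda>t. B *v trunc \<tau> w t) \<le> K * (q * sqrt d)"
        using l2_B[OF lw] mult_left_mono[OF wt[OF \<tau> near] K0(1)] by auto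
      have "2 * C0 * (l2n HL (\<lambda>t. B *v trunc \<tau> w t)) \<le> 2 * C0 * (K * (q * sqrt d))"
        by (intro mult_left_mono v) (use C0 in auto)
      also have "\<dots> = a * sqrt d" by (simp add: a_def)
      finally have "2 * C0 * (l2n HL (\<lambda>t. B *v trunc \<tau> w t)) \<le> a * sqrt d" .
      then have v2: "2 * C0 * (l2n HL (\<lambda>t. B *v trunc \<tau> w t)) \<le> m" using ad by linarith
      then have "C0 * (l2n HL (\<lambda>t. B *v trunc \<tau> w t) + norm (0::real^'a)) \<le> rad C0 / 2" by (simp add: m_def)
      from perturb_opt[OF o0 v(1) this] obtain yh where yh: "has_Wderiv yh (\<lambda>t. G (yh t) + B *v trunc \<tau> w t)" "yh 0 = y0"
        and yhn: "Wnorm (\<lambda>t. yh t - c0 t) \<le> 2 * C0 * (l2n HL (\<lambda>t. B *v trunc \<tau> w t))" and yhR: "\<And>t. 0 \<le> t \<Longrightarrow> norm (yh t) \<le> R" by auto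
      have dd: "has_Wderiv (\<lambda>t. y t - yh t) (\<lambda>t. G (y t) + B *v w t - (G (yh t) + B *v trunc \<tau> w t))"
        by (rule has_Wderiv_diff[OF dy yh(1)])
      have "norm (y \<tau> - yh \<tau>) \<le> (norm (y 0 - yh 0) + integral {0..\<tau>} (\<lambda>t. 0)) * exp (K * \<tau>)"
      proof (rule gronwall_integral_eq[OF _ has_WderivD(2)[OF dd] K0(1)])
        show "continuous_on {0..\<tau>} (\<lambda>t. y t - yh t)"
          by (rule continuous_on_subset[OF has_Wderiv_continuous[OF dd]]) auto
        fix t :: real assume t: "0 \<le> t"
        show "y t - yh t = y 0 - yh 0 + set_lebesgue_integral lborel {0..t} (\<lambda>t. G (y t) + B *v w t - (G (yh t) + B *v trunc \<tau> w t))"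
          by (rule has_WderivD(3)[OF dd t])
        assume "t < \<tau>"
        then show "norm (G (y t) + B *v w t - (G (yh t) + B *v trunc \<tau> w t)) \<le> K * norm (y t - yh t) + 0"
          using G_lip'[OF yR[OF t] yhR[OF t]] by (simp add: trunc_def)
      qed (use \<tau> in auto)
      then have "y \<tau> = yh \<tau>" using y0 yh(2) by simp
      then have "norm (y \<tau> - c0 \<tau>) \<le> Ci * Wnorm (\<lambda>t. yh t - c0 t)"
        using embed[OF inWI[OF has_Wderiv_diff[OF yh(1) D(1)]] \<tau>] by simp
      also have "\<dots> \<le> Ci * m" using yhn v2 Ci by (intro mult_left_mono) auto
      finally show ?thesis .
    qed
    have cont: "continuous_on {0..} (\<lambda>t. norm (y t - c0 t))"
      by (intro continuous_intros has_Wderiv_continuous[OF dy] D(9))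
    have near: "norm (y t1 - c0 t1) < r" if t1: "0 \<le> t1" for t1
    proof (rule ccontr)
      assume far: "\<not> norm (y t1 - c0 t1) < r"
      define S where "S = {t \<in> {0..t1}. r \<le> norm (y t - c0 t)}"
      have "S = {0..t1} \<inter> (\<lambda>t. norm (y t - c0 t)) -` {r..}" by (auto simp: S_def)
      moreover have "continuous_on {0..t1} (\<lambda>t. norm (y t - c0 t))" by (rule continuous_on_subset[OF cont]) auto
      ultimately have "closed S" by (simp add: continuous_closed_preimage)
      moreover have "bounded S" by (rule bounded_subset[of "{0..t1}"]) (auto simp: S_def)
      ultimately have "compact S" by (simp add: compact_eq_bounded_closed)
      moreover have "S \<noteq> {}" using far t1 by (auto simp: S_def)
      ultimately obtain ts where ts: "ts \<in> S" "\<And>t. t \<in> S \<Longrightarrow> ts \<le> t" using compact_attains_inf[of S] by auto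
      have before: "norm (y s - c0 s) < r" if "0 \<le> s" "s < ts" for s
        using ts(2)[of s] that ts(1) by (force simp: S_def)
      have "\<exists>x. 0 \<le> x \<and> x \<le> ts \<and> norm (y x - c0 x) = 3 * r / 4"
        by (rule IVT') (use ts(1) r y0 D(2) in \<open>auto simp: S_def intro: continuous_on_subset[OF cont]\<close>)
      then obtain x where x: "0 \<le> x" "x \<le> ts" "norm (y x - c0 x) = 3 * r / 4" by blast
      have "x \<noteq> ts" using x ts(1) r by (auto simp: S_def)
      then have "norm (y x - c0 x) \<le> Ci * m" using x before by (intro close) auto
      then show False using x r Cim by simp
    qed
    have lw: "l2n HL w \<le> q * sqrt d"
    proof (rule l2_limit(2)[of HL "\<lambda>k. trunc (real k) w"])
      show "l2 HL (trunc (real k) w)" for k by (rule l2_trunc(1)[OF w])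
      show "l2n HL (trunc (real k) w) \<le> q * sqrt d" for k by (rule wt) (use near in auto)
      fix t :: real
      obtain N where "t < real N" using reals_Archimedean2 by blast
      then have "eventually (\<lambda>k. trunc (real k) w t = w t) sequentially"
        by (intro eventually_sequentiallyI[of N]) (auto simp: trunc_def)
      then show "(\<lambda>k. trunc (real k) w t) \<longlonglongrightarrow> w t" by (rule tendsto_eventually)
    qed
    have n2: "norm (y t - c0 t) \<le> Ci * rad C0" if "0 \<le> t" for t
      using close[OF that near] Cim by linarith
    have dyk: "has_Wderiv y (\<lambda>t. G (y t) + (\<lambda>x. 0) (y t) + B *v w t)" using dy by simp
    have dck: "has_Wderiv c0 (\<lambda>t. G (c0 t) + (\<lambda>x. 0) (c0 t) + 0)" using D(1) by simp
    have "Wnorm (\<lambda>t. y t - c0 t) \<le> 2 * C0 * (l2n HL (\<lambda>t. B *v w t - 0) + norm (y 0 - c0 0))"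
      by (rule stability[OF D(9,4,6) dyk dck l2_B(1)[OF w] l2_zero yR D(4) n2, where \<epsilon> = 0])
         (use Ci rad[OF C0] in auto)
    also have "\<dots> \<le> 2 * C0 * (K * (q * sqrt d))"
      using l2_B(2)[OF w] mult_left_mono[OF lw K0(1)] C0 y0 D(2) by (intro mult_left_mono) auto
    finally have W: "Wnorm (\<lambda>t. y t - c0 t) \<le> a * sqrt d" by (simp add: a_def mult_ac)
    also have "\<dots> \<le> L * sqrt d" using d q K0 a by (intro mult_right_mono) (auto simp: L_def)
    finally have W1: "Wnorm (\<lambda>t. y t - c0 t) \<le> L * sqrt d" .
    have ly: "l2 HL (\<lambda>t. y t - c0 t)" by (rule l2_diff(1)[OF has_WderivD(1)[OF dy] D(10)])
    have lF: "l2 HL (\<lambda>t. Fs (y t) - Fs (c0 t))" by (rule l2_diff(1)[OF Fs_l2(1)[OF dy yR] D(11)])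
    have "l2n HL (\<lambda>t. Fs (y t) - Fs (c0 t)) \<le> K * l2n HL (\<lambda>t. y t - c0 t)"
      by (rule l2_bound(2)[OF ly l2D(1)[OF lF]]) (use Fs_lip yR D(4) K0 in auto)
    also have "\<dots> \<le> K * (a * sqrt d)" using W l2n_le_Wnorm[of "\<lambda>t. y t - c0 t"] K0 by (intro mult_left_mono) auto
    finally have "l2n HL (\<lambda>t. w t + (Fs (y t) - Fs (c0 t))) \<le> q * sqrt d + K * (a * sqrt d)"
      using l2_add(2)[OF w lF] lw by linarith
    moreover have "q * sqrt d + K * (a * sqrt d) \<le> L * sqrt d" using a d by (simp add: L_def algebra_simps)
    ultimately have "l2n HL (\<lambda>t. u t - Fs (c0 t)) \<le> L * sqrt d" by (simp add: w_def)
    with W1 show "Wnorm (\<lambda>t. y t - c0 t) \<le> L * sqrt d \<and> l2n HL (\<lambda>t. u t - Fs (c0 t)) \<le> L * sqrt d" by blast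
  qed
qed

end

lemma l2n_tail_tendsto_0:
  assumes "l2 HL a"
  shows "(\<lambda>k. (l2n HL (\<lambda>t. a (real k + t)))\<^sup>2) \<longlonglongrightarrow> 0"
proof -
  have "(\<lambda>k. \<integral>t. (norm (trunc (real k) a t))\<^sup>2 \<partial>HL) \<longlonglongrightarrow> (\<integral>t. (norm (a t))\<^sup>2 \<partial>HL)"
  proof (rule integral_dominated_convergence[where w = "\<lambda>t. (norm (a t))\<^sup>2"])
    show "(\<lambda>t. (norm (trunc (real k) a t))\<^sup>2) \<in> borel_measurable HL" for k
      using l2_trunc(1)[OF assms] by auto
    have "(\<lambda>k. (norm (trunc (real k) a t))\<^sup>2) \<longlonglongrightarrow> (norm (a t))\<^sup>2" for t
    proof -
      obtain N where "t < real N" using reals_Archimedean2 by blast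
      then have "eventually (\<lambda>k. (norm (trunc (real k) a t))\<^sup>2 = (norm (a t))\<^sup>2) sequentially"
        by (intro eventually_sequentiallyI[of N]) (auto simp: trunc_def)
      then show ?thesis by (rule tendsto_eventually)
    qed
    then show "AE t in HL. (\<lambda>k. (norm (trunc (real k) a t))\<^sup>2) \<longlonglongrightarrow> (norm (a t))\<^sup>2" by simp
  qed (use assms in \<open>auto simp: trunc_def\<close>)
  then have "(\<lambda>k. (l2n HL a)\<^sup>2 - (l2n HL (trunc (real k) a))\<^sup>2) \<longlonglongrightarrow> (l2n HL a)\<^sup>2 - (l2n HL a)\<^sup>2"
    unfolding l2n_sq by (intro tendsto_intros)
  moreover have "(l2n HL a)\<^sup>2 - (l2n HL (trunc (real k) a))\<^sup>2 = (l2n HL (\<lambda>t. a (real k + t)))\<^sup>2" for k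
    using l2_shift(2)[OF assms, of "real k"] by simp
  ultimately show ?thesis by simp
qed

context closed_loop_opt
begin

lemma Wderiv_tail_small:
  fixes y :: "real \<Rightarrow> real^'a"
  assumes y: "has_Wderiv y a" and e: "0 < e"
  shows "\<exists>T\<ge>0. \<forall>t\<ge>T. norm (y t) < e"
proof -
  have "(\<lambda>k. sqrt ((l2n HL (\<lambda>t. y (real k + t)))\<^sup>2 + (l2n HL (\<lambda>t. a (real k + t)))\<^sup>2)) \<longlonglongrightarrow> sqrt (0 + 0)"
    by (intro tendsto_intros l2n_tail_tendsto_0 has_WderivD[OF y])
  then have "(\<lambda>k. Ci * sqrt ((l2n HL (\<lambda>t. y (real k + t)))\<^sup>2 + (l2n HL (\<lambda>t. a (real k + t)))\<^sup>2)) \<longlonglongrightarrow> Ci * sqrt (0 + 0)"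
    by (rule tendsto_mult_left)
  then have "eventually (\<lambda>k. Ci * sqrt ((l2n HL (\<lambda>t. y (real k + t)))\<^sup>2 + (l2n HL (\<lambda>t. a (real k + t)))\<^sup>2) < e) sequentially"
    using e by (intro order_tendstoD(2)) auto
  then obtain k :: nat where k: "Ci * sqrt ((l2n HL (\<lambda>t. y (real k + t)))\<^sup>2 + (l2n HL (\<lambda>t. a (real k + t)))\<^sup>2) < e"
    by (auto simp: eventually_sequentially)
  have sh: "has_Wderiv (\<lambda>t. y (real k + t)) (\<lambda>t. a (real k + t))" by (rule has_Wderiv_shift[OF y]) simp
  have "norm (y t) < e" if "real k \<le> t" for t
    using Wderiv_bd[OF sh, of "t - real k"] that k unfolding Wnorm_eq[OF sh] by simp
  then show ?thesis by (intro exI[of _ "real k"]) auto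
qed

lemma flow_lipschitz:
  assumes o1: "opt y1 c1 C" and o2: "opt y2 c2 C" and small: "C * norm (y2 - y1) \<le> rad C / 2"
  shows "Wnorm (\<lambda>t. c2 t - c1 t) \<le> 2 * C * norm (y2 - y1)"
proof -
  have "C * (l2n HL (\<lambda>t. 0::real^'a) + norm (y2 - y1)) \<le> rad C / 2" using small by simp
  from perturb_opt[OF o1 _ this] obtain y where y: "has_Wderiv y (\<lambda>t. G (y t))" "y 0 = y2"
    and n: "Wnorm (\<lambda>t. y t - c1 t) \<le> 2 * C * norm (y2 - y1)" by auto
  have eq: "y t - c1 t = c2 t - c1 t" if "0 \<le> t" for t using optD(8)[OF o2 y that] by simp
  show ?thesis using n Wnorm_cong[OF has_Wderiv_diff[OF y(1) optD(1)[OF o1]] eq] by simp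
qed

text \<open>The points reached at time \<tau> from the open set N form an open set by invariance of domain; finitely much time suffices since
  the trajectory finally enters a ball around 0 contained in N.\<close>

lemma optimal_tube:
  assumes N: "open N" "0 \<in> N" and op: "\<And>y1. y1 \<in> N \<Longrightarrow> opt y1 (ys y1) C" and y0: "y0 \<in> N"
  shows "\<exists>r>0. \<exists>C1. \<forall>t x. 0 \<le> t \<and> norm (x - ys y0 t) < r \<longrightarrow> (\<exists>c. opt x c C1)"
proof -
  have C: "0 < C" using optD(12)[OF op[OF y0]] .
  have cont: "continuous_on N (\<lambda>y1. ys y1 \<tau>)" if \<tau>: "0 \<le> \<tau>" for \<tau>
    unfolding continuous_on_iff
  proof (intro ballI allI impI)
    fix x and e :: real assume x: "x \<in> N" and e: "0 < e"
    define d where "d = min (rad C / (2 * C)) (e / (2 * C * Ci + 1))"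
    have d: "0 < d" using rad(1)[OF C] C e Ci by (simp add: d_def add_pos_pos)
    show "\<exists>d>0. \<forall>x'\<in>N. dist x' x < d \<longrightarrow> dist (ys x' \<tau>) (ys x \<tau>) < e"
    proof (intro exI[of _ d] conjI d ballI impI)
      fix x' assume x': "x' \<in> N" "dist x' x < d"
      then have n: "norm (x' - x) < d" by (simp add: dist_norm)
      have "C * norm (x' - x) \<le> C * (rad C / (2 * C))" using n C by (intro mult_left_mono) (auto simp: d_def)
      then have W: "Wnorm (\<lambda>t. ys x' t - ys x t) \<le> 2 * C * norm (x' - x)"
        using C by (intro flow_lipschitz op x x') simp
      have "norm (ys x' \<tau> - ys x \<tau>) \<le> Ci * Wnorm (\<lambda>t. ys x' t - ys x t)"
        using Wderiv_bd[OF has_Wderiv_diff[OF optD(1)[OF op[OF x'(1)]] optD(1)[OF op[OF x]]] \<tau>] .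
      also have "\<dots> \<le> Ci * (2 * C * norm (x' - x))" using W Ci by (intro mult_left_mono) auto
      also have "\<dots> \<le> (2 * C * Ci + 1) * norm (x' - x)" by (simp add: algebra_simps)
      also have "\<dots> < (2 * C * Ci + 1) * (e / (2 * C * Ci + 1))"
        using n C Ci by (intro mult_strict_left_mono) (auto simp: d_def add_pos_pos)
      also have "\<dots> = e" using C Ci by (simp add: add_pos_pos less_imp_neq[symmetric])
      finally show "dist (ys x' \<tau>) (ys x \<tau>) < e" by (simp add: dist_norm)
    qed
  qed
  have inj: "inj_on (\<lambda>y1. ys y1 \<tau>) N" if \<tau>: "0 \<le> \<tau>" for \<tau>
  proof (rule inj_onI)
    fix a b assume ab: "a \<in> N" "b \<in> N" "ys a \<tau> = ys b \<tau>"
    note Da = optD[OF op[OF ab(1)]] and Db = optD[OF op[OF ab(2)]]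
    have "ys a 0 - ys b 0 = 0"
    proof (rule gronwall_backward_Wderiv[OF has_Wderiv_diff[OF Da(1) Db(1)] K0(1)])
      show "norm (G (ys a t) - G (ys b t)) \<le> K * norm (ys a t - ys b t)" if "0 \<le> t" for t
        using G_lip' Da(4) Db(4) that by auto
    qed (use ab \<tau> in auto)
    then show "a = b" using Da(2) Db(2) by simp
  qed
  have op_img: "open ((\<lambda>y1. ys y1 \<tau>) ` N)" if "0 \<le> \<tau>" for \<tau>
    by (rule invariance_of_domain[OF cont[OF that] N(1) inj[OF that]])
  obtain r0 where r0: "0 < r0" "ball 0 r0 \<subseteq> N" using N by (meson open_contains_ball)
  obtain T where T: "0 \<le> T" "\<And>t. T \<le> t \<Longrightarrow> norm (ys y0 t) < r0 / 2"
    using Wderiv_tail_small[OF optD(1)[OF op[OF y0]], of "r0 / 2"] r0 by auto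
  define \<Omega> where "\<Omega> = (\<Union>\<tau>\<in>{0..T}. (\<lambda>y1. ys y1 \<tau>) ` N)"
  have "open \<Omega>" unfolding \<Omega>_def using op_img by auto
  moreover have "compact (ys y0 ` {0..T})"
    by (intro compact_continuous_image continuous_on_subset[OF optD(9)[OF op[OF y0]]]) auto
  moreover have "ys y0 ` {0..T} \<subseteq> \<Omega>" using y0 by (auto simp: \<Omega>_def)
  ultimately obtain r1 where r1: "0 < r1" "(\<Union>x\<in>ys y0 ` {0..T}. ball x r1) \<subseteq> \<Omega>"
    using compact_subset_open_imp_ball_epsilon_subset by metis
  define r where "r = min r1 (r0 / 2)"
  have r: "0 < r" using r1 r0 by (simp add: r_def)
  have NO: "N \<subseteq> \<Omega>"
  proof
    fix x assume x: "x \<in> N"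
    then have "x = ys x 0" using optD(2)[OF op[OF x]] by simp
    then show "x \<in> \<Omega>" using x T(1) unfolding \<Omega>_def by force
  qed
  have in\<Omega>: "x \<in> \<Omega>" if "0 \<le> t" "norm (x - ys y0 t) < r" for t x
  proof (cases "t \<le> T")
    case True
    then have "x \<in> ball (ys y0 t) r1" "ys y0 t \<in> ys y0 ` {0..T}"
      using that by (auto simp: r_def dist_norm norm_minus_commute)
    then show ?thesis using r1(2) by blast
  next
    case False
    have "norm x \<le> norm (x - ys y0 t) + norm (ys y0 t)" by (metis diff_add_cancel norm_triangle_ineq)
    then have "x \<in> ball 0 r0" using T(2)[of t] False that by (simp add: r_def)
    then show ?thesis using r0 NO by blast
  qed
  have "\<exists>c. opt x c (C * (1 + K * sqrt T))" if xO: "x \<in> \<Omega>" for x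
  proof -
    obtain \<tau> y1 where y1: "0 \<le> \<tau>" "\<tau> \<le> T" "y1 \<in> N" "x = ys y1 \<tau>" using xO by (auto simp: \<Omega>_def)
    have "C * (1 + K * sqrt \<tau>) \<le> C * (1 + K * sqrt T)"
      using C K0 y1 by (intro mult_left_mono add_left_mono) auto
    then show ?thesis using opt_mono[OF tail_opt[OF op[OF y1(3)] y1(1)]] y1(4) by blast
  qed
  then show ?thesis using in\<Omega> r by blast
qed

lemma ensemble_approx:
  assumes op: "\<And>y1. y1 \<in> N \<Longrightarrow> opt y1 (ys y1) C" and C: "0 < C"
  shows "\<exists>\<epsilon>1>0. \<exists>L\<ge>0. \<forall>\<epsilon> F. 0 \<le> \<epsilon> \<and> \<epsilon> \<le> \<epsilon>1 \<and> F 0 = 0 \<and>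
       (\<forall>a b. norm a \<le> R \<and> norm b \<le> R \<longrightarrow> norm ((F a - Fs a) - (F b - Fs b)) \<le> \<epsilon> * norm (a - b)) \<longrightarrow>
     (\<exists>Y. (\<forall>x\<in>N. has_Wderiv (Y x) (\<lambda>t. f (Y x t) + B *v F (Y x t)) \<and> Y x 0 = x \<and> (\<forall>t\<ge>0. norm (Y x t) \<le> R) \<and>
             Wnorm (\<lambda>t. Y x t - ys x t) \<le> L * \<epsilon> \<and> l2 HL (\<lambda>t. F (Y x t)) \<and>
             real_cost (Y x) (\<lambda>t. F (Y x t)) \<le> real_cost (ys x) (\<lambda>t. Fs (ys x t)) + L * \<epsilon>) \<and>
          (\<forall>x\<in>N. \<exists>d>0. \<forall>x'\<in>N. norm (x' - x) < d \<longrightarrow> Wnorm (\<lambda>t. Y x' t - Y x t) \<le> L * norm (x' - x)))"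
proof -
  define \<rho> where "\<rho> = rad C / 4"
  have \<rho>: "0 < \<rho>" "\<rho>0 + Ci * \<rho> \<le> R" "C * (2 * K * (2 * Ci * \<rho>)) \<le> 1/4"
  proof -
    note r = rad[OF C] and p = mult_pos_pos[OF Ci rad(1)[OF C]]
    show "0 < \<rho>" using r by (simp add: \<rho>_def)
    show "\<rho>0 + Ci * \<rho> \<le> R" using r(2) p by (simp add: \<rho>_def)
    have "C * (2 * K * (2 * Ci * \<rho>)) = (C * (2 * K * (Ci * rad C) + 0)) / 2" by (simp add: \<rho>_def)
    then show "C * (2 * K * (2 * Ci * \<rho>)) \<le> 1/4" using r(3) by linarith
  qed
  define \<epsilon>1 where "\<epsilon>1 = min 1 (min (1 / (4 * C * K)) (\<rho> / (2 * C * K * (Mc + 1))))"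
  have \<epsilon>1: "0 < \<epsilon>1" using C K0 \<rho> Mc by (simp add: \<epsilon>1_def)
  define a where "a = 2 * C * K * Mc"
  have a: "0 \<le> a" using C K0 Mc by (simp add: a_def)
  define Ny where "Ny = Mc + a"
  have Ny: "0 \<le> Ny" using a Mc by (simp add: Ny_def)
  define L where "L = a + 2 * C + (K * a * (K * Ny + K * Mc) + \<beta> * (Ny + K * a) * ((1 + K) * Ny + K * Mc))"
  have L0: "0 \<le> K * a * (K * Ny + K * Mc) + \<beta> * (Ny + K * a) * ((1 + K) * Ny + K * Mc)"
    using a K0 Ny Mc beta by (intro add_nonneg_nonneg mult_nonneg_nonneg) auto
  have L: "0 \<le> L" "a \<le> L" "2 * C \<le> L" using L0 a C by (auto simp: L_def)
  show ?thesis
  proof (rule exI[of _ \<epsilon>1], rule conjI[OF \<epsilon>1], rule exI[of _ L], rule conjI[OF L(1)], intro allI impI)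
    fix \<epsilon> :: real and F :: "real^'a \<Rightarrow> real^'b"
    assume as: "0 \<le> \<epsilon> \<and> \<epsilon> \<le> \<epsilon>1 \<and> F 0 = 0 \<and>
       (\<forall>a b. norm a \<le> R \<and> norm b \<le> R \<longrightarrow> norm ((F a - Fs a) - (F b - Fs b)) \<le> \<epsilon> * norm (a - b))"
    then have \<epsilon>: "0 \<le> \<epsilon>" "\<epsilon> \<le> \<epsilon>1" and F0: "F 0 = 0" by auto
    have lip: "norm ((F a - Fs a) - (F b - Fs b)) \<le> \<epsilon> * norm (a - b)" if "norm a \<le> R" "norm b \<le> R" for a b
      using as that by blast
    define k where "k x = B *v (F x - Fs x)" for x
    have Gk: "G x + k x = f x + B *v F x" for x by (simp add: G_def k_def matrix_vector_mult_diff_distrib)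
    have k0: "k 0 = 0" by (simp add: k_def F0 Fs0)
    have klip: "norm (k a - k b) \<le> (K * \<epsilon>) * norm (a - b)" if "norm a \<le> R" "norm b \<le> R" for a b
    proof -
      have "k a - k b = B *v ((F a - Fs a) - (F b - Fs b))" by (simp add: k_def matrix_vector_mult_diff_distrib)
      then have "norm (k a - k b) \<le> K * norm ((F a - Fs a) - (F b - Fs b))" using B_bd by simp
      also have "\<dots> \<le> K * (\<epsilon> * norm (a - b))" by (intro mult_left_mono lip that K0)
      finally show ?thesis by simp
    qed
    have \<epsilon>': "0 \<le> K * \<epsilon>" using K0 \<epsilon> by simp
    have C\<epsilon>: "C * (K * \<epsilon>) \<le> 1/4"
    proof -
      have "C * K * \<epsilon> \<le> C * K * (1 / (4 * C * K))" using \<epsilon> C K0 by (intro mult_left_mono) (auto simp: \<epsilon>1_def)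
      then show ?thesis using C K0 by simp
    qed
    have C\<epsilon>2: "C * (K * \<epsilon> * Mc) \<le> \<rho> / 2"
    proof -
      have "(C * K * (Mc + 1)) * \<epsilon> \<le> (C * K * (Mc + 1)) * (\<rho> / (2 * C * K * (Mc + 1)))"
        using \<epsilon> C K0 Mc by (intro mult_left_mono) (auto simp: \<epsilon>1_def)
      also have "\<dots> = \<rho> / 2 * ((C * K * (Mc + 1)) / (C * K * (Mc + 1)))" by (simp add: mult_ac)
      also have "\<dots> = \<rho> / 2" using C K0 Mc by simp
      finally have "(C * K * (Mc + 1)) * \<epsilon> \<le> \<rho> / 2" .
      moreover have "C * (K * \<epsilon> * Mc) \<le> (C * K * (Mc + 1)) * \<epsilon>" using C K0 \<epsilon> by (simp add: algebra_simps)
      ultimately show ?thesis by linarith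
    qed
    define P where "P x y \<longleftrightarrow> has_Wderiv y (\<lambda>t. G (y t) + k (y t) + 0) \<and> y 0 = ys x 0 + 0 \<and>
       Wnorm (\<lambda>t. y t - ys x t) \<le> 2 * C * (l2n HL (\<lambda>t. 0::real^'a) + (K * \<epsilon>) * l2n HL (ys x) + norm (0::real^'a)) \<and>
       (\<forall>t\<ge>0. norm (y t) \<le> R \<and> norm (y t - ys x t) \<le> Ci * \<rho>)" for x y
    have exP: "\<exists>y. has_Wderiv y (\<lambda>t. G (y t) + k (y t) + 0) \<and> y 0 = ys x 0 + 0 \<and>
       Wnorm (\<lambda>t. y t - ys x t) \<le> 2 * C * (l2n HL (\<lambda>t. 0::real^'a) + (K * \<epsilon>) * l2n HL (ys x) + norm (0::real^'a)) \<and>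
       (\<forall>t\<ge>0. norm (y t) \<le> R \<and> norm (y t - ys x t) \<le> Ci * \<rho>)" if x: "x \<in> N" for x
    proof -
      note D = optD[OF op[OF x]]
      have 1: "C * (2 * K * (Ci * \<rho>) + K * \<epsilon>) \<le> 1/2"
      proof -
        have "C * (2 * K * (Ci * \<rho>)) \<le> C * (2 * K * (2 * Ci * \<rho>))" using C K0 Ci \<rho> by (intro mult_left_mono) auto
        then show ?thesis using \<rho>(3) C\<epsilon> by (simp only: distrib_left)
      qed
      have "C * (K * \<epsilon> * l2n HL (ys x)) \<le> C * (K * \<epsilon> * Mc)" using C \<epsilon>' D(5) by (intro mult_left_mono) auto
      then have 2: "C * (l2n HL (\<lambda>t. 0::real^'a) + (K * \<epsilon>) * l2n HL (ys x) + norm (0::real^'a)) \<le> \<rho> / 2"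
        using C\<epsilon>2 by (simp only: l2n_zero norm_zero add_0_right add_0)
      show ?thesis by (rule perturbation[OF D(1,3,6) l2_zero klip \<epsilon>' k0 \<rho>(1,2) 1 2])
    qed
    then have "\<forall>x\<in>N. \<exists>y. P x y" unfolding P_def by blast
    from bchoice[OF this] obtain Y where "\<And>x. x \<in> N \<Longrightarrow> P x (Y x)" by blast
    then have Y: "\<And>x. x \<in> N \<Longrightarrow> has_Wderiv (Y x) (\<lambda>t. G (Y x t) + k (Y x t) + 0)"
       "\<And>x. x \<in> N \<Longrightarrow> Y x 0 = ys x 0 + 0"
       "\<And>x. x \<in> N \<Longrightarrow> Wnorm (\<lambda>t. Y x t - ys x t) \<le> 2 * C * (l2n HL (\<lambda>t. 0::real^'a) + (K * \<epsilon>) * l2n HL (ys x) + norm (0::real^'a))"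
       "\<And>x t. x \<in> N \<Longrightarrow> 0 \<le> t \<Longrightarrow> norm (Y x t) \<le> R"
       "\<And>x t. x \<in> N \<Longrightarrow> 0 \<le> t \<Longrightarrow> norm (Y x t - ys x t) \<le> Ci * \<rho>" unfolding P_def by blast+
    have YW: "Wnorm (\<lambda>t. Y x t - ys x t) \<le> a * \<epsilon>" if x: "x \<in> N" for x
    proof -
      have "2 * C * ((K * \<epsilon>) * l2n HL (ys x)) \<le> 2 * C * ((K * \<epsilon>) * Mc)"
        using C \<epsilon>' optD(5)[OF op[OF x]] by (intro mult_left_mono) auto
      then show ?thesis using Y(3)[OF x] by (simp add: a_def mult_ac)
    qed
    show "\<exists>Y. (\<forall>x\<in>N. has_Wderiv (Y x) (\<lambda>t. f (Y x t) + B *v F (Y x t)) \<and> Y x 0 = x \<and> (\<forall>t\<ge>0. norm (Y x t) \<le> R) \<and>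
             Wnorm (\<lambda>t. Y x t - ys x t) \<le> L * \<epsilon> \<and> l2 HL (\<lambda>t. F (Y x t)) \<and>
             real_cost (Y x) (\<lambda>t. F (Y x t)) \<le> real_cost (ys x) (\<lambda>t. Fs (ys x t)) + L * \<epsilon>) \<and>
          (\<forall>x\<in>N. \<exists>d>0. \<forall>x'\<in>N. norm (x' - x) < d \<longrightarrow> Wnorm (\<lambda>t. Y x' t - Y x t) \<le> L * norm (x' - x))"
    proof (rule exI[of _ Y], rule conjI)
      show "\<forall>x\<in>N. has_Wderiv (Y x) (\<lambda>t. f (Y x t) + B *v F (Y x t)) \<and> Y x 0 = x \<and> (\<forall>t\<ge>0. norm (Y x t) \<le> R) \<and>
             Wnorm (\<lambda>t. Y x t - ys x t) \<le> L * \<epsilon> \<and> l2 HL (\<lambda>t. F (Y x t)) \<and>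
             real_cost (Y x) (\<lambda>t. F (Y x t)) \<le> real_cost (ys x) (\<lambda>t. Fs (ys x t)) + L * \<epsilon>"
      proof (rule ballI)
        fix x assume x: "x \<in> N"
        note D = optD[OF op[OF x]]
        have dY: "has_Wderiv (Y x) (\<lambda>t. f (Y x t) + B *v F (Y x t))" using Y(1)[OF x] by (simp add: Gk)
        have lY: "l2 HL (Y x)" by (rule has_WderivD(1)[OF dY])
        have ld: "l2 HL (\<lambda>t. Y x t - ys x t)" by (rule l2_diff(1)[OF lY D(10)])
        have nd: "l2n HL (\<lambda>t. Y x t - ys x t) \<le> a * \<epsilon>" using YW[OF x] l2n_le_Wnorm[of "\<lambda>t. Y x t - ys x t"] by linarith
        have e1: "\<epsilon> \<le> 1" using \<epsilon> by (simp add: \<epsilon>1_def)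
        have ae: "a * \<epsilon> \<le> a" using a e1 by (simp add: mult_left_le)
        have nY: "l2n HL (Y x) \<le> Ny"
          using l2_add(2)[OF ld D(10)] nd ae D(5) by (simp add: Ny_def)
        have lF1: "l2 HL (\<lambda>t. F (Y x t) - Fs (Y x t))" "l2n HL (\<lambda>t. F (Y x t) - Fs (Y x t)) \<le> \<epsilon> * l2n HL (Y x)"
          using nemytskii_l2[OF has_Wderiv_continuous[OF dY] Y(4)[OF x] lY, of "\<lambda>x. F x - Fs x" \<epsilon>] lip F0 Fs0 \<epsilon> by auto
        note lFY = Fs_l2[OF dY Y(4)[OF x]]
        have lF2: "l2 HL (\<lambda>t. Fs (Y x t) - Fs (ys x t))" by (rule l2_diff(1)[OF lFY(1) D(11)])
        have nF2: "l2n HL (\<lambda>t. Fs (Y x t) - Fs (ys x t)) \<le> K * l2n HL (\<lambda>t. Y x t - ys x t)"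
          by (rule l2_bound(2)[OF ld l2D(1)[OF lF2]]) (use Fs_lip Y(4)[OF x] D(4) K0 in auto)
        have lF: "l2 HL (\<lambda>t. F (Y x t))" using l2_add(1)[OF lF1(1) lFY(1)] by simp
        have nFd: "l2n HL (\<lambda>t. F (Y x t) - Fs (ys x t)) \<le> (Ny + K * a) * \<epsilon>"
        proof -
          have "l2n HL (\<lambda>t. F (Y x t) - Fs (ys x t)) \<le> \<epsilon> * l2n HL (Y x) + K * l2n HL (\<lambda>t. Y x t - ys x t)"
            using l2_add(2)[OF lF1(1) lF2] lF1(2) nF2 by simp
          also have "\<dots> \<le> \<epsilon> * Ny + K * (a * \<epsilon>)" by (intro add_mono mult_left_mono nY nd \<epsilon> K0)
          finally show ?thesis by (simp add: algebra_simps)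
        qed
        have nF: "l2n HL (\<lambda>t. F (Y x t)) \<le> (1 + K) * Ny"
        proof -
          have "l2n HL (\<lambda>t. F (Y x t)) \<le> \<epsilon> * l2n HL (Y x) + K * l2n HL (Y x)"
            using l2_add(2)[OF lF1(1) lFY(1)] lF1(2) lFY(2) by simp
          also have "\<dots> \<le> 1 * l2n HL (Y x) + K * l2n HL (Y x)" by (intro add_mono mult_right_mono e1) auto
          also have "\<dots> \<le> 1 * Ny + K * Ny" by (intro add_mono mult_left_mono nY K0) auto
          finally show ?thesis by (simp add: algebra_simps)
        qed
        have nFs: "l2n HL (\<lambda>t. Fs (ys x t)) \<le> K * Mc"
          using Fs_l2(2)[OF D(1,4)] mult_left_mono[OF D(5) K0(1)] by linarith
        have Q1: "(l2n HL (\<lambda>t. Q *v Y x t))\<^sup>2 - (l2n HL (\<lambda>t. Q *v ys x t))\<^sup>2 \<le> K * a * (K * Ny + K * Mc) * \<epsilon>"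
        proof -
          have "\<bar>(l2n HL (\<lambda>t. Q *v Y x t))\<^sup>2 - (l2n HL (\<lambda>t. Q *v ys x t))\<^sup>2\<bar>
             \<le> l2n HL (\<lambda>t. Q *v Y x t - Q *v ys x t) * (l2n HL (\<lambda>t. Q *v Y x t) + l2n HL (\<lambda>t. Q *v ys x t))"
            by (rule l2n_sum_sq_diff) (intro l2_Q lY D)+
          also have "\<dots> \<le> (K * (a * \<epsilon>)) * (K * Ny + K * Mc)"
          proof (rule mult_mono)
            have "l2n HL (\<lambda>t. Q *v Y x t - Q *v ys x t) \<le> K * l2n HL (\<lambda>t. Y x t - ys x t)"
              using l2_Q(2)[OF ld] by (simp add: matrix_vector_mult_diff_distrib)
            then show "l2n HL (\<lambda>t. Q *v Y x t - Q *v ys x t) \<le> K * (a * \<epsilon>)" using mult_left_mono[OF nd K0(1)] by linarith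
            show "l2n HL (\<lambda>t. Q *v Y x t) + l2n HL (\<lambda>t. Q *v ys x t) \<le> K * Ny + K * Mc"
              using l2_Q(2)[OF lY] l2_Q(2)[OF D(10)] mult_left_mono[OF nY K0(1)] mult_left_mono[OF D(5) K0(1)] by linarith
          qed (use K0 a \<epsilon> in \<open>auto simp: add_nonneg_nonneg\<close>)
          finally show ?thesis by (simp add: mult_ac)
        qed
        have F1: "(l2n HL (\<lambda>t. F (Y x t)))\<^sup>2 - (l2n HL (\<lambda>t. Fs (ys x t)))\<^sup>2 \<le> (Ny + K * a) * ((1 + K) * Ny + K * Mc) * \<epsilon>"
        proof -
          have "\<bar>(l2n HL (\<lambda>t. F (Y x t)))\<^sup>2 - (l2n HL (\<lambda>t. Fs (ys x t)))\<^sup>2\<bar>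
             \<le> l2n HL (\<lambda>t. F (Y x t) - Fs (ys x t)) * (l2n HL (\<lambda>t. F (Y x t)) + l2n HL (\<lambda>t. Fs (ys x t)))"
            by (rule l2n_sum_sq_diff[OF lF D(11)])
          also have "\<dots> \<le> ((Ny + K * a) * \<epsilon>) * ((1 + K) * Ny + K * Mc)"
            by (intro mult_mono nFd add_mono nF nFs) (use Ny K0 a \<epsilon> in \<open>auto simp: add_nonneg_nonneg\<close>)
          finally show ?thesis by (simp add: mult_ac)
        qed
        have "real_cost (Y x) (\<lambda>t. F (Y x t)) \<le> real_cost (ys x) (\<lambda>t. Fs (ys x t)) + L * \<epsilon>"
        proof -
          define p where "p = K * a * (K * Ny + K * Mc)"
          define q where "q = (Ny + K * a) * ((1 + K) * Ny + K * Mc)"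
          have p: "0 \<le> p" "0 \<le> q" using a K0 Ny Mc by (auto simp: p_def q_def)
          have "\<beta> * ((l2n HL (\<lambda>t. F (Y x t)))\<^sup>2 - (l2n HL (\<lambda>t. Fs (ys x t)))\<^sup>2) \<le> \<beta> * (q * \<epsilon>)"
            using F1 beta by (intro mult_left_mono) (auto simp: q_def)
          then have F2: "\<beta> * (l2n HL (\<lambda>t. F (Y x t)))\<^sup>2 - \<beta> * (l2n HL (\<lambda>t. Fs (ys x t)))\<^sup>2 \<le> \<beta> * (q * \<epsilon>)"
            by (simp only: right_diff_distrib)
          have aux: "(a1 + b1) / 2 \<le> (a2 + b2) / 2 + (d1 + d2) / 2" if "a1 - a2 \<le> d1" "b1 - b2 \<le> d2" for a1 a2 b1 b2 d1 d2 :: real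
            using that by (simp add: field_simps)
          have "real_cost (Y x) (\<lambda>t. F (Y x t)) \<le> real_cost (ys x) (\<lambda>t. Fs (ys x t)) + (p * \<epsilon> + \<beta> * (q * \<epsilon>)) / 2"
            unfolding real_cost_def by (rule aux[OF Q1[folded p_def] F2])
          moreover have "(p * \<epsilon> + \<beta> * (q * \<epsilon>)) / 2 \<le> p * \<epsilon> + \<beta> * (q * \<epsilon>)"
            using p \<epsilon> beta by simp
          moreover have "p * \<epsilon> + \<beta> * (q * \<epsilon>) \<le> L * \<epsilon>"
          proof -
            have "p + \<beta> * q \<le> L" using a C by (simp add: L_def p_def q_def mult.assoc)
            from mult_right_mono[OF this \<epsilon>(1)] show ?thesis by (simp add: algebra_simps)
          qed
          ultimately show ?thesis by linarith
        qed
        moreover have "Wnorm (\<lambda>t. Y x t - ys x t) \<le> L * \<epsilon>" using YW[OF x] mult_right_mono[OF L(2) \<epsilon>(1)] by linarith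
        ultimately show "has_Wderiv (Y x) (\<lambda>t. f (Y x t) + B *v F (Y x t)) \<and> Y x 0 = x \<and> (\<forall>t\<ge>0. norm (Y x t) \<le> R) \<and>
             Wnorm (\<lambda>t. Y x t - ys x t) \<le> L * \<epsilon> \<and> l2 HL (\<lambda>t. F (Y x t)) \<and>
             real_cost (Y x) (\<lambda>t. F (Y x t)) \<le> real_cost (ys x) (\<lambda>t. Fs (ys x t)) + L * \<epsilon>"
          using dY Y(2)[OF x] D(2) Y(4)[OF x] lF by auto
      qed
      show "\<forall>x\<in>N. \<exists>d>0. \<forall>x'\<in>N. norm (x' - x) < d \<longrightarrow> Wnorm (\<lambda>t. Y x' t - Y x t) \<le> L * norm (x' - x)"
      proof (rule ballI)
        fix x assume x: "x \<in> N"
        note D = optD[OF op[OF x]]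
        define d where "d = \<rho> / (2 * C)"
        have d: "0 < d" using \<rho> C by (simp add: d_def)
        show "\<exists>d>0. \<forall>x'\<in>N. norm (x' - x) < d \<longrightarrow> Wnorm (\<lambda>t. Y x' t - Y x t) \<le> L * norm (x' - x)"
        proof (rule exI[of _ d], rule conjI[OF d], intro ballI impI)
          fix x' assume x': "x' \<in> N" "norm (x' - x) < d"
          note D' = optD[OF op[OF x'(1)]]
          have "C * norm (x' - x) \<le> C * d" using x'(2) C by (intro mult_left_mono) auto
          then have Cd: "C * norm (x' - x) \<le> \<rho> / 2" using C by (simp add: d_def)
          have "Wnorm (\<lambda>t. ys x' t - ys x t) \<le> 2 * C * norm (x' - x)"
            by (rule flow_lipschitz[OF op[OF x] op[OF x'(1)]]) (use Cd \<rho>(1) in \<open>simp add: \<rho>_def\<close>)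
          then have W: "Wnorm (\<lambda>t. ys x' t - ys x t) \<le> \<rho>" using Cd by linarith
          have near: "norm (Y x' t - ys x t) \<le> 2 * Ci * \<rho>" if t: "0 \<le> t" for t
          proof -
            have "norm (ys x' t - ys x t) \<le> Ci * \<rho>"
              using Wderiv_bd[OF has_Wderiv_diff[OF D'(1) D(1)] t] mult_left_mono[OF W less_imp_le[OF Ci]] by linarith
            moreover have "norm (Y x' t - ys x t) \<le> norm (Y x' t - ys x' t) + norm (ys x' t - ys x t)"
              by (metis diff_add_cancel diff_add_eq add_diff_eq norm_triangle_ineq)
            ultimately show ?thesis using Y(5)[OF x'(1) t] by linarith
          qed
          have near2: "norm (Y x t - ys x t) \<le> 2 * Ci * \<rho>" if t: "0 \<le> t" for t
            using Y(5)[OF x t] Ci \<rho>(1) mult_pos_pos[OF Ci \<rho>(1)] by linarith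
          have "C * (2 * K * (2 * Ci * \<rho>) + K * \<epsilon>) \<le> 1/2" using \<rho>(3) C\<epsilon> by (simp only: distrib_left)
          then have "Wnorm (\<lambda>t. Y x' t - Y x t) \<le> 2 * C * (l2n HL (\<lambda>t. (0::real^'a) - 0) + norm (Y x' 0 - Y x 0))"
            by (intro stability[OF D(9,4,6) Y(1)[OF x'(1)] Y(1)[OF x] l2_zero l2_zero Y(4)[OF x'(1)] Y(4)[OF x] near near2 klip \<epsilon>'])
          also have "\<dots> = 2 * C * norm (x' - x)" using Y(2)[OF x] Y(2)[OF x'(1)] D(2) D'(2) by simp
          also have "\<dots> \<le> L * norm (x' - x)" using L(3) by (intro mult_right_mono) auto
          finally show "Wnorm (\<lambda>t. Y x' t - Y x t) \<le> L * norm (x' - x)" .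
        qed
      qed
    qed
  qed
qed

end

section \<open>Bochner spaces\<close>

lemma complete_AE_measurable:
  fixes g h :: "'a \<Rightarrow> 'b::topological_space"
  assumes "complete_measure M" "h \<in> borel_measurable M" "AE x in M. g x = h x"
  shows "g \<in> borel_measurable M"
proof (rule measurableI)
  fix A :: "'b set" assume "A \<in> sets borel"
  then have 1: "h -` A \<inter> space M \<in> sets M" using assms(2) by (rule measurable_sets[rotated])
  have "AE x in M. x \<in> h -` A \<inter> space M \<longleftrightarrow> x \<in> g -` A \<inter> space M"
    using assms(3) by eventually_elim auto
  then show "g -` A \<inter> space M \<in> sets M"
    by (rule complete_measure.in_sets_AE[OF assms(1) _ 1]) auto
qed auto

lemma strongly_measE:
  assumes "strongly_meas \<mu> V nrm Y"
  obtains s where "\<And>k. simple_function \<mu> (s k)" "\<And>k x. x \<in> space \<mu> \<Longrightarrow> V (s k x)"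
    "AE x in \<mu>. (\<lambda>k. nrm (\<lambda>t. s k x t - Y x t)) \<longlonglongrightarrow> 0"
  using assms unfolding strongly_meas_def simple_function_def by blast

lemma strongly_measI:
  assumes "\<And>k::nat. simple_function \<mu> (s k)" "\<And>k x. x \<in> space \<mu> \<Longrightarrow> V (s k x)"
    "AE x in \<mu>. (\<lambda>k. nrm (\<lambda>t. s k x t - Y x t)) \<longlonglongrightarrow> 0"
  shows "strongly_meas \<mu> V nrm Y"
  unfolding strongly_meas_def
  using assms unfolding simple_function_def by (intro exI[of _ s]) auto

lemma strongly_meas_functional:
  fixes T :: "(real \<Rightarrow> 'c::euclidean_space) \<Rightarrow> (real \<Rightarrow> 'd::euclidean_space) \<Rightarrow> real"
  assumes cm: "complete_measure \<mu>" and Y: "strongly_meas \<mu> V1 n1 Y" and Z: "strongly_meas \<mu> V2 n2 Z"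
    and VY: "AE x in \<mu>. V1 (Y x)" and VZ: "AE x in \<mu>. V2 (Z x)"
    and T: "\<And>y z s s'. V1 y \<Longrightarrow> V2 z \<Longrightarrow> (\<And>k::nat. V1 (s k)) \<Longrightarrow> (\<And>k. V2 (s' k)) \<Longrightarrow>
       (\<lambda>k. n1 (\<lambda>t. s k t - y t)) \<longlonglongrightarrow> 0 \<Longrightarrow> (\<lambda>k. n2 (\<lambda>t. s' k t - z t)) \<longlonglongrightarrow> 0 \<Longrightarrow> (\<lambda>k. T (s k) (s' k)) \<longlonglongrightarrow> T y z"
  shows "(\<lambda>x. T (Y x) (Z x)) \<in> borel_measurable \<mu>"
proof -
  obtain s where s: "\<And>k::nat. simple_function \<mu> (s k)" "\<And>k x. x \<in> space \<mu> \<Longrightarrow> V1 (s k x)"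
    "AE x in \<mu>. (\<lambda>k. n1 (\<lambda>t. s k x t - Y x t)) \<longlonglongrightarrow> 0" using strongly_measE[OF Y] by blast
  obtain s' where s': "\<And>k::nat. simple_function \<mu> (s' k)" "\<And>k x. x \<in> space \<mu> \<Longrightarrow> V2 (s' k x)"
    "AE x in \<mu>. (\<lambda>k. n2 (\<lambda>t. s' k x t - Z x t)) \<longlonglongrightarrow> 0" using strongly_measE[OF Z] by blast
  have sf: "simple_function \<mu> (\<lambda>x. T (s k x) (s' k x))" for k
    by (rule simple_function_compose2[OF s(1) s'(1)])
  have [measurable]: "(\<lambda>x. T (s k x) (s' k x)) \<in> borel_measurable \<mu>" for k
    by (rule borel_measurable_simple_function[OF sf])
  have "(\<lambda>x. lim (\<lambda>k. T (s k x) (s' k x))) \<in> borel_measurable \<mu>" by measurable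
  moreover have "AE x in \<mu>. T (Y x) (Z x) = lim (\<lambda>k. T (s k x) (s' k x))"
    using s(3) s'(3) VY VZ AE_space
  proof eventually_elim
    case (elim x)
    have "(\<lambda>k. T (s k x) (s' k x)) \<longlonglongrightarrow> T (Y x) (Z x)" by (rule T) (use elim s(2) s'(2) in auto)
    then show ?case by (simp add: limI)
  qed
  ultimately show ?thesis by (rule complete_AE_measurable[OF cm])
qed

fun pick :: "('a::metric_space \<Rightarrow> real) \<Rightarrow> 'a list \<Rightarrow> 'a \<Rightarrow> 'a \<Rightarrow> 'a" where
  "pick d [] x0 x = x0"
| "pick d (c # cs) x0 x = (if dist c x < d c then c else pick d cs x0 x)"

lemma pick_in: "pick d cs x0 x \<in> insert x0 (set cs)"
  by (induction cs) auto

lemma pick_dist: "\<exists>c\<in>set cs. dist c x < d c \<Longrightarrow> dist (pick d cs x0 x) x < d (pick d cs x0 x)"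
  by (induction cs) auto

lemma strongly_meas_continuous:
  fixes Y :: "real^'n \<Rightarrow> real \<Rightarrow> 'c::euclidean_space"
  assumes sp: "space \<mu> = Y0" "compact Y0" "Y0 \<noteq> {}" and borel: "\<forall>A\<in>sets borel. A \<inter> Y0 \<in> sets \<mu>"
    and V: "\<And>x. x \<in> Y0 \<Longrightarrow> V (Y x)" and pos: "\<And>y. 0 \<le> nrm y"
    and cont: "\<And>x e. x \<in> Y0 \<Longrightarrow> 0 < e \<Longrightarrow> \<exists>d>0. \<forall>x'\<in>Y0. dist x x' < d \<longrightarrow> nrm (\<lambda>t. Y x t - Y x' t) < e"
  shows "strongly_meas \<mu> V nrm Y"
proof -
  have "\<exists>s. simple_function \<mu> s \<and> (\<forall>x\<in>Y0. V (s x)) \<and> (\<forall>x\<in>Y0. nrm (\<lambda>t. s x t - Y x t) < e)" if e: "0 < e" for e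
  proof -
    obtain d where d: "\<And>x. x \<in> Y0 \<Longrightarrow> 0 < d x"
      "\<And>x x'. x \<in> Y0 \<Longrightarrow> x' \<in> Y0 \<Longrightarrow> dist x x' < d x \<Longrightarrow> nrm (\<lambda>t. Y x t - Y x' t) < e"
      using cont[OF _ e] by metis
    have "Y0 \<subseteq> (\<Union>x\<in>Y0. ball x (d x))" using d(1) by force
    then obtain S where S: "S \<subseteq> Y0" "finite S" "Y0 \<subseteq> (\<Union>x\<in>S. ball x (d x))"
      using compactE_image[OF sp(2), of Y0 "\<lambda>x. ball x (d x)"] by auto
    obtain cs where cs: "set cs = S" using finite_list[OF S(2)] by blast
    obtain x0 where x0: "x0 \<in> Y0" using sp(3) by blast
    have "simple_function \<mu> (pick d cs' x0)" for cs'
    proof (induction cs')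
      case Nil
      have "pick d [] x0 = (\<lambda>x. x0)" by auto
      then show ?case by simp
    next
      case (Cons c cs')
      have "{x \<in> space \<mu>. dist c x < d c} = ball c (d c) \<inter> Y0" by (auto simp: sp)
      also have "\<dots> \<in> sets \<mu>" using borel by simp
      finally have "simple_function \<mu> (\<lambda>x. if dist c x < d c then c else pick d cs' x0 x)"
        by (intro simple_function_If Cons simple_function_const)
      moreover have "pick d (c # cs') x0 = (\<lambda>x. if dist c x < d c then c else pick d cs' x0 x)" by auto
      ultimately show ?case by simp
    qed
    then have "simple_function \<mu> (\<lambda>x. Y (pick d cs x0 x))" using simple_function_compose[of \<mu> "pick d cs x0" Y] by (simp add: comp_def)
    moreover have pY: "pick d cs x0 x \<in> Y0" for x using pick_in[of d cs x0 x] S(1) cs x0 by auto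
    moreover have "nrm (\<lambda>t. Y (pick d cs x0 x) t - Y x t) < e" if x: "x \<in> Y0" for x
    proof (rule d(2)[OF pY x])
      show "dist (pick d cs x0 x) x < d (pick d cs x0 x)"
        by (rule pick_dist) (use S(3) x cs in \<open>force simp: subset_iff\<close>)
    qed
    ultimately show ?thesis using V by (intro exI[of _ "\<lambda>x. Y (pick d cs x0 x)"]) auto
  qed
  then have "\<forall>k. \<exists>s. simple_function \<mu> s \<and> (\<forall>x\<in>Y0. V (s x)) \<and> (\<forall>x\<in>Y0. nrm (\<lambda>t. s x t - Y x t) < inverse (real (Suc k)))"
    by simp
  then obtain s where s: "\<And>k. simple_function \<mu> (s k)" "\<And>k x. x \<in> Y0 \<Longrightarrow> V (s k x)"
    "\<And>k x. x \<in> Y0 \<Longrightarrow> nrm (\<lambda>t. s k x t - Y x t) < inverse (real (Suc k))" by metis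
  show ?thesis
  proof (rule strongly_measI[OF s(1)])
    show "V (s k x)" if "x \<in> space \<mu>" for k x using s(2) that sp by simp
    show "AE x in \<mu>. (\<lambda>k. nrm (\<lambda>t. s k x t - Y x t)) \<longlonglongrightarrow> 0"
    proof (rule AE_I2)
      fix x assume "x \<in> space \<mu>"
      then have x: "x \<in> Y0" using sp by simp
      show "(\<lambda>k. nrm (\<lambda>t. s k x t - Y x t)) \<longlonglongrightarrow> 0"
        by (rule tendsto_sandwich[OF _ _ tendsto_const LIMSEQ_inverse_real_of_nat])
          (use pos s(3)[OF x] in \<open>auto intro!: always_eventually less_imp_le\<close>)
    qed
  qed
qed

locale ip_fun_space =
  fixes V :: "(real \<Rightarrow> 'c::euclidean_space) \<Rightarrow> bool" and nrm :: "(real \<Rightarrow> 'c) \<Rightarrow> real"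
    and ip :: "(real \<Rightarrow> 'c) \<Rightarrow> (real \<Rightarrow> 'c) \<Rightarrow> real"
  assumes V_diff: "\<And>a b. V a \<Longrightarrow> V b \<Longrightarrow> V (\<lambda>t. a t - b t)"
    and nrm_nonneg: "\<And>a. 0 \<le> nrm a"
    and nrm_diff_le: "\<And>a b. V a \<Longrightarrow> V b \<Longrightarrow> nrm (\<lambda>t. a t - b t) \<le> nrm a + nrm b"
    and nrm_commute: "\<And>a b. V a \<Longrightarrow> V b \<Longrightarrow> nrm (\<lambda>t. a t - b t) = nrm (\<lambda>t. b t - a t)"
    and ip_diff: "\<And>a b c. V a \<Longrightarrow> V b \<Longrightarrow> V c \<Longrightarrow> ip (\<lambda>t. a t - b t) c = ip a c - ip b c"
    and ip_sym: "\<And>a b. V a \<Longrightarrow> V b \<Longrightarrow> ip a b = ip b a"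
    and ip_self: "\<And>a. V a \<Longrightarrow> ip a a = (nrm a)\<^sup>2"
    and ip_le: "\<And>a b. V a \<Longrightarrow> V b \<Longrightarrow> \<bar>ip a b\<bar> \<le> nrm a * nrm b"
begin

lemma nrm_tri:
  assumes "V a" "V b" "V c"
  shows "nrm (\<lambda>t. a t - c t) \<le> nrm (\<lambda>t. a t - b t) + nrm (\<lambda>t. b t - c t)"
proof -
  have "nrm (\<lambda>t. (a t - b t) - (c t - b t)) \<le> nrm (\<lambda>t. a t - b t) + nrm (\<lambda>t. c t - b t)"
    by (intro nrm_diff_le V_diff assms)
  then show ?thesis using nrm_commute[of c b] assms by simp
qed

lemma nrm_rev:
  assumes "V a" "V b"
  shows "\<bar>nrm a - nrm b\<bar> \<le> nrm (\<lambda>t. a t - b t)"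
proof -
  have "nrm (\<lambda>t. a t - (a t - b t)) \<le> nrm a + nrm (\<lambda>t. a t - b t)" by (intro nrm_diff_le V_diff assms)
  moreover have "nrm (\<lambda>t. (a t - b t) - (0 - b t)) = nrm a" by simp
  moreover have "nrm (\<lambda>t. b t - (b t - a t)) \<le> nrm b + nrm (\<lambda>t. b t - a t)" by (intro nrm_diff_le V_diff assms)
  ultimately show ?thesis using nrm_commute[OF assms] by simp
qed

lemma ip_tendsto:
  assumes V: "V y" "V z" "\<And>k::nat. V (s k)" "\<And>k. V (s' k)"
    and s: "(\<lambda>k. nrm (\<lambda>t. s k t - y t)) \<longlonglongrightarrow> 0" "(\<lambda>k. nrm (\<lambda>t. s' k t - z t)) \<longlonglongrightarrow> 0"
  shows "(\<lambda>k. ip (s k) (s' k)) \<longlonglongrightarrow> ip y z"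
proof (rule LIM_zero_cancel, rule Lim_null_comparison)
  show "\<forall>\<^sub>F k in sequentially. norm (ip (s k) (s' k) - ip y z) \<le>
     nrm (\<lambda>t. s k t - y t) * (nrm (\<lambda>t. s' k t - z t) + nrm z) + nrm y * nrm (\<lambda>t. s' k t - z t)"
  proof (rule always_eventually, rule allI)
    fix k
    have "ip (s k) (s' k) - ip y z = ip (\<lambda>t. s k t - y t) (s' k) + ip (\<lambda>t. s' k t - z t) y"
      using V by (simp add: ip_diff ip_sym[of "s' k" y] ip_sym[of z y])
    moreover have "\<bar>ip (\<lambda>t. s k t - y t) (s' k)\<bar> \<le> nrm (\<lambda>t. s k t - y t) * nrm (s' k)"
      by (intro ip_le V_diff V)
    moreover have "nrm (\<lambda>t. s k t - y t) * nrm (s' k) \<le> nrm (\<lambda>t. s k t - y t) * (nrm (\<lambda>t. s' k t - z t) + nrm z)"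
      using nrm_rev[OF V(4) V(2), of k] by (intro mult_left_mono nrm_nonneg) linarith
    moreover have "\<bar>ip (\<lambda>t. s' k t - z t) y\<bar> \<le> nrm (\<lambda>t. s' k t - z t) * nrm y" by (intro ip_le V_diff V)
    ultimately show "norm (ip (s k) (s' k) - ip y z) \<le>
      nrm (\<lambda>t. s k t - y t) * (nrm (\<lambda>t. s' k t - z t) + nrm z) + nrm y * nrm (\<lambda>t. s' k t - z t)"
      by (simp add: mult.commute[of "nrm y"])
  qed
  have "(\<lambda>k. nrm (\<lambda>t. s k t - y t) * (nrm (\<lambda>t. s' k t - z t) + nrm z) + nrm y * nrm (\<lambda>t. s' k t - z t))
    \<longlonglongrightarrow> 0 * (0 + nrm z) + nrm y * 0" by (intro tendsto_intros s)
  then show "(\<lambda>k. nrm (\<lambda>t. s k t - y t) * (nrm (\<lambda>t. s' k t - z t) + nrm z) + nrm y * nrm (\<lambda>t. s' k t - z t)) \<longlonglongrightarrow> 0" by simp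
qed

lemma nrm_diff_tendsto:
  assumes V: "V y" "V z" "\<And>k::nat. V (s k)" "\<And>k. V (s' k)"
    and s: "(\<lambda>k. nrm (\<lambda>t. s k t - y t)) \<longlonglongrightarrow> 0" "(\<lambda>k. nrm (\<lambda>t. s' k t - z t)) \<longlonglongrightarrow> 0"
  shows "(\<lambda>k. nrm (\<lambda>t. s k t - s' k t)) \<longlonglongrightarrow> nrm (\<lambda>t. y t - z t)"
proof (rule LIM_zero_cancel, rule Lim_null_comparison)
  show "\<forall>\<^sub>F k in sequentially. norm (nrm (\<lambda>t. s k t - s' k t) - nrm (\<lambda>t. y t - z t)) \<le>
     nrm (\<lambda>t. s k t - y t) + nrm (\<lambda>t. s' k t - z t)"
  proof (rule always_eventually, rule allI)
    fix k
    have "\<bar>nrm (\<lambda>t. s k t - s' k t) - nrm (\<lambda>t. y t - z t)\<bar> \<le> nrm (\<lambda>t. (s k t - s' k t) - (y t - z t))"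
      by (intro nrm_rev V_diff V)
    also have "(\<lambda>t. (s k t - s' k t) - (y t - z t)) = (\<lambda>t. (s k t - y t) - (s' k t - z t))" by auto
    also have "nrm \<dots> \<le> nrm (\<lambda>t. s k t - y t) + nrm (\<lambda>t. s' k t - z t)" by (intro nrm_diff_le V_diff V)
    finally show "norm (nrm (\<lambda>t. s k t - s' k t) - nrm (\<lambda>t. y t - z t)) \<le>
     nrm (\<lambda>t. s k t - y t) + nrm (\<lambda>t. s' k t - z t)" by simp
  qed
  have "(\<lambda>k. nrm (\<lambda>t. s k t - y t) + nrm (\<lambda>t. s' k t - z t)) \<longlonglongrightarrow> 0 + 0" by (intro tendsto_intros s)
  then show "(\<lambda>k. nrm (\<lambda>t. s k t - y t) + nrm (\<lambda>t. s' k t - z t)) \<longlonglongrightarrow> 0" by simp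
qed

lemma strongly_meas_diff:
  assumes Y: "strongly_meas \<mu> V nrm Y" and Z: "strongly_meas \<mu> V nrm Z"
    and VY: "AE x in \<mu>. V (Y x)" and VZ: "AE x in \<mu>. V (Z x)"
  shows "strongly_meas \<mu> V nrm (\<lambda>x t. Y x t - Z x t)"
proof -
  obtain s where s: "\<And>k::nat. simple_function \<mu> (s k)" "\<And>k x. x \<in> space \<mu> \<Longrightarrow> V (s k x)"
    "AE x in \<mu>. (\<lambda>k. nrm (\<lambda>t. s k x t - Y x t)) \<longlonglongrightarrow> 0" using strongly_measE[OF Y] by blast
  obtain s' where s': "\<And>k::nat. simple_function \<mu> (s' k)" "\<And>k x. x \<in> space \<mu> \<Longrightarrow> V (s' k x)"
    "AE x in \<mu>. (\<lambda>k. nrm (\<lambda>t. s' k x t - Z x t)) \<longlonglongrightarrow> 0" using strongly_measE[OF Z] by blast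
  show ?thesis
  proof (rule strongly_measI[of _ "\<lambda>k x t. s k x t - s' k x t"])
    show "simple_function \<mu> (\<lambda>x t. s k x t - s' k x t)" for k
      by (rule simple_function_compose2[OF s(1) s'(1), of "\<lambda>a b t. a t - b t"])
    show "V (\<lambda>t. s k x t - s' k x t)" if "x \<in> space \<mu>" for k x using s(2) s'(2) that by (intro V_diff) auto
    show "AE x in \<mu>. (\<lambda>k. nrm (\<lambda>t. s k x t - s' k x t - (Y x t - Z x t))) \<longlonglongrightarrow> 0"
      using s(3) s'(3) VY VZ AE_space
    proof eventually_elim
      case (elim x)
      have le: "nrm (\<lambda>t. s k x t - s' k x t - (Y x t - Z x t)) \<le> nrm (\<lambda>t. s k x t - Y x t) + nrm (\<lambda>t. s' k x t - Z x t)" for k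
      proof -
        have "(\<lambda>t. s k x t - s' k x t - (Y x t - Z x t)) = (\<lambda>t. (s k x t - Y x t) - (s' k x t - Z x t))" by auto
        then show ?thesis using nrm_diff_le[OF V_diff V_diff, of "s k x" "Y x" "s' k x" "Z x"] s(2) s'(2) elim by simp
      qed
      have "(\<lambda>k. nrm (\<lambda>t. s k x t - Y x t) + nrm (\<lambda>t. s' k x t - Z x t)) \<longlonglongrightarrow> 0 + 0" by (intro tendsto_intros elim)
      then have l0: "(\<lambda>k. nrm (\<lambda>t. s k x t - Y x t) + nrm (\<lambda>t. s' k x t - Z x t)) \<longlonglongrightarrow> 0" by simp
      show ?case by (rule tendsto_sandwich[OF _ _ tendsto_const l0]) (use nrm_nonneg le in auto)
    qed
  qed
qed

lemma bochner_L2_bounded: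
  assumes cm: "complete_measure \<mu>" and ps: "prob_space \<mu>" and X: "strongly_meas \<mu> V nrm X"
    and V: "AE x in \<mu>. V (X x)" and bd: "AE x in \<mu>. nrm (X x) \<le> c"
  shows "bochner_L2 \<mu> V nrm X"
proof -
  interpret prob_space \<mu> by fact
  have [measurable]: "(\<lambda>x. nrm (X x)) \<in> borel_measurable \<mu>"
  proof (rule strongly_meas_functional[OF cm X X V V, of "\<lambda>y z. nrm y"])
    fix y z s s'
    assume V: "V y" "V z" "\<And>k::nat. V (s k)" "\<And>k::nat. V (s' k)" and l: "(\<lambda>k. nrm (\<lambda>t. s k t - y t)) \<longlonglongrightarrow> 0"
    show "(\<lambda>k. nrm (s k)) \<longlonglongrightarrow> nrm y"
      by (rule LIM_zero_cancel, rule Lim_null_comparison[OF _ l]) (use nrm_rev[OF V(3,1)] in simp)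
  qed
  have "AE x in \<mu>. norm ((nrm (X x))\<^sup>2) \<le> c\<^sup>2" using bd by eventually_elim (simp add: power_mono nrm_nonneg)
  then have "integrable \<mu> (\<lambda>x. (nrm (X x))\<^sup>2)" by (rule integrable_const_bound) simp
  then show ?thesis using X V by (simp add: bochner_L2_def)
qed

lemma strongly_meas_lipschitz:
  fixes Y :: "real^'n \<Rightarrow> real \<Rightarrow> 'c"
  assumes sp: "space \<mu> = Y0" "compact Y0" "Y0 \<noteq> {}" and borel: "\<forall>A\<in>sets borel. A \<inter> Y0 \<in> sets \<mu>"
    and V: "\<And>x. x \<in> Y0 \<Longrightarrow> V (Y x)"
    and lip: "\<And>x. x \<in> Y0 \<Longrightarrow> \<exists>d>0. \<exists>L\<ge>0. \<forall>x'\<in>Y0. norm (x' - x) < d \<longrightarrow> nrm (\<lambda>t. Y x' t - Y x t) \<le> L * norm (x' - x)"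
  shows "strongly_meas \<mu> V nrm Y"
proof (rule strongly_meas_continuous[where V = V and nrm = nrm, OF sp borel V nrm_nonneg])
  fix x :: "real^'n" and e :: real assume x: "x \<in> Y0" and e: "0 < e"
  obtain d L where d: "0 < d" "0 \<le> L" "\<And>x'. x' \<in> Y0 \<Longrightarrow> norm (x' - x) < d \<Longrightarrow> nrm (\<lambda>t. Y x' t - Y x t) \<le> L * norm (x' - x)"
    using lip[OF x] by blast
  show "\<exists>d>0. \<forall>x'\<in>Y0. dist x x' < d \<longrightarrow> nrm (\<lambda>t. Y x t - Y x' t) < e"
  proof (rule exI[of _ "min d (e / (L + 1))"], rule conjI, use d e in simp, intro ballI impI)
    fix x' assume x': "x' \<in> Y0" "dist x x' < min d (e / (L + 1))"
    then have n: "norm (x' - x) < d" "norm (x' - x) < e / (L + 1)" by (auto simp: dist_norm norm_minus_commute)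
    have "L * norm (x' - x) \<le> (L + 1) * norm (x' - x)" by (simp add: distrib_right)
    also have "\<dots> < e" using n(2) d(2) by (simp add: field_simps)
    finally show "nrm (\<lambda>t. Y x t - Y x' t) < e"
      using d(3)[OF x'(1) n(1)] nrm_commute[OF V[OF x] V[OF x'(1)]] by linarith
  qed
qed

lemma nrm_l2:
  assumes "bochner_L2 \<mu> V nrm X"
  shows "l2 \<mu> (\<lambda>x. nrm (X x))" "l2n \<mu> (\<lambda>x. nrm (X x)) = bochner_norm \<mu> nrm X"
proof -
  have i: "integrable \<mu> (\<lambda>x. (nrm (X x))\<^sup>2)" using assms by (simp add: bochner_L2_def)
  have "(\<lambda>x. sqrt ((nrm (X x))\<^sup>2)) \<in> borel_measurable \<mu>" using borel_measurable_integrable[OF i] by measurable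
  then have "(\<lambda>x. nrm (X x)) \<in> borel_measurable \<mu>" by (simp add: nrm_nonneg)
  then show "l2 \<mu> (\<lambda>x. nrm (X x))" using i by (simp add: l2_def)
  show "l2n \<mu> (\<lambda>x. nrm (X x)) = bochner_norm \<mu> nrm X" by (simp add: l2n_def bochner_norm_def)
qed

lemma integrable_ip:
  assumes m: "(\<lambda>x. ip (X x) (Z x)) \<in> borel_measurable \<mu>" and V: "AE x in \<mu>. V (X x)" "AE x in \<mu>. V (Z x)"
    and l: "l2 \<mu> (\<lambda>x. nrm (X x))" "l2 \<mu> (\<lambda>x. nrm (Z x))"
  shows "integrable \<mu> (\<lambda>x. ip (X x) (Z x))" "\<bar>\<integral>x. ip (X x) (Z x) \<partial>\<mu>\<bar> \<le> l2n \<mu> (\<lambda>x. nrm (X x)) * l2n \<mu> (\<lambda>x. nrm (Z x))"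
proof -
  have ib: "integrable \<mu> (\<lambda>x. norm (nrm (X x)) * norm (nrm (Z x)))" by (rule integrable_l2_mult[OF l])
  have le: "AE x in \<mu>. norm (ip (X x) (Z x)) \<le> norm (nrm (X x)) * norm (nrm (Z x))"
    using V by eventually_elim (simp add: ip_le nrm_nonneg)
  show i: "integrable \<mu> (\<lambda>x. ip (X x) (Z x))"
    by (rule Bochner_Integration.integrable_bound[OF ib m]) (use le in \<open>eventually_elim, simp\<close>)
  have "\<bar>\<integral>x. ip (X x) (Z x) \<partial>\<mu>\<bar> \<le> (\<integral>x. norm (ip (X x) (Z x)) \<partial>\<mu>)" using integral_norm_bound[of \<mu> "\<lambda>x. ip (X x) (Z x)"] by simp
  also have "\<dots> \<le> (\<integral>x. norm (nrm (X x)) * norm (nrm (Z x)) \<partial>\<mu>)" by (rule integral_mono_AE) (use i ib le in auto)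
  also have "\<dots> \<le> l2n \<mu> (\<lambda>x. nrm (X x)) * l2n \<mu> (\<lambda>x. nrm (Z x))" by (rule l2_mult_le[OF l])
  finally show "\<bar>\<integral>x. ip (X x) (Z x) \<partial>\<mu>\<bar> \<le> l2n \<mu> (\<lambda>x. nrm (X x)) * l2n \<mu> (\<lambda>x. nrm (Z x))" .
qed

lemma measurable_ip:
  assumes "complete_measure \<mu>" "bochner_L2 \<mu> V nrm X" "bochner_L2 \<mu> V nrm Z"
  shows "(\<lambda>x. ip (X x) (Z x)) \<in> borel_measurable \<mu>" "(\<lambda>x. nrm (\<lambda>t. X x t - Z x t)) \<in> borel_measurable \<mu>"
  by (rule strongly_meas_functional[OF assms(1), of V nrm _ V nrm]; use assms ip_tendsto nrm_diff_tendsto in \<open>auto simp: bochner_L2_def\<close>)+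

lemma bochner_L2_diff:
  assumes cm: "complete_measure \<mu>" and X: "bochner_L2 \<mu> V nrm X" and Z: "bochner_L2 \<mu> V nrm Z"
  shows "bochner_L2 \<mu> V nrm (\<lambda>x t. X x t - Z x t)"
proof -
  have V: "AE x in \<mu>. V (X x)" "AE x in \<mu>. V (Z x)" using X Z by (auto simp: bochner_L2_def)
  have "strongly_meas \<mu> V nrm (\<lambda>x t. X x t - Z x t)"
    by (intro strongly_meas_diff) (use X Z in \<open>auto simp: bochner_L2_def\<close>)
  moreover have "AE x in \<mu>. V (\<lambda>t. X x t - Z x t)" using V by eventually_elim (rule V_diff)
  moreover have "integrable \<mu> (\<lambda>x. (nrm (\<lambda>t. X x t - Z x t))\<^sup>2)"
  proof (rule Bochner_Integration.integrable_bound)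
    show "integrable \<mu> (\<lambda>x. 2 * (nrm (X x))\<^sup>2 + 2 * (nrm (Z x))\<^sup>2)" using X Z by (auto simp: bochner_L2_def)
    show "(\<lambda>x. (nrm (\<lambda>t. X x t - Z x t))\<^sup>2) \<in> borel_measurable \<mu>" using measurable_ip(2)[OF assms] by measurable
    show "AE x in \<mu>. norm ((nrm (\<lambda>t. X x t - Z x t))\<^sup>2) \<le> norm (2 * (nrm (X x))\<^sup>2 + 2 * (nrm (Z x))\<^sup>2)"
      using V
    proof eventually_elim
      case (elim x)
      have "(nrm (\<lambda>t. X x t - Z x t))\<^sup>2 \<le> (nrm (X x) + nrm (Z x))\<^sup>2" by (intro power_mono nrm_diff_le elim nrm_nonneg)
      also have "\<dots> \<le> 2 * (nrm (X x))\<^sup>2 + 2 * (nrm (Z x))\<^sup>2" using zero_le_power2[of "nrm (X x) - nrm (Z x)"]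
        unfolding power2_sum power2_diff by linarith
      finally show ?case by simp
    qed
  qed
  ultimately show ?thesis by (simp add: bochner_L2_def)
qed

lemma strong_imp_weak:
  assumes cm: "complete_measure \<mu>" and Xs: "bochner_L2 \<mu> V nrm Xs" and V: "\<And>k::nat. AE x in \<mu>. V (X k x)"
    and m: "\<And>k Z. bochner_L2 \<mu> V nrm Z \<Longrightarrow> (\<lambda>x. ip (X k x) (Z x)) \<in> borel_measurable \<mu>"
    and md: "\<And>k. (\<lambda>x. nrm (\<lambda>t. X k x t - Xs x t)) \<in> borel_measurable \<mu>"
    and id: "\<And>k. integrable \<mu> (\<lambda>x. (nrm (\<lambda>t. X k x t - Xs x t))\<^sup>2)"
    and lim: "(\<lambda>k. \<integral>x. (nrm (\<lambda>t. X k x t - Xs x t))\<^sup>2 \<partial>\<mu>) \<longlonglongrightarrow> 0"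
    and Z: "bochner_L2 \<mu> V nrm Z"
  shows "(\<lambda>k. bochner_ip \<mu> ip (X k) Z) \<longlonglongrightarrow> bochner_ip \<mu> ip Xs Z"
proof -
  have VX: "AE x in \<mu>. V (Xs x)" "AE x in \<mu>. V (Z x)" using Xs Z by (auto simp: bochner_L2_def)
  have ld: "l2 \<mu> (\<lambda>x. nrm (\<lambda>t. X k x t - Xs x t))" for k using md id by (simp add: l2_def)
  have eq: "AE x in \<mu>. ip (\<lambda>t. X k x t - Xs x t) (Z x) = ip (X k x) (Z x) - ip (Xs x) (Z x)" for k
    using V[of k] VX by eventually_elim (rule ip_diff)
  have mm: "(\<lambda>x. ip (\<lambda>t. X k x t - Xs x t) (Z x)) \<in> borel_measurable \<mu>" for k
    by (rule complete_AE_measurable[OF cm _ eq]) (intro borel_measurable_diff m Z measurable_ip(1)[OF cm Xs Z])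
  have Vd: "AE x in \<mu>. V (\<lambda>t. X k x t - Xs x t)" for k using V[of k] VX(1) by eventually_elim (rule V_diff)
  note b = integrable_ip[OF mm Vd VX(2) ld nrm_l2(1)[OF Z]]
  have iXs: "integrable \<mu> (\<lambda>x. ip (Xs x) (Z x))" by (rule integrable_ip(1)[OF measurable_ip(1)[OF cm Xs Z] VX nrm_l2(1)[OF Xs] nrm_l2(1)[OF Z]])
  have d: "(\<integral>x. ip (X k x) (Z x) \<partial>\<mu>) - (\<integral>x. ip (Xs x) (Z x) \<partial>\<mu>) = (\<integral>x. ip (\<lambda>t. X k x t - Xs x t) (Z x) \<partial>\<mu>)" for k
  proof -
    have "(\<integral>x. ip (X k x) (Z x) \<partial>\<mu>) = (\<integral>x. ip (\<lambda>t. X k x t - Xs x t) (Z x) + ip (Xs x) (Z x) \<partial>\<mu>)"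
      by (rule integral_cong_AE) (use m[OF Z] mm measurable_ip(1)[OF cm Xs Z] eq[of k] in auto)
    then show ?thesis using b(1) iXs by simp
  qed
  show ?thesis unfolding bochner_ip_def
  proof (rule LIM_zero_cancel, rule Lim_null_comparison)
    show "\<forall>\<^sub>F k in sequentially. norm ((\<integral>x. ip (X k x) (Z x) \<partial>\<mu>) - (\<integral>x. ip (Xs x) (Z x) \<partial>\<mu>)) \<le>
      sqrt (\<integral>x. (nrm (\<lambda>t. X k x t - Xs x t))\<^sup>2 \<partial>\<mu>) * l2n \<mu> (\<lambda>x. nrm (Z x))"
      unfolding d using b(2) by (simp add: l2n_def)
    have "(\<lambda>k. sqrt (\<integral>x. (nrm (\<lambda>t. X k x t - Xs x t))\<^sup>2 \<partial>\<mu>) * l2n \<mu> (\<lambda>x. nrm (Z x))) \<longlonglongrightarrow> sqrt 0 * l2n \<mu> (\<lambda>x. nrm (Z x))"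
      by (intro tendsto_mult tendsto_const tendsto_real_sqrt lim)
    then show "(\<lambda>k. sqrt (\<integral>x. (nrm (\<lambda>t. X k x t - Xs x t))\<^sup>2 \<partial>\<mu>) * l2n \<mu> (\<lambda>x. nrm (Z x))) \<longlonglongrightarrow> 0" by simp
  qed
qed

lemma weak_limit_eq:
  assumes cm: "complete_measure \<mu>" and Xs: "bochner_L2 \<mu> V nrm Xs" and Xh: "bochner_L2 \<mu> V nrm Xh"
    and 1: "\<And>Z. bochner_L2 \<mu> V nrm Z \<Longrightarrow> (\<lambda>k. bochner_ip \<mu> ip (X k) Z) \<longlonglongrightarrow> bochner_ip \<mu> ip Xs Z"
    and 2: "\<And>Z. bochner_L2 \<mu> V nrm Z \<Longrightarrow> (\<lambda>k. bochner_ip \<mu> ip (X (r k)) Z) \<longlonglongrightarrow> bochner_ip \<mu> ip Xh Z"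
    and r: "strict_mono r"
  shows "AE x in \<mu>. nrm (\<lambda>t. Xh x t - Xs x t) = 0"
proof -
  define Z where "Z x t = Xh x t - Xs x t" for x t
  have Z: "bochner_L2 \<mu> V nrm Z" unfolding Z_def by (rule bochner_L2_diff[OF cm Xh Xs])
  have V: "AE x in \<mu>. V (Xs x)" "AE x in \<mu>. V (Xh x)" "AE x in \<mu>. V (Z x)" using Xs Xh Z by (auto simp: bochner_L2_def)
  have "bochner_ip \<mu> ip Xh Z = bochner_ip \<mu> ip Xs Z"
    using LIMSEQ_unique[OF 2[OF Z]] LIMSEQ_subseq_LIMSEQ[OF 1[OF Z] r] by (simp add: comp_def)
  moreover have i: "integrable \<mu> (\<lambda>x. ip (Xh x) (Z x))" "integrable \<mu> (\<lambda>x. ip (Xs x) (Z x))"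
    by (intro integrable_ip(1) measurable_ip(1)[OF cm] Xs Xh Z V nrm_l2(1))+
  ultimately have "(\<integral>x. ip (Xh x) (Z x) - ip (Xs x) (Z x) \<partial>\<mu>) = 0" by (simp add: bochner_ip_def)
  moreover have eq: "AE x in \<mu>. ip (Xh x) (Z x) - ip (Xs x) (Z x) = (nrm (Z x))\<^sup>2"
    using V
  proof eventually_elim
    case (elim x)
    have "ip (Xh x) (Z x) - ip (Xs x) (Z x) = ip (\<lambda>t. Xh x t - Xs x t) (Z x)" using elim by (simp add: ip_diff)
    also have "(\<lambda>t. Xh x t - Xs x t) = Z x" by (auto simp: Z_def)
    finally show ?case using ip_self[OF elim(3)] by simp
  qed
  moreover have iz: "integrable \<mu> (\<lambda>x. (nrm (Z x))\<^sup>2)" using Z by (simp add: bochner_L2_def)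
  moreover have "(\<integral>x. ip (Xh x) (Z x) - ip (Xs x) (Z x) \<partial>\<mu>) = (\<integral>x. (nrm (Z x))\<^sup>2 \<partial>\<mu>)"
    by (rule integral_cong_AE) (use i iz eq in auto)
  ultimately have "AE x in \<mu>. (nrm (Z x))\<^sup>2 = 0" by (simp add: integral_nonneg_eq_0_iff_AE)
  then show ?thesis by (simp add: Z_def[abs_def])
qed

lemma strong_limit_cong:
  assumes cm: "complete_measure \<mu>" and V: "AE x in \<mu>. V (X x)" "AE x in \<mu>. V (Xs x)" "AE x in \<mu>. V (Xh x)"
    and md: "(\<lambda>x. nrm (\<lambda>t. X x t - Xs x t)) \<in> borel_measurable \<mu>"
    and eq: "AE x in \<mu>. nrm (\<lambda>t. Xh x t - Xs x t) = 0"
  shows "bochner_norm \<mu> nrm (\<lambda>x t. X x t - Xh x t) = bochner_norm \<mu> nrm (\<lambda>x t. X x t - Xs x t)"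
proof -
  have e: "AE x in \<mu>. nrm (\<lambda>t. X x t - Xh x t) = nrm (\<lambda>t. X x t - Xs x t)"
    using V eq
  proof eventually_elim
    case (elim x)
    have "nrm (\<lambda>t. X x t - Xh x t) \<le> nrm (\<lambda>t. X x t - Xs x t) + nrm (\<lambda>t. Xs x t - Xh x t)"
      "nrm (\<lambda>t. X x t - Xs x t) \<le> nrm (\<lambda>t. X x t - Xh x t) + nrm (\<lambda>t. Xh x t - Xs x t)"
      by (intro nrm_tri elim)+
    then show ?case using elim nrm_commute[of "Xs x" "Xh x"] by simp
  qed
  have "(\<lambda>x. nrm (\<lambda>t. X x t - Xh x t)) \<in> borel_measurable \<mu>" by (rule complete_AE_measurable[OF cm md e])
  then show ?thesis unfolding bochner_norm_def
    by (intro arg_cong[where f = sqrt] integral_cong_AE) (use md e in auto)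
qed

end

lemma integral_HL_inner_diff:
  fixes a b c :: "real \<Rightarrow> 'c::euclidean_space"
  assumes "l2 HL a" "l2 HL b" "l2 HL c"
  shows "L2ip (\<lambda>t. a t - b t) c = L2ip a c - L2ip b c"
  using integrable_l2_inner[OF assms(1,3)] integrable_l2_inner[OF assms(2,3)]
  by (simp add: L2ip_HL inner_diff_left)

interpretation L2: ip_fun_space "sq_int :: (real \<Rightarrow> 'c::euclidean_space) \<Rightarrow> bool" L2norm L2ip
proof
  fix a b c :: "real \<Rightarrow> 'c"
  show "0 \<le> L2norm a" by (simp add: L2norm_l2n)
  { assume "sq_int a" "sq_int b"
    then have l: "l2 HL a" "l2 HL b" by (auto simp: sq_int_l2)
    show "sq_int (\<lambda>t. a t - b t)" "L2norm (\<lambda>t. a t - b t) \<le> L2norm a + L2norm b" "L2norm (\<lambda>t. a t - b t) = L2norm (\<lambda>t. b t - a t)"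
      "L2ip a b = L2ip b a" "\<bar>L2ip a b\<bar> \<le> L2norm a * L2norm b"
      using l2_diff[OF l] l2n_minus_commute[of HL a b] l2_inner_le[OF l]
      by (simp_all add: sq_int_l2 L2norm_l2n L2ip_HL inner_commute)
    assume "sq_int c"
    then show "L2ip (\<lambda>t. a t - b t) c = L2ip a c - L2ip b c" using l by (intro integral_HL_inner_diff) (auto simp: sq_int_l2) }
  show "L2ip a a = (L2norm a)\<^sup>2" by (simp add: L2norm_l2n L2ip_HL l2n_sq power2_norm_eq_inner)
qed

lemma Wip_eq:
  assumes "has_Wderiv a a'" "has_Wderiv b b'"
  shows "Wip a b = L2ip a b + L2ip a' b'"
proof -
  have d: "has_Wderiv a (Wdot a)" "has_Wderiv b (Wdot b)" using assms by (auto intro: has_Wderiv_Wdot inWI)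
  have "L2ip (Wdot a) (Wdot b) = L2ip a' b'" unfolding L2ip_HL
  proof (rule integral_cong_AE)
    show "AE t in HL. Wdot a t \<bullet> Wdot b t = a' t \<bullet> b' t"
      using has_Wderiv_unique[OF d(1) assms(1)] has_Wderiv_unique[OF d(2) assms(2)] by eventually_elim simp
  qed (use l2D(1)[OF has_WderivD(2)[OF d(1)]] l2D(1)[OF has_WderivD(2)[OF d(2)]]
     l2D(1)[OF has_WderivD(2)[OF assms(1)]] l2D(1)[OF has_WderivD(2)[OF assms(2)]] in auto)
  then show ?thesis by (simp add: Wip_def)
qed

interpretation W: ip_fun_space "inW :: (real \<Rightarrow> 'c::euclidean_space) \<Rightarrow> bool" Wnorm Wip
proof
  fix a b c :: "real \<Rightarrow> 'c"
  show "0 \<le> Wnorm a" by simp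
  { assume "inW a"
    then have d: "has_Wderiv a (Wdot a)" by (rule has_Wderiv_Wdot)
    show "Wip a a = (Wnorm a)\<^sup>2" unfolding Wip_def Wnorm_eq[OF d] by (simp add: L2ip_HL l2n_sq power2_norm_eq_inner)
    assume "inW b"
    then have e: "has_Wderiv b (Wdot b)" by (rule has_Wderiv_Wdot)
    show "inW (\<lambda>t. a t - b t)" by (rule inW_diff) fact+
    show "Wnorm (\<lambda>t. a t - b t) = Wnorm (\<lambda>t. b t - a t)" by (rule Wnorm_minus_commute) fact+
    show "Wnorm (\<lambda>t. a t - b t) \<le> Wnorm a + Wnorm b"
      using Wnorm_add_le[OF \<open>inW a\<close> inW_scaleR[OF \<open>inW b\<close>, of "-1"]] Wnorm_scaleR[OF \<open>inW b\<close>, of "-1"] by simp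
    show "Wip a b = Wip b a" by (simp add: Wip_def L2ip_HL inner_commute)
    have "\<bar>Wip a b\<bar> \<le> l2n HL a * l2n HL b + l2n HL (Wdot a) * l2n HL (Wdot b)"
      unfolding Wip_def L2ip_HL using l2_inner_le[OF has_WderivD(1)[OF d] has_WderivD(1)[OF e]] l2_inner_le[OF has_WderivD(2)[OF d] has_WderivD(2)[OF e]]
      by linarith
    also have "\<dots> \<le> Wnorm a * Wnorm b"
    proof -
      define p q p' q' where "p = l2n HL a" "q = l2n HL b" "p' = l2n HL (Wdot a)" "q' = l2n HL (Wdot b)"
      have "(p * q + p' * q')\<^sup>2 \<le> (p\<^sup>2 + p'\<^sup>2) * (q\<^sup>2 + q'\<^sup>2)"
        using zero_le_power2[of "p * q' - p' * q"] by (simp add: power2_eq_square algebra_simps)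
      then have "p * q + p' * q' \<le> sqrt ((p\<^sup>2 + p'\<^sup>2) * (q\<^sup>2 + q'\<^sup>2))" by (rule real_le_rsqrt)
      then show ?thesis unfolding Wnorm_eq[OF d] Wnorm_eq[OF e] by (simp add: p_q_p'_q'_def real_sqrt_mult)
    qed
    finally show "\<bar>Wip a b\<bar> \<le> Wnorm a * Wnorm b" .
    assume "inW c"
    then have g: "has_Wderiv c (Wdot c)" by (rule has_Wderiv_Wdot)
    show "Wip (\<lambda>t. a t - b t) c = Wip a c - Wip b c"
      unfolding Wip_eq[OF has_Wderiv_diff[OF d e] g] Wip_eq[OF d g] Wip_eq[OF e g]
      by (simp add: integral_HL_inner_diff has_WderivD[OF d] has_WderivD[OF e] has_WderivD[OF g]) }
qed

section \<open>Ensemble solutions\<close>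

lemma trap_inner_tendsto:
  fixes r :: "real \<Rightarrow> 'a::euclidean_space"
  assumes r: "l2 HL r" and a: "0 \<le> a"
  shows "(\<lambda>n. L2ip r (\<lambda>t. trap a (a + inverse (real (Suc n))) t *\<^sub>R b)) \<longlonglongrightarrow> set_lebesgue_integral lborel {0..a} r \<bullet> b"
proof -
  have inv: "0 < inverse (real (Suc n))" "inverse (real (Suc n)) \<le> 1" for n
    by (simp_all add: inverse_le_1_iff)
  have lt: "a < a + inverse (real (Suc n))" for n using inv by simp
  have ind: "l2 HL (\<lambda>t. indicator {0..a + 1} t :: real)" by (rule l2_indicator_Icc(1)) (use a in simp)
  have ind2: "l2 HL (\<lambda>t. indicator {0..a} t :: real)" by (rule l2_indicator_Icc(1)) (use a in simp)
  have i0: "integrable HL (\<lambda>t. indicat_real {0..a} t *\<^sub>R r t)"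
    by (rule Bochner_Integration.integrable_bound[OF integrable_l2_mult[OF ind2 r]])
      (use l2D(1)[OF ind2] l2D(1)[OF r] in \<open>auto simp del: borel_measurable_indicator_iff\<close>)
  have "(\<lambda>n. \<integral>t. r t \<bullet> (trap a (a + inverse (real (Suc n))) t *\<^sub>R b) \<partial>HL) \<longlonglongrightarrow> (\<integral>t. (indicat_real {0..a} t *\<^sub>R r t) \<bullet> b \<partial>HL)"
  proof (rule integral_dominated_convergence[where w = "\<lambda>t. norm b * (norm (r t) * norm (indicat_real {0..a + 1} t))"])
    show "(\<lambda>t. (indicat_real {0..a} t *\<^sub>R r t) \<bullet> b) \<in> borel_measurable HL"
      using borel_measurable_integrable[OF i0] by measurable
    show "(\<lambda>t. r t \<bullet> (trap a (a + inverse (real (Suc n))) t *\<^sub>R b)) \<in> borel_measurable HL" for n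
      by (rule borel_measurable_inner[OF l2D(1)[OF r] l2D(1)[OF has_WderivD(1)[OF has_Wderiv_trap[OF a lt]]]])
    show "integrable HL (\<lambda>t. norm b * (norm (r t) * norm (indicat_real {0..a + 1} t)))"
      by (intro integrable_mult_right integrable_l2_mult r ind)
    show "AE t in HL. (\<lambda>n. r t \<bullet> (trap a (a + inverse (real (Suc n))) t *\<^sub>R b)) \<longlonglongrightarrow> (indicat_real {0..a} t *\<^sub>R r t) \<bullet> b"
    proof (rule AE_I2)
      fix t assume t: "t \<in> space HL"
      have "eventually (\<lambda>n. r t \<bullet> (trap a (a + inverse (real (Suc n))) t *\<^sub>R b) = (indicat_real {0..a} t *\<^sub>R r t) \<bullet> b) sequentially"
      proof (cases "t \<le> a")
        case True
        then show ?thesis using t trap_simps(1)[OF lt True] by simp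
      next
        case False
        then have "eventually (\<lambda>n. inverse (real (Suc n)) < t - a) sequentially"
          using order_tendstoD(2)[OF LIMSEQ_inverse_real_of_nat, of "t - a"] by simp
        then show ?thesis
          by eventually_elim (use False trap_simps(2)[OF lt] in auto)
      qed
      then show "(\<lambda>n. r t \<bullet> (trap a (a + inverse (real (Suc n))) t *\<^sub>R b)) \<longlonglongrightarrow> (indicat_real {0..a} t *\<^sub>R r t) \<bullet> b"
        by (rule tendsto_eventually)
    qed
    show "AE t in HL. norm (r t \<bullet> (trap a (a + inverse (real (Suc n))) t *\<^sub>R b)) \<le> norm b * (norm (r t) * norm (indicat_real {0..a + 1} t))" for n
    proof (rule AE_I2)
      fix t assume t: "t \<in> space HL"
      define \<tau> where "\<tau> = trap a (a + inverse (real (Suc n))) t"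
      have \<tau>: "0 \<le> \<tau>" "\<tau> \<le> indicat_real {0..a + 1} t"
        using trap_simps(2,3,4)[OF lt[of n], of t] inv(2)[of n] t by (auto simp: \<tau>_def indicator_def)
      have "norm (r t \<bullet> (\<tau> *\<^sub>R b)) \<le> norm (r t) * norm (\<tau> *\<^sub>R b)" unfolding real_norm_def by (rule Cauchy_Schwarz_ineq2)
      also have "\<dots> = (norm (r t) * norm b) * \<tau>" using \<tau> by simp
      also have "\<dots> \<le> (norm (r t) * norm b) * indicat_real {0..a + 1} t" by (intro mult_left_mono \<tau>) simp
      finally show "norm (r t \<bullet> (trap a (a + inverse (real (Suc n))) t *\<^sub>R b)) \<le> norm b * (norm (r t) * norm (indicat_real {0..a + 1} t))"
        by (simp add: \<tau>_def mult_ac)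
    qed
  qed
  moreover have "(\<integral>t. (indicat_real {0..a} t *\<^sub>R r t) \<bullet> b \<partial>HL) = set_lebesgue_integral lborel {0..a} r \<bullet> b"
  proof -
    have "set_lebesgue_integral lborel {0..a} r = (\<integral>t. indicat_real {0..a} t *\<^sub>R r t \<partial>HL)"
      unfolding set_integral_HL[OF order_refl] unfolding set_lebesgue_integral_def ..
    then show ?thesis using integral_inner_left[of b HL "\<lambda>t. indicat_real {0..a} t *\<^sub>R r t"] i0 by simp
  qed
  ultimately show ?thesis by (simp only: L2ip_HL)
qed

lemma indefinite_zero_dense:
  fixes r :: "real \<Rightarrow> 'a::euclidean_space"
  assumes r: "l2 HL r" and z: "\<And>p q::nat. set_lebesgue_integral lborel {0..real p / real (Suc q)} r = 0" and t: "0 \<le> t"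
  shows "set_lebesgue_integral lborel {0..t} r = 0"
proof -
  define a where "a k = real (nat \<lfloor>t * real (Suc k)\<rfloor>) / real (Suc k)" for k
  have fl: "real (nat \<lfloor>t * real (Suc k)\<rfloor>) = of_int \<lfloor>t * real (Suc k)\<rfloor>" for k using t by simp
  have lo: "t - inverse (real (Suc k)) \<le> a k" and hi: "a k \<le> t" for k
  proof -
    have "t * real (Suc k) - 1 \<le> of_int \<lfloor>t * real (Suc k)\<rfloor>" by linarith
    then have "(t * real (Suc k) - 1) / real (Suc k) \<le> a k" unfolding a_def fl by (intro divide_right_mono) auto
    moreover have "(t * real (Suc k) - 1) / real (Suc k) = t - inverse (real (Suc k))"
      by (simp add: diff_divide_distrib inverse_eq_divide del: of_nat_Suc)
    ultimately show "t - inverse (real (Suc k)) \<le> a k" by simp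
    have "of_int \<lfloor>t * real (Suc k)\<rfloor> \<le> t * real (Suc k)" by linarith
    then have "a k \<le> (t * real (Suc k)) / real (Suc k)" unfolding a_def fl by (intro divide_right_mono) auto
    then show "a k \<le> t" by (simp del: of_nat_Suc)
  qed
  have "(\<lambda>k. t - inverse (real (Suc k))) \<longlonglongrightarrow> t - 0" by (intro tendsto_intros LIMSEQ_inverse_real_of_nat)
  then have lim: "a \<longlonglongrightarrow> t" by (intro tendsto_sandwich[OF _ _ _ tendsto_const, of _ a]) (use lo hi in auto)
  have "\<And>k. a k \<in> {0..}" by (simp add: a_def)
  then have "(\<lambda>k. set_lebesgue_integral lborel {0..a k} r) \<longlonglongrightarrow> set_lebesgue_integral lborel {0..t} r"
    using continuous_on_tendsto_compose[OF continuous_on_indefinite[OF r] lim] t by simp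
  then have "(\<lambda>k::nat. 0) \<longlonglongrightarrow> set_lebesgue_integral lborel {0..t} r" unfolding a_def z .
  then show ?thesis by (simp add: LIMSEQ_const_iff)
qed

text \<open>Countably many test functions suffice, so that the exceptional null set does not depend on the test function.\<close>

lemma aform_zero_imp_solution:
  fixes f :: "real^'n \<Rightarrow> real^'n" and B :: "real^'m^'n"
  assumes y: "inW y" and lf: "l2 HL (\<lambda>t. f (y t))" and lF: "l2 HL (\<lambda>t. B *v F (y t))"
    and eq: "\<And>(p::nat) (q::nat) n b. b \<in> Basis \<Longrightarrow>
       aform f B F y x (\<lambda>t. trap (real p / real (Suc q)) (real p / real (Suc q) + inverse (real (Suc n))) t *\<^sub>R b) = 0"
  shows "has_Wderiv y (\<lambda>t. f (y t) + B *v F (y t))" "y 0 = x"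
proof -
  have d: "has_Wderiv y (Wdot y)" by (rule has_Wderiv_Wdot[OF y])
  define r where "r t = Wdot y t - f (y t) - B *v F (y t)" for t
  have lr: "l2 HL r" unfolding r_def by (intro l2_diff(1) has_WderivD(2)[OF d] lf lF)
  have I: "set_lebesgue_integral lborel {0..real p / real (Suc q)} r = - (y 0 - x)" for p q :: nat
  proof (rule euclidean_eqI)
    fix b :: "real^'n" assume b: "b \<in> Basis"
    define a where "a = real p / real (Suc q)"
    have a: "0 \<le> a" by (simp add: a_def)
    have "L2ip r (\<lambda>t. trap a (a + inverse (real (Suc n))) t *\<^sub>R b) = - (y 0 - x) \<bullet> b" for n
    proof -
      have "trap a (a + inverse (real (Suc n))) 0 = 1" using a by (intro trap_simps(1)) auto
      then show ?thesis using eq[OF b, of p q n] unfolding aform_def a_def[symmetric] r_def by (simp add: inner_diff_left)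
    qed
    then have "(\<lambda>n::nat. - (y 0 - x) \<bullet> b) \<longlonglongrightarrow> set_lebesgue_integral lborel {0..a} r \<bullet> b"
      using trap_inner_tendsto[OF lr a, of b] by simp
    then show "set_lebesgue_integral lborel {0..real p / real (Suc q)} r \<bullet> b = - (y 0 - x) \<bullet> b"
      by (simp add: LIMSEQ_const_iff a_def)
  qed
  have "set_lebesgue_integral lborel {0..0} r = 0" using set_integral_Icc(2)[OF lr, of 0 0] by simp
  then show y0: "y 0 = x" using I[of 0 0] by simp
  have z: "set_lebesgue_integral lborel {0..t} r = 0" if "0 \<le> t" for t
    by (rule indefinite_zero_dense[OF lr _ that]) (use I y0 in simp)
  have lg: "l2 HL (\<lambda>t. f (y t) + B *v F (y t))" by (rule l2_add(1)[OF lf lF])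
  show "has_Wderiv y (\<lambda>t. f (y t) + B *v F (y t))" unfolding has_Wderiv_l2
  proof (intro conjI allI impI lg has_WderivD(1)[OF d])
    fix t :: real assume t: "0 \<le> t"
    have "set_lebesgue_integral lborel {0..t} (Wdot y) = (LBINT t:{0..t}. r t + (f (y t) + B *v F (y t)))"
      by (simp add: r_def)
    also have "\<dots> = set_lebesgue_integral lborel {0..t} r + (LBINT t:{0..t}. f (y t) + B *v F (y t))"
      by (intro set_integral_add l2_HL_set_integrable lr lg) auto
    finally show "y t = y 0 + (LBINT t:{0..t}. f (y t) + B *v F (y t))"
      by (subst has_WderivD(3)[OF d t]) (simp add: z[OF t])
  qed
qed

lemma bochner_L2_indicator:
  fixes \<phi> :: "real \<Rightarrow> 'c::euclidean_space"
  assumes "prob_space \<mu>" "inW \<phi>" "A \<in> sets \<mu>"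
  shows "bochner_L2 \<mu> inW Wnorm (\<lambda>x t. indicat_real A x *\<^sub>R \<phi> t)"
proof -
  interpret prob_space \<mu> by fact
  have "simple_function \<mu> (indicat_real A)" using assms(3) by (rule simple_function_indicator)
  then have sf: "simple_function \<mu> (\<lambda>x t. indicat_real A x *\<^sub>R \<phi> t)"
    using simple_function_compose1[of \<mu> "indicat_real A" "\<lambda>c t. c *\<^sub>R \<phi> t"] by simp
  have V: "inW (\<lambda>t. indicat_real A x *\<^sub>R \<phi> t)" for x by (rule inW_scaleR[OF assms(2)])
  have "Wnorm (\<lambda>t. 0::'c) = 0" using Wnorm_scaleR[OF assms(2), of 0] by simp
  then have "strongly_meas \<mu> inW Wnorm (\<lambda>x t. indicat_real A x *\<^sub>R \<phi> t)"
    by (intro strongly_measI[of _ "\<lambda>k x t. indicat_real A x *\<^sub>R \<phi> t"] sf V) simp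
  moreover have "integrable \<mu> (\<lambda>x. (Wnorm (\<lambda>t. indicat_real A x *\<^sub>R \<phi> t))\<^sup>2)"
  proof -
    have "(Wnorm (\<lambda>t. indicat_real A x *\<^sub>R \<phi> t))\<^sup>2 = indicat_real A x * (Wnorm \<phi>)\<^sup>2" for x
      unfolding Wnorm_scaleR[OF assms(2)] by (simp add: indicator_def)
    then show ?thesis using assms(3) by (auto simp: emeasure_eq_measure)
  qed
  ultimately show ?thesis using V by (simp add: bochner_L2_def)
qed

lemma aform_scale:
  "aform f B F y x (\<lambda>t. c *\<^sub>R \<phi> t) = c * aform f B F y x \<phi>"
  unfolding aform_def L2ip_def inner_scaleR_right by (simp add: distrib_left)

lemma ens_sol_aform_zero:
  fixes f :: "real^'n \<Rightarrow> real^'n" and B :: "real^'m^'n"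
  assumes ps: "prob_space \<mu>" and es: "ens_sol \<mu> f B m F Y" and \<phi>: "inW \<phi>"
  shows "AE x in \<mu>. aform f B F (Y x) x \<phi> = 0"
proof -
  interpret prob_space \<mu> by fact
  define h where "h x = aform f B F (Y x) x \<phi>" for x
  have test: "integrable \<mu> (\<lambda>x. indicat_real A x * h x)" "(\<integral>x. indicat_real A x * h x \<partial>\<mu>) = 0" if "A \<in> sets \<mu>" for A
    using es[unfolded ens_sol_def] bochner_L2_indicator[OF ps \<phi> that] unfolding h_def aform_scale[symmetric] by blast+
  have "integrable \<mu> (\<lambda>x. indicat_real (space \<mu>) x * h x)" by (rule test) simp
  then have h[measurable]: "h \<in> borel_measurable \<mu>"
    by (rule measurable_cong[THEN iffD1, rotated, OF borel_measurable_integrable]) simp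
  define P where "P = {x \<in> space \<mu>. 0 < h x}"
  define N where "N = {x \<in> space \<mu>. h x < 0}"
  have PN: "P \<in> sets \<mu>" "N \<in> sets \<mu>" unfolding P_def N_def by measurable
  have "AE x in \<mu>. indicat_real P x * h x = 0"
    using test[OF PN(1)] by (subst integral_nonneg_eq_0_iff_AE[symmetric]) (auto simp: P_def indicator_def)
  moreover have "AE x in \<mu>. - (indicat_real N x * h x) = 0"
    using test[OF PN(2)] by (subst integral_nonneg_eq_0_iff_AE[symmetric]) (auto simp: N_def indicator_def)
  ultimately show ?thesis using AE_space
  proof eventually_elim
    case (elim x)
    then have "h x = 0" by (cases "h x" "0::real" rule: linorder_cases) (auto simp: P_def N_def)
    then show ?case by (simp add: h_def)
  qed
qed

lemma ens_sol_AE_solution: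
  fixes f :: "real^'n \<Rightarrow> real^'n" and B :: "real^'m^'n"
  assumes ps: "prob_space \<mu>" and es: "ens_sol \<mu> f B m F Y"
    and reg: "\<And>y. inW y \<Longrightarrow> Wnorm y \<le> 2 * m \<Longrightarrow> l2 HL (\<lambda>t. f (y t)) \<and> l2 HL (\<lambda>t. B *v F (y t))"
  shows "AE x in \<mu>. has_Wderiv (Y x) (\<lambda>t. f (Y x t) + B *v F (Y x t)) \<and> Y x 0 = x"
proof -
  define \<phi> where "\<phi> p q n b t = trap (real p / real (Suc q)) (real p / real (Suc q) + inverse (real (Suc n))) t *\<^sub>R b"
    for p q n :: nat and b :: "real^'n" and t
  have in\<phi>: "inW (\<phi> p q n b)" for p q n b unfolding \<phi>_def by (rule inWI[OF has_Wderiv_trap]) auto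
  have "AE x in \<mu>. aform f B F (Y x) x (\<phi> p q n b) = 0" for p q n b by (rule ens_sol_aform_zero[OF ps es in\<phi>])
  then have "AE x in \<mu>. \<forall>p q n. \<forall>b\<in>Basis. aform f B F (Y x) x (\<phi> p q n b) = 0"
    by (simp add: AE_all_countable AE_finite_all)
  moreover have "AE x in \<mu>. inW (Y x) \<and> Wnorm (Y x) \<le> 2 * m" using es by (simp add: ens_sol_def)
  ultimately show ?thesis
  proof eventually_elim
    case (elim x)
    note r = reg[of "Y x"]
    show ?case
      using aform_zero_imp_solution[of "Y x" f B F x] r elim unfolding \<phi>_def by blast
  qed
qed

lemma solution_imp_aform_zero:
  assumes "has_Wderiv y (\<lambda>t. f (y t) + B *v F (y t))" "y 0 = x"
  shows "aform f B F y x \<phi> = 0"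
proof -
  have "AE t in HL. Wdot y t = f (y t) + B *v F (y t)"
    by (rule has_Wderiv_unique[OF has_Wderiv_Wdot[OF inWI[OF assms(1)]] assms(1)])
  then have z: "AE t in HL. (Wdot y t - f (y t) - B *v F (y t)) \<bullet> \<phi> t = 0" by eventually_elim simp
  have "(\<integral>t. (Wdot y t - f (y t) - B *v F (y t)) \<bullet> \<phi> t \<partial>HL) = 0"
    by (rule integral_eq_zero_AE[OF z])
  then show ?thesis using assms(2) by (simp add: aform_def L2ip_HL)
qed

section \<open>Regularity of networks\<close>

definition diff_loclip :: "(real^'n \<Rightarrow> real) \<Rightarrow> bool" where
  "diff_loclip g \<longleftrightarrow> (\<forall>x. g differentiable (at x)) \<and>
     (\<forall>r. \<exists>L\<ge>0. \<forall>a b. norm a \<le> r \<longrightarrow> norm b \<le> r \<longrightarrow> \<bar>g a - g b\<bar> \<le> L * norm (a - b))"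

lemma diff_loclip_lipschitz:
  "diff_loclip g \<Longrightarrow> \<exists>L\<ge>0. \<forall>a b. norm a \<le> r \<longrightarrow> norm b \<le> r \<longrightarrow> \<bar>g a - g b\<bar> \<le> L * norm (a - b)"
  by (simp add: diff_loclip_def)

lemma diff_loclip_const: "diff_loclip (\<lambda>x. c)"
  unfolding diff_loclip_def by (auto intro: exI[of _ 0])

lemma diff_loclip_add:
  assumes "diff_loclip g" "diff_loclip h" shows "diff_loclip (\<lambda>x. g x + h x)"
  unfolding diff_loclip_def
proof (intro conjI allI)
  fix r
  obtain L where L: "0 \<le> L" "\<And>a b. norm a \<le> r \<Longrightarrow> norm b \<le> r \<Longrightarrow> \<bar>g a - g b\<bar> \<le> L * norm (a - b)" using diff_loclip_lipschitz[OF assms(1), of r] by blast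
  obtain L' where L': "0 \<le> L'" "\<And>a b. norm a \<le> r \<Longrightarrow> norm b \<le> r \<Longrightarrow> \<bar>h a - h b\<bar> \<le> L' * norm (a - b)" using diff_loclip_lipschitz[OF assms(2), of r] by blast
  have "\<bar>g a + h a - (g b + h b)\<bar> \<le> (L + L') * norm (a - b)" if "norm a \<le> r" "norm b \<le> r" for a b
    using L(2)[OF that] L'(2)[OF that] by (simp add: distrib_right)
  then show "\<exists>L\<ge>0. \<forall>a b. norm a \<le> r \<longrightarrow> norm b \<le> r \<longrightarrow> \<bar>g a + h a - (g b + h b)\<bar> \<le> L * norm (a - b)"
    using L(1) L'(1) by (intro exI[of _ "L + L'"]) auto
qed (use assms in \<open>auto simp: diff_loclip_def intro: differentiable_add\<close>)

lemma diff_loclip_cmult: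
  assumes "diff_loclip g" shows "diff_loclip (\<lambda>x. c * g x)"
  unfolding diff_loclip_def
proof (intro conjI allI)
  fix r
  obtain L where L: "0 \<le> L" "\<And>a b. norm a \<le> r \<Longrightarrow> norm b \<le> r \<Longrightarrow> \<bar>g a - g b\<bar> \<le> L * norm (a - b)" using diff_loclip_lipschitz[OF assms, of r] by blast
  have "\<bar>c * g a - c * g b\<bar> \<le> (\<bar>c\<bar> * L) * norm (a - b)" if "norm a \<le> r" "norm b \<le> r" for a b
    using mult_left_mono[OF L(2)[OF that], of "\<bar>c\<bar>"] by (simp add: abs_mult[symmetric] right_diff_distrib mult.assoc)
  then show "\<exists>L\<ge>0. \<forall>a b. norm a \<le> r \<longrightarrow> norm b \<le> r \<longrightarrow> \<bar>c * g a - c * g b\<bar> \<le> L * norm (a - b)"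
    using L(1) by (intro exI[of _ "\<bar>c\<bar> * L"]) auto
qed (use assms in \<open>auto simp: diff_loclip_def intro: differentiable_mult\<close>)

lemma diff_loclip_sum: "finite I \<Longrightarrow> (\<And>i. i \<in> I \<Longrightarrow> diff_loclip (g i)) \<Longrightarrow> diff_loclip (\<lambda>x. \<Sum>i\<in>I. g i x)"
  by (induction I rule: finite_induct) (auto intro: diff_loclip_const diff_loclip_add)

lemma diff_loclip_inner: "diff_loclip (\<lambda>x. w \<bullet> x)"
  unfolding diff_loclip_def
proof (intro conjI allI)
  show "(\<lambda>x. w \<bullet> x) differentiable (at x)" for x by (simp add: bounded_linear_imp_differentiable bounded_linear_inner_right)
  have "\<bar>w \<bullet> a - w \<bullet> b\<bar> \<le> norm w * norm (a - b)" for a b unfolding inner_diff_right[symmetric] by (rule Cauchy_Schwarz_ineq2)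
  then show "\<exists>L\<ge>0. \<forall>a b. norm a \<le> r \<longrightarrow> norm b \<le> r \<longrightarrow> \<bar>w \<bullet> a - w \<bullet> b\<bar> \<le> L * norm (a - b)" for r
    by (intro exI[of _ "norm w"]) auto
qed

lemma diff_loclip_compose:
  assumes g: "diff_loclip g" and \<sigma>: "continuous_on UNIV \<sigma>'" "\<And>x. (\<sigma> has_real_derivative \<sigma>' x) (at x)"
  shows "diff_loclip (\<lambda>x. \<sigma> (g x))"
  unfolding diff_loclip_def
proof (intro conjI allI)
  fix x
  have "\<sigma> differentiable (at (g x))" using \<sigma>(2) unfolding real_differentiable_def by blast
  moreover have "g differentiable (at x)" using g by (simp add: diff_loclip_def)
  ultimately show "(\<lambda>x. \<sigma> (g x)) differentiable (at x)"
    using differentiable_chain_at[of g x \<sigma>] by (simp add: comp_def)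
next
  fix r
  show "\<exists>L\<ge>0. \<forall>a b. norm a \<le> r \<longrightarrow> norm b \<le> r \<longrightarrow> \<bar>\<sigma> (g a) - \<sigma> (g b)\<bar> \<le> L * norm (a - b)"
  proof (cases "0 \<le> r")
    case False
    then show ?thesis by (intro exI[of _ 0]) (auto dest: order_trans[OF norm_ge_zero])
  next
    case True
    obtain L where L: "0 \<le> L" "\<And>a b. norm a \<le> r \<Longrightarrow> norm b \<le> r \<Longrightarrow> \<bar>g a - g b\<bar> \<le> L * norm (a - b)" using diff_loclip_lipschitz[OF g, of r] by blast
    define m where "m = \<bar>g 0\<bar> + L * r"
    have gm: "g a \<in> {-m..m}" if "norm a \<le> r" for a
    proof -
      have "\<bar>g a - g 0\<bar> \<le> L * r" using L(2)[OF that, of 0] True mult_left_mono[OF that L(1)] by simp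
      then show ?thesis by (auto simp: m_def)
    qed
    have "compact (\<sigma>' ` {-m..m})" by (intro compact_continuous_image continuous_on_subset[OF \<sigma>(1)]) auto
    then obtain D where D: "0 < D" "\<And>u. u \<in> {-m..m} \<Longrightarrow> norm (\<sigma>' u) \<le> D"
      using compact_imp_bounded bounded_pos by (metis image_eqI)
    have "\<bar>\<sigma> u - \<sigma> v\<bar> \<le> D * \<bar>u - v\<bar>" if "u \<in> {-m..m}" "v \<in> {-m..m}" for u v
      using field_differentiable_bound[of "{-m..m}" \<sigma> \<sigma>' D u v] that D(2) \<sigma>(2) by (auto intro: DERIV_subset)
    then have "\<bar>\<sigma> (g a) - \<sigma> (g b)\<bar> \<le> (D * L) * norm (a - b)" if "norm a \<le> r" "norm b \<le> r" for a b
      using gm that mult_left_mono[OF L(2)[OF that], of D] D(1) by (smt (verit) mult.assoc)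
    then show ?thesis using D(1) L(1) by (intro exI[of _ "D * L"]) auto
  qed
qed

lemma diff_loclip_layer:
  assumes \<sigma>: "continuous_on UNIV \<sigma>'" "\<And>x. (\<sigma> has_real_derivative \<sigma>' x) (at x)"
    and h: "\<And>j. diff_loclip (\<lambda>x. h x j)"
  shows "diff_loclip (\<lambda>x. layer \<sigma> d d' Wb (h x) j)"
proof (cases "j < d'")
  case True
  have "diff_loclip (\<lambda>x. \<sigma> ((\<Sum>k<d. fst Wb j k * h x k) + snd Wb j))"
    by (intro diff_loclip_compose[OF _ \<sigma>] diff_loclip_add diff_loclip_sum diff_loclip_cmult diff_loclip_const h) auto
  then show ?thesis using True by (simp add: layer_def)
qed (simp add: layer_def diff_loclip_const)

lemma diff_loclip_mids_eval:
  assumes \<sigma>: "continuous_on UNIV \<sigma>'" "\<And>x. (\<sigma> has_real_derivative \<sigma>' x) (at x)"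
    and h: "\<And>j. diff_loclip (\<lambda>x. h x j)"
  shows "diff_loclip (\<lambda>x. mids_eval \<sigma> ds Ls (h x) j)"
  using h
proof (induction Ls arbitrary: ds h)
  case Nil
  have "mids_eval \<sigma> ds [] (h x) = h x" for x by (cases ds rule: list.exhaust; simp)
  then show ?case using Nil by simp
next
  case (Cons Wb Ls)
  show ?case
  proof (cases ds)
    case Nil
    then show ?thesis using Cons.prems by simp
  next
    case d: (Cons d ds1)
    show ?thesis
    proof (cases ds1)
      case Nil
      then show ?thesis using Cons.prems d by simp
    next
      case (Cons d' ds2)
      then show ?thesis using d Cons.IH[OF diff_loclip_layer[OF \<sigma> Cons.prems]] by simp
    qed
  qed
qed

lemma Fnet_regular:
  fixes \<theta> :: "('n::finite, 'm::finite) nnet"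
  assumes "\<exists>\<sigma>'. continuous_on UNIV \<sigma>' \<and> (\<forall>x. (\<sigma> has_real_derivative \<sigma>' x) (at x))"
  shows "Fnet \<sigma> hid \<theta> differentiable (at x)" "Fnet \<sigma> hid \<theta> 0 = 0"
    "\<exists>L\<ge>0. \<forall>a b. norm a \<le> r \<longrightarrow> norm b \<le> r \<longrightarrow> norm (Fnet \<sigma> hid \<theta> a - Fnet \<sigma> hid \<theta> b) \<le> L * norm (a - b)"
proof -
  obtain \<sigma>' where \<sigma>: "continuous_on UNIV \<sigma>'" "\<And>x. (\<sigma> has_real_derivative \<sigma>' x) (at x)" using assms by blast
  show "Fnet \<sigma> hid \<theta> 0 = 0" by (simp add: Fnet_def)
  have h1: "diff_loclip (\<lambda>x. (\<lambda>j. if j < n then \<sigma> (W1 \<theta> j \<bullet> x + b1 \<theta> j) else 0) j)" for j n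
    using diff_loclip_compose[OF diff_loclip_add[OF diff_loclip_inner[of "W1 \<theta> j"] diff_loclip_const[of "b1 \<theta> j"]] \<sigma>] by (cases "j < n") (simp_all add: diff_loclip_const)
  have P: "diff_loclip (\<lambda>x. Psi \<sigma> hid \<theta> x $ i)" for i
    unfolding Psi_def Let_def vec_lambda_beta
    by (rule diff_loclip_add[OF diff_loclip_sum[OF finite_lessThan diff_loclip_cmult[OF diff_loclip_mids_eval[OF \<sigma> h1]]] diff_loclip_const])
  have N: "diff_loclip (\<lambda>x. Fnet \<sigma> hid \<theta> x $ i)" for i
    using diff_loclip_add[OF P[of i] diff_loclip_const[of "- Psi \<sigma> hid \<theta> 0 $ i"]] by (simp add: Fnet_def)
  show "Fnet \<sigma> hid \<theta> differentiable (at x)"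
  proof (rule differentiable_componentwise_within[THEN iffD2], rule ballI)
    fix b :: "real^'m" assume "b \<in> Basis"
    then obtain i where "b = axis i 1" by (auto simp: Basis_vec_def)
    then show "(\<lambda>x. Fnet \<sigma> hid \<theta> x \<bullet> b) differentiable (at x)" using N[of i] by (simp add: inner_axis diff_loclip_def)
  qed
  have "\<forall>i. \<exists>L\<ge>0. \<forall>a b. norm a \<le> r \<longrightarrow> norm b \<le> r \<longrightarrow> \<bar>Fnet \<sigma> hid \<theta> a $ i - Fnet \<sigma> hid \<theta> b $ i\<bar> \<le> L * norm (a - b)"
    using diff_loclip_lipschitz[OF N] by blast
  then obtain L where L: "\<And>i. 0 \<le> L i" "\<And>i a b. norm a \<le> r \<Longrightarrow> norm b \<le> r \<Longrightarrow> \<bar>Fnet \<sigma> hid \<theta> a $ i - Fnet \<sigma> hid \<theta> b $ i\<bar> \<le> L i * norm (a - b)"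
    by metis
  have "norm (Fnet \<sigma> hid \<theta> a - Fnet \<sigma> hid \<theta> b) \<le> (\<Sum>i\<in>UNIV. L i) * norm (a - b)" if "norm a \<le> r" "norm b \<le> r" for a b
  proof -
    have "norm (Fnet \<sigma> hid \<theta> a - Fnet \<sigma> hid \<theta> b) \<le> (\<Sum>i\<in>UNIV. \<bar>(Fnet \<sigma> hid \<theta> a - Fnet \<sigma> hid \<theta> b) $ i\<bar>)" by (rule norm_le_l1_cart)
    also have "\<dots> \<le> (\<Sum>i\<in>UNIV. L i * norm (a - b))" by (rule sum_mono) (use L(2)[OF that] in simp)
    finally show ?thesis by (simp add: sum_distrib_right)
  qed
  then show "\<exists>L\<ge>0. \<forall>a b. norm a \<le> r \<longrightarrow> norm b \<le> r \<longrightarrow> norm (Fnet \<sigma> hid \<theta> a - Fnet \<sigma> hid \<theta> b) \<le> L * norm (a - b)"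
    using L(1) by (intro exI[of _ "\<Sum>i\<in>UNIV. L i"]) (auto intro: sum_nonneg)
qed

lemma C11_estimates:
  fixes g :: "real^'n \<Rightarrow> real^'k"
  assumes d: "\<And>x. norm x \<le> R \<Longrightarrow> (g has_derivative D x) (at x within cball 0 R)"
    and l: "\<And>x y. norm x \<le> R \<Longrightarrow> norm y \<le> R \<Longrightarrow> onorm (\<lambda>h. D x h - D y h) \<le> L * dist x y"
    and R: "0 \<le> R"
  shows "\<exists>K\<ge>0. (\<forall>x h. norm x \<le> R \<longrightarrow> norm (D x h) \<le> K * norm h) \<and>
     (\<forall>x y h. norm x \<le> R \<longrightarrow> norm y \<le> R \<longrightarrow> norm (D x h - D y h) \<le> K * norm (x - y) * norm h) \<and>
     (\<forall>a b. norm a \<le> R \<longrightarrow> norm b \<le> R \<longrightarrow> norm (g a - g b) \<le> K * norm (a - b)) \<and>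
     (\<forall>a b c. norm a \<le> R \<longrightarrow> norm b \<le> R \<longrightarrow> norm c \<le> R \<longrightarrow>
        norm (g a - g b - D c (a - b)) \<le> K * (norm (a - c) + norm (b - c)) * norm (a - b))"
proof -
  have bl: "bounded_linear (D x)" if "norm x \<le> R" for x using d[OF that] by (rule has_derivative_bounded_linear)
  have bd: "bounded_linear (\<lambda>h. D x h - D y h)" if "norm x \<le> R" "norm y \<le> R" for x y
    by (intro bounded_linear_sub bl that)
  have l': "onorm (\<lambda>h. D x h - D y h) \<le> \<bar>L\<bar> * norm (x - y)" if "norm x \<le> R" "norm y \<le> R" for x y
  proof -
    have "L * dist x y \<le> \<bar>L\<bar> * norm (x - y)" by (auto simp: dist_norm intro: mult_right_mono)
    then show ?thesis using l[OF that] by linarith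
  qed
  have e1: "norm (D x h - D y h) \<le> \<bar>L\<bar> * norm (x - y) * norm h" if "norm x \<le> R" "norm y \<le> R" for x y h
    using onorm[OF bd[OF that], of h] mult_right_mono[OF l'[OF that], of "norm h"] by simp
  define K0 where "K0 = onorm (D 0) + \<bar>L\<bar> * R"
  have K0: "0 \<le> K0" using R onorm_pos_le[OF bl[of 0]] by (simp add: K0_def)
  have e2: "norm (D x h) \<le> K0 * norm h" if "norm x \<le> R" for x h
  proof -
    have "norm (D x h) \<le> norm (D x h - D 0 h) + norm (D 0 h)" by (metis diff_add_cancel norm_triangle_ineq)
    also have "norm (D x h - D 0 h) \<le> \<bar>L\<bar> * norm (x - 0) * norm h" using R by (intro e1 that) simp
    also have "\<dots> \<le> \<bar>L\<bar> * R * norm h" using that by (intro mult_right_mono mult_left_mono) auto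
    also have "norm (D 0 h) \<le> onorm (D 0) * norm h" by (rule onorm[OF bl]) (use R in simp)
    finally show ?thesis by (simp add: K0_def distrib_right)
  qed
  have e3: "norm (g a - g b) \<le> K0 * norm (a - b)" if "norm a \<le> R" "norm b \<le> R" for a b
  proof (rule differentiable_bound[of "cball 0 R" g D])
    show "onorm (D x) \<le> K0" if "x \<in> cball 0 R" for x by (rule onorm_bound[OF K0]) (use e2 that in auto)
  qed (use d that in auto)
  have e4: "norm (g a - g b - D c (a - b)) \<le> \<bar>L\<bar> * (norm (a - c) + norm (b - c)) * norm (a - b)"
    if abc: "norm a \<le> R" "norm b \<le> R" "norm c \<le> R" for a b c
  proof -
    have lc: "linear (D c)" using bl[OF abc(3)] by (simp add: bounded_linear.linear)
    have sub: "closed_segment a b \<subseteq> cball 0 R" by (rule closed_segment_subset) (use abc in auto)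
    have "norm ((g a - D c a) - (g b - D c b)) \<le> \<bar>L\<bar> * (norm (a - c) + norm (b - c)) * norm (a - b)"
    proof (rule differentiable_bound[of "closed_segment a b" "\<lambda>x. g x - D c x" "\<lambda>x h. D x h - D c h"])
      fix x assume x: "x \<in> closed_segment a b"
      then have xR: "norm x \<le> R" using sub by auto
      show "((\<lambda>x. g x - D c x) has_derivative (\<lambda>h. D x h - D c h)) (at x within closed_segment a b)"
        by (intro has_derivative_diff has_derivative_subset[OF d[OF xR] sub] bounded_linear_imp_has_derivative bl abc)
      have "norm (x - c) \<le> norm (a - c) + norm (b - c)"
      proof -
        obtain u where u: "0 \<le> u" "u \<le> 1" "x = (1 - u) *\<^sub>R a + u *\<^sub>R b" using x by (auto simp: in_segment)
        have "x - c = (1 - u) *\<^sub>R (a - c) + u *\<^sub>R (b - c)" by (simp add: u(3) algebra_simps)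
        then have "norm (x - c) \<le> norm ((1 - u) *\<^sub>R (a - c)) + norm (u *\<^sub>R (b - c))" by (simp only: norm_triangle_ineq)
        also have "\<dots> = (1 - u) * norm (a - c) + u * norm (b - c)" using u by simp
        also have "\<dots> \<le> 1 * norm (a - c) + 1 * norm (b - c)" using u by (intro add_mono mult_right_mono) auto
        finally show ?thesis by simp
      qed
      from mult_left_mono[OF this, of "\<bar>L\<bar>"] show "onorm (\<lambda>h. D x h - D c h) \<le> \<bar>L\<bar> * (norm (a - c) + norm (b - c))"
        using l'[OF xR abc(3)] by linarith
    qed auto
    then show ?thesis by (simp add: linear_diff[OF lc] algebra_simps)
  qed
  have le: "\<bar>L\<bar> \<le> K0 + \<bar>L\<bar>" "K0 \<le> K0 + \<bar>L\<bar>" using K0 by auto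
  show ?thesis
  proof (intro exI[of _ "K0 + \<bar>L\<bar>"] conjI allI impI)
    show "norm (D x h) \<le> (K0 + \<bar>L\<bar>) * norm h" if "norm x \<le> R" for x h
      using e2[OF that, of h] mult_right_mono[OF le(2), of "norm h"] by simp
    show "norm (D x h - D y h) \<le> (K0 + \<bar>L\<bar>) * norm (x - y) * norm h" if "norm x \<le> R" "norm y \<le> R" for x y h
      using e1[OF that, of h] mult_right_mono[OF mult_right_mono[OF le(1), of "norm (x - y)"], of "norm h"] by simp
    show "norm (g a - g b) \<le> (K0 + \<bar>L\<bar>) * norm (a - b)" if "norm a \<le> R" "norm b \<le> R" for a b
      using e3[OF that] mult_right_mono[OF le(2), of "norm (a - b)"] by simp
    show "norm (g a - g b - D c (a - b)) \<le> (K0 + \<bar>L\<bar>) * (norm (a - c) + norm (b - c)) * norm (a - b)"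
      if "norm a \<le> R" "norm b \<le> R" "norm c \<le> R" for a b c
      using e4[OF that] mult_right_mono[OF mult_right_mono[OF le(1), of "norm (a - c) + norm (b - c)"], of "norm (a - b)"] by simp
  qed (use K0 in auto)
qed

section \<open>Convergence of the network minimizers\<close>

lemma LIMSEQ_zero_subseq:
  fixes X :: "nat \<Rightarrow> real"
  assumes "\<And>r :: nat \<Rightarrow> nat. strict_mono r \<Longrightarrow> \<exists>s :: nat \<Rightarrow> nat. strict_mono s \<and> (\<lambda>n. X (r (s n))) \<longlonglongrightarrow> 0"
  shows "X \<longlonglongrightarrow> 0"
proof (rule ccontr)
  assume "\<not> X \<longlonglongrightarrow> 0"
  then obtain e where e: "0 < e" "\<And>N. \<exists>n\<ge>N. e \<le> \<bar>X n\<bar>" by (fastforce simp: LIMSEQ_iff not_less)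
  then have "infinite {n. e \<le> \<bar>X n\<bar>}" unfolding infinite_nat_iff_unbounded_le by auto
  then obtain r :: "nat \<Rightarrow> nat" where r: "strict_mono r" "\<And>n. e \<le> \<bar>X (r n)\<bar>"
    using infinite_enumerate[of "{n. e \<le> \<bar>X n\<bar>}"] by auto
  obtain s where "(\<lambda>n. X (r (s n))) \<longlonglongrightarrow> 0" using assms[OF r(1)] by blast
  then have "eventually (\<lambda>n. \<bar>X (r (s n))\<bar> < e) sequentially"
    using e(1) order_tendstoD(2)[OF tendsto_rabs_zero, of _ _ e] by simp
  then obtain n where "\<bar>X (r (s n))\<bar> < e" by (auto simp: eventually_sequentially)
  then show False using r(2)[of "s n"] by simp
qed

lemma AE_convergence_from_costs:
  fixes J a b :: "nat \<Rightarrow> 'a \<Rightarrow> real" and V :: "'a \<Rightarrow> real"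
  assumes ps: "prob_space \<mu>"
    and J: "\<And>k. integrable \<mu> (J k)" and V: "integrable \<mu> V"
    and JV: "\<And>k. AE x in \<mu>. V x \<le> J k x"
    and lim: "\<delta> \<longlonglongrightarrow> 0" "\<And>k. (\<integral>x. J k x \<partial>\<mu>) \<le> (\<integral>x. V x \<partial>\<mu>) + \<delta> k"
    and ma: "\<And>k. a k \<in> borel_measurable \<mu>" and mb: "\<And>k. b k \<in> borel_measurable \<mu>"
    and a0: "\<And>k x. 0 \<le> a k x" and b0: "\<And>k x. 0 \<le> b k x"
    and near: "AE x in \<mu>. \<exists>L d0. 0 < d0 \<and> 0 \<le> L \<and> (\<forall>k. J k x - V x \<le> d0 \<longrightarrow> a k x \<le> L * sqrt (J k x - V x) \<and> b k x \<le> L * sqrt (J k x - V x))"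
    and abd: "\<And>k. AE x in \<mu>. a k x \<le> m1" and bbd: "\<And>k. AE x in \<mu>. (b k x)\<^sup>2 \<le> c1 * (J k x - V x) + c2" and c1: "0 \<le> c1"
  shows "\<And>k. integrable \<mu> (\<lambda>x. (a k x)\<^sup>2)" "\<And>k. integrable \<mu> (\<lambda>x. (b k x)\<^sup>2)"
    "(\<lambda>k. \<integral>x. (a k x)\<^sup>2 \<partial>\<mu>) \<longlonglongrightarrow> 0" "(\<lambda>k. \<integral>x. (b k x)\<^sup>2 \<partial>\<mu>) \<longlonglongrightarrow> 0"
proof -
  interpret prob_space \<mu> by fact
  note [measurable] = ma mb
  have abd2: "AE x in \<mu>. norm ((a k x)\<^sup>2) \<le> m1\<^sup>2" for k using abd[of k] by eventually_elim (use a0 in \<open>auto intro: power_mono\<close>)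
  show ia: "integrable \<mu> (\<lambda>x. (a k x)\<^sup>2)" for k
    by (rule integrable_const_bound[OF abd2]) simp
  have iub: "integrable \<mu> (\<lambda>x. c1 * (J k x - V x) + c2)" for k using J V by simp
  show ib: "integrable \<mu> (\<lambda>x. (b k x)\<^sup>2)" for k
    by (rule Bochner_Integration.integrable_bound[OF iub[of k]]) (use bbd[of k] in \<open>simp, eventually_elim, simp\<close>)
  have id: "integrable \<mu> (\<lambda>x. J k x - V x)" for k using J V by simp
  have dlim: "(\<lambda>k. \<integral>x. norm (J k x - V x) \<partial>\<mu>) \<longlonglongrightarrow> 0"
  proof (rule tendsto_sandwich[OF _ _ tendsto_const lim(1)])
    show "\<forall>\<^sub>F k in sequentially. (\<integral>x. norm (J k x - V x) \<partial>\<mu>) \<le> \<delta> k"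
    proof (rule always_eventually, rule allI)
      fix k
      have "(\<integral>x. norm (J k x - V x) \<partial>\<mu>) = (\<integral>x. J k x - V x \<partial>\<mu>)"
        by (rule integral_cong_AE) (use id[of k] JV[of k] in auto)
      then show "(\<integral>x. norm (J k x - V x) \<partial>\<mu>) \<le> \<delta> k" using lim(2)[of k] J V by simp
    qed
  qed simp
  have JVall: "AE x in \<mu>. \<forall>k. V x \<le> J k x" using JV by (simp add: AE_all_countable)
  have sub: "\<exists>s. strict_mono s \<and> (\<lambda>n. \<integral>x. (a (r (s n)) x)\<^sup>2 \<partial>\<mu>) \<longlonglongrightarrow> 0 \<and> (\<lambda>n. \<integral>x. (b (r (s n)) x)\<^sup>2 \<partial>\<mu>) \<longlonglongrightarrow> 0"
    if r: "strict_mono r" for r :: "nat \<Rightarrow> nat"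
  proof -
    have rlim: "(\<lambda>k. \<integral>x. norm (J (r k) x - V x) \<partial>\<mu>) \<longlonglongrightarrow> 0"
      using LIMSEQ_subseq_LIMSEQ[OF dlim r] by (simp add: comp_def)
    then obtain s where s: "strict_mono s" "AE x in \<mu>. (\<lambda>n. J (r (s n)) x - V x) \<longlonglongrightarrow> 0"
      using tendsto_L1_AE_subseq[of \<mu> "\<lambda>k x. J (r k) x - V x"] id by blast
    define q where "q n = r (s n)" for n
    have ab: "AE x in \<mu>. (\<lambda>n. a (q n) x) \<longlonglongrightarrow> 0 \<and> (\<lambda>n. b (q n) x) \<longlonglongrightarrow> 0"
      using s(2) near JVall
    proof eventually_elim
      case (elim x)
      then obtain L d0 where L: "0 < d0" "0 \<le> L"
        "\<And>k. J k x - V x \<le> d0 \<Longrightarrow> a k x \<le> L * sqrt (J k x - V x) \<and> b k x \<le> L * sqrt (J k x - V x)" by blast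
      have ev: "eventually (\<lambda>n. J (q n) x - V x < d0) sequentially" using order_tendstoD(2)[OF elim(1) L(1)] by (simp add: q_def)
      have "(\<lambda>n. L * sqrt (J (q n) x - V x)) \<longlonglongrightarrow> L * sqrt 0" using elim(1) unfolding q_def by (intro tendsto_intros)
      then have l: "(\<lambda>n. L * sqrt (J (q n) x - V x)) \<longlonglongrightarrow> 0" by simp
      have "(\<lambda>n. a (q n) x) \<longlonglongrightarrow> 0"
        by (rule tendsto_sandwich[OF _ _ tendsto_const l]) (use a0 in simp, use ev in eventually_elim, use L(3) in auto)
      moreover have "(\<lambda>n. b (q n) x) \<longlonglongrightarrow> 0"
        by (rule tendsto_sandwich[OF _ _ tendsto_const l]) (use b0 in simp, use ev in eventually_elim, use L(3) in auto)
      ultimately show ?case by simp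
    qed
    have "(\<lambda>n. \<integral>x. (a (q n) x)\<^sup>2 \<partial>\<mu>) \<longlonglongrightarrow> (\<integral>x. 0 \<partial>\<mu>)"
    proof (rule integral_dominated_convergence[where w = "\<lambda>x. m1\<^sup>2"])
      show "AE x in \<mu>. (\<lambda>n. (a (q n) x)\<^sup>2) \<longlonglongrightarrow> 0"
        using ab by eventually_elim (metis tendsto_power[of _ 0 _ 2] zero_power2)
    qed (use abd2 in auto)
    moreover have "(\<lambda>n. \<integral>x. (b (q n) x)\<^sup>2 \<partial>\<mu>) \<longlonglongrightarrow> 0"
    proof -
      define g where "g n x = max 0 ((b (q n) x)\<^sup>2 - c1 * (J (q n) x - V x))" for n x
      have [measurable]: "J k \<in> borel_measurable \<mu>" "V \<in> borel_measurable \<mu>" for k using J V by auto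
      have mg: "g n \<in> borel_measurable \<mu>" for n unfolding g_def by measurable
      have gbd: "AE x in \<mu>. norm (g n x) \<le> \<bar>c2\<bar>" for n
        using bbd[of "q n"] by eventually_elim (auto simp: g_def)
      have ig: "integrable \<mu> (g n)" for n by (rule integrable_const_bound[OF gbd mg])
      have gl: "(\<lambda>n. \<integral>x. g n x \<partial>\<mu>) \<longlonglongrightarrow> (\<integral>x. 0 \<partial>\<mu>)"
      proof (rule integral_dominated_convergence[where w = "\<lambda>x. \<bar>c2\<bar>"])
        show "AE x in \<mu>. (\<lambda>n. g n x) \<longlonglongrightarrow> 0"
          using ab s(2)
        proof eventually_elim
          case (elim x)
          then have "(\<lambda>n. max 0 ((b (q n) x)\<^sup>2 - c1 * (J (q n) x - V x))) \<longlonglongrightarrow> max 0 (0\<^sup>2 - c1 * 0)"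
            unfolding q_def by (intro tendsto_intros) auto
          then show ?case by (simp add: g_def)
        qed
      qed (use gbd mg in auto)
      have up: "(\<lambda>n. (\<integral>x. g n x \<partial>\<mu>) + c1 * (\<integral>x. norm (J (q n) x - V x) \<partial>\<mu>)) \<longlonglongrightarrow> 0 + c1 * 0"
      proof (intro tendsto_intros)
        show "(\<lambda>n. \<integral>x. g n x \<partial>\<mu>) \<longlonglongrightarrow> 0" using gl by simp
        show "(\<lambda>n. \<integral>x. norm (J (q n) x - V x) \<partial>\<mu>) \<longlonglongrightarrow> 0"
          using LIMSEQ_subseq_LIMSEQ[OF rlim s(1)] by (simp add: comp_def q_def)
      qed
      show ?thesis
      proof (rule tendsto_sandwich[OF _ _ tendsto_const])
        show "\<forall>\<^sub>F n in sequentially. (\<integral>x. (b (q n) x)\<^sup>2 \<partial>\<mu>) \<le> (\<integral>x. g n x \<partial>\<mu>) + c1 * (\<integral>x. norm (J (q n) x - V x) \<partial>\<mu>)"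
        proof (rule always_eventually, rule allI)
          fix n
          have inn: "integrable \<mu> (\<lambda>x. norm (J (q n) x - V x))" by (rule integrable_norm[OF id])
          have "(\<integral>x. (b (q n) x)\<^sup>2 \<partial>\<mu>) \<le> (\<integral>x. g n x + c1 * norm (J (q n) x - V x) \<partial>\<mu>)"
          proof (rule integral_mono[OF ib])
            show "integrable \<mu> (\<lambda>x. g n x + c1 * norm (J (q n) x - V x))"
              by (intro Bochner_Integration.integrable_add ig integrable_mult_right inn)
            fix x
            have "c1 * (J (q n) x - V x) \<le> c1 * norm (J (q n) x - V x)" by (intro mult_left_mono c1) simp
            then show "(b (q n) x)\<^sup>2 \<le> g n x + c1 * norm (J (q n) x - V x)" by (simp add: g_def)
          qed
          also have "\<dots> = (\<integral>x. g n x \<partial>\<mu>) + c1 * (\<integral>x. norm (J (q n) x - V x) \<partial>\<mu>)"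
            by (subst Bochner_Integration.integral_add[OF ig integrable_mult_right[OF inn]]) simp
          finally show "(\<integral>x. (b (q n) x)\<^sup>2 \<partial>\<mu>) \<le> (\<integral>x. g n x \<partial>\<mu>) + c1 * (\<integral>x. norm (J (q n) x - V x) \<partial>\<mu>)" .
        qed
        show "(\<lambda>n. (\<integral>x. g n x \<partial>\<mu>) + c1 * (\<integral>x. norm (J (q n) x - V x) \<partial>\<mu>)) \<longlonglongrightarrow> 0" using up by simp
      qed simp
    qed
    ultimately show ?thesis using s(1) by (intro exI[of _ s]) (simp add: q_def)
  qed
  show "(\<lambda>k. \<integral>x. (a k x)\<^sup>2 \<partial>\<mu>) \<longlonglongrightarrow> 0" by (rule LIMSEQ_zero_subseq) (use sub in blast)
  show "(\<lambda>k. \<integral>x. (b k x)\<^sup>2 \<partial>\<mu>) \<longlonglongrightarrow> 0" by (rule LIMSEQ_zero_subseq) (use sub in blast)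
qed

definition loclip :: "(real^'n \<Rightarrow> 'b::euclidean_space) \<Rightarrow> bool" where
  "loclip F \<longleftrightarrow> F 0 = 0 \<and> (\<forall>r. \<exists>L\<ge>0. \<forall>a b. norm a \<le> r \<longrightarrow> norm b \<le> r \<longrightarrow> norm (F a - F b) \<le> L * norm (a - b))"

lemma loclipD:
  "loclip F \<Longrightarrow> \<exists>L\<ge>0. \<forall>a b. norm a \<le> r \<longrightarrow> norm b \<le> r \<longrightarrow> norm (F a - F b) \<le> L * norm (a - b)"
  unfolding loclip_def by blast

lemma loclip_matrix:
  fixes Q :: "real^'n^'k"
  shows "loclip (\<lambda>x. Q *v x)"
  unfolding loclip_def
proof (intro conjI allI)
  have "norm (Q *v a - Q *v b) \<le> onorm ((*v) Q) * norm (a - b)" for a b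
    using onorm[OF matrix_vector_mul_bounded_linear[of Q], of "a - b"] by (simp add: matrix_vector_mult_diff_distrib)
  then show "\<exists>L\<ge>0. \<forall>a b. norm a \<le> r \<longrightarrow> norm b \<le> r \<longrightarrow> norm (Q *v a - Q *v b) \<le> L * norm (a - b)" for r
    by (intro exI[of _ "onorm ((*v) Q)"]) (auto simp: onorm_pos_le matrix_vector_mul_bounded_linear)
qed simp

lemma loclip_matrix_comp:
  fixes Q :: "real^'m^'k" and F :: "real^'n \<Rightarrow> real^'m"
  assumes "loclip F"
  shows "loclip (\<lambda>x. Q *v F x)"
  unfolding loclip_def
proof (intro conjI allI)
  show "Q *v F 0 = 0" using assms by (simp add: loclip_def)
  fix r
  obtain L where L: "0 \<le> L" "\<And>a b. norm a \<le> r \<Longrightarrow> norm b \<le> r \<Longrightarrow> norm (F a - F b) \<le> L * norm (a - b)" using loclipD[OF assms, of r] by blast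
  have o: "0 \<le> onorm ((*v) Q)" by (simp add: onorm_pos_le matrix_vector_mul_bounded_linear)
  have "norm (Q *v F a - Q *v F b) \<le> (onorm ((*v) Q) * L) * norm (a - b)" if "norm a \<le> r" "norm b \<le> r" for a b
    using onorm[OF matrix_vector_mul_bounded_linear[of Q], of "F a - F b"] mult_left_mono[OF L(2)[OF that] o]
    by (simp add: matrix_vector_mult_diff_distrib mult.assoc)
  then show "\<exists>L\<ge>0. \<forall>a b. norm a \<le> r \<longrightarrow> norm b \<le> r \<longrightarrow> norm (Q *v F a - Q *v F b) \<le> L * norm (a - b)"
    using o L(1) by (intro exI[of _ "onorm ((*v) Q) * L"]) auto
qed

lemma lipschitz_l2:
  fixes F :: "real^'n \<Rightarrow> 'b::euclidean_space"
  assumes y: "inW y" "inW z" and r: "\<And>t. 0 \<le> t \<Longrightarrow> norm (y t) \<le> r" "\<And>t. 0 \<le> t \<Longrightarrow> norm (z t) \<le> r"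
    and F: "\<And>a b. norm a \<le> r \<Longrightarrow> norm b \<le> r \<Longrightarrow> norm (F a - F b) \<le> L * norm (a - b)" "0 \<le> L" "F 0 = 0"
  shows "l2 HL (\<lambda>t. F (y t))" "l2n HL (\<lambda>t. F (y t) - F (z t)) \<le> L * l2n HL (\<lambda>t. y t - z t)"
proof -
  have r0: "0 \<le> r" using r(1)[of 0] norm_ge_zero[of "y 0"] by linarith
  have cF: "continuous_on (cball 0 r) F" by (rule lipschitz_continuous_on[of _ _ L]) (use F in auto)
  have c: "continuous_on {0..} y" "continuous_on {0..} z" using y by (auto simp: inW_def intro: has_Wderiv_continuous)
  have m: "(\<lambda>t. F (y t)) \<in> borel_measurable HL" "(\<lambda>t. F (z t)) \<in> borel_measurable HL"
    by (intro continuous_on_HL_measurable continuous_on_compose2[OF cF] c; use r in force)+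
  show "l2 HL (\<lambda>t. F (y t))"
    by (rule l2_bound(1)[OF inW_l2[OF y(1)] m(1), of L]) (use F(1)[of _ 0] F(2,3) r r0 in auto)
  show "l2n HL (\<lambda>t. F (y t) - F (z t)) \<le> L * l2n HL (\<lambda>t. y t - z t)"
    by (rule l2_bound(2)[OF l2_diff(1)[OF inW_l2[OF y(1)] inW_l2[OF y(2)]]]) (use m F r in auto)
qed

context
  fixes Ci :: real
  assumes Ci: "0 < Ci" and emb: "\<forall>y::real \<Rightarrow> real^'n. inW y \<longrightarrow> (\<forall>t\<ge>0. norm (y t) \<le> Ci * Wnorm y)"
begin

lemma loclip_l2:
  fixes F :: "real^'n \<Rightarrow> 'b::euclidean_space"
  assumes F: "loclip F" and y: "inW y"
  shows "l2 HL (\<lambda>t. F (y t))"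
proof -
  obtain L where L: "0 \<le> L" "\<And>a b. norm a \<le> Ci * Wnorm y \<Longrightarrow> norm b \<le> Ci * Wnorm y \<Longrightarrow> norm (F a - F b) \<le> L * norm (a - b)"
    using loclipD[OF F, of "Ci * Wnorm y"] by blast
  show ?thesis by (rule lipschitz_l2(1)[OF y y _ _ L(2) L(1)]) (use emb y F in \<open>auto simp: loclip_def\<close>)
qed

lemma loclip_tendsto:
  fixes F :: "real^'n \<Rightarrow> 'b::euclidean_space"
  assumes F: "loclip F" and y: "inW y" "\<And>k::nat. inW (s k)" and lim: "(\<lambda>k. Wnorm (\<lambda>t. s k t - y t)) \<longlonglongrightarrow> 0"
  shows "(\<lambda>k. L2norm (\<lambda>t. F (s k t) - F (y t))) \<longlonglongrightarrow> 0"
proof -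
  define r where "r = Ci * (Wnorm y + 1)"
  obtain L where L: "0 \<le> L" "\<And>a b. norm a \<le> r \<Longrightarrow> norm b \<le> r \<Longrightarrow> norm (F a - F b) \<le> L * norm (a - b)" using loclipD[OF F, of r] by blast
  have ev: "eventually (\<lambda>k. Wnorm (\<lambda>t. s k t - y t) < 1) sequentially" using order_tendstoD(2)[OF lim] by simp
  have yr: "norm (y t) \<le> r" if "0 \<le> t" for t
    using emb[rule_format, OF y(1) that] Ci by (simp add: r_def distrib_left)
  have ub: "eventually (\<lambda>k. L2norm (\<lambda>t. F (s k t) - F (y t)) \<le> L * Wnorm (\<lambda>t. s k t - y t)) sequentially"
    using ev
  proof eventually_elim
    case (elim k)
    have sr: "norm (s k t) \<le> r" if "0 \<le> t" for t
    proof -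
      have "Wnorm (s k) \<le> Wnorm y + 1" using Wnorm_le_diff[OF y(2) y(1), of k] elim by linarith
      from mult_left_mono[OF this less_imp_le[OF Ci]] show ?thesis using emb[rule_format, OF y(2) that, of k] unfolding r_def by linarith
    qed
    have "L2norm (\<lambda>t. F (s k t) - F (y t)) \<le> L * l2n HL (\<lambda>t. s k t - y t)" unfolding L2norm_l2n
      by (rule lipschitz_l2(2)[OF y(2) y(1) sr yr L(2) L(1)]) (use F in \<open>auto simp: loclip_def\<close>)
    also have "\<dots> \<le> L * Wnorm (\<lambda>t. s k t - y t)" by (intro mult_left_mono l2n_le_Wnorm L)
    finally show ?case .
  qed
  have "(\<lambda>k. L * Wnorm (\<lambda>t. s k t - y t)) \<longlonglongrightarrow> L * 0" by (intro tendsto_intros lim)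
  then have l0: "(\<lambda>k. L * Wnorm (\<lambda>t. s k t - y t)) \<longlonglongrightarrow> 0" by simp
  show ?thesis by (rule tendsto_sandwich[OF _ ub tendsto_const l0]) (simp add: L2norm_l2n)
qed

lemma measurable_nemytskii:
  fixes Y :: "'x \<Rightarrow> real \<Rightarrow> real^'n" and Z :: "'x \<Rightarrow> real \<Rightarrow> 'b::euclidean_space" and F :: "real^'n \<Rightarrow> 'b"
  assumes cm: "complete_measure \<mu>" and Y: "strongly_meas \<mu> inW Wnorm Y" "AE x in \<mu>. inW (Y x)" and F: "loclip F"
    and Z: "strongly_meas \<mu> sq_int L2norm Z" "AE x in \<mu>. sq_int (Z x)"
  shows "(\<lambda>x. L2ip (\<lambda>t. F (Y x t)) (Z x)) \<in> borel_measurable \<mu>"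
    "(\<lambda>x. L2norm (\<lambda>t. F (Y x t) - Z x t)) \<in> borel_measurable \<mu>"
proof -
  show "(\<lambda>x. L2ip (\<lambda>t. F (Y x t)) (Z x)) \<in> borel_measurable \<mu>"
  proof (rule strongly_meas_functional[OF cm Y(1) Z(1) Y(2) Z(2), of "\<lambda>y z. L2ip (\<lambda>t. F (y t)) z"])
    fix y :: "real \<Rightarrow> real^'n" and z :: "real \<Rightarrow> 'b" and s s'
    assume "inW y" "sq_int z" "\<And>k::nat. inW (s k)" "\<And>k. sq_int (s' k)"
      "(\<lambda>k. Wnorm (\<lambda>t. s k t - y t)) \<longlonglongrightarrow> 0" "(\<lambda>k. L2norm (\<lambda>t. s' k t - z t)) \<longlonglongrightarrow> 0"
    then show "(\<lambda>k. L2ip (\<lambda>t. F (s k t)) (s' k)) \<longlonglongrightarrow> L2ip (\<lambda>t. F (y t)) z"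
      by (intro L2.ip_tendsto loclip_tendsto F) (auto simp: sq_int_l2 intro: loclip_l2[OF F])
  qed
  show "(\<lambda>x. L2norm (\<lambda>t. F (Y x t) - Z x t)) \<in> borel_measurable \<mu>"
  proof (rule strongly_meas_functional[OF cm Y(1) Z(1) Y(2) Z(2), of "\<lambda>y z. L2norm (\<lambda>t. F (y t) - z t)"])
    fix y :: "real \<Rightarrow> real^'n" and z :: "real \<Rightarrow> 'b" and s s'
    assume "inW y" "sq_int z" "\<And>k::nat. inW (s k)" "\<And>k. sq_int (s' k)"
      "(\<lambda>k. Wnorm (\<lambda>t. s k t - y t)) \<longlonglongrightarrow> 0" "(\<lambda>k. L2norm (\<lambda>t. s' k t - z t)) \<longlonglongrightarrow> 0"
    then show "(\<lambda>k. L2norm (\<lambda>t. F (s k t) - s' k t)) \<longlonglongrightarrow> L2norm (\<lambda>t. F (y t) - z t)"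
      by (intro L2.nrm_diff_tendsto loclip_tendsto F) (auto simp: sq_int_l2 intro: loclip_l2[OF F])
  qed
qed

lemma measurable_nemytskii_norm:
  fixes Y :: "'x \<Rightarrow> real \<Rightarrow> real^'n" and F :: "real^'n \<Rightarrow> 'b::euclidean_space"
  assumes cm: "complete_measure \<mu>" and Y: "strongly_meas \<mu> inW Wnorm Y" "AE x in \<mu>. inW (Y x)" and F: "loclip F"
  shows "(\<lambda>x. L2norm (\<lambda>t. F (Y x t))) \<in> borel_measurable \<mu>"
proof -
  have "strongly_meas \<mu> sq_int L2norm (\<lambda>x t. 0 :: 'b)"
    by (rule strongly_measI[of _ "\<lambda>k x t. 0"]) (auto simp: sq_int_l2 l2_def L2norm_l2n l2n_def)
  from measurable_nemytskii(2)[OF cm Y F this] show ?thesis by (simp add: sq_int_l2 l2_def)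
qed

end

definition Jquad :: "real^'n^'n \<Rightarrow> real \<Rightarrow> (real \<Rightarrow> real^'n) \<Rightarrow> (real \<Rightarrow> real^'m) \<Rightarrow> real" where
  "Jquad Q \<beta> y u = ((l2n HL (\<lambda>t. Q *v y t))\<^sup>2 + \<beta> * (l2n HL u)\<^sup>2) / 2"

lemma Jcost_eq_Jquad:
  assumes "l2 HL (\<lambda>t. Q *v y t)" "l2 HL u" "0 \<le> \<beta>"
  shows "Jcost Q \<beta> y u = ennreal (Jquad Q \<beta> y u)"
proof -
  have i1: "integrable HL (\<lambda>t. (norm (Q *v y t))\<^sup>2)" and i2: "integrable HL (\<lambda>t. (norm (u t))\<^sup>2)" using assms by auto
  have "(\<integral>\<^sup>+t\<in>{0..}. ennreal ((norm (Q *v y t))\<^sup>2 + \<beta> * (norm (u t))\<^sup>2) \<partial>lborel)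
     = (\<integral>\<^sup>+t. ennreal ((norm (Q *v y t))\<^sup>2 + \<beta> * (norm (u t))\<^sup>2) \<partial>HL)"
    unfolding HL_def by (subst nn_integral_restrict_space) auto
  also have "\<dots> = ennreal (\<integral>t. (norm (Q *v y t))\<^sup>2 + \<beta> * (norm (u t))\<^sup>2 \<partial>HL)"
    by (rule nn_integral_eq_integral) (use i1 i2 assms(3) in auto)
  also have "(\<integral>t. (norm (Q *v y t))\<^sup>2 + \<beta> * (norm (u t))\<^sup>2 \<partial>HL) = (l2n HL (\<lambda>t. Q *v y t))\<^sup>2 + \<beta> * (l2n HL u)\<^sup>2"
    using i1 i2 by (simp add: l2n_sq)
  finally have "Jcost Q \<beta> y u = ennreal ((l2n HL (\<lambda>t. Q *v y t))\<^sup>2 + \<beta> * (l2n HL u)\<^sup>2) / ennreal 2"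
    by (simp add: Jcost_def)
  also have "\<dots> = ennreal (((l2n HL (\<lambda>t. Q *v y t))\<^sup>2 + \<beta> * (l2n HL u)\<^sup>2) / 2)"
    by (rule divide_ennreal) (use assms(3) in auto)
  finally show ?thesis by (simp add: Jquad_def)
qed

lemma Jquad_nonneg: "0 \<le> \<beta> \<Longrightarrow> 0 \<le> Jquad Q \<beta> y u" by (simp add: Jquad_def)

lemma MY0_bounds:
  assumes "compact Y0" "0 \<in> Y0" "0 < M"
  shows "y \<in> Y0 \<Longrightarrow> M * norm y \<le> MY0 M Y0" "0 \<le> MY0 M Y0" "MY0 M Y0 = M * (SUP y\<in>Y0. norm y)"
proof -
  have bdd: "bdd_above (norm ` Y0)"
    by (intro bounded_imp_bdd_above compact_imp_bounded compact_continuous_image continuous_on_norm_id assms)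
  show b: "M * norm y \<le> MY0 M Y0" if "y \<in> Y0" for y
    unfolding MY0_def using that bdd assms(3) by (intro mult_left_mono cSUP_upper) auto
  show "0 \<le> MY0 M Y0" using b[OF assms(2)] by simp
  show "MY0 M Y0 = M * (SUP y\<in>Y0. norm y)" by (simp add: MY0_def)
qed

lemma loclip_C11:
  fixes f :: "real^'n \<Rightarrow> real^'k"
  assumes d: "\<And>x. f differentiable (at x)" and f0: "f 0 = 0"
    and l: "\<And>K. compact K \<Longrightarrow> \<exists>L. \<forall>x\<in>K. \<forall>y\<in>K.
        onorm (\<lambda>h. frechet_derivative f (at x) h - frechet_derivative f (at y) h) \<le> L * dist x y"
  shows "loclip f"
  unfolding loclip_def
proof (intro conjI allI f0)
  fix r :: real
  show "\<exists>L\<ge>0. \<forall>a b. norm a \<le> r \<longrightarrow> norm b \<le> r \<longrightarrow> norm (f a - f b) \<le> L * norm (a - b)"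
  proof (cases "0 \<le> r")
    case False
    then show ?thesis by (intro exI[of _ 0]) (auto dest: order_trans[OF norm_ge_zero])
  next
    case True
    obtain L where L: "\<And>x y. norm x \<le> r \<Longrightarrow> norm y \<le> r \<Longrightarrow>
        onorm (\<lambda>h. frechet_derivative f (at x) h - frechet_derivative f (at y) h) \<le> L * dist x y"
      using l[OF compact_cball[of 0 r]] unfolding mem_cball_0 Ball_def by blast
    have "(f has_derivative frechet_derivative f (at x)) (at x within cball 0 r)" for x
      by (rule has_derivative_at_withinI[OF frechet_derivative_works[THEN iffD1, OF d]])
    note est = C11_estimates[where g = f and D = "\<lambda>x. frechet_derivative f (at x)" and R = r and L = L, OF this L True]
    then show ?thesis by blast
  qed
qed

lemma eps_approx_lipschitz:
  fixes \<theta> :: "('n::finite, 'm::finite) nnet"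
  assumes \<sigma>: "\<exists>\<sigma>'. continuous_on UNIV \<sigma>' \<and> (\<forall>x. (\<sigma> has_real_derivative \<sigma>' x) (at x))"
    and Fs: "\<And>x. norm x \<le> R \<Longrightarrow> Fs differentiable (at x within cball 0 R)"
    and ap: "eps_approx \<sigma> hid Fs R \<epsilon> \<theta>" and ab: "norm a \<le> R" "norm b \<le> R"
  shows "norm ((Fnet \<sigma> hid \<theta> a - Fs a) - (Fnet \<sigma> hid \<theta> b - Fs b)) \<le> \<epsilon> * norm (a - b)"
proof -
  let ?F = "Fnet \<sigma> hid \<theta>"
  have "norm ((Fs a - ?F a) - (Fs b - ?F b)) \<le> \<epsilon> * norm (a - b)"
  proof (rule differentiable_bound[of "cball 0 R" "\<lambda>x. Fs x - ?F x" "\<lambda>x h. frechet_derivative Fs (at x within cball 0 R) h - frechet_derivative ?F (at x) h"])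
    fix x :: "real^'n" assume "x \<in> cball 0 R"
    then have x: "norm x \<le> R" by simp
    have 1: "(Fs has_derivative frechet_derivative Fs (at x within cball 0 R)) (at x within cball 0 R)"
      using Fs[OF x] frechet_derivative_works by blast
    have "(?F has_derivative frechet_derivative ?F (at x)) (at x)"
      using Fnet_regular(1)[OF \<sigma>] frechet_derivative_works by blast
    then have 2: "(?F has_derivative frechet_derivative ?F (at x)) (at x within cball 0 R)" by (rule has_derivative_at_withinI)
    show "((\<lambda>x. Fs x - ?F x) has_derivative (\<lambda>h. frechet_derivative Fs (at x within cball 0 R) h - frechet_derivative ?F (at x) h)) (at x within cball 0 R)"
      by (rule has_derivative_diff[OF 1 2])
    have "norm (Fs x - ?F x) + onorm (\<lambda>h. frechet_derivative Fs (at x within cball 0 R) h - frechet_derivative ?F (at x) h) \<le> \<epsilon>"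
      using ap x unfolding eps_approx_def by blast
    then show "onorm (\<lambda>h. frechet_derivative Fs (at x within cball 0 R) h - frechet_derivative ?F (at x) h) \<le> \<epsilon>"
      using norm_ge_zero[of "Fs x - ?F x"] by linarith
  qed (use ab in auto)
  moreover have "(?F a - Fs a) - (?F b - Fs b) = - ((Fs a - ?F a) - (Fs b - ?F b))" by simp
  ultimately show ?thesis by (simp only: norm_minus_cancel)
qed

lemma closed_loop_C11:
  fixes f :: "real^'n \<Rightarrow> real^'n" and B :: "real^'m^'n" and Fs :: "real^'n \<Rightarrow> real^'m"
  assumes Ci: "0 < Ci" and embed: "\<And>(y::real \<Rightarrow> real^'n) t. inW y \<Longrightarrow> 0 \<le> t \<Longrightarrow> norm (y t) \<le> Ci * Wnorm y"
    and beta: "0 < \<beta>" and R: "0 < R" and f0: "f 0 = 0" and Fs0: "Fs 0 = 0"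
    and f: "\<And>x. norm x \<le> R \<Longrightarrow> (f has_derivative Df x) (at x within cball 0 R)"
      "\<And>x y. norm x \<le> R \<Longrightarrow> norm y \<le> R \<Longrightarrow> onorm (\<lambda>h. Df x h - Df y h) \<le> L1 * dist x y"
    and F: "\<And>x. norm x \<le> R \<Longrightarrow> (Fs has_derivative DF x) (at x within cball 0 R)"
      "\<And>x y. norm x \<le> R \<Longrightarrow> norm y \<le> R \<Longrightarrow> onorm (\<lambda>h. DF x h - DF y h) \<le> L2 * dist x y"
  shows "\<exists>K. closed_loop f B Fs (\<lambda>x h. Df x h + B *v DF x h) DF Q \<beta> Ci R K"
proof -
  have R0: "0 \<le> R" using R by simp
  obtain Kf where Kf: "0 \<le> Kf" "\<And>x h. norm x \<le> R \<Longrightarrow> norm (Df x h) \<le> Kf * norm h"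
    "\<And>x y h. norm x \<le> R \<Longrightarrow> norm y \<le> R \<Longrightarrow> norm (Df x h - Df y h) \<le> Kf * norm (x - y) * norm h"
    "\<And>a b. norm a \<le> R \<Longrightarrow> norm b \<le> R \<Longrightarrow> norm (f a - f b) \<le> Kf * norm (a - b)"
    "\<And>a b c. norm a \<le> R \<Longrightarrow> norm b \<le> R \<Longrightarrow> norm c \<le> R \<Longrightarrow>
        norm (f a - f b - Df c (a - b)) \<le> Kf * (norm (a - c) + norm (b - c)) * norm (a - b)"
    using C11_estimates[OF f R0] by blast
  obtain KF where KF: "0 \<le> KF" "\<And>x h. norm x \<le> R \<Longrightarrow> norm (DF x h) \<le> KF * norm h"
    "\<And>x y h. norm x \<le> R \<Longrightarrow> norm y \<le> R \<Longrightarrow> norm (DF x h - DF y h) \<le> KF * norm (x - y) * norm h"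
    "\<And>a b. norm a \<le> R \<Longrightarrow> norm b \<le> R \<Longrightarrow> norm (Fs a - Fs b) \<le> KF * norm (a - b)"
    "\<And>a b c. norm a \<le> R \<Longrightarrow> norm b \<le> R \<Longrightarrow> norm c \<le> R \<Longrightarrow>
        norm (Fs a - Fs b - DF c (a - b)) \<le> KF * (norm (a - c) + norm (b - c)) * norm (a - b)"
    using C11_estimates[OF F R0] by blast
  define KB where "KB = onorm ((*v) B)"
  define KQ where "KQ = onorm ((*v) Q)"
  have KB: "0 \<le> KB" "norm (B *v w) \<le> KB * norm w" for w
    using onorm[OF matrix_vector_mul_bounded_linear[of B]] by (auto simp: KB_def onorm_pos_le matrix_vector_mul_bounded_linear)
  have KQ: "0 \<le> KQ" "norm (Q *v w) \<le> KQ * norm w" for w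
    using onorm[OF matrix_vector_mul_bounded_linear[of Q]] by (auto simp: KQ_def onorm_pos_le matrix_vector_mul_bounded_linear)
  define K where "K = 1 + Kf + KF + KB * KF + KB + KQ"
  have KBF: "0 \<le> KB * KF" using KB KF by simp
  have le: "1 \<le> K" "Kf \<le> K" "KF \<le> K" "KB \<le> K" "KQ \<le> K" "Kf + KB * KF \<le> K"
    using Kf(1) KF(1) KB(1) KQ(1) KBF by (auto simp: K_def)
  have comb: "norm (u + B *v w) \<le> K * s" if "norm u \<le> Kf * s" "norm w \<le> KF * s" "0 \<le> s" for u w s
  proof -
    have "norm (u + B *v w) \<le> norm u + KB * norm w" using norm_triangle_ineq[of u "B *v w"] KB(2)[of w] by linarith
    also have "\<dots> \<le> Kf * s + KB * (KF * s)" using that KB by (intro add_mono mult_left_mono) auto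
    also have "\<dots> = (Kf + KB * KF) * s" by (simp add: algebra_simps)
    also have "\<dots> \<le> K * s" using le that by (intro mult_right_mono) auto
    finally show ?thesis .
  qed
  have up: "norm w \<le> K * s" if "norm w \<le> KF * s" "0 \<le> s" for w :: "real^'m" and s
    using that mult_right_mono[OF le(3) that(2)] by linarith
  have mono3: "Kx * p * q = Kx * (p * q)" for Kx p q :: real by simp
  have lin: "linear (Df x)" "linear (DF x)" if "norm x \<le> R" for x
    using has_derivative_linear[OF f(1)[OF that]] has_derivative_linear[OF F(1)[OF that]] .
  have "closed_loop f B Fs (\<lambda>x h. Df x h + B *v DF x h) DF Q \<beta> Ci R K"
  proof (rule closed_loop.intro)
    show "linear (\<lambda>h. Df x h + B *v DF x h)" if "norm x \<le> R" for x
      using linear_compose_add[OF lin(1)[OF that] linear_compose[OF lin(2)[OF that] matrix_vector_mul_linear[of B]]] by (simp add: comp_def)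
    show "norm (Df x h + B *v DF x h) \<le> K * norm h" if "norm x \<le> R" for x h
      using that by (intro comb Kf KF) auto
    show "norm (Df x h + B *v DF x h - (Df y h + B *v DF y h)) \<le> K * norm (x - y) * norm h" if "norm x \<le> R" "norm y \<le> R" for x y h
    proof -
      have eq: "Df x h + B *v DF x h - (Df y h + B *v DF y h) = (Df x h - Df y h) + B *v (DF x h - DF y h)"
        by (simp add: matrix_vector_mult_diff_distrib)
      show ?thesis unfolding eq using comb[of "Df x h - Df y h" "norm (x - y) * norm h" "DF x h - DF y h"] Kf(3)[OF that, of h] KF(3)[OF that, of h]
        by (simp add: mono3)
    qed
    show "norm (f a + B *v Fs a - (f b + B *v Fs b)) \<le> K * norm (a - b)" if "norm a \<le> R" "norm b \<le> R" for a b
    proof -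
      have eq: "f a + B *v Fs a - (f b + B *v Fs b) = (f a - f b) + B *v (Fs a - Fs b)" by (simp add: matrix_vector_mult_diff_distrib)
      show ?thesis unfolding eq by (rule comb[OF Kf(4)[OF that] KF(4)[OF that]]) simp
    qed
    show "norm (f a + B *v Fs a - (f b + B *v Fs b) - (Df c (a - b) + B *v DF c (a - b))) \<le> K * (norm (a - c) + norm (b - c)) * norm (a - b)"
      if "norm a \<le> R" "norm b \<le> R" "norm c \<le> R" for a b c
    proof -
      have eq: "f a + B *v Fs a - (f b + B *v Fs b) - (Df c (a - b) + B *v DF c (a - b)) =
        (f a - f b - Df c (a - b)) + B *v (Fs a - Fs b - DF c (a - b))" by (simp add: matrix_vector_mult_diff_distrib)
      show ?thesis unfolding eq
        using comb[of "f a - f b - Df c (a - b)" "(norm (a - c) + norm (b - c)) * norm (a - b)" "Fs a - Fs b - DF c (a - b)"] Kf(5)[OF that] KF(5)[OF that]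
        by (simp only: mono3) (simp add: add_nonneg_nonneg)
    qed
    show "norm (DF x h) \<le> K * norm h" if "norm x \<le> R" for x h by (rule up[OF KF(2)[OF that]]) simp
    show "norm (DF x h - DF y h) \<le> K * norm (x - y) * norm h" if "norm x \<le> R" "norm y \<le> R" for x y h
      unfolding mono3 by (rule up) (use KF(3)[OF that, of h] in \<open>auto simp: mono3\<close>)
    show "norm (Fs a - Fs b) \<le> K * norm (a - b)" if "norm a \<le> R" "norm b \<le> R" for a b by (rule up[OF KF(4)[OF that]]) simp
    show "norm (Fs a - Fs b - DF c (a - b)) \<le> K * (norm (a - c) + norm (b - c)) * norm (a - b)"
      if "norm a \<le> R" "norm b \<le> R" "norm c \<le> R" for a b c
      unfolding mono3 by (rule up) (use KF(5)[OF that] in \<open>simp_all only: mono3, auto\<close>)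
    show "norm (B *v w) \<le> K * norm w" for w using KB(2)[of w] mult_right_mono[OF le(4), of "norm w"] by simp
    show "norm (Q *v w) \<le> K * norm w" for w using KQ(2)[of w] mult_right_mono[OF le(5), of "norm w"] by simp
    show "linear (DF x)" if "norm x \<le> R" for x by (rule lin(2)[OF that])
  qed (fact Ci embed beta R f0 Fs0 le(1))+
  then show ?thesis by blast
qed

lemma standing_assumption_1D:
  fixes f :: "real^'n \<Rightarrow> real^'n" and B :: "real^'m^'n" and Fs :: "real^'n \<Rightarrow> real^'m"
  assumes SA1: "standing_assumption_1 f B Q \<beta> Y0 Ci NY0 Fs ystar M"
  shows "compact Y0" "0 \<in> Y0" "open NY0" "Y0 \<subseteq> NY0" "0 < M" "f 0 = 0" "Fs 0 = 0" "\<And>x. f differentiable (at x)"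
    "\<And>y0. y0 \<in> NY0 \<Longrightarrow> Wnorm (ystar y0) \<le> M * norm y0"
    "\<And>K. compact K \<Longrightarrow> \<exists>L. \<forall>x\<in>K. \<forall>y\<in>K.
        onorm (\<lambda>h. frechet_derivative f (at x) h - frechet_derivative f (at y) h) \<le> L * dist x y"
    "\<And>y0. y0 \<in> NY0 \<Longrightarrow> cl_sol f B Fs y0 (ystar y0)"
    "\<And>y0. y0 \<in> NY0 \<Longrightarrow> OCP_min f B Q \<beta> y0 (ystar y0) (\<lambda>t. Fs (ystar y0 t))"
    "\<And>y0 z t. y0 \<in> NY0 \<Longrightarrow> cl_sol f B Fs y0 z \<Longrightarrow> 0 \<le> t \<Longrightarrow> z t = ystar y0 t"
    "R = 2 * (Ci * MY0 M Y0) \<Longrightarrow> \<exists>DF :: real^'n \<Rightarrow> real^'n \<Rightarrow> real^'m.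
        (\<forall>x\<in>cball 0 R. (Fs has_derivative DF x) (at x within cball 0 R)) \<and>
        (\<exists>L. \<forall>x\<in>cball 0 R. \<forall>y\<in>cball 0 R. onorm (\<lambda>h. DF x h - DF y h) \<le> L * dist x y)"
proof -
  note S = SA1[unfolded standing_assumption_1_def]
  show "compact Y0" using S by (elim conjE)
  show "0 \<in> Y0" using S by (elim conjE)
  show "open NY0" using S by (elim conjE)
  show "Y0 \<subseteq> NY0" using S by (elim conjE)
  show "0 < M" using S by (elim conjE)
  show "f 0 = 0" using S by (elim conjE)
  show "Fs 0 = 0" using S by (elim conjE)
  have "\<forall>x. f differentiable (at x)" using S by (elim conjE)
  then show "f differentiable (at x)" for x by blast
  have "\<forall>y0\<in>NY0. Wnorm (ystar y0) \<le> M * norm y0" using S by (elim conjE)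
  then show "Wnorm (ystar y0) \<le> M * norm y0" if "y0 \<in> NY0" for y0 using that by blast
  have "\<forall>K. compact K \<longrightarrow> (\<exists>L. \<forall>x\<in>K. \<forall>y\<in>K.
      onorm (\<lambda>h. frechet_derivative f (at x) h - frechet_derivative f (at y) h) \<le> L * dist x y)" using S by (elim conjE)
  then show "\<exists>L. \<forall>x\<in>K. \<forall>y\<in>K.
      onorm (\<lambda>h. frechet_derivative f (at x) h - frechet_derivative f (at y) h) \<le> L * dist x y" if "compact K" for K using that by blast
  have b: "\<forall>y0\<in>NY0. cl_sol f B Fs y0 (ystar y0) \<and>
      (\<forall>z. cl_sol f B Fs y0 z \<longrightarrow> (\<forall>t\<ge>0. z t = ystar y0 t)) \<and>
      OCP_min f B Q \<beta> y0 (ystar y0) (\<lambda>t. Fs (ystar y0 t))" using S by (elim conjE)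
  show "cl_sol f B Fs y0 (ystar y0)" "OCP_min f B Q \<beta> y0 (ystar y0) (\<lambda>t. Fs (ystar y0 t))" if "y0 \<in> NY0" for y0
    using bspec[OF b that] by blast+
  show "z t = ystar y0 t" if "y0 \<in> NY0" "cl_sol f B Fs y0 z" "0 \<le> t" for y0 z t
    using bspec[OF b that(1)] that(2,3) by blast
  show "\<exists>DF :: real^'n \<Rightarrow> real^'n \<Rightarrow> real^'m.
        (\<forall>x\<in>cball 0 R. (Fs has_derivative DF x) (at x within cball 0 R)) \<and>
        (\<exists>L. \<forall>x\<in>cball 0 R. \<forall>y\<in>cball 0 R. onorm (\<lambda>h. DF x h - DF y h) \<le> L * dist x y)" if "R = 2 * (Ci * MY0 M Y0)"
    using S unfolding that by (elim conjE)
qed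

lemma pointwise_estimates:
  fixes f :: "real^'n \<Rightarrow> real^'n" and B :: "real^'m^'n" and Fs :: "real^'n \<Rightarrow> real^'m"
  assumes beta: "0 < \<beta>" and Ci: "0 < Ci"
    and emb: "\<forall>y::real \<Rightarrow> real^'n. inW y \<longrightarrow> (\<forall>t\<ge>0. norm (y t) \<le> Ci * Wnorm y)"
    and SA1: "standing_assumption_1 f B Q \<beta> Y0 Ci NY0 Fs ystar M"
    and A3: "assumption_3 f B Fs NY0 ystar C"
    and mpos: "0 < MY0 M Y0" and R_def: "R = 2 * (Ci * MY0 M Y0)"
  shows "\<And>x. x \<in> Y0 \<Longrightarrow> \<exists>d>0. \<exists>L\<ge>0. \<forall>x'\<in>Y0. norm (x' - x) < d \<longrightarrow> Wnorm (\<lambda>t. ystar x' t - ystar x t) \<le> L * norm (x' - x)"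
    "\<exists>K\<ge>0. \<forall>a b. norm a \<le> R \<longrightarrow> norm b \<le> R \<longrightarrow> norm (Fs a - Fs b) \<le> K * norm (a - b)"
    "\<And>x. x \<in> Y0 \<Longrightarrow> \<exists>L d0. 0 < d0 \<and> 0 \<le> L \<and> (\<forall>y u d. feasible f B x y u \<and> (\<forall>t\<ge>0. norm (y t) \<le> R) \<and> 0 \<le> d \<and> d \<le> d0 \<and>
       Jquad Q \<beta> y u \<le> Jquad Q \<beta> (ystar x) (\<lambda>t. Fs (ystar x t)) + d \<longrightarrow>
       Wnorm (\<lambda>t. y t - ystar x t) \<le> L * sqrt d \<and> l2n HL (\<lambda>t. u t - Fs (ystar x t)) \<le> L * sqrt d)"
    "\<exists>\<epsilon>1>0. \<exists>L\<ge>0. \<forall>\<epsilon> F. 0 \<le> \<epsilon> \<and> \<epsilon> \<le> \<epsilon>1 \<and> F 0 = 0 \<and>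
       (\<forall>a b. norm a \<le> R \<and> norm b \<le> R \<longrightarrow> norm ((F a - Fs a) - (F b - Fs b)) \<le> \<epsilon> * norm (a - b)) \<longrightarrow>
     (\<exists>Y. (\<forall>x\<in>Y0. has_Wderiv (Y x) (\<lambda>t. f (Y x t) + B *v F (Y x t)) \<and> Y x 0 = x \<and> (\<forall>t\<ge>0. norm (Y x t) \<le> R) \<and>
             Wnorm (\<lambda>t. Y x t - ystar x t) \<le> L * \<epsilon> \<and> l2 HL (\<lambda>t. F (Y x t)) \<and>
             Jquad Q \<beta> (Y x) (\<lambda>t. F (Y x t)) \<le> Jquad Q \<beta> (ystar x) (\<lambda>t. Fs (ystar x t)) + L * \<epsilon>) \<and>
          (\<forall>x\<in>Y0. \<exists>d>0. \<forall>x'\<in>Y0. norm (x' - x) < d \<longrightarrow> Wnorm (\<lambda>t. Y x' t - Y x t) \<le> L * norm (x' - x)))"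
proof -
  have embed: "norm (y t) \<le> Ci * Wnorm y" if "inW y" "0 \<le> t" for y :: "real \<Rightarrow> real^'n" and t using emb that by blast
  note S = standing_assumption_1D[OF SA1]
  note Y0 = S(1,2) and NY = S(3,4) and M = S(5) and f0 = S(6) and Fs0 = S(7) and fd = S(8) and yM = S(9)
    and fl = S(10) and cl = S(11) and oc = S(12) and un = S(13)
  from S(14)[OF R_def] obtain DF :: "real^'n \<Rightarrow> real^'n \<Rightarrow> real^'m" and L2 where
    d1: "\<forall>x\<in>cball 0 R. (Fs has_derivative DF x) (at x within cball 0 R)" and
    d2: "\<forall>x\<in>cball 0 R. \<forall>y\<in>cball 0 R. onorm (\<lambda>h. DF x h - DF y h) \<le> L2 * dist x y" by (elim exE conjE)
  have DF: "(Fs has_derivative DF x) (at x within cball 0 R)" if "norm x \<le> R" for x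
    using d1 that by simp
  have DL: "onorm (\<lambda>h. DF x h - DF y h) \<le> L2 * dist x y" if "norm x \<le> R" "norm y \<le> R" for x y
    using d2 that by simp
  obtain L1 where L1: "\<And>x y. norm x \<le> R \<Longrightarrow> norm y \<le> R \<Longrightarrow> onorm (\<lambda>h. frechet_derivative f (at x) h - frechet_derivative f (at y) h) \<le> L1 * dist x y"
    using fl[OF compact_cball[of 0 R]] unfolding mem_cball_0 Ball_def by blast
  have R: "0 < R" using Ci mpos by (simp add: R_def)
  have fD: "(f has_derivative frechet_derivative f (at x)) (at x within cball 0 R)" for x
    by (rule has_derivative_at_withinI[OF frechet_derivative_works[THEN iffD1, OF fd]])
  define A where "A x h = frechet_derivative f (at x) h + B *v DF x h" for x h
  obtain K where K: "closed_loop f B Fs A DF Q \<beta> Ci R K"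
    using closed_loop_C11[where f = f and Df = "\<lambda>x. frechet_derivative f (at x)" and Fs = Fs and DF = DF and B = B and Q = Q,
        OF Ci embed beta R f0 Fs0 fD L1 DF DL] unfolding A_def[abs_def] by blast
  define \<rho>0 where "\<rho>0 = 3 / 4 * R"
  define Mc where "Mc = 2 * MY0 M Y0"
  interpret op: closed_loop_opt f B Fs A DF Q \<beta> Ci R K \<rho>0 Mc
    by (rule closed_loop_opt.intro[OF K closed_loop_opt_axioms.intro]) (use R mpos in \<open>auto simp: \<rho>0_def Mc_def\<close>)
  have Jeq: "op.real_cost y u = Jquad Q \<beta> y u" for y u by (simp add: op.real_cost_def Jquad_def)
  define sn where "sn = (SUP y\<in>Y0. norm y)"
  have m: "MY0 M Y0 = M * sn" by (simp add: MY0_def sn_def)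
  have sn: "0 < sn" using mpos M unfolding m by (simp add: zero_less_mult_iff)
  define N where "N = NY0 \<inter> ball 0 (3/2 * sn)"
  have Nopen: "open N" using NY by (auto simp: N_def)
  have Y0N: "Y0 \<subseteq> N"
  proof
    fix y assume y: "y \<in> Y0"
    have "M * norm y \<le> M * sn" using MY0_bounds(1)[OF Y0 M y] unfolding m .
    then have "norm y \<le> sn" using M by simp
    then show "y \<in> N" using NY y sn by (auto simp: N_def)
  qed
  have frF: "frechet_derivative Fs (at x) = DF x" if "norm x < R" for x
  proof -
    have "x \<in> interior (cball 0 R)" using that by (simp add: interior_cball)
    then have e: "at x within cball 0 R = at x" by (rule at_within_interior)
    have "(Fs has_derivative DF x) (at x)" using DF[OF less_imp_le[OF that]] unfolding e .
    then show ?thesis by (rule frechet_derivative_at[symmetric])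
  qed
  have C0: "0 < C" using A3 by (simp add: assumption_3_def)
  have opt: "op.opt y1 (ystar y1) C" if y1: "y1 \<in> N" for y1
    unfolding op.opt_def
  proof (intro conjI allI impI)
    have y1N: "y1 \<in> NY0" and y1n: "norm y1 < 3/2 * sn" using y1 by (auto simp: N_def)
    have d: "has_Wderiv (ystar y1) (\<lambda>t. op.G (ystar y1 t))" and y10: "ystar y1 0 = y1"
      using cl[OF y1N] by (auto simp: cl_sol_def op.G_def)
    show "has_Wderiv (ystar y1) (\<lambda>t. op.G (ystar y1 t))" "ystar y1 0 = y1" by fact+
    have W: "Wnorm (ystar y1) \<le> 3/2 * MY0 M Y0"
      using yM[OF y1N] mult_left_mono[OF less_imp_le[OF y1n] less_imp_le[OF M]] unfolding m by linarith
    show bd: "norm (ystar y1 t) \<le> \<rho>0" if "0 \<le> t" for t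
      using embed[OF inWI[OF d] that] mult_left_mono[OF W less_imp_le[OF Ci]] unfolding \<rho>0_def R_def by linarith
    show "l2n HL (ystar y1) \<le> Mc" using W l2n_le_Wnorm[of "ystar y1"] mpos by (simp add: Mc_def)
    have lin: "has_Wderiv z (\<lambda>t. A (ystar y1 t) (z t) + v t) \<longleftrightarrow> has_Wderiv z (\<lambda>t. frechet_derivative f (at (ystar y1 t)) (z t)
                       + B *v frechet_derivative Fs (at (ystar y1 t)) (z t) + v t)" for z v
    proof (rule has_Wderiv_cong[OF refl])
      fix t :: real assume "0 \<le> t"
      then have "norm (ystar y1 t) < R" using bd[of t] R by (simp add: \<rho>0_def)
      then show "A (ystar y1 t) (z t) + v t = frechet_derivative f (at (ystar y1 t)) (z t)
                       + B *v frechet_derivative Fs (at (ystar y1 t)) (z t) + v t" by (simp add: A_def frF)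
    qed
    show "op.lin_solvable (ystar y1) C" unfolding op.lin_solvable_def
    proof (intro conjI C0 allI impI)
      fix h and v :: "real \<Rightarrow> real^'n" assume v: "l2 HL v"
      obtain z where z: "lin_sol f B Fs (ystar y1) h v z"
         "\<And>z' t. lin_sol f B Fs (ystar y1) h v z' \<Longrightarrow> 0 \<le> t \<Longrightarrow> z' t = z t" "Wnorm z \<le> C * (L2norm v + norm h)"
        using A3 y1N v unfolding assumption_3_def sq_int_l2 by blast
      have z1: "has_Wderiv z (\<lambda>t. A (ystar y1 t) (z t) + v t)" "z 0 = h" using z(1) unfolding lin_sol_def lin by blast+
      then show "\<exists>z. has_Wderiv z (\<lambda>t. A (ystar y1 t) (z t) + v t) \<and> z 0 = h" by blast
      fix z' assume z': "has_Wderiv z' (\<lambda>t. A (ystar y1 t) (z' t) + v t) \<and> z' 0 = h"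
      then have "lin_sol f B Fs (ystar y1) h v z'" unfolding lin_sol_def lin by blast
      from z(2)[OF this] have "Wnorm z' = Wnorm z" using Wnorm_cong[OF z1(1), of z'] by simp
      then show "Wnorm z' \<le> C * (l2n HL v + norm h)" using z(3) by (simp add: L2norm_l2n)
    qed
    show "op.real_cost (ystar y1) (\<lambda>t. Fs (ystar y1 t)) \<le> op.real_cost y u" if fe: "feasible f B y1 y u" for y u
    proof -
      have "Jcost Q \<beta> (ystar y1) (\<lambda>t. Fs (ystar y1 t)) \<le> Jcost Q \<beta> y u" using oc[OF y1N] fe by (simp add: OCP_min_def)
      moreover have "feasible f B y1 (ystar y1) (\<lambda>t. Fs (ystar y1 t))" using oc[OF y1N] by (simp add: OCP_min_def)
      then have "l2 HL (ystar y1)" "l2 HL (\<lambda>t. Fs (ystar y1 t))" by (auto simp: op.feasible_iff dest: has_WderivD)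
      moreover have "l2 HL y" "l2 HL u" using fe by (auto simp: op.feasible_iff dest: has_WderivD)
      ultimately have "ennreal (Jquad Q \<beta> (ystar y1) (\<lambda>t. Fs (ystar y1 t))) \<le> ennreal (Jquad Q \<beta> y u)"
        using beta by (simp add: Jcost_eq_Jquad op.l2_Q)
      then show ?thesis unfolding Jeq using beta by (subst (asm) ennreal_le_iff) (auto intro: Jquad_nonneg)
    qed
    show "z t = ystar y1 t" if "has_Wderiv z (\<lambda>t. op.G (z t)) \<and> z 0 = y1" "0 \<le> t" for z t
      using un[OF y1N _ that(2), of z] that(1) by (simp add: cl_sol_def op.G_def)
  qed
  have zN: "0 \<in> N" using Y0N Y0 by blast
  show "\<exists>d>0. \<exists>L\<ge>0. \<forall>x'\<in>Y0. norm (x' - x) < d \<longrightarrow> Wnorm (\<lambda>t. ystar x' t - ystar x t) \<le> L * norm (x' - x)" if x: "x \<in> Y0" for x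
  proof (rule exI[of _ "op.rad C / (2 * C)"], rule conjI)
    show "0 < op.rad C / (2 * C)" using op.rad(1)[OF C0] C0 by simp
    show "\<exists>L\<ge>0. \<forall>x'\<in>Y0. norm (x' - x) < op.rad C / (2 * C) \<longrightarrow> Wnorm (\<lambda>t. ystar x' t - ystar x t) \<le> L * norm (x' - x)"
    proof (rule exI[of _ "2 * C"], rule conjI, use C0 in simp, intro ballI impI)
      fix x' assume x': "x' \<in> Y0" "norm (x' - x) < op.rad C / (2 * C)"
      have "C * norm (x' - x) \<le> op.rad C / 2" using x'(2) C0 by (simp add: field_simps)
      then show "Wnorm (\<lambda>t. ystar x' t - ystar x t) \<le> 2 * C * norm (x' - x)"
        by (intro op.flow_lipschitz opt) (use Y0N x x' in auto)
    qed
  qed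
  show "\<exists>K\<ge>0. \<forall>a b. norm a \<le> R \<longrightarrow> norm b \<le> R \<longrightarrow> norm (Fs a - Fs b) \<le> K * norm (a - b)"
    using op.Fs_lip op.K0 by blast
  show "\<exists>L d0. 0 < d0 \<and> 0 \<le> L \<and> (\<forall>y u d. feasible f B x y u \<and> (\<forall>t\<ge>0. norm (y t) \<le> R) \<and> 0 \<le> d \<and> d \<le> d0 \<and>
       Jquad Q \<beta> y u \<le> Jquad Q \<beta> (ystar x) (\<lambda>t. Fs (ystar x t)) + d \<longrightarrow>
       Wnorm (\<lambda>t. y t - ystar x t) \<le> L * sqrt d \<and> l2n HL (\<lambda>t. u t - Fs (ystar x t)) \<le> L * sqrt d)" if x: "x \<in> Y0" for x
  proof -
    have xN: "x \<in> N" using x Y0N by blast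
    obtain r C1 where r: "0 < r" "\<And>t x'. 0 \<le> t \<Longrightarrow> norm (x' - ystar x t) < r \<Longrightarrow> \<exists>c. op.opt x' c C1"
      using op.optimal_tube[OF Nopen zN opt xN] by blast
    show ?thesis using op.near_minimizer[OF opt[OF xN] r] unfolding Jeq .
  qed
  show "\<exists>\<epsilon>1>0. \<exists>L\<ge>0. \<forall>\<epsilon> F. 0 \<le> \<epsilon> \<and> \<epsilon> \<le> \<epsilon>1 \<and> F 0 = 0 \<and>
       (\<forall>a b. norm a \<le> R \<and> norm b \<le> R \<longrightarrow> norm ((F a - Fs a) - (F b - Fs b)) \<le> \<epsilon> * norm (a - b)) \<longrightarrow>
     (\<exists>Y. (\<forall>x\<in>Y0. has_Wderiv (Y x) (\<lambda>t. f (Y x t) + B *v F (Y x t)) \<and> Y x 0 = x \<and> (\<forall>t\<ge>0. norm (Y x t) \<le> R) \<and>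
             Wnorm (\<lambda>t. Y x t - ystar x t) \<le> L * \<epsilon> \<and> l2 HL (\<lambda>t. F (Y x t)) \<and>
             Jquad Q \<beta> (Y x) (\<lambda>t. F (Y x t)) \<le> Jquad Q \<beta> (ystar x) (\<lambda>t. Fs (ystar x t)) + L * \<epsilon>) \<and>
          (\<forall>x\<in>Y0. \<exists>d>0. \<forall>x'\<in>Y0. norm (x' - x) < d \<longrightarrow> Wnorm (\<lambda>t. Y x' t - Y x t) \<le> L * norm (x' - x)))"
    using op.ensemble_approx[where N = Y0 and ys = ystar, OF opt[OF subsetD[OF Y0N]] C0] unfolding Jeq by simp
qed

lemma loclip_Fnet:
  fixes \<theta> :: "('n::finite, 'm::finite) nnet"
  assumes "\<exists>\<sigma>'. continuous_on UNIV \<sigma>' \<and> (\<forall>x. (\<sigma> has_real_derivative \<sigma>' x) (at x))"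
  shows "loclip (Fnet \<sigma> hid \<theta>)"
  unfolding loclip_def using Fnet_regular(2,3)[OF assms] by blast

lemma ystar_bochner:
  fixes f :: "real^'n \<Rightarrow> real^'n" and B :: "real^'m^'n" and Fs :: "real^'n \<Rightarrow> real^'m"
  assumes beta: "0 < \<beta>" and Ci: "0 < Ci"
    and emb: "\<forall>y::real \<Rightarrow> real^'n. inW y \<longrightarrow> (\<forall>t\<ge>0. norm (y t) \<le> Ci * Wnorm y)"
    and SA1: "standing_assumption_1 f B Q \<beta> Y0 Ci NY0 Fs ystar M"
    and A3: "assumption_3 f B Fs NY0 ystar C"
    and mu: "prob_space \<mu>" "space \<mu> = Y0" "complete_measure \<mu>" "\<forall>A\<in>sets borel. A \<inter> Y0 \<in> sets \<mu>"
  shows "bochner_L2 \<mu> inW Wnorm ystar" "bochner_L2 \<mu> sq_int L2norm (\<lambda>x t. Fs (ystar x t))"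
    "\<And>x. x \<in> Y0 \<Longrightarrow> inW (ystar x) \<and> Wnorm (ystar x) \<le> MY0 M Y0 \<and> l2 HL (\<lambda>t. Fs (ystar x t))"
    "\<exists>c. \<forall>x\<in>Y0. L2norm (\<lambda>t. Fs (ystar x t)) \<le> c"
proof -
  have embed: "norm (y t) \<le> Ci * Wnorm y" if "inW y" "0 \<le> t" for y :: "real \<Rightarrow> real^'n" and t using emb that by blast
  note S = standing_assumption_1D[OF SA1]
  define R where "R = 2 * (Ci * MY0 M Y0)"
  have m0: "0 \<le> MY0 M Y0" by (rule MY0_bounds(2)[OF S(1,2,5)])
  have ne: "Y0 \<noteq> {}" using S(2) by blast
  have 1: "inW (ystar x)" "Wnorm (ystar x) \<le> MY0 M Y0" "l2 HL (\<lambda>t. Fs (ystar x t))" if x: "x \<in> Y0" for x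
  proof -
    have xN: "x \<in> NY0" using x S(4) by blast
    show "inW (ystar x)" using S(11)[OF xN] by (auto simp: cl_sol_def intro: inWI)
    show "Wnorm (ystar x) \<le> MY0 M Y0" using S(9)[OF xN] MY0_bounds(1)[OF S(1,2,5) x] by linarith
    show "l2 HL (\<lambda>t. Fs (ystar x t))" using S(12)[OF xN] by (simp add: OCP_min_def feasible_def sq_int_l2)
  qed
  then show "\<And>x. x \<in> Y0 \<Longrightarrow> inW (ystar x) \<and> Wnorm (ystar x) \<le> MY0 M Y0 \<and> l2 HL (\<lambda>t. Fs (ystar x t))" by blast
  have AE: "AE x in \<mu>. inW (ystar x)" "AE x in \<mu>. Wnorm (ystar x) \<le> MY0 M Y0" "AE x in \<mu>. sq_int (\<lambda>t. Fs (ystar x t))"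
    by (rule AE_I2; use 1 mu(2) in \<open>auto simp: sq_int_l2\<close>)+
  have key: "(\<forall>x\<in>Y0. \<exists>d>0. \<exists>L\<ge>0. \<forall>x'\<in>Y0. norm (x' - x) < d \<longrightarrow> Wnorm (\<lambda>t. ystar x' t - ystar x t) \<le> L * norm (x' - x)) \<and>
    (\<forall>x\<in>Y0. \<exists>d>0. \<exists>L\<ge>0. \<forall>x'\<in>Y0. norm (x' - x) < d \<longrightarrow> L2norm (\<lambda>t. Fs (ystar x' t) - Fs (ystar x t)) \<le> L * norm (x' - x)) \<and>
    (\<exists>c. \<forall>x\<in>Y0. L2norm (\<lambda>t. Fs (ystar x t)) \<le> c)"
  proof (cases "MY0 M Y0 = 0")
    case True
    have "x = 0" if "x \<in> Y0" for x using MY0_bounds(1)[OF S(1,2,5) that] True S(5) by (simp add: mult_le_0_iff)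
    then have Y00: "Y0 = {0}" using S(2) by auto
    have z: "Wnorm (\<lambda>t. ystar 0 t - ystar 0 t) = 0" using Wnorm_scaleR[OF 1(1)[OF S(2)], of 0] by simp
    have z2: "L2norm (\<lambda>t. Fs (ystar 0 t) - Fs (ystar 0 t)) = 0" by (simp add: L2norm_l2n l2n_def)
    have w: "\<exists>d>0::real. \<exists>L\<ge>0. \<forall>x'\<in>{0}. norm (x' - 0) < d \<longrightarrow> h x' \<le> L * norm (x' - 0)" if "h 0 = 0" for h :: "real^'n \<Rightarrow> real"
      using that by (intro exI[of _ 1] conjI exI[of _ 0]) auto
    show ?thesis unfolding Y00
      using w[of "\<lambda>x'. Wnorm (\<lambda>t. ystar x' t - ystar 0 t)", OF z] w[of "\<lambda>x'. L2norm (\<lambda>t. Fs (ystar x' t) - Fs (ystar 0 t))", OF z2]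
      by blast
  next
    case False
    then have mpos: "0 < MY0 M Y0" using m0 by simp
    note core = pointwise_estimates[OF beta Ci emb SA1 A3 mpos R_def]
    obtain K where K: "0 \<le> K" "\<And>a b. norm a \<le> R \<Longrightarrow> norm b \<le> R \<Longrightarrow> norm (Fs a - Fs b) \<le> K * norm (a - b)" using core(2) by blast
    have yR: "norm (ystar x t) \<le> R" if "x \<in> Y0" "0 \<le> t" for x t
    proof -
      have "Ci * Wnorm (ystar x) \<le> Ci * MY0 M Y0" using 1(2)[OF that(1)] Ci by (intro mult_left_mono) auto
      then show ?thesis using embed[OF 1(1)[OF that(1)] that(2)] mult_nonneg_nonneg[OF less_imp_le[OF Ci] m0] unfolding R_def by linarith
    qed
    have FL: "L2norm (\<lambda>t. Fs (ystar x' t) - Fs (ystar x t)) \<le> K * Wnorm (\<lambda>t. ystar x' t - ystar x t)" if "x \<in> Y0" "x' \<in> Y0" for x x'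
    proof -
      have "l2n HL (\<lambda>t. Fs (ystar x' t) - Fs (ystar x t)) \<le> K * l2n HL (\<lambda>t. ystar x' t - ystar x t)"
        by (rule lipschitz_l2(2)[OF 1(1)[OF that(2)] 1(1)[OF that(1)] yR[OF that(2)] yR[OF that(1)] K(2,1) S(7)])
      also have "\<dots> \<le> K * Wnorm (\<lambda>t. ystar x' t - ystar x t)" by (intro mult_left_mono l2n_le_Wnorm K)
      finally show ?thesis by (simp add: L2norm_l2n)
    qed
    have lip: "\<exists>d>0. \<exists>L\<ge>0. \<forall>x'\<in>Y0. norm (x' - x) < d \<longrightarrow> L2norm (\<lambda>t. Fs (ystar x' t) - Fs (ystar x t)) \<le> L * norm (x' - x)" if x: "x \<in> Y0" for x
    proof -
      obtain d L where d: "0 < d" "0 \<le> L" "\<And>x'. x' \<in> Y0 \<Longrightarrow> norm (x' - x) < d \<Longrightarrow> Wnorm (\<lambda>t. ystar x' t - ystar x t) \<le> L * norm (x' - x)"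
        using core(1)[OF x] by blast
      have "L2norm (\<lambda>t. Fs (ystar x' t) - Fs (ystar x t)) \<le> (K * L) * norm (x' - x)" if "x' \<in> Y0" "norm (x' - x) < d" for x'
        using FL[OF x that(1)] mult_left_mono[OF d(3)[OF that] K(1)] by (simp add: mult.assoc)
      then show ?thesis using d K(1) by (intro exI[of _ d] conjI exI[of _ "K * L"]) auto
    qed
    have bd: "L2norm (\<lambda>t. Fs (ystar x t)) \<le> K * MY0 M Y0" if x: "x \<in> Y0" for x
    proof -
      have z: "inW (\<lambda>t. 0::real^'n)" using inW_scaleR[OF 1(1)[OF x], of 0] by simp
      have R0: "0 \<le> R" using m0 Ci by (simp add: R_def)
      have "l2n HL (\<lambda>t. Fs (ystar x t) - Fs 0) \<le> K * l2n HL (\<lambda>t. ystar x t - 0)"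
        by (rule lipschitz_l2(2)[OF 1(1)[OF x] z yR[OF x] _ K(2,1) S(7)]) (use R0 in auto)
      also have "\<dots> \<le> K * MY0 M Y0" using 1(2)[OF x] l2n_le_Wnorm[of "ystar x"] K(1) by (intro mult_left_mono) auto
      finally show ?thesis by (simp add: L2norm_l2n S(7))
    qed
    show ?thesis using core(1) lip bd by blast
  qed
  then obtain c where c: "\<And>x. x \<in> Y0 \<Longrightarrow> L2norm (\<lambda>t. Fs (ystar x t)) \<le> c" by blast
  then show "\<exists>c. \<forall>x\<in>Y0. L2norm (\<lambda>t. Fs (ystar x t)) \<le> c" by blast
  have "strongly_meas \<mu> inW Wnorm ystar"
    by (rule W.strongly_meas_lipschitz[OF mu(2) S(1) ne mu(4) 1(1)]) (use key in blast)+
  then show "bochner_L2 \<mu> inW Wnorm ystar" by (rule W.bochner_L2_bounded[OF mu(3,1) _ AE(1,2)])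
  have "strongly_meas \<mu> sq_int L2norm (\<lambda>x t. Fs (ystar x t))"
    by (rule L2.strongly_meas_lipschitz[OF mu(2) S(1) ne mu(4)]) (use key 1(3) sq_int_l2 in blast)+
  moreover have "AE x in \<mu>. L2norm (\<lambda>t. Fs (ystar x t)) \<le> c" by (rule AE_I2) (use c mu(2) in auto)
  ultimately show "bochner_L2 \<mu> sq_int L2norm (\<lambda>x t. Fs (ystar x t))" by (intro L2.bochner_L2_bounded[OF mu(3,1) _ AE(3)])
qed

lemma jens_eq:
  fixes Q :: "real^'n^'n" and F :: "real^'n \<Rightarrow> real^'m"
  assumes "integrable \<mu> (\<lambda>x. Jquad Q \<beta> (Y x) (\<lambda>t. F (Y x t)))" "0 \<le> \<beta>"
    and l: "AE x in \<mu>. l2 HL (\<lambda>t. Q *v Y x t) \<and> l2 HL (\<lambda>t. F (Y x t))"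
  shows "jens \<mu> Q \<beta> F Y = ennreal (\<integral>x. Jquad Q \<beta> (Y x) (\<lambda>t. F (Y x t)) \<partial>\<mu>)"
proof -
  have "jens \<mu> Q \<beta> F Y = (\<integral>\<^sup>+x. ennreal (Jquad Q \<beta> (Y x) (\<lambda>t. F (Y x t))) \<partial>\<mu>)"
    unfolding jens_def by (rule nn_integral_cong_AE) (use l in \<open>eventually_elim, auto simp: Jcost_eq_Jquad assms(2)\<close>)
  also have "\<dots> = ennreal (\<integral>x. Jquad Q \<beta> (Y x) (\<lambda>t. F (Y x t)) \<partial>\<mu>)"
    by (rule nn_integral_eq_integral[OF assms(1)]) (simp add: Jquad_nonneg assms(2))
  finally show ?thesis .
qed

lemma ensemble_limit:
  fixes f :: "real^'n \<Rightarrow> real^'n" and B :: "real^'m^'n" and Q :: "real^'n^'n" and Fs :: "real^'n \<Rightarrow> real^'m"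
    and \<theta>\<epsilon> :: "real \<Rightarrow> ('n, 'm) nnet" and \<theta> :: "nat \<Rightarrow> ('n, 'm) nnet" and Y :: "nat \<Rightarrow> real^'n \<Rightarrow> real \<Rightarrow> real^'n"
  assumes beta: "0 < \<beta>" and Ci: "0 < Ci"
    and emb: "\<forall>y::real \<Rightarrow> real^'n. inW y \<longrightarrow> (\<forall>t\<ge>0. norm (y t) \<le> Ci * Wnorm y)"
    and SA1: "standing_assumption_1 f B Q \<beta> Y0 Ci NY0 Fs ystar M"
    and A3: "assumption_3 f B Fs NY0 ystar C"
    and mu: "prob_space \<mu>" "space \<mu> = Y0" "complete_measure \<mu>" "\<forall>A\<in>sets borel. A \<inter> Y0 \<in> sets \<mu>"
    and mpos: "0 < MY0 M Y0"
    and \<sigma>: "\<exists>\<sigma>'. continuous_on UNIV \<sigma>' \<and> (\<forall>x. (\<sigma> has_real_derivative \<sigma>' x) (at x))"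
    and approx: "\<forall>\<epsilon>>0. arch_ok (hid \<epsilon>) \<and> \<theta>\<epsilon> \<epsilon> \<in> params (hid \<epsilon>) \<and> Rad (hid \<epsilon>) \<eta>1 \<eta>2 (\<theta>\<epsilon> \<epsilon>) \<and>
                 eps_approx \<sigma> (hid \<epsilon>) Fs (2 * (Ci * MY0 M Y0)) \<epsilon> (\<theta>\<epsilon> \<epsilon>)"
    and eps2: "0 < \<epsilon>2" "\<forall>\<epsilon>. 0 < \<epsilon> \<and> \<epsilon> < \<epsilon>2 \<longrightarrow>
                 0 < sumsqW (hid \<epsilon>) (\<theta>\<epsilon> \<epsilon>) \<and> 0 < \<alpha> \<epsilon> \<and>
                 \<alpha> \<epsilon> \<le> \<epsilon> / (2 * sumsqW (hid \<epsilon>) (\<theta>\<epsilon> \<epsilon>))"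
    and eps_pos: "\<forall>k. 0 < eps k" and eps_lim: "eps \<longlonglongrightarrow> 0"
    and minimizers: "\<forall>k. net_min \<mu> f B Q \<beta> (MY0 M Y0) \<sigma> (hid (eps k)) \<eta>1 \<eta>2 (\<alpha> (eps k)) (\<theta> k) (Y k)"
  shows "\<And>k. integrable \<mu> (\<lambda>x. (Wnorm (\<lambda>t. Y k x t - ystar x t))\<^sup>2)"
    "\<And>k. integrable \<mu> (\<lambda>x. (L2norm (\<lambda>t. Fnet \<sigma> (hid (eps k)) (\<theta> k) (Y k x t) - Fs (ystar x t)))\<^sup>2)"
    "(\<lambda>k. \<integral>x. (Wnorm (\<lambda>t. Y k x t - ystar x t))\<^sup>2 \<partial>\<mu>) \<longlonglongrightarrow> 0"
    "(\<lambda>k. \<integral>x. (L2norm (\<lambda>t. Fnet \<sigma> (hid (eps k)) (\<theta> k) (Y k x t) - Fs (ystar x t)))\<^sup>2 \<partial>\<mu>) \<longlonglongrightarrow> 0"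
proof -
  interpret prob_space \<mu> by (rule mu(1))
  have embed: "norm (y t) \<le> Ci * Wnorm y" if "inW y" "0 \<le> t" for y :: "real \<Rightarrow> real^'n" and t using emb that by blast
  note S = standing_assumption_1D[OF SA1]
  note cm = mu(3)
  define m where "m = MY0 M Y0"
  define R where "R = 2 * (Ci * MY0 M Y0)"
  have m: "0 < m" using mpos by (simp add: m_def)
  note core = pointwise_estimates[OF beta Ci emb SA1 A3 mpos R_def]
  note ys = ystar_bochner[OF beta Ci emb SA1 A3 mu]
  have ysW: "inW (ystar x)" "Wnorm (ystar x) \<le> m" "l2 HL (\<lambda>t. Fs (ystar x t))" if "x \<in> Y0" for x
    using ys(3)[OF that] by (auto simp: m_def)
  have b0: "0 \<le> \<beta>" using beta by simp
  define F where "F k = Fnet \<sigma> (hid (eps k)) (\<theta> k)" for k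
  have F: "loclip (F k)" for k unfolding F_def by (rule loclip_Fnet[OF \<sigma>])
  have fL: "loclip f" by (rule loclip_C11[OF S(8,6,10)])
  have es: "ens_sol \<mu> f B m (F k) (Y k)" for k using minimizers by (simp add: net_min_def F_def m_def)
  have Ysm: "strongly_meas \<mu> inW Wnorm (Y k)" and YW: "AE x in \<mu>. inW (Y k x) \<and> Wnorm (Y k x) \<le> 2 * m" for k
    using es[of k] by (auto simp: ens_sol_def)
  have YinW: "AE x in \<mu>. inW (Y k x)" for k using YW[of k] by eventually_elim simp
  have sol: "AE x in \<mu>. has_Wderiv (Y k x) (\<lambda>t. f (Y k x t) + B *v F k (Y k x t)) \<and> Y k x 0 = x" for k
    by (rule ens_sol_AE_solution[OF mu(1) es])
      (use loclip_l2[OF Ci emb fL] loclip_l2[OF Ci emb loclip_matrix_comp[OF F]] in blast)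
  define J where "J k x = Jquad Q \<beta> (Y k x) (\<lambda>t. F k (Y k x t))" for k x
  define V where "V x = Jquad Q \<beta> (ystar x) (\<lambda>t. Fs (ystar x t))" for x
  have QL: "loclip ((*v) Q)" by (rule loclip_matrix)
  have bnd: "\<exists>c\<ge>0. \<forall>y. inW y \<and> Wnorm y \<le> r \<longrightarrow> l2n HL (\<lambda>t. H (y t)) \<le> c" if H: "loclip H" for H :: "real^'n \<Rightarrow> real^'k" and r
  proof -
    obtain L where L: "0 \<le> L" "\<And>a b. norm a \<le> Ci * \<bar>r\<bar> \<Longrightarrow> norm b \<le> Ci * \<bar>r\<bar> \<Longrightarrow> norm (H a - H b) \<le> L * norm (a - b)"
      using loclipD[OF H, of "Ci * \<bar>r\<bar>"] by blast
    have H0: "H 0 = 0" using H by (simp add: loclip_def)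
    have "l2n HL (\<lambda>t. H (y t)) \<le> L * \<bar>r\<bar>" if y: "inW y" "Wnorm y \<le> r" for y
    proof -
      have z: "inW (\<lambda>t. 0::real^'n)" using inW_scaleR[OF y(1), of 0] by simp
      have "Ci * Wnorm y \<le> Ci * \<bar>r\<bar>" using y(2) Ci by (intro mult_left_mono) auto
      then have yb: "norm (y t) \<le> Ci * \<bar>r\<bar>" if "0 \<le> t" for t using embed[OF y(1) that] by linarith
      have "l2n HL (\<lambda>t. H (y t) - H 0) \<le> L * l2n HL (\<lambda>t. y t - 0)"
        by (rule lipschitz_l2(2)[OF y(1) z yb _ L(2,1) H0]) (use Ci in auto)
      also have "\<dots> \<le> L * \<bar>r\<bar>" using l2n_le_Wnorm[of y] y(2) L(1) by (intro mult_left_mono) auto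
      finally show ?thesis by (simp add: H0)
    qed
    then show ?thesis using L(1) by (intro exI[of _ "L * \<bar>r\<bar>"]) auto
  qed
  have Jbd: "Jquad Q \<beta> y u \<le> (a\<^sup>2 + \<beta> * b\<^sup>2) / 2" if "l2n HL (\<lambda>t. Q *v y t) \<le> a" "l2n HL u \<le> b" for y u a b
    unfolding Jquad_def using that b0 by (intro divide_right_mono add_mono mult_left_mono power_mono) auto
  have Jm: "J k \<in> borel_measurable \<mu>" for k
  proof -
    have "(\<lambda>x. L2norm (\<lambda>t. Q *v Y k x t)) \<in> borel_measurable \<mu>" "(\<lambda>x. L2norm (\<lambda>t. F k (Y k x t))) \<in> borel_measurable \<mu>"
      by (intro measurable_nemytskii_norm[OF Ci emb cm Ysm YinW] QL F)+
    then show ?thesis unfolding J_def[abs_def] Jquad_def L2norm_l2n by measurable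
  qed
  have J0: "0 \<le> J k x" for k x by (simp add: J_def Jquad_nonneg b0)
  have Jint: "integrable \<mu> (J k)" for k
  proof -
    obtain a where a: "\<And>y. inW y \<and> Wnorm y \<le> 2 * m \<Longrightarrow> l2n HL (\<lambda>t. Q *v y t) \<le> a" using bnd[OF QL, of "2 * m"] by blast
    obtain b where b: "\<And>y. inW y \<and> Wnorm y \<le> 2 * m \<Longrightarrow> l2n HL (\<lambda>t. F k (y t)) \<le> b" using bnd[OF F, of "2 * m" k] by blast
    have "AE x in \<mu>. norm (J k x) \<le> (a\<^sup>2 + \<beta> * b\<^sup>2) / 2"
      using YW[of k]
    proof eventually_elim
      case (elim x)
      show ?case using Jbd[OF a[OF elim] b[OF elim]] J0[of k x] by (simp add: J_def)
    qed
    then show ?thesis by (rule integrable_const_bound) (rule Jm)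
  qed
  have Vm: "V \<in> borel_measurable \<mu>"
  proof -
    have "(\<lambda>x. L2norm (\<lambda>t. Q *v ystar x t)) \<in> borel_measurable \<mu>"
      by (rule measurable_nemytskii_norm[OF Ci emb cm _ _ QL]) (use ys(1) in \<open>auto simp: bochner_L2_def\<close>)
    moreover have "(\<lambda>x. L2norm (\<lambda>t. Fs (ystar x t))) \<in> borel_measurable \<mu>" using L2.nrm_l2(1)[OF ys(2)] by auto
    ultimately show ?thesis unfolding V_def[abs_def] Jquad_def L2norm_l2n by measurable
  qed
  obtain Vb where Vb: "\<And>x. x \<in> Y0 \<Longrightarrow> V x \<le> Vb"
  proof -
    obtain a where a: "\<And>y. inW y \<and> Wnorm y \<le> m \<Longrightarrow> l2n HL (\<lambda>t. Q *v y t) \<le> a" using bnd[OF QL, of m] by blast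
    obtain c where c: "\<And>x. x \<in> Y0 \<Longrightarrow> l2n HL (\<lambda>t. Fs (ystar x t)) \<le> c" using ys(4) unfolding L2norm_l2n by blast
    show thesis
    proof (rule that)
      show "V x \<le> (a\<^sup>2 + \<beta> * c\<^sup>2) / 2" if "x \<in> Y0" for x
        unfolding V_def by (rule Jbd) (use a c ysW that in auto)
    qed
  qed
  have V0: "0 \<le> V x" for x by (simp add: V_def Jquad_nonneg b0)
  have Vint: "integrable \<mu> V"
  proof (rule integrable_const_bound[where B = Vb])
    show "AE x in \<mu>. norm (V x) \<le> Vb" by (rule AE_I2) (use Vb V0 mu(2) in simp)
  qed (rule Vm)
  have spY: "AE x in \<mu>. x \<in> Y0" by (rule AE_I2) (simp add: mu(2))
  have lF: "l2 HL (\<lambda>t. F k (y t))" "l2 HL (\<lambda>t. Q *v y t)" if "inW y" for k y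
    by (rule loclip_l2[OF Ci emb F that], rule loclip_l2[OF Ci emb QL that])
  have fe: "AE x in \<mu>. feasible f B x (Y k x) (\<lambda>t. F k (Y k x t)) \<and> (\<forall>t\<ge>0. norm (Y k x t) \<le> R) \<and> inW (Y k x) \<and> Wnorm (Y k x) \<le> 2 * m" for k
    using sol[of k] YW[of k]
  proof eventually_elim
    case (elim x)
    have "norm (Y k x t) \<le> R" if "0 \<le> t" for t
    proof -
      have "Ci * Wnorm (Y k x) \<le> Ci * (2 * m)" using elim Ci by (intro mult_left_mono) auto
      then show ?thesis using embed[of "Y k x" t] elim that unfolding R_def m_def by linarith
    qed
    then show ?case using elim lF(1)[of "Y k x" k] by (simp add: feasible_def sq_int_l2)
  qed
  have JV: "AE x in \<mu>. V x \<le> J k x" for k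
    using fe[of k] spY
  proof eventually_elim
    case (elim x)
    have "Jcost Q \<beta> (ystar x) (\<lambda>t. Fs (ystar x t)) \<le> Jcost Q \<beta> (Y k x) (\<lambda>t. F k (Y k x t))"
      using S(12)[of x] S(4) elim by (auto simp: OCP_min_def)
    then have "ennreal (V x) \<le> ennreal (J k x)"
      using Jcost_eq_Jquad[OF lF(2)[OF ysW(1)[OF elim(2)]] ysW(3)[OF elim(2)] b0]
        Jcost_eq_Jquad[OF lF(2)[of "Y k x"] lF(1)[of "Y k x" k] b0] elim by (simp add: V_def J_def)
    then show ?case using J0 by (subst (asm) ennreal_le_iff) auto
  qed
  define a where "a k x = Wnorm (\<lambda>t. Y k x t - ystar x t)" for k x
  define b where "b k x = L2norm (\<lambda>t. F k (Y k x t) - Fs (ystar x t))" for k x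
  have am: "a k \<in> borel_measurable \<mu>" for k
  proof -
    have "AE x in \<mu>. Wnorm (Y k x) \<le> 2 * m" using YW[of k] by eventually_elim simp
    then show ?thesis unfolding a_def
      by (intro W.measurable_ip(2)[OF cm _ ys(1)] W.bochner_L2_bounded[OF cm mu(1) Ysm YinW])
  qed
  have bm: "b k \<in> borel_measurable \<mu>" for k
    unfolding b_def by (rule measurable_nemytskii(2)[OF Ci emb cm Ysm YinW F]) (use ys(2) in \<open>auto simp: bochner_L2_def\<close>)
  obtain \<epsilon>1 L where e1: "0 < \<epsilon>1" "0 \<le> L" and ens: "\<forall>\<epsilon> F. 0 \<le> \<epsilon> \<and> \<epsilon> \<le> \<epsilon>1 \<and> F 0 = 0 \<and>
       (\<forall>a b. norm a \<le> R \<and> norm b \<le> R \<longrightarrow> norm ((F a - Fs a) - (F b - Fs b)) \<le> \<epsilon> * norm (a - b)) \<longrightarrow>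
     (\<exists>Y. (\<forall>x\<in>Y0. has_Wderiv (Y x) (\<lambda>t. f (Y x t) + B *v F (Y x t)) \<and> Y x 0 = x \<and> (\<forall>t\<ge>0. norm (Y x t) \<le> R) \<and>
             Wnorm (\<lambda>t. Y x t - ystar x t) \<le> L * \<epsilon> \<and> l2 HL (\<lambda>t. F (Y x t)) \<and>
             Jquad Q \<beta> (Y x) (\<lambda>t. F (Y x t)) \<le> Jquad Q \<beta> (ystar x) (\<lambda>t. Fs (ystar x t)) + L * \<epsilon>) \<and>
          (\<forall>x\<in>Y0. \<exists>d>0. \<forall>x'\<in>Y0. norm (x' - x) < d \<longrightarrow> Wnorm (\<lambda>t. Y x' t - Y x t) \<le> L * norm (x' - x)))"
    using core(4) by (elim exE conjE)
  have Fsd: "Fs differentiable (at x within cball 0 R)" if "norm x \<le> R" for x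
    using S(14)[OF R_def] that unfolding differentiable_def by auto
  have compare: "(\<integral>x. J k x \<partial>\<mu>) \<le> (\<integral>x. V x \<partial>\<mu>) + (L + 1) * eps k" if small: "eps k < \<epsilon>2" "eps k \<le> \<epsilon>1" "L * eps k \<le> m" for k
  proof -
    define \<epsilon> where "\<epsilon> = eps k"
    have \<epsilon>: "0 < \<epsilon>" using eps_pos by (simp add: \<epsilon>_def)
    define F' where "F' = Fnet \<sigma> (hid \<epsilon>) (\<theta>\<epsilon> \<epsilon>)"
    have ap: "\<theta>\<epsilon> \<epsilon> \<in> params (hid \<epsilon>)" "Rad (hid \<epsilon>) \<eta>1 \<eta>2 (\<theta>\<epsilon> \<epsilon>)" "eps_approx \<sigma> (hid \<epsilon>) Fs R \<epsilon> (\<theta>\<epsilon> \<epsilon>)"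
      using approx \<epsilon> unfolding R_def by blast+
    have F'lip: "norm ((F' a - Fs a) - (F' b - Fs b)) \<le> \<epsilon> * norm (a - b)" if "norm a \<le> R" "norm b \<le> R" for a b
      unfolding F'_def by (rule eps_approx_lipschitz[OF \<sigma> Fsd ap(3) that])
    have F'0: "F' 0 = 0" unfolding F'_def by (rule Fnet_regular(2)[OF \<sigma>])
    have F'L: "loclip F'" unfolding F'_def by (rule loclip_Fnet[OF \<sigma>])
    have "\<exists>Y. (\<forall>x\<in>Y0. has_Wderiv (Y x) (\<lambda>t. f (Y x t) + B *v F' (Y x t)) \<and> Y x 0 = x \<and> (\<forall>t\<ge>0. norm (Y x t) \<le> R) \<and>
             Wnorm (\<lambda>t. Y x t - ystar x t) \<le> L * \<epsilon> \<and> l2 HL (\<lambda>t. F' (Y x t)) \<and>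
             Jquad Q \<beta> (Y x) (\<lambda>t. F' (Y x t)) \<le> Jquad Q \<beta> (ystar x) (\<lambda>t. Fs (ystar x t)) + L * \<epsilon>) \<and>
          (\<forall>x\<in>Y0. \<exists>d>0. \<forall>x'\<in>Y0. norm (x' - x) < d \<longrightarrow> Wnorm (\<lambda>t. Y x' t - Y x t) \<le> L * norm (x' - x))"
      using F'lip F'0 \<epsilon> small by (intro ens[rule_format]) (simp add: \<epsilon>_def)
    then obtain Y' where Y'0: "\<forall>x\<in>Y0. has_Wderiv (Y' x) (\<lambda>t. f (Y' x t) + B *v F' (Y' x t)) \<and> Y' x 0 = x \<and> (\<forall>t\<ge>0. norm (Y' x t) \<le> R) \<and>
             Wnorm (\<lambda>t. Y' x t - ystar x t) \<le> L * \<epsilon> \<and> l2 HL (\<lambda>t. F' (Y' x t)) \<and>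
             Jquad Q \<beta> (Y' x) (\<lambda>t. F' (Y' x t)) \<le> Jquad Q \<beta> (ystar x) (\<lambda>t. Fs (ystar x t)) + L * \<epsilon>"
      and Y'c: "\<forall>x\<in>Y0. \<exists>d>0. \<forall>x'\<in>Y0. norm (x' - x) < d \<longrightarrow> Wnorm (\<lambda>t. Y' x' t - Y' x t) \<le> L * norm (x' - x)" by (elim exE conjE)
    have Y': "has_Wderiv (Y' x) (\<lambda>t. f (Y' x t) + B *v F' (Y' x t))" "Y' x 0 = x" "Wnorm (\<lambda>t. Y' x t - ystar x t) \<le> L * \<epsilon>"
      "l2 HL (\<lambda>t. F' (Y' x t))" "Jquad Q \<beta> (Y' x) (\<lambda>t. F' (Y' x t)) \<le> V x + L * \<epsilon>" if "x \<in> Y0" for x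
      using Y'0 that unfolding V_def by blast+
    have Y'W: "inW (Y' x)" if "x \<in> Y0" for x using inWI[OF Y'(1)[OF that]] .
    have Y'n: "Wnorm (Y' x) \<le> 2 * m" if "x \<in> Y0" for x
      using Wnorm_le_diff[OF Y'W[OF that] ysW(1)[OF that]] ysW(2)[OF that] Y'(3)[OF that] small(3) unfolding \<epsilon>_def by linarith
    have ne: "Y0 \<noteq> {}" using S(2) by blast
    have "strongly_meas \<mu> inW Wnorm Y'"
      by (rule W.strongly_meas_lipschitz[OF mu(2) S(1) ne mu(4) Y'W]) (use Y'c e1(2) in blast)+
    moreover have "AE x in \<mu>. inW (Y' x) \<and> Wnorm (Y' x) \<le> 2 * m" by (rule AE_I2) (use Y'W Y'n mu(2) in simp)
    moreover have "integrable \<mu> (\<lambda>x. aform f B F' (Y' x) x (\<Phi> x)) \<and> (\<integral>x. aform f B F' (Y' x) x (\<Phi> x) \<partial>\<mu>) = 0" for \<Phi>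
    proof -
      have z: "aform f B F' (Y' x) x (\<Phi> x) = 0" if "x \<in> space \<mu>" for x
        by (rule solution_imp_aform_zero) (use Y' that mu(2) in auto)
      have "integrable \<mu> (\<lambda>x. aform f B F' (Y' x) x (\<Phi> x)) = integrable \<mu> (\<lambda>x. 0::real)"
        "(\<integral>x. aform f B F' (Y' x) x (\<Phi> x) \<partial>\<mu>) = (\<integral>x. 0 \<partial>\<mu>)"
        by (rule Bochner_Integration.integrable_cong[OF refl z], assumption, rule Bochner_Integration.integral_cong[OF refl z])
      then show ?thesis by simp
    qed
    ultimately have es': "ens_sol \<mu> f B m F' Y'" unfolding ens_sol_def by blast
    have min: "jens \<mu> Q \<beta> (F k) (Y k) + Greg (hid \<epsilon>) \<eta>1 \<eta>2 (\<alpha> \<epsilon>) (\<theta> k) \<le> jens \<mu> Q \<beta> F' Y' + Greg (hid \<epsilon>) \<eta>1 \<eta>2 (\<alpha> \<epsilon>) (\<theta>\<epsilon> \<epsilon>)"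
      using minimizers ap(1) es' unfolding net_min_def F_def F'_def \<epsilon>_def m_def by blast
    have jk: "jens \<mu> Q \<beta> (F k) (Y k) = ennreal (\<integral>x. J k x \<partial>\<mu>)"
      unfolding J_def
    proof (rule jens_eq[OF _ b0])
      show "integrable \<mu> (\<lambda>x. Jquad Q \<beta> (Y k x) (\<lambda>t. F k (Y k x t)))" using Jint[of k] unfolding J_def .
      show "AE x in \<mu>. l2 HL (\<lambda>t. Q *v Y k x t) \<and> l2 HL (\<lambda>t. F k (Y k x t))"
        using YinW[of k] by eventually_elim (simp add: lF)
    qed
    have jp: "jens \<mu> Q \<beta> F' Y' \<le> ennreal ((\<integral>x. V x \<partial>\<mu>) + L * \<epsilon>)"
    proof -
      have "jens \<mu> Q \<beta> F' Y' \<le> (\<integral>\<^sup>+x. ennreal (V x + L * \<epsilon>) \<partial>\<mu>)" unfolding jens_def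
      proof (rule nn_integral_mono)
        fix x assume "x \<in> space \<mu>"
        then have x: "x \<in> Y0" by (simp add: mu(2))
        show "Jcost Q \<beta> (Y' x) (\<lambda>t. F' (Y' x t)) \<le> ennreal (V x + L * \<epsilon>)"
          unfolding Jcost_eq_Jquad[OF lF(2)[OF Y'W[OF x]] Y'(4)[OF x] b0] by (rule ennreal_leI[OF Y'(5)[OF x]])
      qed
      also have "\<dots> = ennreal (\<integral>x. V x + L * \<epsilon> \<partial>\<mu>)"
        by (rule nn_integral_eq_integral) (use Vint V0 e1(2) \<epsilon> in \<open>auto intro: add_nonneg_nonneg\<close>)
      also have "(\<integral>x. V x + L * \<epsilon> \<partial>\<mu>) = (\<integral>x. V x \<partial>\<mu>) + L * \<epsilon>" using Vint by (simp add: prob_space)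
      finally show ?thesis .
    qed
    have G: "Greg (hid \<epsilon>) \<eta>1 \<eta>2 (\<alpha> \<epsilon>) (\<theta>\<epsilon> \<epsilon>) \<le> ennreal (\<epsilon> / 2)"
    proof -
      have s: "0 < sumsqW (hid \<epsilon>) (\<theta>\<epsilon> \<epsilon>)" "\<alpha> \<epsilon> \<le> \<epsilon> / (2 * sumsqW (hid \<epsilon>) (\<theta>\<epsilon> \<epsilon>))" using eps2(2) \<epsilon> small(1) by (auto simp: \<epsilon>_def)
      have "\<alpha> \<epsilon> * sumsqW (hid \<epsilon>) (\<theta>\<epsilon> \<epsilon>) \<le> \<epsilon> / (2 * sumsqW (hid \<epsilon>) (\<theta>\<epsilon> \<epsilon>)) * sumsqW (hid \<epsilon>) (\<theta>\<epsilon> \<epsilon>)"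
        using s by (intro mult_right_mono) auto
      also have "\<dots> = \<epsilon> / 2" using s by simp
      finally show ?thesis using ap(2) by (simp add: Greg_def ennreal_leI)
    qed
    have VL: "0 \<le> (\<integral>x. V x \<partial>\<mu>) + L * \<epsilon>" using V0 e1(2) \<epsilon> by (intro add_nonneg_nonneg integral_nonneg) auto
    have "ennreal (\<integral>x. J k x \<partial>\<mu>) \<le> jens \<mu> Q \<beta> (F k) (Y k) + Greg (hid \<epsilon>) \<eta>1 \<eta>2 (\<alpha> \<epsilon>) (\<theta> k)" unfolding jk by simp
    also note min
    also have "jens \<mu> Q \<beta> F' Y' + Greg (hid \<epsilon>) \<eta>1 \<eta>2 (\<alpha> \<epsilon>) (\<theta>\<epsilon> \<epsilon>) \<le> ennreal ((\<integral>x. V x \<partial>\<mu>) + L * \<epsilon>) + ennreal (\<epsilon> / 2)"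
      by (intro add_mono jp G)
    also have "\<dots> = ennreal ((\<integral>x. V x \<partial>\<mu>) + L * \<epsilon> + \<epsilon> / 2)" using VL \<epsilon> by (intro ennreal_plus[symmetric]) auto
    finally have "(\<integral>x. J k x \<partial>\<mu>) \<le> (\<integral>x. V x \<partial>\<mu>) + L * \<epsilon> + \<epsilon> / 2" using VL \<epsilon> by (subst (asm) ennreal_le_iff) auto
    then show ?thesis using \<epsilon> unfolding \<epsilon>_def by (simp add: distrib_right)
  qed
  define ok where "ok k \<longleftrightarrow> eps k < \<epsilon>2 \<and> eps k \<le> \<epsilon>1 \<and> L * eps k \<le> m" for k
  define \<delta> where "\<delta> k = (if ok k then (L + 1) * eps k else (\<integral>x. J k x \<partial>\<mu>) - (\<integral>x. V x \<partial>\<mu>))" for k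
  have \<delta>lim: "\<delta> \<longlonglongrightarrow> 0"
  proof -
    have "(\<lambda>k. (L + 1) * eps k) \<longlonglongrightarrow> (L + 1) * 0" by (intro tendsto_intros eps_lim)
    then have l: "(\<lambda>k. (L + 1) * eps k) \<longlonglongrightarrow> 0" by simp
    have "(\<lambda>k. L * eps k) \<longlonglongrightarrow> L * 0" by (intro tendsto_intros eps_lim)
    then have "eventually (\<lambda>k. L * eps k < m) sequentially" using m by (intro order_tendstoD(2)) auto
    moreover have "eventually (\<lambda>k. eps k < \<epsilon>2) sequentially" "eventually (\<lambda>k. eps k < \<epsilon>1) sequentially"
      by (rule order_tendstoD(2)[OF eps_lim], use eps2 e1 in simp)+
    ultimately have "eventually (\<lambda>k. (L + 1) * eps k = \<delta> k) sequentially"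
      by eventually_elim (simp add: \<delta>_def ok_def)
    then show ?thesis using l by (rule Lim_transform_eventually[rotated])
  qed
  have \<delta>: "(\<integral>x. J k x \<partial>\<mu>) \<le> (\<integral>x. V x \<partial>\<mu>) + \<delta> k" for k
    using compare[of k] by (auto simp: \<delta>_def ok_def)
  have near: "AE x in \<mu>. \<exists>L d0. 0 < d0 \<and> 0 \<le> L \<and> (\<forall>k. J k x - V x \<le> d0 \<longrightarrow> a k x \<le> L * sqrt (J k x - V x) \<and> b k x \<le> L * sqrt (J k x - V x))"
  proof -
    have "AE x in \<mu>. \<forall>k. feasible f B x (Y k x) (\<lambda>t. F k (Y k x t)) \<and> (\<forall>t\<ge>0. norm (Y k x t) \<le> R)"
      unfolding AE_all_countable using fe by (auto elim: AE_mp)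
    moreover have "AE x in \<mu>. \<forall>k. V x \<le> J k x" unfolding AE_all_countable using JV by blast
    ultimately show ?thesis using spY
    proof eventually_elim
      case (elim x)
      obtain L d0 where L: "0 < d0" "0 \<le> L" and n: "\<forall>y u d. feasible f B x y u \<and> (\<forall>t\<ge>0. norm (y t) \<le> R) \<and> 0 \<le> d \<and> d \<le> d0 \<and>
       Jquad Q \<beta> y u \<le> Jquad Q \<beta> (ystar x) (\<lambda>t. Fs (ystar x t)) + d \<longrightarrow>
       Wnorm (\<lambda>t. y t - ystar x t) \<le> L * sqrt d \<and> l2n HL (\<lambda>t. u t - Fs (ystar x t)) \<le> L * sqrt d"
        using core(3)[OF elim(3)] by (elim exE conjE)
      have "a k x \<le> L * sqrt (J k x - V x) \<and> b k x \<le> L * sqrt (J k x - V x)" if "J k x - V x \<le> d0" for k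
      proof -
        have "feasible f B x (Y k x) (\<lambda>t. F k (Y k x t)) \<and> (\<forall>t\<ge>0. norm (Y k x t) \<le> R) \<and> 0 \<le> J k x - V x \<and> J k x - V x \<le> d0 \<and>
          Jquad Q \<beta> (Y k x) (\<lambda>t. F k (Y k x t)) \<le> Jquad Q \<beta> (ystar x) (\<lambda>t. Fs (ystar x t)) + (J k x - V x)"
          using elim that by (simp add: J_def V_def)
        from n[rule_format, OF this] show ?thesis by (simp add: a_def b_def L2norm_l2n)
      qed
      then show ?case using L by blast
    qed
  qed
  have abd: "AE x in \<mu>. a k x \<le> 3 * m" for k
    using fe[of k] spY
  proof eventually_elim
    case (elim x)
    then show ?case using W.nrm_diff_le[of "Y k x" "ystar x"] ysW[OF elim(2)] unfolding a_def by linarith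
  qed
  have bbd: "AE x in \<mu>. (b k x)\<^sup>2 \<le> 4 / \<beta> * (J k x - V x) + 8 / \<beta> * Vb" for k
    using fe[of k] spY
  proof eventually_elim
    case (elim x)
    define p where "p = l2n HL (\<lambda>t. F k (Y k x t))"
    define q where "q = l2n HL (\<lambda>t. Fs (ystar x t))"
    have "b k x \<le> p + q" unfolding b_def L2norm_l2n p_def q_def
      by (rule l2_diff(2)) (use elim lF ysW in auto)
    then have "(b k x)\<^sup>2 \<le> (p + q)\<^sup>2" by (intro power_mono) (auto simp: b_def L2norm_l2n)
    also have "\<dots> \<le> 2 * p\<^sup>2 + 2 * q\<^sup>2" using zero_le_power2[of "p - q"] unfolding power2_sum power2_diff by linarith
    also have "\<dots> \<le> 2 * (2 / \<beta> * J k x) + 2 * (2 / \<beta> * V x)"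
    proof -
      have "\<beta> * p\<^sup>2 \<le> 2 * J k x" "\<beta> * q\<^sup>2 \<le> 2 * V x" by (simp_all add: J_def V_def Jquad_def p_def q_def)
      then have "p\<^sup>2 \<le> 2 / \<beta> * J k x" "q\<^sup>2 \<le> 2 / \<beta> * V x" using beta by (simp_all add: field_simps)
      then show ?thesis by linarith
    qed
    also have "\<dots> = 4 / \<beta> * (J k x - V x) + 8 / \<beta> * V x" using beta by (simp add: field_simps)
    also have "\<dots> \<le> 4 / \<beta> * (J k x - V x) + 8 / \<beta> * Vb" using Vb[OF elim(2)] beta by (intro add_left_mono mult_left_mono) auto
    finally show ?case .
  qed
  have a0: "0 \<le> a k x" "0 \<le> b k x" for k x by (auto simp: a_def b_def L2norm_l2n)
  have c1: "0 \<le> 4 / \<beta>" using beta by simp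
  note res = AE_convergence_from_costs[OF mu(1) Jint Vint JV \<delta>lim \<delta> am bm a0 near abd bbd c1]
  show "integrable \<mu> (\<lambda>x. (Wnorm (\<lambda>t. Y k x t - ystar x t))\<^sup>2)" for k using res(1)[of k] by (simp add: a_def)
  show "integrable \<mu> (\<lambda>x. (L2norm (\<lambda>t. Fnet \<sigma> (hid (eps k)) (\<theta> k) (Y k x t) - Fs (ystar x t)))\<^sup>2)" for k
    using res(2)[of k] by (simp add: b_def F_def)
  show "(\<lambda>k. \<integral>x. (Wnorm (\<lambda>t. Y k x t - ystar x t))\<^sup>2 \<partial>\<mu>) \<longlonglongrightarrow> 0" using res(3) by (simp add: a_def)
  show "(\<lambda>k. \<integral>x. (L2norm (\<lambda>t. Fnet \<sigma> (hid (eps k)) (\<theta> k) (Y k x t) - Fs (ystar x t)))\<^sup>2 \<partial>\<mu>) \<longlonglongrightarrow> 0"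
    using res(4) by (simp add: b_def F_def)
qed

lemma has_Wderiv_AE_cong:
  fixes y :: "real \<Rightarrow> 'a::euclidean_space"
  assumes "has_Wderiv y a" "l2 HL b" "AE t in HL. a t = b t"
  shows "has_Wderiv y b"
proof -
  have eq: "set_lebesgue_integral lborel {0..t} a = set_lebesgue_integral lborel {0..t} b" if "0 \<le> t" for t
    unfolding set_lebesgue_integral_def
  proof (rule integral_cong_AE)
    show "(\<lambda>s. indicator {0..t} s *\<^sub>R a s) \<in> borel_measurable lborel" "(\<lambda>s. indicator {0..t} s *\<^sub>R b s) \<in> borel_measurable lborel"
      using l2_HL_set_integrable[OF has_WderivD(2)[OF assms(1)], of 0 t] l2_HL_set_integrable[OF assms(2), of 0 t]
      by (auto simp: set_integrable_def dest: borel_measurable_integrable)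
    show "AE s in lborel. indicator {0..t} s *\<^sub>R a s = indicator {0..t} s *\<^sub>R b s"
      using assms(3)[unfolded AE_HL] by eventually_elim (auto split: split_indicator)
  qed
  show ?thesis unfolding has_Wderiv_l2
    by (intro conjI allI impI assms(2) has_WderivD(1)[OF assms(1)]) (subst eq[symmetric], assumption, rule has_WderivD(3)[OF assms(1)])
qed

lemma OCP_min_AE_cong:
  fixes f :: "real^'n \<Rightarrow> real^'n" and B :: "real^'m^'n"
  assumes m: "OCP_min f B Q \<beta> x y u" and z: "\<And>t. 0 \<le> t \<Longrightarrow> z t = y t" and v: "l2 HL v" "AE t in HL. u t = v t"
  shows "OCP_min f B Q \<beta> x z v"
proof -
  have d: "has_Wderiv y (\<lambda>t. f (y t) + B *v u t)" and u: "l2 HL u" and y0: "y 0 = x"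
    and opt: "\<And>y' u'. feasible f B x y' u' \<Longrightarrow> Jcost Q \<beta> y u \<le> Jcost Q \<beta> y' u'"
    using m by (auto simp: OCP_min_def feasible_def sq_int_l2)
  have bv: "l2 HL (\<lambda>t. B *v (v t - u t))"
    by (rule l2_bound(1)[OF l2_diff(1)[OF v(1) u], of _ "onorm ((*v) B)"])
      (use l2D(1)[OF v(1)] l2D(1)[OF u] in \<open>auto intro!: onorm borel_measurable_continuous_on[of "(*v) B"] linear_continuous_on simp: matrix_vector_mul_bounded_linear onorm_pos_le\<close>)
  have eq: "(\<lambda>t. f (y t) + B *v v t) = (\<lambda>t. (f (y t) + B *v u t) + B *v (v t - u t))"
    by (simp add: matrix_vector_mult_diff_distrib)
  have "has_Wderiv y (\<lambda>t. f (y t) + B *v v t)"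
    by (rule has_Wderiv_AE_cong[OF d]) (unfold eq, rule l2_add(1)[OF has_WderivD(2)[OF d] bv], use v(2) in auto)
  then have "has_Wderiv z (\<lambda>t. f (z t) + B *v v t)"
    using has_Wderiv_cong[of y z "\<lambda>t. f (y t) + B *v v t" "\<lambda>t. f (z t) + B *v v t"] z by simp
  moreover have "Jcost Q \<beta> z v = Jcost Q \<beta> y u"
    unfolding Jcost_def
    by (rule arg_cong[where f = "\<lambda>c. c / 2"], rule nn_integral_cong_AE)
      (use v(2)[unfolded AE_HL] in \<open>eventually_elim, auto simp: z split: split_indicator\<close>)
  ultimately show ?thesis using opt v(1) y0 z[of 0] by (simp add: OCP_min_def feasible_def sq_int_l2)
qed

theorem mainTheorem17:
  fixes f :: "real^'n \<Rightarrow> real^'n" and B :: "real^'m^'n" and Q :: "real^'n^'n" and \<beta> :: real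
    and Y0 :: "(real^'n) set" and \<mu> :: "(real^'n) measure"
    and Ci M C :: real and NY0 :: "(real^'n) set" and Fs :: "real^'n \<Rightarrow> real^'m"
    and ystar :: "real^'n \<Rightarrow> real \<Rightarrow> real^'n"
    and \<sigma> :: "real \<Rightarrow> real" and \<eta>1 \<eta>2 \<epsilon>0 \<epsilon>2 :: real
    and hid :: "real \<Rightarrow> nat list" and \<theta>\<epsilon> :: "real \<Rightarrow> ('n, 'm) nnet" and \<alpha> :: "real \<Rightarrow> real"
    and eps :: "nat \<Rightarrow> real" and \<theta> :: "nat \<Rightarrow> ('n, 'm) nnet"
    and Y :: "nat \<Rightarrow> real^'n \<Rightarrow> real \<Rightarrow> real^'n" and U :: "nat \<Rightarrow> real^'n \<Rightarrow> real \<Rightarrow> real^'m"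
  assumes Q_psd: "transpose Q = Q" "\<forall>x. 0 \<le> x \<bullet> (Q *v x)"
    and beta_pos: "0 < \<beta>"
    and embedding: "0 < Ci" "\<forall>y::real \<Rightarrow> real^'n. inW y \<longrightarrow> (\<forall>t\<ge>0. norm (y t) \<le> Ci * Wnorm y)"
    and SA1: "standing_assumption_1 f B Q \<beta> Y0 Ci NY0 Fs ystar M"
    and A3: "assumption_3 f B Fs NY0 ystar C"
    and mu: "prob_space \<mu>" "space \<mu> = Y0" "complete_measure \<mu>"
            "\<forall>A\<in>sets borel. A \<inter> Y0 \<in> sets \<mu>"
    and sigma_C1: "\<exists>\<sigma>'. continuous_on UNIV \<sigma>' \<and> (\<forall>x. (\<sigma> has_real_derivative \<sigma>' x) (at x))"
    and sigma_nonpoly: "\<not> (\<exists>(c::nat \<Rightarrow> real) N. \<forall>x. \<sigma> x = (\<Sum>i\<le>N. c i * x ^ i))"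
    and eta: "0 < \<eta>1" "0 < \<eta>2"
    and approx: "\<forall>\<epsilon>>0. arch_ok (hid \<epsilon>) \<and> \<theta>\<epsilon> \<epsilon> \<in> params (hid \<epsilon>) \<and> Rad (hid \<epsilon>) \<eta>1 \<eta>2 (\<theta>\<epsilon> \<epsilon>) \<and>
                 eps_approx \<sigma> (hid \<epsilon>) Fs (2 * (Ci * MY0 M Y0)) \<epsilon> (\<theta>\<epsilon> \<epsilon>)"
    and eps2: "0 < \<epsilon>2" "\<forall>\<epsilon>. 0 < \<epsilon> \<and> \<epsilon> < \<epsilon>2 \<longrightarrow>
                 0 < sumsqW (hid \<epsilon>) (\<theta>\<epsilon> \<epsilon>) \<and> 0 < \<alpha> \<epsilon> \<and>
                 \<alpha> \<epsilon> \<le> \<epsilon> / (2 * sumsqW (hid \<epsilon>) (\<theta>\<epsilon> \<epsilon>))"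
    and eps0: "0 < \<epsilon>0" "\<forall>\<epsilon>. 0 < \<epsilon> \<and> \<epsilon> < \<epsilon>0 \<longrightarrow>
                 (\<exists>\<theta>' Y'. net_min \<mu> f B Q \<beta> (MY0 M Y0) \<sigma> (hid \<epsilon>) \<eta>1 \<eta>2 (\<alpha> \<epsilon>) \<theta>' Y')"
    and eps_seq: "\<forall>k. 0 < eps k \<and> eps k < \<epsilon>0" "eps \<longlonglongrightarrow> 0"
    and minimizers: "\<forall>k. net_min \<mu> f B Q \<beta> (MY0 M Y0) \<sigma> (hid (eps k)) \<eta>1 \<eta>2 (\<alpha> (eps k)) (\<theta> k) (Y k)"
    and U_def: "\<forall>k. U k = (\<lambda>y0 t. Fnet \<sigma> (hid (eps k)) (\<theta> k) (Y k y0 t))"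
  shows "(\<exists>r Yh Uh. weak_sub_conv \<mu> Y U r Yh Uh) \<and>
         (\<forall>r Yh Uh. weak_sub_conv \<mu> Y U r Yh Uh \<longrightarrow>
            (AE y0 in \<mu>. Wnorm (Yh y0) \<le> 2 * MY0 M Y0) \<and>
            (AE y0 in \<mu>. has_Wderiv (Yh y0) (\<lambda>t. f (Yh y0 t) + B *v Uh y0 t) \<and>
                          Yh y0 0 = y0 \<and> OCP_min f B Q \<beta> y0 (Yh y0) (Uh y0))) \<and>
         (invertible Q \<longrightarrow>
            (\<forall>r Yh Uh. weak_sub_conv \<mu> Y U r Yh Uh \<longrightarrow>
               (\<lambda>k. bochner_norm \<mu> Wnorm (\<lambda>y0 t. Y (r k) y0 t - Yh y0 t)) \<longlonglongrightarrow> 0 \<and>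
               (\<lambda>k. bochner_norm \<mu> L2norm (\<lambda>y0 t. U (r k) y0 t - Uh y0 t)) \<longlonglongrightarrow> 0))"
proof -
  note S = standing_assumption_1D[OF SA1]
  note Ci = embedding(1) and emb = embedding(2) and cm = mu(3)
  note ys = ystar_bochner[OF beta_pos Ci emb SA1 A3 mu]
  define m where "m = MY0 M Y0"
  define Us where "Us x t = Fs (ystar x t)" for x t
  define F where "F k = Fnet \<sigma> (hid (eps k)) (\<theta> k)" for k
  have m0: "0 \<le> m" unfolding m_def by (rule MY0_bounds(2)[OF S(1,2,5)])
  have U: "U k x = (\<lambda>t. F k (Y k x t))" for k x using U_def by (simp add: F_def)
  have F: "loclip (F k)" for k unfolding F_def by (rule loclip_Fnet[OF sigma_C1])
  have es: "ens_sol \<mu> f B m (F k) (Y k)" for k using minimizers by (simp add: net_min_def F_def m_def)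
  have Ysm: "strongly_meas \<mu> inW Wnorm (Y k)" and YW: "AE x in \<mu>. inW (Y k x) \<and> Wnorm (Y k x) \<le> 2 * m" for k
    using es[of k] by (auto simp: ens_sol_def)
  have YinW: "AE x in \<mu>. inW (Y k x)" and Ybd: "AE x in \<mu>. Wnorm (Y k x) \<le> 2 * m" for k
    using YW[of k] by (eventually_elim, simp)+
  have YB: "bochner_L2 \<mu> inW Wnorm (Y k)" for k by (rule W.bochner_L2_bounded[OF cm mu(1) Ysm YinW Ybd])
  have UsB: "bochner_L2 \<mu> sq_int L2norm Us" unfolding Us_def by (rule ys(2))
  have ysW: "inW (ystar x)" "Wnorm (ystar x) \<le> m" "sq_int (Us x)" if "x \<in> Y0" for x
    using ys(3)[OF that] by (auto simp: m_def Us_def[abs_def] sq_int_l2)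
  have spY: "AE x in \<mu>. x \<in> Y0" by (rule AE_I2) (simp add: mu(2))
  have Usq: "AE x in \<mu>. sq_int (U k x)" for k
    using YinW[of k] unfolding U sq_int_l2 by eventually_elim (rule loclip_l2[OF Ci emb F])
  have Uip: "(\<lambda>x. L2ip (U k x) (Z x)) \<in> borel_measurable \<mu>" "(\<lambda>x. L2norm (\<lambda>t. U k x t - Z x t)) \<in> borel_measurable \<mu>"
    if "bochner_L2 \<mu> sq_int L2norm Z" for k and Z :: "real^'n \<Rightarrow> real \<Rightarrow> real^'m"
    unfolding U by (rule measurable_nemytskii[OF Ci emb cm Ysm YinW F]; use that in \<open>simp add: bochner_L2_def\<close>)+
  have dW: "(\<lambda>x. Wnorm (\<lambda>t. Y k x t - ystar x t)) \<in> borel_measurable \<mu>" for k by (rule W.measurable_ip(2)[OF cm YB ys(1)])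
  have dU: "(\<lambda>x. L2norm (\<lambda>t. U k x t - Us x t)) \<in> borel_measurable \<mu>" for k by (rule Uip(2)[OF UsB])
  have lim: "(\<forall>k. integrable \<mu> (\<lambda>x. (Wnorm (\<lambda>t. Y k x t - ystar x t))\<^sup>2)) \<and>
     (\<forall>k. integrable \<mu> (\<lambda>x. (L2norm (\<lambda>t. U k x t - Us x t))\<^sup>2)) \<and>
     (\<lambda>k. \<integral>x. (Wnorm (\<lambda>t. Y k x t - ystar x t))\<^sup>2 \<partial>\<mu>) \<longlonglongrightarrow> 0 \<and>
     (\<lambda>k. \<integral>x. (L2norm (\<lambda>t. U k x t - Us x t))\<^sup>2 \<partial>\<mu>) \<longlonglongrightarrow> 0"
  proof (cases "m = 0")
    case False
    then have mpos: "0 < MY0 M Y0" using m0 by (simp add: m_def)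
    have epos: "\<forall>k. 0 < eps k" using eps_seq(1) by blast
    note L = ensemble_limit[OF beta_pos Ci emb SA1 A3 mu mpos sigma_C1 approx eps2 epos eps_seq(2) minimizers]
    show ?thesis unfolding U F_def Us_def using L by blast
  next
    case True
    have z: "AE x in \<mu>. Wnorm (\<lambda>t. Y k x t - ystar x t) = 0 \<and> L2norm (\<lambda>t. U k x t - Us x t) = 0" for k
      using YW[of k] spY
    proof eventually_elim
      case (elim x)
      have n: "Wnorm (Y k x) = 0" "Wnorm (ystar x) = 0"
        using elim ysW[OF elim(2)] W.nrm_nonneg[of "Y k x"] W.nrm_nonneg[of "ystar x"] True by auto
      have t: "Y k x t = 0" "ystar x t = 0" if "0 \<le> t" for t
        using emb elim ysW(1)[OF elim(2)] n that by (metis mult_zero_right norm_le_zero_iff)+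
      have "Wnorm (\<lambda>t. Y k x t - ystar x t) = 0"
        using W.nrm_diff_le[of "Y k x" "ystar x"] elim ysW(1)[OF elim(2)] n W.nrm_nonneg[of "\<lambda>t. Y k x t - ystar x t"] by simp
      moreover have "l2n HL (\<lambda>t. U k x t - Us x t) = l2n HL (\<lambda>t. 0 :: real^'m)"
        by (rule l2n_HL_cong) (use t F[of k] S(7) in \<open>auto simp: U Us_def loclip_def\<close>)
      ultimately show ?case by (simp add: L2norm_l2n l2n_def)
    qed
    have 1: "integrable \<mu> g \<and> (\<integral>x. g x \<partial>\<mu>) = 0" if "AE x in \<mu>. g x = 0" "g \<in> borel_measurable \<mu>" for g :: "real^'n \<Rightarrow> real"
      using integrable_cong_AE[of g \<mu> "\<lambda>x. 0"] integral_cong_AE[of g \<mu> "\<lambda>x. 0"] that by simp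
    have "integrable \<mu> (\<lambda>x. (Wnorm (\<lambda>t. Y k x t - ystar x t))\<^sup>2) \<and> (\<integral>x. (Wnorm (\<lambda>t. Y k x t - ystar x t))\<^sup>2 \<partial>\<mu>) = 0"
      "integrable \<mu> (\<lambda>x. (L2norm (\<lambda>t. U k x t - Us x t))\<^sup>2) \<and> (\<integral>x. (L2norm (\<lambda>t. U k x t - Us x t))\<^sup>2 \<partial>\<mu>) = 0" for k
      by (rule 1; use z[of k] dW[of k] dU[of k] in \<open>auto elim!: AE_mp\<close>)+
    then show ?thesis by simp
  qed
  have weakW: "(\<lambda>k. bochner_ip \<mu> Wip (Y k) Z) \<longlonglongrightarrow> bochner_ip \<mu> Wip ystar Z" if "bochner_L2 \<mu> inW Wnorm Z" for Z
    by (rule W.strong_imp_weak[OF cm ys(1) YinW W.measurable_ip(1)[OF cm YB] dW _ _ that]) (use lim in blast)+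
  have weakU: "(\<lambda>k. bochner_ip \<mu> L2ip (U k) Z) \<longlonglongrightarrow> bochner_ip \<mu> L2ip Us Z" if "bochner_L2 \<mu> sq_int L2norm Z" for Z
    by (rule L2.strong_imp_weak[OF cm UsB Usq Uip(1) dU _ _ that]) (use lim in blast)+
  have ex: "weak_sub_conv \<mu> Y U id ystar Us"
    unfolding weak_sub_conv_def using ys(1) UsB weakW weakU by (simp add: strict_mono_def)
  have uniq: "strict_mono r \<and> (AE x in \<mu>. inW (Yh x)) \<and> (AE x in \<mu>. sq_int (Uh x)) \<and>
      (AE x in \<mu>. Wnorm (\<lambda>t. Yh x t - ystar x t) = 0) \<and> (AE x in \<mu>. L2norm (\<lambda>t. Uh x t - Us x t) = 0)"
    if "weak_sub_conv \<mu> Y U r Yh Uh" for r Yh Uh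
  proof -
    have r: "strict_mono r" and B: "bochner_L2 \<mu> inW Wnorm Yh" "bochner_L2 \<mu> sq_int L2norm Uh"
      and w: "\<And>Z. bochner_L2 \<mu> inW Wnorm Z \<Longrightarrow> (\<lambda>k. bochner_ip \<mu> Wip (Y (r k)) Z) \<longlonglongrightarrow> bochner_ip \<mu> Wip Yh Z"
      "\<And>Z. bochner_L2 \<mu> sq_int L2norm Z \<Longrightarrow> (\<lambda>k. bochner_ip \<mu> L2ip (U (r k)) Z) \<longlonglongrightarrow> bochner_ip \<mu> L2ip Uh Z"
      using that unfolding weak_sub_conv_def by blast+
    have "AE x in \<mu>. Wnorm (\<lambda>t. Yh x t - ystar x t) = 0"
      by (rule W.weak_limit_eq[OF cm ys(1) B(1) weakW w(1) r])
    moreover have "AE x in \<mu>. L2norm (\<lambda>t. Uh x t - Us x t) = 0"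
      by (rule L2.weak_limit_eq[OF cm UsB B(2) weakU w(2) r])
    ultimately show ?thesis using r B unfolding bochner_L2_def by blast
  qed
  have limit: "AE x in \<mu>. Wnorm (Yh x) \<le> m \<and> OCP_min f B Q \<beta> x (Yh x) (Uh x)"
    if "weak_sub_conv \<mu> Y U r Yh Uh" for r Yh Uh
  proof -
    have a: "AE x in \<mu>. inW (Yh x)" "AE x in \<mu>. sq_int (Uh x)" "AE x in \<mu>. Wnorm (\<lambda>t. Yh x t - ystar x t) = 0"
      "AE x in \<mu>. L2norm (\<lambda>t. Uh x t - Us x t) = 0" using uniq[OF that] by blast+
    show ?thesis using a spY
    proof eventually_elim
      case (elim x)
      note y = ysW[OF elim(5)]
      have eq: "Yh x t = ystar x t" if "0 \<le> t" for t
        using emb[rule_format, OF W.V_diff[OF elim(1) y(1)] that] elim(3) by simp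
      have u: "l2 HL (Uh x)" "l2 HL (Us x)" using elim(2) y(3) by (simp_all add: sq_int_l2)
      have "AE t in HL. Uh x t - Us x t = 0"
        by (rule l2n_eq_0_AE[OF l2_diff(1)[OF u]]) (use elim(4) in \<open>simp add: L2norm_l2n\<close>)
      then have ae: "AE t in HL. Fs (ystar x t) = Uh x t" by eventually_elim (simp add: Us_def)
      have "OCP_min f B Q \<beta> x (ystar x) (\<lambda>t. Fs (ystar x t))" using S(12) S(4) elim(5) by blast
      from OCP_min_AE_cong[OF this eq u(1) ae] have "OCP_min f B Q \<beta> x (Yh x) (Uh x)" .
      moreover have "Wnorm (Yh x) \<le> m" using W.nrm_rev[OF elim(1) y(1)] elim(3) y(2) by simp
      ultimately show ?case by blast
    qed
  qed
  have strong: "(\<lambda>k. bochner_norm \<mu> Wnorm (\<lambda>x t. Y (r k) x t - Yh x t)) \<longlonglongrightarrow> 0 \<and>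
       (\<lambda>k. bochner_norm \<mu> L2norm (\<lambda>x t. U (r k) x t - Uh x t)) \<longlonglongrightarrow> 0"
    if "weak_sub_conv \<mu> Y U r Yh Uh" for r Yh Uh
  proof -
    note u = uniq[OF that]
    have V: "AE x in \<mu>. inW (ystar x)" "AE x in \<mu>. sq_int (Us x)" using ys(1) UsB by (auto simp: bochner_L2_def)
    have eW: "bochner_norm \<mu> Wnorm (\<lambda>x t. Y (r k) x t - Yh x t) = bochner_norm \<mu> Wnorm (\<lambda>x t. Y (r k) x t - ystar x t)" for k
      by (rule W.strong_limit_cong[OF cm YinW V(1) _ dW]) (use u in blast)+
    have eU: "bochner_norm \<mu> L2norm (\<lambda>x t. U (r k) x t - Uh x t) = bochner_norm \<mu> L2norm (\<lambda>x t. U (r k) x t - Us x t)" for k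
      by (rule L2.strong_limit_cong[OF cm Usq V(2) _ dU]) (use u in blast)+
    have sq: "(\<lambda>k. sqrt (g (r k))) \<longlonglongrightarrow> 0" if "g \<longlonglongrightarrow> 0" for g :: "nat \<Rightarrow> real"
      using tendsto_real_sqrt[OF LIMSEQ_subseq_LIMSEQ[OF that, of r]] u by (simp add: comp_def)
    have "(\<lambda>k. bochner_norm \<mu> Wnorm (\<lambda>x t. Y (r k) x t - ystar x t)) \<longlonglongrightarrow> 0"
      "(\<lambda>k. bochner_norm \<mu> L2norm (\<lambda>x t. U (r k) x t - Us x t)) \<longlonglongrightarrow> 0"
      unfolding bochner_norm_def by (rule sq, use lim in blast)+
    then show ?thesis unfolding eW eU by blast
  qed
  show ?thesis
  proof (intro conjI allI impI)
    show "\<exists>r Yh Uh. weak_sub_conv \<mu> Y U r Yh Uh" using ex by blast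
  next
    fix r Yh Uh assume w: "weak_sub_conv \<mu> Y U r Yh Uh"
    show "AE x in \<mu>. Wnorm (Yh x) \<le> 2 * MY0 M Y0" using limit[OF w] m0 unfolding m_def by (auto elim!: AE_mp)
    show "AE x in \<mu>. has_Wderiv (Yh x) (\<lambda>t. f (Yh x t) + B *v Uh x t) \<and> Yh x 0 = x \<and> OCP_min f B Q \<beta> x (Yh x) (Uh x)"
      using limit[OF w] by eventually_elim (auto simp: OCP_min_def feasible_def)
    show "(\<lambda>k. bochner_norm \<mu> Wnorm (\<lambda>y0 t. Y (r k) y0 t - Yh y0 t)) \<longlonglongrightarrow> 0"
      "(\<lambda>k. bochner_norm \<mu> L2norm (\<lambda>y0 t. U (r k) y0 t - Uh y0 t)) \<longlonglongrightarrow> 0" using strong[OF w] by blast+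
  qed
qed

end
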